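(* Let $p\ge 1$, and let $D,f,g,r,B,\xi,i_0$ be as in the context. Suppose there exist functions $V\in C^{2,1}(\mathbb{R}^d\times\mathbb{R}_+\times S;\mathbb{R}_+)$, $U\in C(\mathbb{R}^d\times[-\tau,\infty);\mathbb{R}_+)$, $\gamma:\mathbb{R}_+\to\mathbb{R}_+$, $\psi\in L^1(\mathbb{R}_+;\mathbb{R}_+)$ and positive constants $c_1,\alpha_1,\alpha_2,\lambda$ such that $\int_0^\infty e^{\lambda t}\gamma(t)\,dt<\infty$, $\alpha_1\ge\alpha_2e^{\lambda\tau}$, $\beta e^{\lambda\tau}<1$, and for all $x,y\in\mathbb{R}^d$, $t\ge 0$, $i\in S$, $$c_1|x|^p\le V(x,t,i),$$ $$LV(x,y,t,i)\le\gamma(t)+(\psi(t)-\lambda)V(x-D(y,i),t,i)-\alpha_1U(x,t)+\alpha_2U(y,t-\tau).$$ Then the exact solution $X$ of the neutral stochastic differential delay equation with Markov switching $$d[X(t)-D(X(t-\tau),r(t))]=f(X(t),X(t-\tau),t,r(t))\,dt+g(X(t),X(t-\tau),t,r(t))\,dB_t,\quad t\ge 0,$$ with initial data $X(s)=\xi(s)$ for $s\in[-\tau,0]$, $r(0)=i_0$, is $p$-th moment exponentially stable with Lyapunov exponent no greater than $-\lambda$, that is, $$\limsup_{t\to\infty}\frac{\log\mathbb{E}|X(t)|^p}{t}\le-\lambda.$$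
   Context: Setting. $(\Omega,\mathscr{F},P)$ is a probability space with a complete filtration $(\mathscr{F}_t)_{t\ge0}$; $d,m\in\mathbb{N}$ and $\tau>0$ are fixed. $|\cdot|$ is the Euclidean norm, $\langle\cdot,\cdot\rangle$ the inner product, and $\|\cdot\|$ the Hilbert-Schmidt norm of matrices (also written $|\cdot|$). $r(t)$, $t\ge0$, is a right-continuous $(\mathscr{F}_t)$-adapted Markov chain with values in the finite set $S=\{1,\dots,N\}$ and generator $\Gamma=(\gamma_{ij})_{N\times N}$: $P(r(t+\delta)=j\mid r(t)=i)=\gamma_{ij}\delta+o(\delta)$ for $i\ne j$, where $\gamma_{ij}\ge0$ for $i\neq j$ and $\gamma_{ii}=-\sum_{j\ne i}\gamma_{ij}$. $(B_t)_{t\ge0}$ is an $m$-dimensional standard $(\mathscr{F}_t)$-Brownian motion independent of $r$. The initial datum $\xi=\{\xi(s):s\in[-\tau,0]\}$ is a bounded, $\mathscr{F}_0$-measurable, $C([-\tau,0];\mathbb{R}^d)$-valued random variable, and $r(0)=i_0\in S$. Coefficients and standing assumptions. $D:\mathbb{R}^d\times S\to\mathbb{R}^d$, $f:\mathbb{R}^d\times\mathbb{R}^d\times\mathbb{R}_+\times S\to\mathbb{R}^d$, $g:\mathbb{R}^d\times\mathbb{R}^d\times\mathbb{R}_+\times S\to\mathbb{R}^{d\times m}$ are Borel measurable and satisfy: - local Lipschitz condition: for each $R>0$ there is $L_R>0$ with $|f(x,y,t,i)-f(\bar x,\bar y,t,i)|\vee|g(x,y,t,i)-g(\bar x,\bar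 y,t,i)|\le L_R(|x-\bar x|+|y-\bar y|)$ for all $(t,i)\in\mathbb{R}_+\times S$ and $|x|\vee|y|\vee|\bar x|\vee|\bar y|\le R$; - there is $0<\beta<1$ with $|D(x,i)-D(y,i)|\le\beta|x-y|$ for all $x,y\in\mathbb{R}^d$, $i\in S$ (this fixes $\beta$); - $D(0,i)=0$, $f(0,0,t,i)=0$, $g(0,0,t,i)=0$ for all $(t,i)\in\mathbb{R}_+\times S$. The exact solution $X(t)$, $t\ge-\tau$, is the unique global solution of the equation with the given initial data (under the hypotheses of the claim, such a solution exists and is unique). Operator $L$. For $V\in C^{2,1}(\mathbb{R}^d\times\mathbb{R}_+\times S;\mathbb{R}_+)$ (twice continuously differentiable in $x$, once in $t$), $LV:\mathbb{R}^d\times\mathbb{R}^d\times\mathbb{R}_+\times S\to\mathbb{R}$ is $$LV(x,y,t,i)=V_t(x-D(y,i),t,i)+V_x(x-D(y,i),t,i)f(x,y,t,i)+\tfrac12\mathrm{trace}\big[g^T(x,y,t,i)V_{xx}(x-D(y,i),t,i)g(x,y,t,i)\big]+\sum_{j=1}^N\gamma_{ij}V(x-D(y,i),t,j),$$ where $V_t=\partial V/\partial t$, $V_x=(\partial V/\partial x_1,\dots,\partial V/\partial x_d)$ (row vector), $V_{xx}=(\partial^2V/\partial x_l\partial x_j)_{d\times d}$. *)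

theory Defs
  imports "HOL-Probability.Probability" "HOL-Library.Landau_Symbols"
begin

section \<open>Filtrations, Brownian motion and Markov chains\<close>

text \<open>Time is indexed by the type of reals, but only the members \<open>F t\<close> with \<open>t \<ge> 0\<close> are constrained
  or used. Completeness asks for all subsets of null sets, so it also forces \<open>M\<close> to be complete.\<close>

definition complete_filtration :: "'a measure \<Rightarrow> (real \<Rightarrow> 'a measure) \<Rightarrow> bool" where
  "complete_filtration M F \<longleftrightarrow>
     (\<forall>t\<ge>0. subalgebra M (F t)) \<and>
     (\<forall>s t. 0 \<le> s \<and> s \<le> t \<longrightarrow> sets (F s) \<subseteq> sets (F t)) \<and>
     (\<forall>N\<in>null_sets M. \<forall>A\<subseteq>N. A \<in> sets (F 0))"

definition adapted_process ::
    "(real \<Rightarrow> 'a measure) \<Rightarrow> 'b measure \<Rightarrow> (real \<Rightarrow> 'a \<Rightarrow> 'b) \<Rightarrow> bool" where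
  "adapted_process F K Y \<longleftrightarrow> (\<forall>t\<ge>0. Y t \<in> measurable (F t) K)"

definition progressively_measurable ::
    "(real \<Rightarrow> 'a measure) \<Rightarrow> (real \<Rightarrow> 'a \<Rightarrow> 'b::topological_space) \<Rightarrow> bool" where
  "progressively_measurable F Y \<longleftrightarrow>
     (\<forall>T\<ge>0. (\<lambda>(t, \<omega>). Y t \<omega>) \<in> borel_measurable (restrict_space borel {0..T} \<Otimes>\<^sub>M F T))"

text \<open>The events determined by the whole path \<open>(Y t)\<close>, \<open>t \<ge> 0\<close>, of a \<open>K\<close>-valued process.\<close>

definition process_events ::
    "'a measure \<Rightarrow> 'b measure \<Rightarrow> (real \<Rightarrow> 'a \<Rightarrow> 'b) \<Rightarrow> 'a set set" where
  "process_events M K Y =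
     sets (vimage_algebra (space M) (\<lambda>\<omega>. \<lambda>t\<in>{0..}. Y t \<omega>) (PiM {0..} (\<lambda>_. K)))"

definition brownian_motion ::
    "'a measure \<Rightarrow> (real \<Rightarrow> 'a measure) \<Rightarrow> (real \<Rightarrow> 'a \<Rightarrow> real^'m) \<Rightarrow> bool" where
  "brownian_motion M F B \<longleftrightarrow>
     adapted_process F borel B \<and>
     (AE \<omega> in M. B 0 \<omega> = 0) \<and>
     (AE \<omega> in M. continuous_on {0..} (\<lambda>t. B t \<omega>)) \<and>
     (\<forall>s t. 0 \<le> s \<and> s < t \<longrightarrow>
        prob_space.indep_set M (sets (F s))
          (sets (vimage_algebra (space M) (\<lambda>\<omega>. B t \<omega> - B s \<omega>) borel)) \<and>
        distributed M lborel (\<lambda>\<omega>. B t \<omega> - B s \<omega>)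
          (\<lambda>x. ennreal (\<Prod>k\<in>UNIV. normal_density 0 (sqrt (t - s)) (x $ k))))"

text \<open>The state space is a finite type, which carries the discrete topology: right-continuity of
  \<open>r\<close> at \<open>t\<close> means that \<open>r\<close> is constant on some \<open>[t, t + \<epsilon>)\<close>. The Markov property is
  with respect to the filtration \<open>F\<close>, with time-homogeneous transition probabilities
  \<open>P \<delta> i j\<close>; the entries of the generator are their derivatives at \<open>\<delta> = 0\<close>.\<close>

definition generator_matrix :: "real^'s^'s \<Rightarrow> bool" where
  "generator_matrix \<Gamma> \<longleftrightarrow>
     (\<forall>i j. i \<noteq> j \<longrightarrow> \<Gamma> $ i $ j \<ge> 0) \<and> (\<forall>i. \<Gamma> $ i $ i = - (\<Sum>j\<in>UNIV - {i}. \<Gamma> $ i $ j))"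

definition markov_chain ::
    "'a measure \<Rightarrow> (real \<Rightarrow> 'a measure) \<Rightarrow> real^'s^'s \<Rightarrow> (real \<Rightarrow> 'a \<Rightarrow> 's::finite) \<Rightarrow> bool" where
  "markov_chain M F \<Gamma> r \<longleftrightarrow>
     generator_matrix \<Gamma> \<and>
     adapted_process F (count_space UNIV) r \<and>
     (\<forall>\<omega>\<in>space M. \<forall>t\<ge>0. \<forall>\<^sub>F u in at_right t. r u \<omega> = r t \<omega>) \<and>
     (\<exists>P :: real \<Rightarrow> 's \<Rightarrow> 's \<Rightarrow> real.
        (\<forall>\<delta>\<ge>0. \<forall>i. (\<forall>j. P \<delta> i j \<ge> 0) \<and> (\<Sum>j\<in>UNIV. P \<delta> i j) = 1) \<and>
        (\<forall>s\<ge>0. \<forall>\<delta>\<ge>0. \<forall>j. AE \<omega> in M.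
           real_cond_exp M (F s) (\<lambda>\<omega>'. indicator {j} (r (s + \<delta>) \<omega>')) \<omega> = P \<delta> (r s \<omega>) j) \<and>
        (\<forall>i j. i \<noteq> j \<longrightarrow> (\<lambda>\<delta>. P \<delta> i j - \<Gamma> $ i $ j * \<delta>) \<in> o[at_right 0](\<lambda>\<delta>. \<delta>)))"


section \<open>The Ito integral\<close>

text \<open>A list of triples \<open>(a, b, c)\<close> represents the simple process that is the sum of the
  \<open>c \<cdot> 1\<^bsub>(a, b]\<^esub>\<close>, where \<open>c\<close> is bounded and measurable with respect to \<open>F a\<close>.\<close>

type_synonym ('a, 'm, 'd) simple_process = "(real \<times> real \<times> ('a \<Rightarrow> real^'m^'d)) list"

definition simple_process ::
    "(real \<Rightarrow> 'a measure) \<Rightarrow> ('a, 'm::finite, 'd::finite) simple_process \<Rightarrow> bool" where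
  "simple_process F H \<longleftrightarrow>
     (\<forall>(a, b, c)\<in>set H. 0 \<le> a \<and> a \<le> b \<and> c \<in> borel_measurable (F a) \<and> bounded (c ` space (F a)))"

definition simple_value ::
    "('a, 'm::finite, 'd::finite) simple_process \<Rightarrow> real \<Rightarrow> 'a \<Rightarrow> real^'m^'d" where
  "simple_value H t \<omega> = (\<Sum>(a, b, c)\<leftarrow>H. indicator {a<..b} t *\<^sub>R c \<omega>)"

definition simple_integral ::
    "(real \<Rightarrow> 'a \<Rightarrow> real^'m) \<Rightarrow> ('a, 'm::finite, 'd::finite) simple_process \<Rightarrow> real \<Rightarrow> 'a \<Rightarrow> real^'d" where
  "simple_integral B H t \<omega> = (\<Sum>(a, b, c)\<leftarrow>H. c \<omega> *v (B (min t b) \<omega> - B (min t a) \<omega>))"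

text \<open>Measurability is part of the definition because \<^const>\<open>measure\<close> is \<open>0\<close> on non-measurable sets.\<close>

definition null_in_probability :: "'a measure \<Rightarrow> (nat \<Rightarrow> 'a \<Rightarrow> ennreal) \<Rightarrow> bool" where
  "null_in_probability M Y \<longleftrightarrow>
     (\<forall>n. Y n \<in> borel_measurable M) \<and>
     (\<forall>\<epsilon>>0. (\<lambda>n. measure M {\<omega>\<in>space M. ennreal \<epsilon> < Y n \<omega>}) \<longlonglongrightarrow> 0)"

text \<open>\<open>I\<close> is a version with continuous paths of the process \<open>\<integral>\<^sub>0\<^sup>t G(s) dB(s)\<close>,
  for \<open>G\<close> progressively measurable and almost surely locally square integrable. The integral is
  the limit in probability of the integrals of simple processes \<open>H n\<close> approximating \<open>G\<close>;
  it does not depend on the choice of \<open>H\<close>, so \<open>I\<close> is unique up to indistinguishability.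
  The norm of a matrix is its Hilbert--Schmidt norm.\<close>

definition has_ito_integral ::
    "'a measure \<Rightarrow> (real \<Rightarrow> 'a measure) \<Rightarrow> (real \<Rightarrow> 'a \<Rightarrow> real^'m) \<Rightarrow>
     (real \<Rightarrow> 'a \<Rightarrow> real^'m^'d) \<Rightarrow> (real \<Rightarrow> 'a \<Rightarrow> real^'d) \<Rightarrow> bool" where
  "has_ito_integral M F B G I \<longleftrightarrow>
     progressively_measurable F G \<and>
     (AE \<omega> in M. \<forall>T\<ge>0. (\<integral>\<^sup>+s\<in>{0..T}. ennreal ((norm (G s \<omega>))\<^sup>2) \<partial>lborel) < \<infinity>) \<and>
     adapted_process F borel I \<and>
     (AE \<omega> in M. continuous_on {0..} (\<lambda>t. I t \<omega>)) \<and>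
     (\<exists>H :: nat \<Rightarrow> ('a, 'm, 'd) simple_process.
        (\<forall>n. simple_process F (H n)) \<and>
        (\<forall>T\<ge>0. null_in_probability M
           (\<lambda>n \<omega>. \<integral>\<^sup>+s\<in>{0..T}. ennreal ((norm (simple_value (H n) s \<omega> - G s \<omega>))\<^sup>2) \<partial>lborel)) \<and>
        (\<forall>t\<ge>0. null_in_probability M
           (\<lambda>n \<omega>. ennreal (norm (simple_integral B (H n) t \<omega> - I t \<omega>)))))"


section \<open>Neutral stochastic differential delay equations with Markov switching\<close>

definition nsdde_coefficients ::
    "real \<Rightarrow> (real^'d \<Rightarrow> 's::finite \<Rightarrow> real^'d) \<Rightarrow>
     (real^'d \<Rightarrow> real^'d \<Rightarrow> real \<Rightarrow> 's \<Rightarrow> real^'d) \<Rightarrow>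
     (real^'d \<Rightarrow> real^'d \<Rightarrow> real \<Rightarrow> 's \<Rightarrow> real^'m^'d) \<Rightarrow> bool" where
  "nsdde_coefficients \<beta> D f g \<longleftrightarrow>
     (\<lambda>(x, i). D x i) \<in> borel_measurable (borel \<Otimes>\<^sub>M count_space UNIV) \<and>
     (\<lambda>(x, y, t, i). f x y t i) \<in>
       borel_measurable (borel \<Otimes>\<^sub>M borel \<Otimes>\<^sub>M restrict_space borel {0..} \<Otimes>\<^sub>M count_space UNIV) \<and>
     (\<lambda>(x, y, t, i). g x y t i) \<in>
       borel_measurable (borel \<Otimes>\<^sub>M borel \<Otimes>\<^sub>M restrict_space borel {0..} \<Otimes>\<^sub>M count_space UNIV) \<and>
     (\<forall>R>0. \<exists>K>0. \<forall>x y x' y' t i.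
        t \<ge> 0 \<and> norm x \<le> R \<and> norm y \<le> R \<and> norm x' \<le> R \<and> norm y' \<le> R \<longrightarrow>
        max (norm (f x y t i - f x' y' t i)) (norm (g x y t i - g x' y' t i))
          \<le> K * (norm (x - x') + norm (y - y'))) \<and>
     0 < \<beta> \<and> \<beta> < 1 \<and>
     (\<forall>x y i. norm (D x i - D y i) \<le> \<beta> * norm (x - y)) \<and>
     (\<forall>i. D 0 i = 0) \<and>
     (\<forall>t\<ge>0. \<forall>i. f 0 0 t i = 0 \<and> g 0 0 t i = 0)"

definition initial_segment ::
    "'a measure \<Rightarrow> (real \<Rightarrow> 'a measure) \<Rightarrow> real \<Rightarrow> (real \<Rightarrow> 'a \<Rightarrow> real^'d) \<Rightarrow> bool" where
  "initial_segment M F \<tau> \<xi> \<longleftrightarrow>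
     (\<forall>s\<in>{-\<tau>..0}. \<xi> s \<in> borel_measurable (F 0)) \<and>
     (\<forall>\<omega>\<in>space M. continuous_on {-\<tau>..0} (\<lambda>s. \<xi> s \<omega>)) \<and>
     (\<exists>K. \<forall>\<omega>\<in>space M. \<forall>s\<in>{-\<tau>..0}. norm (\<xi> s \<omega>) \<le> K)"

definition cadlag_from :: "real \<Rightarrow> (real \<Rightarrow> 'b::topological_space) \<Rightarrow> bool" where
  "cadlag_from a h \<longleftrightarrow>
     (\<forall>t\<ge>a. (h \<longlongrightarrow> h t) (at_right t)) \<and> (\<forall>t>a. \<exists>l. (h \<longlongrightarrow> l) (at_left t))"

text \<open>Only \<open>X(t) - D(X(t - \<tau>), r(t))\<close> has continuous paths; \<open>X\<close> itself may jump when \<open>r\<close> does,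
  so paths of solutions are required to be cadlag.\<close>

definition nsdde_solution ::
    "'a measure \<Rightarrow> (real \<Rightarrow> 'a measure) \<Rightarrow> (real \<Rightarrow> 'a \<Rightarrow> real^'m) \<Rightarrow> (real \<Rightarrow> 'a \<Rightarrow> 's::finite) \<Rightarrow>
     real \<Rightarrow> (real^'d \<Rightarrow> 's \<Rightarrow> real^'d) \<Rightarrow>
     (real^'d \<Rightarrow> real^'d \<Rightarrow> real \<Rightarrow> 's \<Rightarrow> real^'d) \<Rightarrow>
     (real^'d \<Rightarrow> real^'d \<Rightarrow> real \<Rightarrow> 's \<Rightarrow> real^'m^'d) \<Rightarrow>
     (real \<Rightarrow> 'a \<Rightarrow> real^'d) \<Rightarrow> (real \<Rightarrow> 'a \<Rightarrow> real^'d) \<Rightarrow> bool" where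
  "nsdde_solution M F B r \<tau> D f g \<xi> X \<longleftrightarrow>
     (\<forall>t\<ge>-\<tau>. X t \<in> borel_measurable (F (max 0 t))) \<and>
     (\<forall>\<omega>\<in>space M. cadlag_from (-\<tau>) (\<lambda>t. X t \<omega>)) \<and>
     (AE \<omega> in M. \<forall>s\<in>{-\<tau>..0}. X s \<omega> = \<xi> s \<omega>) \<and>
     (AE \<omega> in M. \<forall>t\<ge>0.
        set_integrable lborel {0..t} (\<lambda>s. f (X s \<omega>) (X (s - \<tau>) \<omega>) s (r s \<omega>))) \<and>
     (\<exists>I. has_ito_integral M F B (\<lambda>s \<omega>. g (X s \<omega>) (X (s - \<tau>) \<omega>) s (r s \<omega>)) I \<and>
        (AE \<omega> in M. \<forall>t\<ge>0.
           X t \<omega> - D (X (t - \<tau>) \<omega>) (r t \<omega>) =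
             X 0 \<omega> - D (X (-\<tau>) \<omega>) (r 0 \<omega>)
             + (LINT s:{0..t}|lborel. f (X s \<omega>) (X (s - \<tau>) \<omega>) s (r s \<omega>)) + I t \<omega>))"


section \<open>The operator associated with the equation\<close>

definition partial_deriv :: "'d \<Rightarrow> (real^'d \<Rightarrow> real) \<Rightarrow> real^'d \<Rightarrow> real" where
  "partial_deriv l h x = deriv (\<lambda>s. h (x + s *\<^sub>R axis l 1)) 0"

definition partial_differentiable :: "'d \<Rightarrow> (real^'d \<Rightarrow> real) \<Rightarrow> real^'d \<Rightarrow> bool" where
  "partial_differentiable l h x \<longleftrightarrow> (\<lambda>s. h (x + s *\<^sub>R axis l 1)) differentiable (at 0)"

definition deriv_t :: "(real^'d \<Rightarrow> real \<Rightarrow> 's \<Rightarrow> real) \<Rightarrow> real^'d \<Rightarrow> real \<Rightarrow> 's \<Rightarrow> real" where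
  "deriv_t V x t i = vector_derivative (\<lambda>s. V x s i) (at t within {0..})"

definition deriv_x :: "(real^'d \<Rightarrow> real \<Rightarrow> 's \<Rightarrow> real) \<Rightarrow> real^'d \<Rightarrow> real \<Rightarrow> 's \<Rightarrow> real^'d" where
  "deriv_x V x t i = (\<chi> l. partial_deriv l (\<lambda>z. V z t i) x)"

definition deriv_xx :: "(real^'d \<Rightarrow> real \<Rightarrow> 's \<Rightarrow> real) \<Rightarrow> real^'d \<Rightarrow> real \<Rightarrow> 's \<Rightarrow> real^'d^'d" where
  "deriv_xx V x t i = (\<chi> l j. partial_deriv l (partial_deriv j (\<lambda>z. V z t i)) x)"

text \<open>\<open>C\<^sup>2\<^sup>,\<^sup>1\<close> on \<open>\<real>\<^sup>d \<times> [0, \<infinity>) \<times> S\<close>; the time derivative is one-sided at \<open>0\<close>.\<close>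

definition C21 :: "(real^'d \<Rightarrow> real \<Rightarrow> 's \<Rightarrow> real) \<Rightarrow> bool" where
  "C21 V \<longleftrightarrow>
     (\<forall>x i. \<forall>t\<ge>0.
        (\<lambda>s. V x s i) differentiable (at t within {0..}) \<and>
        (\<forall>j. partial_differentiable j (\<lambda>z. V z t i) x) \<and>
        (\<forall>l j. partial_differentiable l (partial_deriv j (\<lambda>z. V z t i)) x)) \<and>
     (\<forall>i. continuous_on (UNIV \<times> {0..}) (\<lambda>(x, t). V x t i) \<and>
          continuous_on (UNIV \<times> {0..}) (\<lambda>(x, t). deriv_t V x t i) \<and>
          continuous_on (UNIV \<times> {0..}) (\<lambda>(x, t). deriv_x V x t i) \<and>
          continuous_on (UNIV \<times> {0..}) (\<lambda>(x, t). deriv_xx V x t i))"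

definition L_operator ::
    "real^'s^'s \<Rightarrow> (real^'d \<Rightarrow> 's::finite \<Rightarrow> real^'d) \<Rightarrow>
     (real^'d \<Rightarrow> real^'d \<Rightarrow> real \<Rightarrow> 's \<Rightarrow> real^'d) \<Rightarrow>
     (real^'d \<Rightarrow> real^'d \<Rightarrow> real \<Rightarrow> 's \<Rightarrow> real^'m^'d) \<Rightarrow>
     (real^'d \<Rightarrow> real \<Rightarrow> 's \<Rightarrow> real) \<Rightarrow> real^'d \<Rightarrow> real^'d \<Rightarrow> real \<Rightarrow> 's \<Rightarrow> real" where
  "L_operator \<Gamma> D f g V x y t i =
     deriv_t V (x - D y i) t i
     + deriv_x V (x - D y i) t i \<bullet> f x y t i
     + 1 / 2 * trace (transpose (g x y t i) ** deriv_xx V (x - D y i) t i ** g x y t i)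
     + (\<Sum>j\<in>UNIV. \<Gamma> $ i $ j * V (x - D y i) t j)"


section \<open>Moment exponents\<close>

definition ln_ennreal :: "ennreal \<Rightarrow> ereal" where
  "ln_ennreal z = (if z = 0 then -\<infinity> else if z = \<infinity> then \<infinity> else ereal (ln (enn2real z)))"

definition moment_lyapunov_exponent ::
    "'a measure \<Rightarrow> real \<Rightarrow> (real \<Rightarrow> 'a \<Rightarrow> 'b::real_normed_vector) \<Rightarrow> ereal" where
  "moment_lyapunov_exponent M p X =
     Limsup at_top (\<lambda>t. ln_ennreal (\<integral>\<^sup>+\<omega>. ennreal (norm (X t \<omega>) powr p) \<partial>M) / ereal t)"

end

theory Submission
  imports Defs
begin

text \<open>The process \<open>Z(t) = X(t) - D(X(t - \<tau>), r(t))\<close> has continuous paths. It is stopped at the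
  exit time \<open>\<sigma>\<close> from a ball, and Dynkin's inequality for \<open>W(z, t, i) = e\<^sup>\<lambda>\<^sup>t V(z, t, i)\<close> is
  proved directly on dyadic grids, without an Ito formula: the process is killed after \<open>\<sigma>\<close>, which has
  the right sign since \<open>V \<ge> 0\<close> and means that the chain need not be stopped; over one grid interval
  the increment of \<open>W\<close> is expanded to second order, the jump of the chain enters through its
  transition probabilities, and the stochastic integral only through its first two conditional moments.
  The \<open>U\<close> terms then cancel along each path because \<open>\<alpha>\<^sub>1 \<ge> \<alpha>\<^sub>2 e\<^sup>\<lambda>\<^sup>\<tau>\<close>, and Gronwall's
  inequality with the integrable kernel \<open>\<psi>\<close> bounds \<open>e\<^sup>\<lambda>\<^sup>t E V(Z(t), t, r(t))\<close> on the event that \<open>Z\<close> has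
  not left the ball, uniformly in its radius. Finally,
  \<open>|X(t)|\<^sup>p \<le> (1 - \<beta>)\<^sup>1\<^sup>-\<^sup>p |Z(t)|\<^sup>p + \<beta> |X(t - \<tau>)|\<^sup>p\<close> together with
  \<open>\<beta> e\<^sup>\<lambda>\<^sup>\<tau> < 1\<close> carries the decay over from \<open>Z\<close> to \<open>X\<close>, one delay interval at a time.\<close>

section \<open>Brownian increments and simple processes\<close>

text \<open>The Ito integral is given only as a limit in probability of simple integrals, so none of
  its moments is available at the outset. Stopping bounds the integrand, and a cap on the energy of
  the approximants turns almost sure convergence into convergence in \<open>L^2\<close>. The
  isometry then passes to the limit in tested form, against bounded weights known at the start of a
  step; conditional expectations take this form throughout. In the one-step expansion the delicate
  terms are products of a jump of the chain, or of a squared increment, with an increment of the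
  path. Summed over the grid they are at most the number of jumps, or the discrete quadratic
  variation, times the largest increment. The first two have second moments bounded uniformly in the
  grid, the last tends to 0 in \<open>L^2\<close> without any rate, and Cauchy-Schwarz combines the
  two facts. The modulus of continuity of the second derivatives is fixed before the grid is
  refined, because its threshold appears in a denominator.\<close>

lemma integral_lborel_prod:
  fixes F :: "'a::euclidean_space \<Rightarrow> real \<Rightarrow> real"
  assumes F: "\<And>b. b \<in> Basis \<Longrightarrow> integrable lborel (F b)"
  shows "integrable lborel (\<lambda>x. \<Prod>b\<in>Basis. F b (x \<bullet> b))"
    and "(\<integral>x. (\<Prod>b\<in>Basis. F b (x \<bullet> b)) \<partial>lborel) = (\<Prod>b\<in>Basis. \<integral>x. F b x \<partial>lborel)"
proof -
  interpret product_sigma_finite "\<lambda>b::'a. lborel :: real measure" ..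
  have [measurable]: "F b \<in> borel_measurable borel" if "b \<in> Basis" for b
    using F[OF that] by auto
  have *: "(\<Prod>b\<in>Basis. F b ((\<Sum>b\<in>Basis. f b *\<^sub>R b) \<bullet> b)) = (\<Prod>b\<in>Basis. F b (f b))" for f :: "'a \<Rightarrow> real"
    by (intro prod.cong) auto
  have m: "(\<lambda>x::'a. \<Prod>b\<in>Basis. F b (x \<bullet> b)) \<in> borel_measurable borel"
    by measurable
  have m2: "(\<lambda>f. \<Sum>b\<in>Basis. f b *\<^sub>R b) \<in> (\<Pi>\<^sub>M b\<in>Basis. lborel) \<rightarrow>\<^sub>M (borel :: 'a measure)"
    by measurable
  show "integrable lborel (\<lambda>x. \<Prod>b\<in>Basis. F b (x \<bullet> b))"
    unfolding lborel_eq[where 'a='a]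
    by (subst integrable_distr_eq[OF m2 m]) (simp add: * product_integrable_prod F)
  show "(\<integral>x. (\<Prod>b\<in>Basis. F b (x \<bullet> b)) \<partial>lborel) = (\<Prod>b\<in>Basis. \<integral>x. F b x \<partial>lborel)"
    unfolding lborel_eq[where 'a='a]
    by (subst integral_distr[OF m2 m]) (simp add: * product_integral_prod F)
qed

text \<open>The index type takes the place of the orthonormal basis: \<open>ix\<close> inverts the
  map that sends an index to its axis vector.\<close>

lemma integral_lborel_prod_vec:
  fixes F :: "'m::finite \<Rightarrow> real \<Rightarrow> real"
  assumes F: "\<And>k. integrable lborel (F k)"
  shows "integrable lborel (\<lambda>x::real^'m. \<Prod>k\<in>UNIV. F k (x $ k))"
    and "(\<integral>x. (\<Prod>k\<in>UNIV. F k (x $ k)) \<partial>(lborel :: (real^'m) measure)) = (\<Prod>k\<in>UNIV. \<integral>x. F k x \<partial>lborel)"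
proof -
  define ix where "ix b = (THE k. b = axis k (1::real))" for b :: "real^'m"
  have ix: "ix (axis k 1) = k" for k
    unfolding ix_def by (auto simp: axis_eq_axis)
  have B: "(Basis :: (real^'m) set) = (\<lambda>k. axis k 1) ` UNIV"
    by (auto simp: Basis_vec_def)
  have inj: "inj (\<lambda>k. axis k (1::real) :: real^'m)"
    by (auto simp: inj_on_def axis_eq_axis)
  have p: "(\<Prod>k\<in>UNIV. G (axis k 1)) = (\<Prod>b\<in>(Basis :: (real^'m) set). G b)" for G :: "real^'m \<Rightarrow> real"
    unfolding B by (subst prod.reindex[OF inj]) simp
  have *: "(\<Prod>k\<in>UNIV. F k (x $ k)) = (\<Prod>b\<in>Basis. F (ix b) (x \<bullet> b))" for x :: "real^'m"
    using p[of "\<lambda>b. F (ix b) (x \<bullet> b)"] by (simp add: ix inner_axis)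
  have **: "(\<Prod>k\<in>UNIV. \<integral>x. F k x \<partial>lborel) = (\<Prod>b\<in>(Basis :: (real^'m) set). \<integral>x. F (ix b) x \<partial>lborel)"
    using p[of "\<lambda>b. \<integral>x. F (ix b) x \<partial>lborel"] by (simp add: ix)
  show "integrable lborel (\<lambda>x::real^'m. \<Prod>k\<in>UNIV. F k (x $ k))"
    and "(\<integral>x. (\<Prod>k\<in>UNIV. F k (x $ k)) \<partial>(lborel :: (real^'m) measure)) = (\<Prod>k\<in>UNIV. \<integral>x. F k x \<partial>lborel)"
    unfolding * ** using integral_lborel_prod[of "\<lambda>b. F (ix b)"] F by auto
qed

text \<open>Mean and covariance of the centred product Gaussian. A monomial splits over the
  coordinates just as the density does, so everything reduces to the moments of order 0, 1 and 2 in
  one dimension.\<close>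

lemma gaussian_moments:
  fixes \<sigma> :: real and k l :: "'m::finite"
  assumes \<sigma>: "\<sigma> > 0"
  shows "has_bochner_integral lborel (\<lambda>x::real^'m. (\<Prod>j\<in>UNIV. normal_density 0 \<sigma> (x $ j)) * x $ k) 0"
    and "has_bochner_integral lborel (\<lambda>x::real^'m. (\<Prod>j\<in>UNIV. normal_density 0 \<sigma> (x $ j)) * (x $ k * x $ l))
           (if k = l then \<sigma>\<^sup>2 else 0)"
proof -
  have i0: "has_bochner_integral lborel (normal_density 0 \<sigma>) 1"
    using \<sigma> by (auto simp: has_bochner_integral_iff)
  have i1: "has_bochner_integral lborel (\<lambda>x. normal_density 0 \<sigma> x * x) 0"
    by (rule normal_moment_nz_1[OF \<sigma>])
  have i2: "has_bochner_integral lborel (\<lambda>x. normal_density 0 \<sigma> x * (x * x)) (\<sigma>\<^sup>2)"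
    using normal_moment_even[OF \<sigma>, of 0 1] \<sigma>
    by (simp add: power2_eq_square field_simps eval_nat_numeral)
  \<comment> \<open>The coordinate \<open>x $ k\<close> is absorbed into the factor of index
    \<open>k\<close>; that factor then has integral 0 and annihilates the product.\<close>
  define F where "F j x = normal_density 0 \<sigma> x * (if j = k then x else 1)" for j x
  have F: "has_bochner_integral lborel (F j) (if j = k then 0 else 1)" for j
    using i0 i1 by (cases "j = k") (auto simp: F_def[abs_def] cong: if_cong)
  have Fi: "integrable lborel (F j)" for j
    using F[of j] by (auto simp: has_bochner_integral_iff)
  have eq: "(\<Prod>j\<in>UNIV. normal_density 0 \<sigma> (x $ j)) * x $ k = (\<Prod>j\<in>UNIV. F j (x $ j))" for x :: "real^'m"
    by (auto simp: F_def prod.distrib)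
  have "(\<Prod>j\<in>UNIV. \<integral>x. F j x \<partial>lborel) = 0"
    using F by (auto simp: has_bochner_integral_iff)
  then show "has_bochner_integral lborel (\<lambda>x::real^'m. (\<Prod>j\<in>UNIV. normal_density 0 \<sigma> (x $ j)) * x $ k) 0"
    unfolding eq using integral_lborel_prod_vec[of F, OF Fi] by (auto simp: has_bochner_integral_iff)
  \<comment> \<open>Each power is attached on its own: for \<open>k = l\<close> one factor carries
    the square, for distinct indices two factors carry a single power and integrate to 0.\<close>
  define G where "G j x = normal_density 0 \<sigma> x * ((if j = k then x else 1) * (if j = l then x else 1))" for j x
  have G: "has_bochner_integral lborel (G j)
      (if j = k \<and> j = l then \<sigma>\<^sup>2 else if j = k \<or> j = l then 0 else 1)" for j
    using i0 i1 i2 by (cases "j = k"; cases "j = l") (auto simp: G_def[abs_def] cong: if_cong)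
  have Gi: "integrable lborel (G j)" for j
    using G[of j] by (auto simp: has_bochner_integral_iff)
  have eq: "(\<Prod>j\<in>UNIV. normal_density 0 \<sigma> (x $ j)) * (x $ k * x $ l) = (\<Prod>j\<in>UNIV. G j (x $ j))" for x :: "real^'m"
    by (auto simp: G_def prod.distrib)
  have "(\<Prod>j\<in>UNIV. \<integral>x. G j x \<partial>lborel)
      = (\<Prod>j\<in>UNIV. if j = k \<and> j = l then \<sigma>\<^sup>2 else if j = k \<or> j = l then 0 else 1)"
    using G by (intro prod.cong) (auto simp: has_bochner_integral_iff)
  also have "\<dots> = (if k = l then \<sigma>\<^sup>2 else 0)"
  proof (cases "k = l")
    case True
    then have "(\<Prod>j\<in>UNIV. if j = k \<and> j = l then \<sigma>\<^sup>2 else if j = k \<or> j = l then 0 else 1)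
        = (\<Prod>j\<in>UNIV. if j = k then \<sigma>\<^sup>2 else 1)"
      by (intro prod.cong) auto
    with True show ?thesis by simp
  next
    case False
    then show ?thesis by auto
  qed
  finally show "has_bochner_integral lborel (\<lambda>x::real^'m. (\<Prod>j\<in>UNIV. normal_density 0 \<sigma> (x $ j)) * (x $ k * x $ l))
           (if k = l then \<sigma>\<^sup>2 else 0)"
    unfolding eq using integral_lborel_prod_vec[of G, OF Gi] by (auto simp: has_bochner_integral_iff)
qed

text \<open>Independence of the increment from \<open>F s\<close> factorises the expectation, and
  the increment contributes its Gaussian moments. The weight is merely integrable, since it will
  contain earlier increments, which are unbounded.\<close>

lemma brownian_increment_moments:
  fixes B :: "real \<Rightarrow> 'a \<Rightarrow> real^'m::finite" and Y :: "'a \<Rightarrow> real"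
  assumes M: "prob_space M" and filt: "complete_filtration M F" and B: "brownian_motion M F B"
    and st: "0 \<le> s" "s \<le> t" and Y: "Y \<in> borel_measurable (F s)" and iY: "integrable M Y"
  shows "has_bochner_integral M (\<lambda>w. Y w * (B t w - B s w) $ k) 0"
    and "has_bochner_integral M (\<lambda>w. Y w * ((B t w - B s w) $ k * (B t w - B s w) $ l))
           (if k = l then (t - s) * (\<integral>w. Y w \<partial>M) else 0)"
proof -
  interpret prob_space M by fact
  have "has_bochner_integral M (\<lambda>w. Y w * (B t w - B s w) $ k) 0 \<and>
    has_bochner_integral M (\<lambda>w. Y w * ((B t w - B s w) $ k * (B t w - B s w) $ l))
           (if k = l then (t - s) * (\<integral>w. Y w \<partial>M) else 0)"
  proof (cases "s = t")
    \<comment> \<open>The law of the increment is prescribed only for \<open>s < t\<close>; for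
      equal times the increment is 0.\<close>
    case True
    then show ?thesis by (simp add: has_bochner_integral_zero)
  next
    case False
    with st have st': "s < t" by simp
    let ?D = "\<lambda>w. B t w - B s w"
    from B st st' have ind: "indep_set (sets (F s)) (sets (vimage_algebra (space M) ?D borel))"
      and dist: "distributed M lborel ?D (\<lambda>x. ennreal (\<Prod>k\<in>UNIV. normal_density 0 (sqrt (t - s)) (x $ k)))"
      by (auto simp: brownian_motion_def)
    have sub: "subalgebra M (F s)"
      using filt st by (auto simp: complete_filtration_def)
    have YM: "Y \<in> borel_measurable M"
      using Y sub measurable_from_subalg by blast
    have Dm: "?D \<in> borel_measurable M"
      using distributed_measurable[OF dist] by simp
    \<comment> \<open>Independence of random variables means independence of the sigma-algebras they
      generate. These lie inside \<open>F s\<close> and the sigma-algebra of the increment, and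
      independence passes to smaller families.\<close>
    have iv: "indep_var borel Y borel (\<lambda>w. h (?D w))" if h: "h \<in> borel_measurable borel" for h :: "real^'m \<Rightarrow> real"
    proof -
      have sp: "space (F s) = space M" using sub by (auto simp: subalgebra_def)
      have 1: "sigma_sets (space M) {Y -` A \<inter> space M |A. A \<in> sets borel} \<subseteq> sets (F s)"
      proof -
        have "{Y -` A \<inter> space M |A. A \<in> sets borel} \<subseteq> sets (F s)"
          using measurable_sets[OF Y] sp by auto
        from sets.sigma_sets_subset[OF this] show ?thesis by (simp add: sp)
      qed
      have 2: "sigma_sets (space M) {(\<lambda>w. h (?D w)) -` A \<inter> space M |A. A \<in> sets borel}
          \<subseteq> sets (vimage_algebra (space M) ?D borel)"
      proof -
        have "(\<lambda>w. h (?D w)) \<in> borel_measurable (vimage_algebra (space M) ?D borel)"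
          using h by (intro measurable_compose[OF _ h] measurable_vimage_algebra1) auto
        from measurable_sets[OF this] have "{(\<lambda>w. h (?D w)) -` A \<inter> space M |A. A \<in> sets borel}
          \<subseteq> sets (vimage_algebra (space M) ?D borel)" by auto
        then show ?thesis
          using sets.sigma_sets_subset[of _ "vimage_algebra (space M) ?D borel"] by simp
      qed
      have "indep_set (sigma_sets (space M) {Y -` A \<inter> space M |A. A \<in> sets borel})
        (sigma_sets (space M) {(\<lambda>w. h (?D w)) -` A \<inter> space M |A. A \<in> sets borel})"
        using ind 1 2 unfolding indep_set_def by (rule_tac indep_sets_mono_sets) (auto split: bool.split)
      then show ?thesis
        using YM Dm h by (auto simp: indep_var_eq)
    qed
    have ex: "has_bochner_integral M (\<lambda>w. Y w * h (?D w)) ((\<integral>w. Y w \<partial>M) * c)"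
      if h: "h \<in> borel_measurable borel"
        and hc: "has_bochner_integral lborel (\<lambda>x. (\<Prod>k\<in>UNIV. normal_density 0 (sqrt (t - s)) (x $ k)) * h x) c"
      for h :: "real^'m \<Rightarrow> real" and c
    proof -
      have nn: "(\<Prod>k\<in>UNIV. normal_density 0 (sqrt (t - s)) (x $ k)) \<ge> 0" for x :: "real^'m"
        by (intro prod_nonneg) auto
      have i: "integrable M (\<lambda>w. h (?D w))"
        using hc h nn by (subst distributed_integrable[OF dist, symmetric]) (auto simp: has_bochner_integral_iff)
      have e: "(\<integral>w. h (?D w) \<partial>M) = c"
        using hc h nn by (subst distributed_integral[OF dist, symmetric]) (auto simp: has_bochner_integral_iff)
      from indep_var_lebesgue_integral[OF iv[OF h] iY i] indep_var_integrable[OF iv[OF h] iY i] e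
      show ?thesis by (auto simp: has_bochner_integral_iff)
    qed
    have p: "sqrt (t - s) > 0" using st' by simp
    show ?thesis
      using ex[OF _ gaussian_moments(1)[OF p, of k]] ex[OF _ gaussian_moments(2)[OF p, of k l]] st'
      by (cases "k = l") (auto simp: mult.commute)
  qed
  then show "has_bochner_integral M (\<lambda>w. Y w * (B t w - B s w) $ k) 0"
    and "has_bochner_integral M (\<lambda>w. Y w * ((B t w - B s w) $ k * (B t w - B s w) $ l))
           (if k = l then (t - s) * (\<integral>w. Y w \<partial>M) else 0)" by auto
qed

lemma measurable_vec_nth [measurable (raw)]:
  "f \<in> borel_measurable M \<Longrightarrow> (\<lambda>x. (f x :: ('b::euclidean_space)^'n::finite) $ i) \<in> borel_measurable M"
  by (rule measurable_compose[OF _ borel_measurable_continuous_onI[of "\<lambda>v. v $ i"]])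
     (auto intro: continuous_intros)

lemma measurable_matrix_vector_mult [measurable (raw)]:
  fixes C :: "'a \<Rightarrow> real^'m::finite^'d::finite"
  assumes "C \<in> borel_measurable M" "v \<in> borel_measurable M"
  shows "(\<lambda>x. C x *v v x) \<in> borel_measurable M"
  by (rule borel_measurable_continuous_Pair[OF assms])
     (auto simp: matrix_vector_mult_def intro!: continuous_intros)

locale filtered_brownian = prob_space M for M :: "'a measure" +
  fixes F :: "real \<Rightarrow> 'a measure" and B :: "real \<Rightarrow> 'a \<Rightarrow> real^'m::finite"
  assumes filt: "complete_filtration M F" and bm: "brownian_motion M F B"
begin

abbreviation LM :: "(real \<times> 'a) measure" where "LM \<equiv> lborel \<Otimes>\<^sub>M M"

lemma sub: "0 \<le> t \<Longrightarrow> subalgebra M (F t)"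
  and sets_mono: "0 \<le> s \<Longrightarrow> s \<le> t \<Longrightarrow> sets (F s) \<subseteq> sets (F t)"
  using filt by (auto simp: complete_filtration_def)

lemma space_F [simp]: "0 \<le> t \<Longrightarrow> space (F t) = space M"
  using sub by (auto simp: subalgebra_def)

lemma meas_M: "0 \<le> t \<Longrightarrow> f \<in> measurable (F t) K \<Longrightarrow> f \<in> measurable M K"
  using sub measurable_from_subalg by blast

lemma meas_mono: "0 \<le> s \<Longrightarrow> s \<le> t \<Longrightarrow> f \<in> measurable (F s) K \<Longrightarrow> f \<in> measurable (F t) K"
  using sets_mono[of s t] by (auto simp: measurable_def)

lemma B_meas: "0 \<le> s \<Longrightarrow> s \<le> t \<Longrightarrow> B s \<in> borel_measurable (F t)"
  using bm meas_mono[of s t "B s"] by (auto simp: brownian_motion_def adapted_process_def)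

lemma integrable_mult_bounded:
  fixes \<zeta> c :: "'a \<Rightarrow> real"
  assumes "integrable M \<zeta>" and [measurable]: "c \<in> borel_measurable M" and c: "\<And>w. w \<in> space M \<Longrightarrow> \<bar>c w\<bar> \<le> K"
  shows "integrable M (\<lambda>w. \<zeta> w * c w)"
proof (rule Bochner_Integration.integrable_bound)
  have [measurable]: "\<zeta> \<in> borel_measurable M" using assms(1) by auto
  show "integrable M (\<lambda>w. K * \<zeta> w)" using assms(1) by simp
  show "(\<lambda>w. \<zeta> w * c w) \<in> borel_measurable M" by measurable
  show "AE w in M. norm (\<zeta> w * c w) \<le> norm (K * \<zeta> w)"
  proof (rule AE_I2)
    fix w assume "w \<in> space M"
    from c[OF this] have "\<bar>\<zeta> w\<bar> * \<bar>c w\<bar> \<le> \<bar>\<zeta> w\<bar> * \<bar>K\<bar>"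
      by (intro mult_left_mono) auto
    then show "norm (\<zeta> w * c w) \<le> norm (K * \<zeta> w)"
      by (simp add: abs_mult mult.commute)
  qed
qed

lemma integrable_bounded:
  fixes c :: "'a \<Rightarrow> real"
  assumes "c \<in> borel_measurable M" and c: "\<And>w. w \<in> space M \<Longrightarrow> \<bar>c w\<bar> \<le> K"
  shows "integrable M c"
  using integrable_mult_bounded[of "\<lambda>_. 1" c K] assms by simp

text \<open>The isometry over one time step, weighted by a random variable known at time
  \<open>s\<close> and polarised over two coordinates: the covariance rate is the entry
  \<open>a\<close>, \<open>b\<close> of \<open>C\<close> times its transpose. Boundedness of
  \<open>C\<close> keeps the products of its entries with \<open>\<zeta>\<close> integrable.\<close>

lemma matrix_increment_moments:
  fixes C :: "'a \<Rightarrow> real^'m^'d::finite" and \<zeta> :: "'a \<Rightarrow> real"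
  assumes st: "0 \<le> s" "s \<le> t"
    and C: "C \<in> borel_measurable (F s)" and Cb: "\<And>w. w \<in> space M \<Longrightarrow> norm (C w) \<le> K"
    and \<zeta>: "\<zeta> \<in> borel_measurable (F s)" "integrable M \<zeta>"
  shows "has_bochner_integral M (\<lambda>w. \<zeta> w * (C w *v (B t w - B s w)) $ a) 0"
    and "has_bochner_integral M (\<lambda>w. \<zeta> w * ((C w *v (B t w - B s w)) $ a * (C w *v (B t w - B s w)) $ b))
           (\<integral>w. \<zeta> w * ((t - s) * (\<Sum>k\<in>UNIV. C w $ a $ k * C w $ b $ k)) \<partial>M)"
proof -
  note [measurable] = C \<zeta>(1)
  have Cc: "\<bar>C w $ a $ k\<bar> \<le> K" if "w \<in> space M" for w a k
    using Cb[OF that] component_le_norm_cart[of "C w $ a" k] Finite_Cartesian_Product.norm_nth_le[of "C w" a] by linarith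
  have Cm: "(\<lambda>w. C w $ a $ k) \<in> borel_measurable (F s)" for a k
    by measurable
  have i1: "integrable M (\<lambda>w. \<zeta> w * C w $ a $ k)" for a k
    by (rule integrable_mult_bounded[OF \<zeta>(2)]) (use Cc meas_M[OF st(1) Cm] in auto)
  have i2: "integrable M (\<lambda>w. \<zeta> w * C w $ a $ k * C w $ b $ l)" for a b k l
    by (rule integrable_mult_bounded[OF i1]) (use Cc meas_M[OF st(1) Cm] in auto)
  note bim = brownian_increment_moments[OF prob_space_axioms filt bm st]
  have "has_bochner_integral M (\<lambda>w. \<Sum>k\<in>UNIV. (\<zeta> w * C w $ a $ k) * (B t w - B s w) $ k) (\<Sum>k\<in>(UNIV::'m set). 0)"
    by (rule has_bochner_integral_sum) (rule bim(1)[OF _ i1], measurable)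
  then show "has_bochner_integral M (\<lambda>w. \<zeta> w * (C w *v (B t w - B s w)) $ a) 0"
    by (simp add: matrix_vector_mult_def sum_distrib_left mult.assoc)
  have "has_bochner_integral M (\<lambda>w. \<Sum>k\<in>UNIV. \<Sum>l\<in>UNIV. (\<zeta> w * C w $ a $ k * C w $ b $ l) *
      ((B t w - B s w) $ k * (B t w - B s w) $ l))
    (\<Sum>k\<in>UNIV. \<Sum>l\<in>UNIV. if k = l then (t - s) * (\<integral>w. \<zeta> w * C w $ a $ k * C w $ b $ l \<partial>M) else 0)"
    by (rule has_bochner_integral_sum, rule has_bochner_integral_sum) (rule bim(2)[OF _ i2], measurable)
  moreover have "(\<Sum>k\<in>UNIV. \<Sum>l\<in>UNIV. (\<zeta> w * C w $ a $ k * C w $ b $ l) *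
      ((B t w - B s w) $ k * (B t w - B s w) $ l))
    = \<zeta> w * ((C w *v (B t w - B s w)) $ a * (C w *v (B t w - B s w)) $ b)" for w
    unfolding matrix_vector_mult_def by (simp add: sum_product) (simp add: sum_distrib_left mult_ac)
  moreover have "(\<Sum>k\<in>UNIV. \<Sum>l\<in>UNIV. if k = l then (t - s) * (\<integral>w. \<zeta> w * C w $ a $ k * C w $ b $ l \<partial>M) else 0)
    = (\<integral>w. \<zeta> w * ((t - s) * (\<Sum>k\<in>UNIV. C w $ a $ k * C w $ b $ k)) \<partial>M)"
  proof -
    have "(\<integral>w. \<zeta> w * ((t - s) * (\<Sum>k\<in>UNIV. C w $ a $ k * C w $ b $ k)) \<partial>M)
      = (\<integral>w. (\<Sum>k\<in>UNIV. (t - s) * (\<zeta> w * C w $ a $ k * C w $ b $ k)) \<partial>M)"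
      by (simp add: sum_distrib_left mult_ac)
    also have "\<dots> = (\<Sum>k\<in>UNIV. (t - s) * (\<integral>w. \<zeta> w * C w $ a $ k * C w $ b $ k \<partial>M))"
      using i2 by (subst Bochner_Integration.integral_sum) auto
    finally show ?thesis by simp
  qed
  ultimately show "has_bochner_integral M (\<lambda>w. \<zeta> w * ((C w *v (B t w - B s w)) $ a * (C w *v (B t w - B s w)) $ b))
           (\<integral>w. \<zeta> w * ((t - s) * (\<Sum>k\<in>UNIV. C w $ a $ k * C w $ b $ k)) \<partial>M)"
    by simp
qed

section \<open>Ito sums along a deterministic grid\<close>

definition grid_sum :: "(nat \<Rightarrow> real) \<Rightarrow> (nat \<Rightarrow> 'a \<Rightarrow> real^'m^'d::finite) \<Rightarrow> nat \<Rightarrow> 'a \<Rightarrow> real^'d" where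
  "grid_sum u c k w = (\<Sum>j<k. c j w *v (B (u (Suc j)) w - B (u j) w))"

lemma grid_mono:
  assumes "\<And>k. k < L \<Longrightarrow> u k < (u (Suc k) :: real)" and "p \<le> q" "q \<le> L"
  shows "u p \<le> u q"
  using assms(2,3)
proof (induction q rule: dec_induct)
  case (step n)
  then show ?case using assms(1)[of n] by force
qed simp

lemma grid_sum_measurable:
  fixes c :: "nat \<Rightarrow> 'a \<Rightarrow> real^'m^'d::finite"
  assumes u: "u 0 = 0" "\<And>k. k < L \<Longrightarrow> u k < u (Suc k)" and c: "\<And>k. k < L \<Longrightarrow> c k \<in> borel_measurable (F (u k))"
    and q: "q \<le> L"
  shows "grid_sum u c q \<in> borel_measurable (F (u q))"
proof -
  have nn: "0 \<le> u j" if "j \<le> L" for j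
    using grid_mono[of L u 0 j] u that by auto
  have "(\<lambda>w. c j w *v (B (u (Suc j)) w - B (u j) w)) \<in> borel_measurable (F (u q))" if j: "j < q" for j
  proof -
    have le: "0 \<le> u j" "u j \<le> u q" "0 \<le> u (Suc j)" "u (Suc j) \<le> u q"
      using nn j q by (auto intro!: grid_mono[of L u] u(2))
    have [measurable]: "c j \<in> borel_measurable (F (u q))" "B (u j) \<in> borel_measurable (F (u q))"
      "B (u (Suc j)) \<in> borel_measurable (F (u q))"
      using meas_mono[OF le(1,2) c] B_meas le j q by auto
    show ?thesis
      by measurable
  qed
  then show ?thesis
    unfolding grid_sum_def[abs_def] by measurable
qed


text \<open>Induction on the end of the window. The newest increment is uncorrelated with all that
  is known before it, so only its own second moment is added. The first moments belong to the
  induction because they supply the integrability of the weights in the two mixed terms.\<close>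

lemma grid_sum_moments:
  fixes c :: "nat \<Rightarrow> 'a \<Rightarrow> real^'m^'d::finite"
  assumes u: "u 0 = 0" "\<And>k. k < L \<Longrightarrow> u k < u (Suc k)"
    and c: "\<And>k. k < L \<Longrightarrow> c k \<in> borel_measurable (F (u k))"
    and cb: "\<And>k w. k < L \<Longrightarrow> w \<in> space M \<Longrightarrow> norm (c k w) \<le> K k"
    and pq: "p \<le> q" "q \<le> L"
    and \<eta>: "\<eta> \<in> borel_measurable (F (u p))" "\<And>w. w \<in> space M \<Longrightarrow> \<bar>\<eta> w\<bar> \<le> C"
  shows "has_bochner_integral M (\<lambda>w. \<eta> w * (grid_sum u c q w - grid_sum u c p w) $ a) 0 \<and>
    has_bochner_integral M (\<lambda>w. \<eta> w * (grid_sum u c q w - grid_sum u c p w) $ b) 0 \<and>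
    has_bochner_integral M (\<lambda>w. \<eta> w * ((grid_sum u c q w - grid_sum u c p w) $ a * (grid_sum u c q w - grid_sum u c p w) $ b))
      (\<integral>w. \<eta> w * (\<Sum>k=p..<q. (u (Suc k) - u k) * (\<Sum>i\<in>UNIV. c k w $ a $ i * c k w $ b $ i)) \<partial>M)"
  using pq
proof (induction q rule: dec_induct)
  case base
  then show ?case by (simp add: has_bochner_integral_zero)
next
  case (step q)
  then have q: "q < L" "q \<le> L" and pq: "p \<le> q" by auto
  have nn: "0 \<le> u j" if "j \<le> L" for j
    using grid_mono[of L u 0 j] u that by auto
  have up: "0 \<le> u p" "u p \<le> u q" "0 \<le> u q" "u q \<le> u (Suc q)"
    using nn q pq u(2)[of q] grid_mono[of L u p q] u(2) by (auto intro: less_imp_le)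
  let ?D = "\<lambda>w. grid_sum u c q w - grid_sum u c p w"
  let ?X = "\<lambda>w. c q w *v (B (u (Suc q)) w - B (u q) w)"
  have IH: "has_bochner_integral M (\<lambda>w. \<eta> w * ?D w $ a) 0"
    "has_bochner_integral M (\<lambda>w. \<eta> w * ?D w $ b) 0"
    "has_bochner_integral M (\<lambda>w. \<eta> w * (?D w $ a * ?D w $ b))
      (\<integral>w. \<eta> w * (\<Sum>k=p..<q. (u (Suc k) - u k) * (\<Sum>i\<in>UNIV. c k w $ a $ i * c k w $ b $ i)) \<partial>M)"
    using step.IH q by auto
  have m[measurable]: "grid_sum u c q \<in> borel_measurable (F (u q))" "grid_sum u c p \<in> borel_measurable (F (u q))"
    "\<eta> \<in> borel_measurable (F (u q))"
  proof -
    show "grid_sum u c q \<in> borel_measurable (F (u q))"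
      using u c q(2) by (rule grid_sum_measurable)
    show "grid_sum u c p \<in> borel_measurable (F (u q))"
      by (rule meas_mono[OF up(1,2)], rule grid_sum_measurable[of u L]) (use u c q pq in auto)
    show "\<eta> \<in> borel_measurable (F (u q))"
      by (rule meas_mono[OF up(1,2) \<eta>(1)])
  qed
  have \<eta>i: "integrable M \<eta>"
    using meas_M[OF up(1) \<eta>(1)] \<eta>(2) by (rule integrable_bounded)
  note mim = matrix_increment_moments[OF up(3,4) c[OF q(1)] cb[OF q(1)]]
  have X1: "has_bochner_integral M (\<lambda>w. \<eta> w * ?X w $ a') 0" for a'
    by (rule mim) (use \<eta>i in auto)
  have X2: "has_bochner_integral M (\<lambda>w. \<eta> w * (?X w $ a * ?X w $ b))
      (\<integral>w. \<eta> w * ((u (Suc q) - u q) * (\<Sum>i\<in>UNIV. c q w $ a $ i * c q w $ b $ i)) \<partial>M)"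
    by (rule mim) (use \<eta>i in auto)
  \<comment> \<open>In the mixed terms the past increment joins the weight; it is measurable at time
    \<open>u q\<close>, so the first-moment claim for one step applies.\<close>
  have X3: "has_bochner_integral M (\<lambda>w. (\<eta> w * ?D w $ a) * ?X w $ b) 0"
    by (rule mim) (use IH(1) in \<open>auto simp: has_bochner_integral_iff\<close>)
  have X4: "has_bochner_integral M (\<lambda>w. (\<eta> w * ?D w $ b) * ?X w $ a) 0"
    by (rule mim) (use IH(2) in \<open>auto simp: has_bochner_integral_iff\<close>)
  have S: "grid_sum u c (Suc q) w - grid_sum u c p w = ?D w + ?X w" for w
    by (simp add: grid_sum_def)
  have i: "integrable M (\<lambda>w. \<eta> w * ((u (Suc k) - u k) * (\<Sum>i\<in>UNIV. c k w $ a $ i * c k w $ b $ i)))" if k: "k < L" for k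
  proof -
    have mk: "c k \<in> borel_measurable M"
      by (rule meas_M[OF _ c[OF k]]) (use nn k in auto)
    have "\<bar>c k w $ a $ i\<bar> \<le> K k" if "w \<in> space M" for w a i
      using cb[OF k that] component_le_norm_cart[of "c k w $ a" i] Finite_Cartesian_Product.norm_nth_le[of "c k w" a] by linarith
    then have "integrable M (\<lambda>w. \<eta> w * c k w $ a $ i * c k w $ b $ i)" for i
      by (intro integrable_mult_bounded[where K="K k"] \<eta>i) (use mk in auto)
    then have "integrable M (\<lambda>w. \<Sum>i\<in>UNIV. (u (Suc k) - u k) * (\<eta> w * c k w $ a $ i * c k w $ b $ i))"
      by auto
    then show ?thesis
      by (simp add: sum_distrib_left mult_ac)
  qed
  have 1: "has_bochner_integral M (\<lambda>w. \<eta> w * (grid_sum u c (Suc q) w - grid_sum u c p w) $ a) 0"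
    using has_bochner_integral_add[OF IH(1) X1[of a]] unfolding S by (simp add: algebra_simps)
  have 2: "has_bochner_integral M (\<lambda>w. \<eta> w * (grid_sum u c (Suc q) w - grid_sum u c p w) $ b) 0"
    using has_bochner_integral_add[OF IH(2) X1[of b]] unfolding S by (simp add: algebra_simps)
  have e: "(\<integral>w. \<eta> w * (\<Sum>k=p..<Suc q. (u (Suc k) - u k) * (\<Sum>i\<in>UNIV. c k w $ a $ i * c k w $ b $ i)) \<partial>M)
    = (\<integral>w. \<eta> w * (\<Sum>k=p..<q. (u (Suc k) - u k) * (\<Sum>i\<in>UNIV. c k w $ a $ i * c k w $ b $ i)) \<partial>M)
      + (\<integral>w. \<eta> w * ((u (Suc q) - u q) * (\<Sum>i\<in>UNIV. c q w $ a $ i * c q w $ b $ i)) \<partial>M)"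
  proof -
    have "integrable M (\<lambda>w. \<Sum>k=p..<q. \<eta> w * ((u (Suc k) - u k) * (\<Sum>i\<in>UNIV. c k w $ a $ i * c k w $ b $ i)))"
      using i q by (intro Bochner_Integration.integrable_sum) auto
    then show ?thesis
      using pq i[OF q(1)] by (subst Bochner_Integration.integral_add[symmetric]) (auto simp: sum_distrib_left distrib_left)
  qed
  have 3: "has_bochner_integral M (\<lambda>w. \<eta> w * ((grid_sum u c (Suc q) w - grid_sum u c p w) $ a * (grid_sum u c (Suc q) w - grid_sum u c p w) $ b))
      (\<integral>w. \<eta> w * (\<Sum>k=p..<Suc q. (u (Suc k) - u k) * (\<Sum>i\<in>UNIV. c k w $ a $ i * c k w $ b $ i)) \<partial>M)"
    using has_bochner_integral_add[OF has_bochner_integral_add[OF IH(3) X2] has_bochner_integral_add[OF X3 X4]]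
    unfolding S e by (simp add: algebra_simps)
  from 1 2 3 show ?case by blast
qed

text \<open>Endpoints of \<open>H\<close> may be grid points or lie beyond the last one, but none
  falls strictly inside a cell; hence \<open>H\<close> is constant in time on every cell
  \<open>{u k<..u (Suc k)}\<close>.\<close>

definition grid_for :: "('a, 'm, 'd::finite) simple_process \<Rightarrow> (nat \<Rightarrow> real) \<Rightarrow> nat \<Rightarrow> bool" where
  "grid_for H u L \<longleftrightarrow> u 0 = 0 \<and> (\<forall>k<L. u k < u (Suc k)) \<and>
     (\<forall>k<L. \<forall>(a, b, c)\<in>set H. a \<notin> {u k<..<u (Suc k)} \<and> b \<notin> {u k<..<u (Suc k)})"

text \<open>The grid enumerates in increasing order the prescribed points and those endpoints of
  \<open>H\<close> that lie in the time interval. Endpoints outside it are dropped, as they cannot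
  enter a cell.\<close>

lemma grid_for_exists:
  fixes H :: "('a, 'm, 'd::finite) simple_process"
  assumes "finite P" "P \<subseteq> {0..T}" "0 \<in> P" "T \<in> P"
  obtains u L where "grid_for H u L" "u L = T" "P \<subseteq> u ` {..L}" "u ` {..L} \<subseteq> {0..T}"
proof -
  define Q where "Q = P \<union> ({0..T} \<inter> ((\<lambda>(a,b,c). a) ` set H \<union> (\<lambda>(a,b,c). b) ` set H))"
  have Q: "finite Q" "0 \<in> Q" "T \<in> Q" "Q \<subseteq> {0..T}" "P \<subseteq> Q"
    using assms by (auto simp: Q_def)
  define xs where "xs = sorted_list_of_set Q"
  define u where "u k = xs ! k" for k
  define L where "L = length xs - 1"
  have sx: "set xs = Q" "sorted_wrt (<) xs" 
    using Q by (auto simp: xs_def)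
  have len: "length xs = Suc L"
    using sx Q unfolding L_def by (cases xs) auto
  have inj: "u i < u j" if "i < j" "j \<le> L" for i j
    using sorted_wrt_nth_less[OF sx(2)] that len by (auto simp: u_def)
  have mono: "u i \<le> u j" if "i \<le> j" "j \<le> L" for i j
    using inj[of i j] that by (cases "i = j") auto
  have img: "u ` {..L} = Q"
  proof -
    have "set xs = u ` {..<Suc L}" unfolding u_def len[symmetric] by (auto simp: set_conv_nth)
    then show ?thesis by (simp add: sx lessThan_Suc_atMost)
  qed
  have u0: "u 0 = 0"
  proof -
    from Q(2) img obtain k where "k \<le> L" "u k = 0" by force
    with mono[of 0 k] have "u 0 \<le> 0" by auto
    moreover have "u 0 \<in> Q" using img by auto
    ultimately show ?thesis using Q by force
  qed
  have uL: "u L = T"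
  proof -
    from Q(3) img obtain k where "k \<le> L" "u k = T" by force
    with mono[of k L] have "T \<le> u L" by auto
    moreover have "u L \<in> Q" using img by auto
    ultimately show ?thesis using Q by force
  qed
  have gap: "x \<notin> {u k<..<u (Suc k)}" if k: "k < L" and x: "x \<in> Q" for k x
  proof
    assume *: "x \<in> {u k<..<u (Suc k)}"
    from x img obtain j where j: "j \<le> L" "x = u j" by force
    show False
    proof (cases "j \<le> k")
      case True
      with mono[of j k] k * j show False by auto
    next
      case False
      with mono[of "Suc k" j] k * j show False by auto
    qed
  qed
  have "x \<in> Q" if "x \<in> {u k<..<u (Suc k)}" "k < L" "(a, b, c) \<in> set H" "x = a \<or> x = b" for x k a b c
  proof -
    have "u k \<in> Q" "u (Suc k) \<in> Q" using img that by auto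
    then have "x \<in> {0..T}" using that Q by force
    with that show ?thesis by (force simp: Q_def)
  qed
  then have "a \<notin> {u k<..<u (Suc k)} \<and> b \<notin> {u k<..<u (Suc k)}" if "k < L" "(a, b, c) \<in> set H" for k a b c
    using gap that by blast
  with inj u0 have "grid_for H u L"
    unfolding grid_for_def by auto
  from that[OF this uL] img Q show ?thesis by blast
qed

lemma grid_for_mono: "grid_for H u L \<Longrightarrow> p \<le> q \<Longrightarrow> q \<le> L \<Longrightarrow> u p \<le> u q"
  by (rule grid_mono[of L u]) (auto simp: grid_for_def)

lemma grid_for_gap:
  assumes "grid_for H u L" "k < L" "(a, b, c) \<in> set H"
  shows "a \<notin> {u k<..<u (Suc k)}" "b \<notin> {u k<..<u (Suc k)}" "u k < u (Suc k)"
  using assms unfolding grid_for_def by blast+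

text \<open>Cells and intervals of \<open>H\<close> are both open on the left and closed on the
  right, so the right end of a cell represents the whole cell.\<close>

lemma grid_for_value:
  assumes "grid_for H u L" "k < L" "s \<in> {u k<..u (Suc k)}"
  shows "simple_value H s w = simple_value H (u (Suc k)) w"
proof -
  have "indicator {a<..b} s *\<^sub>R c w = indicator {a<..b} (u (Suc k)) *\<^sub>R c w" if "(a, b, c) \<in> set H" for a b c
  proof -
    have "a \<notin> {u k<..<u (Suc k)}" "b \<notin> {u k<..<u (Suc k)}"
      using assms that unfolding grid_for_def by blast+
    with assms(3) have "s \<in> {a<..b} \<longleftrightarrow> u (Suc k) \<in> {a<..b}"
      by auto
    then show ?thesis by (auto simp: indicator_def)
  qed
  then show ?thesis
    unfolding simple_value_def by (intro arg_cong[of _ _ sum_list] map_cong) auto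
qed

text \<open>In passing from \<open>u k\<close> to \<open>u (Suc k)\<close> each summand of
  \<open>H\<close> gains either the full Brownian increment over the cell or nothing.\<close>

lemma grid_for_integral:
  fixes H :: "('a, 'm, 'd::finite) simple_process"
  assumes g: "grid_for H u L" and H: "simple_process F H" and k: "k \<le> L"
  shows "simple_integral B H (u k) w = grid_sum u (\<lambda>k. simple_value H (u (Suc k))) k w"
  using k
proof (induction k)
  case 0
  have "c w *v (B (min (u 0) b) w - B (min (u 0) a) w) = 0" if "(a, b, c) \<in> set H" for a b c
  proof -
    have "0 \<le> a" "a \<le> b" "u 0 = 0" using that H g unfolding simple_process_def grid_for_def by auto
    then show ?thesis by simp
  qed
  then have "simple_integral B H (u 0) w = (\<Sum>(a,b,c)\<leftarrow>H. 0)"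
    unfolding simple_integral_def by (intro arg_cong[of _ _ sum_list] map_cong) auto
  then show ?case by (auto simp: grid_sum_def case_prod_beta')
next
  case (Suc k)
  have lin: "(\<Sum>(a,b,c)\<leftarrow>H'. indicator {a<..b} t *\<^sub>R c w) *v v = (\<Sum>(a,b,c)\<leftarrow>H'. indicator {a<..b} t *\<^sub>R (c w *v v))"
    for H' :: "('a, 'm, 'd) simple_process" and v and t :: real
    by (induction H') (auto simp: matrix_vector_mult_add_rdistrib scaleR_matrix_vector_assoc)
  have "c w *v (B (min (u (Suc k)) b) w - B (min (u (Suc k)) a) w)
    = c w *v (B (min (u k) b) w - B (min (u k) a) w)
     + indicator {a<..b} (u (Suc k)) *\<^sub>R (c w *v (B (u (Suc k)) w - B (u k) w))" if "(a, b, c) \<in> set H" for a b c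
  proof -
    have "a \<notin> {u k<..<u (Suc k)}" "b \<notin> {u k<..<u (Suc k)}" "u k < u (Suc k)"
      using grid_for_gap[OF g _ that, of k] Suc by auto
    moreover have "a \<le> b" using that H unfolding simple_process_def by auto
    ultimately consider "u (Suc k) \<le> a" | "a \<le> u k" "u (Suc k) \<le> b" | "b \<le> u k"
      by force
    then show ?thesis
      using \<open>a \<le> b\<close> \<open>u k < u (Suc k)\<close> by cases (auto simp: min_def matrix_vector_mult_diff_distrib)
  qed
  then have "simple_integral B H (u (Suc k)) w = (\<Sum>(a,b,c)\<leftarrow>H. c w *v (B (min (u k) b) w - B (min (u k) a) w)
     + indicator {a<..b} (u (Suc k)) *\<^sub>R (c w *v (B (u (Suc k)) w - B (u k) w)))"
    unfolding simple_integral_def by (intro arg_cong[of _ _ sum_list] map_cong) auto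
  also have "\<dots> = simple_integral B H (u k) w + simple_value H (u (Suc k)) w *v (B (u (Suc k)) w - B (u k) w)"
    unfolding simple_integral_def simple_value_def lin by (simp add: sum_list_addf case_prod_beta')
  finally show ?case
    using Suc by (simp add: grid_sum_def)
qed

text \<open>Although the value is taken at the right end of the cell, it is known at the left end:
  an interval that contains \<open>u (Suc k)\<close> must have begun by \<open>u k\<close>, because
  no endpoint lies inside the cell.\<close>

lemma grid_for_adapted:
  assumes g: "grid_for H u L" and H: "simple_process F H" and k: "k < L"
  shows "simple_value H (u (Suc k)) \<in> borel_measurable (F (u k))"
    and "\<exists>K. \<forall>w\<in>space M. norm (simple_value H (u (Suc k)) w) \<le> K"
proof -
  have uk: "0 \<le> u k" "u k < u (Suc k)" 
    using grid_for_mono[OF g, of 0 k] g k by (auto simp: grid_for_def)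
  have 1: "(\<lambda>w. indicator {a<..b} (u (Suc k)) *\<^sub>R c w) \<in> borel_measurable (F (u k)) \<and>
      (\<exists>K. \<forall>w\<in>space M. norm (indicator {a<..b} (u (Suc k)) *\<^sub>R c w) \<le> K)" if abc: "(a, b, c) \<in> set H" for a b c
  proof -
    have *: "0 \<le> a" "c \<in> borel_measurable (F a)" "bounded (c ` space (F a))" 
      using abc H unfolding simple_process_def by auto
    have "a \<notin> {u k<..<u (Suc k)}" using g abc k unfolding grid_for_def by blast
    show ?thesis
    proof (cases "a \<le> u k")
      case True
      from * obtain K where K: "\<And>w. w \<in> space M \<Longrightarrow> norm (c w) \<le> K"
        by (auto simp: bounded_iff)
      have [measurable]: "c \<in> borel_measurable (F (u k))"
        by (rule meas_mono[OF *(1) True *(2)])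
      have "\<forall>w\<in>space M. norm (indicator {a<..b} (u (Suc k)) *\<^sub>R c w) \<le> \<bar>K\<bar>"
        using K by (force simp: indicator_def)
      then show ?thesis by auto
    next
      case False
      with \<open>a \<notin> _\<close> uk have "u (Suc k) \<le> a" by auto
      then have "indicator {a<..b} (u (Suc k)) = (0::real)" by (auto simp: indicator_def)
      then show ?thesis by auto
    qed
  qed
  have "(\<lambda>w. \<Sum>(a,b,c)\<leftarrow>H'. indicator {a<..b} (u (Suc k)) *\<^sub>R c w) \<in> borel_measurable (F (u k)) \<and>
    (\<exists>K. \<forall>w\<in>space M. norm (\<Sum>(a,b,c)\<leftarrow>H'. indicator {a<..b} (u (Suc k)) *\<^sub>R c w) \<le> K)"
    if "set H' \<subseteq> set H" for H'
    using that
  proof (induction H')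
    case Nil
    then show ?case by auto
  next
    case (Cons x H')
    obtain a b c where x: "x = (a, b, c)" by (cases x)
    from Cons x have abc: "(a, b, c) \<in> set H" by auto
    from Cons obtain K where K: "\<And>w. w \<in> space M \<Longrightarrow> norm (\<Sum>(a,b,c)\<leftarrow>H'. indicator {a<..b} (u (Suc k)) *\<^sub>R c w) \<le> K"
      and m[measurable]: "(\<lambda>w. \<Sum>(a,b,c)\<leftarrow>H'. indicator {a<..b} (u (Suc k)) *\<^sub>R c w) \<in> borel_measurable (F (u k))"
      by auto
    from 1[OF abc] obtain K' where K': "\<And>w. w \<in> space M \<Longrightarrow> norm (indicator {a<..b} (u (Suc k)) *\<^sub>R c w) \<le> K'"
      and m'[measurable]: "(\<lambda>w. indicator {a<..b} (u (Suc k)) *\<^sub>R c w) \<in> borel_measurable (F (u k))"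
      by auto
    have "\<forall>w\<in>space M. norm (indicator {a<..b} (u (Suc k)) *\<^sub>R c w + (\<Sum>(a,b,c)\<leftarrow>H'. indicator {a<..b} (u (Suc k)) *\<^sub>R c w)) \<le> K' + K"
      using K K' by (auto intro!: norm_triangle_mono)
    moreover have "(\<lambda>w. indicator {a<..b} (u (Suc k)) *\<^sub>R c w + (\<Sum>(a,b,c)\<leftarrow>H'. indicator {a<..b} (u (Suc k)) *\<^sub>R c w)) \<in> borel_measurable (F (u k))"
      by (rule borel_measurable_add[OF m' m])
    ultimately show ?case by (auto simp: x)
  qed
  from this[of H] show "simple_value H (u (Suc k)) \<in> borel_measurable (F (u k))"
    and "\<exists>K. \<forall>w\<in>space M. norm (simple_value H (u (Suc k)) w) \<le> K"
    by (auto simp: simple_value_def[abs_def])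
qed

lemma grid_for_set_integral:
  fixes h :: "real \<Rightarrow> real"
  assumes g: "grid_for H u L" and pq: "p \<le> q" "q \<le> L"
    and h: "\<And>k s. k < L \<Longrightarrow> s \<in> {u k<..u (Suc k)} \<Longrightarrow> h s = v k"
  shows "has_bochner_integral lborel (\<lambda>s. indicator {u p<..u q} s * h s) (\<Sum>k=p..<q. (u (Suc k) - u k) * v k)"
  using pq
proof (induction q rule: dec_induct)
  case base
  then show ?case by (simp add: has_bochner_integral_zero)
next
  case (step q)
  have le: "u p \<le> u q" "u q < u (Suc q)"
    using grid_for_mono[OF g, of p q] step g by (auto simp: grid_for_def)
  have "has_bochner_integral lborel (\<lambda>s. indicator {u q<..u (Suc q)} s * v q) ((u (Suc q) - u q) * v q)"
    using has_bochner_integral_mult_left[OF has_bochner_integral_real_indicator[of "{u q<..u (Suc q)}" lborel], of "v q"] le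
    by (auto simp: measure_def)
  moreover have "indicator {u q<..u (Suc q)} s * v q = indicator {u q<..u (Suc q)} s * h s" for s
    using h[of q s] step by (auto simp: indicator_def)
  ultimately have "has_bochner_integral lborel (\<lambda>s. indicator {u q<..u (Suc q)} s * h s) ((u (Suc q) - u q) * v q)"
    by simp
  from has_bochner_integral_add[OF step.IH this]
  have "has_bochner_integral lborel (\<lambda>s. indicator {u p<..u q} s * h s + indicator {u q<..u (Suc q)} s * h s)
     (\<Sum>k = p..<Suc q. (u (Suc k) - u k) * v k)"
    using step by simp
  moreover have "indicator {u p<..u q} s * h s + indicator {u q<..u (Suc q)} s * h s = indicator {u p<..u (Suc q)} s * h s" for s
    using le by (auto simp: indicator_def)
  ultimately show ?case by simp
qed

text \<open>Both \<open>s\<close> and \<open>t\<close> are put on the grid, so the increment between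
  them is a difference of two Ito sums, and the sum over the cells in between is the time integral
  of a step function.\<close>

lemma simple_integral_moments:
  fixes H :: "('a, 'm, 'd::finite) simple_process"
  assumes H: "simple_process F H" and st: "0 \<le> s" "s \<le> t"
    and \<eta>: "\<eta> \<in> borel_measurable (F s)" "\<And>w. w \<in> space M \<Longrightarrow> \<bar>\<eta> w\<bar> \<le> C"
  shows "has_bochner_integral M (\<lambda>w. \<eta> w * (simple_integral B H t w - simple_integral B H s w) $ a) 0"
    and "has_bochner_integral M (\<lambda>w. \<eta> w * ((simple_integral B H t w - simple_integral B H s w) $ a *
        (simple_integral B H t w - simple_integral B H s w) $ b))
      (\<integral>w. \<eta> w * (\<integral>x. indicator {s<..t} x * (\<Sum>i\<in>UNIV. simple_value H x w $ a $ i * simple_value H x w $ b $ i) \<partial>lborel) \<partial>M)"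
    and "simple_integral B H t \<in> borel_measurable (F t)"
    and "\<exists>K. \<forall>w\<in>space M. \<forall>x\<in>{0<..t}. norm (simple_value H x w) \<le> K"
proof -
  obtain u L where g: "grid_for H u L" and u: "u L = t" "{0, s, t} \<subseteq> u ` {..L}" "u ` {..L} \<subseteq> {0..t}"
    using grid_for_exists[of "{0, s, t}" t H] st by auto
  then obtain p where p: "p \<le> L" "u p = s" by force
  let ?c = "\<lambda>k. simple_value H (u (Suc k))"
  have gi: "simple_integral B H (u k) w = grid_sum u ?c k w" if "k \<le> L" for k w
    by (rule grid_for_integral[OF g H that])
  from grid_for_adapted[OF g H] obtain K where K: "\<And>k w. k < L \<Longrightarrow> w \<in> space M \<Longrightarrow> norm (?c k w) \<le> K k"
    by metis
  have *: "u 0 = 0" "\<And>k. k < L \<Longrightarrow> u k < u (Suc k)"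
    using g by (auto simp: grid_for_def)
  note m = grid_sum_moments[of u L ?c K p L \<eta> C a b, OF * grid_for_adapted(1)[OF g H] K p(1) order_refl, unfolded p]
  have m1: "has_bochner_integral M (\<lambda>w. \<eta> w * (grid_sum u ?c L w - grid_sum u ?c p w) $ a) 0"
    by (rule m[THEN conjunct1]) (use \<eta> in auto)
  have m2: "has_bochner_integral M (\<lambda>w. \<eta> w * ((grid_sum u ?c L w - grid_sum u ?c p w) $ a * (grid_sum u ?c L w - grid_sum u ?c p w) $ b))
      (\<integral>w. \<eta> w * (\<Sum>k=p..<L. (u (Suc k) - u k) * (\<Sum>i\<in>UNIV. ?c k w $ a $ i * ?c k w $ b $ i)) \<partial>M)"
    by (rule m[THEN conjunct2, THEN conjunct2]) (use \<eta> in auto)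
  show "has_bochner_integral M (\<lambda>w. \<eta> w * (simple_integral B H t w - simple_integral B H s w) $ a) 0"
    unfolding gi[OF p(1), unfolded p] gi[OF order_refl, unfolded u] by (rule m1)
  have "(\<integral>x. indicator {s<..t} x * (\<Sum>i\<in>UNIV. simple_value H x w $ a $ i * simple_value H x w $ b $ i) \<partial>lborel)
    = (\<Sum>k=p..<L. (u (Suc k) - u k) * (\<Sum>i\<in>UNIV. ?c k w $ a $ i * ?c k w $ b $ i))" for w
  proof -
    have "(\<Sum>i\<in>UNIV. simple_value H x w $ a $ i * simple_value H x w $ b $ i) = (\<Sum>i\<in>UNIV. ?c k w $ a $ i * ?c k w $ b $ i)"
      if "k < L" "x \<in> {u k<..u (Suc k)}" for k x
      unfolding grid_for_value[OF g that] ..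
    from grid_for_set_integral[OF g p(1) order_refl this]
    show ?thesis
      unfolding p u by (simp add: has_bochner_integral_iff)
  qed
  then show "has_bochner_integral M (\<lambda>w. \<eta> w * ((simple_integral B H t w - simple_integral B H s w) $ a *
        (simple_integral B H t w - simple_integral B H s w) $ b))
      (\<integral>w. \<eta> w * (\<integral>x. indicator {s<..t} x * (\<Sum>i\<in>UNIV. simple_value H x w $ a $ i * simple_value H x w $ b $ i) \<partial>lborel) \<partial>M)"
    using m2 unfolding gi[OF p(1), unfolded p] gi[OF order_refl, unfolded u] by simp
  show "simple_integral B H t \<in> borel_measurable (F t)"
    using grid_sum_measurable[of u L ?c L, OF * grid_for_adapted(1)[OF g H]]
    unfolding u gi[OF order_refl, unfolded u, symmetric, abs_def] by auto
  have cover: "\<exists>k<q. x \<in> {u k<..u (Suc k)}" if "x \<in> {0<..u q}" "q \<le> L" for x q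
    using that
  proof (induction q)
    case 0
    then show ?case using *(1) by auto
  next
    case (Suc q)
    then show ?case by (cases "x \<le> u q") (auto intro: less_SucI)
  qed
  have "\<forall>w\<in>space M. \<forall>x\<in>{0<..t}. norm (simple_value H x w) \<le> (\<Sum>k<L. \<bar>K k\<bar>)"
  proof safe
    fix w x assume w: "w \<in> space M" and "x \<in> {0<..t}"
    with cover[of x L] u obtain k where k: "k < L" "x \<in> {u k<..u (Suc k)}" by auto
    have "norm (simple_value H x w) \<le> K k"
      using grid_for_value[OF g k] K[OF k(1) w] by simp
    also have "\<dots> \<le> (\<Sum>k<L. \<bar>K k\<bar>)"
      using k member_le_sum[of k "{..<L}" "\<lambda>k. \<bar>K k\<bar>"] by auto
    finally show "norm (simple_value H x w) \<le> (\<Sum>k<L. \<bar>K k\<bar>)" .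
  qed
  then show "\<exists>K. \<forall>w\<in>space M. \<forall>x\<in>{0<..t}. norm (simple_value H x w) \<le> K" by blast
qed

text \<open>Counterpart for extended nonnegative integrals on the closed interval, used for
  energies; the point 0 belongs to no cell but is a null set.\<close>

lemma grid_for_nn_integral:
  fixes h :: "real \<Rightarrow> real"
  assumes g: "grid_for H u L"
    and h: "\<And>k s. k < L \<Longrightarrow> s \<in> {u k<..u (Suc k)} \<Longrightarrow> h s = v k" and v: "\<And>k. k < L \<Longrightarrow> 0 \<le> v k"
  shows "(\<integral>\<^sup>+s\<in>{0..u L}. ennreal (h s) \<partial>lborel) = ennreal (\<Sum>k<L. (u (Suc k) - u k) * v k)"
proof -
  have u0: "u 0 = 0" using g by (simp add: grid_for_def)
  have b: "has_bochner_integral lborel (\<lambda>s. indicator {0<..u L} s * h s) (\<Sum>k<L. (u (Suc k) - u k) * v k)"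
    using grid_for_set_integral[OF g le0 order_refl h] by (simp add: u0 atLeast0LessThan)
  have cover: "\<exists>k<q. x \<in> {u k<..u (Suc k)}" if "x \<in> {0<..u q}" "q \<le> L" for x q
    using that
  proof (induction q)
    case 0
    then show ?case using u0 by auto
  next
    case (Suc q)
    then show ?case by (cases "x \<le> u q") (auto intro: less_SucI)
  qed
  have nn: "0 \<le> indicator {0<..u L} s * h s" for s
    using cover[of s L] h v by (cases "s \<in> {0<..u L}") force+
  have "(\<integral>\<^sup>+s\<in>{0..u L}. ennreal (h s) \<partial>lborel) = (\<integral>\<^sup>+s. ennreal (indicator {0<..u L} s * h s) \<partial>lborel)"
  proof (rule nn_integral_cong_AE)
    show "AE s in lborel. ennreal (h s) * indicator {0..u L} s = ennreal (indicator {0<..u L} s * h s)"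
      using AE_lborel_singleton[of 0] by eventually_elim (auto simp: indicator_def)
  qed
  also have "\<dots> = ennreal (\<Sum>k<L. (u (Suc k) - u k) * v k)"
    using b nn by (subst nn_integral_eq_integral) (auto simp: has_bochner_integral_iff)
  finally show ?thesis .
qed

end

section \<open>The stopped Ito integral\<close>

text \<open>The stopping property is stated through survival, \<open>t < \<sigma> w\<close>, because
  this is the indicator by which the coefficient of the step that begins at \<open>t\<close> is
  multiplied. From \<open>T\<close> on these events are empty.\<close>

locale bounded_stopping = filtered_brownian M F B
  for M :: "'a measure" and F and B :: "real \<Rightarrow> 'a \<Rightarrow> real^'m::finite" +
  fixes T :: real and \<sigma> :: "'a \<Rightarrow> real"
  assumes T: "0 < T"
    and \<sigma>_meas [measurable]: "\<sigma> \<in> borel_measurable M"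
    and \<sigma>_bounds: "\<And>w. w \<in> space M \<Longrightarrow> 0 \<le> \<sigma> w \<and> \<sigma> w \<le> T"
    and \<sigma>_stop: "\<And>t. 0 \<le> t \<Longrightarrow> t < T \<Longrightarrow> {w \<in> space M. t < \<sigma> w} \<in> sets (F t)"
begin

section \<open>Dyadic rounding of the stopping time\<close>

definition gp :: "nat \<Rightarrow> nat \<Rightarrow> real" where "gp n k = real k * T / 2 ^ n"

text \<open>\<open>\<sigma>\<close> rounded up to the next grid point of level \<open>n\<close>.
  Rounding up, and not down, keeps survival beyond a given time observable at that time.\<close>

definition \<sigma>_up :: "nat \<Rightarrow> 'a \<Rightarrow> real" where
  "\<sigma>_up n w = T / 2 ^ n * of_int \<lceil>\<sigma> w * 2 ^ n / T\<rceil>"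

lemma gp_simps [simp]: "gp n 0 = 0" "gp n (2 ^ n) = T"
  by (auto simp: gp_def)

lemma gp_nonneg [simp]: "0 \<le> gp n k"
  using T by (simp add: gp_def)

lemma gp_less_iff [simp]: "gp n j < gp n k \<longleftrightarrow> j < k" and gp_le_iff [simp]: "gp n j \<le> gp n k \<longleftrightarrow> j \<le> k"
  using T by (auto simp: gp_def divide_less_cancel divide_le_cancel)

lemma gp_le_T: "k \<le> 2 ^ n \<Longrightarrow> gp n k \<le> T"
  using gp_le_iff[of n k "2 ^ n"] by simp

lemma gp_refine: "gp n k = gp (n + d) (k * 2 ^ d)"
  using T by (simp add: gp_def power_add)

text \<open>Floor and ceiling are adjoint with respect to strict comparison: \<open>x\<close>
  precedes the rounded time exactly when the grid point at or below \<open>x\<close> precedes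
  \<open>\<sigma>\<close>. Hence the event is already observable at that grid point.\<close>

lemma \<sigma>_up_less_iff: "x < \<sigma>_up n w \<longleftrightarrow> T / 2 ^ n * of_int \<lfloor>x * 2 ^ n / T\<rfloor> < \<sigma> w"
proof -
  have "x < \<sigma>_up n w \<longleftrightarrow> x * 2 ^ n / T < of_int \<lceil>\<sigma> w * 2 ^ n / T\<rceil>"
    using T by (simp add: \<sigma>_up_def field_simps)
  also have "\<dots> \<longleftrightarrow> \<lfloor>x * 2 ^ n / T\<rfloor> < \<lceil>\<sigma> w * 2 ^ n / T\<rceil>"
    by (simp add: floor_less_iff)
  also have "\<dots> \<longleftrightarrow> of_int \<lfloor>x * 2 ^ n / T\<rfloor> < \<sigma> w * 2 ^ n / T"
    by (simp add: less_ceiling_iff)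
  also have "\<dots> \<longleftrightarrow> T / 2 ^ n * of_int \<lfloor>x * 2 ^ n / T\<rfloor> < \<sigma> w"
    using T by (simp add: field_simps)
  finally show ?thesis .
qed

lemma \<sigma>_up_ge: "\<sigma> w \<le> \<sigma>_up n w"
proof -
  have "\<sigma> w * 2 ^ n \<le> of_int \<lceil>\<sigma> w * 2 ^ n / T\<rceil> * T"
    by (subst pos_divide_le_eq[OF T, symmetric]) (rule le_of_int_ceiling)
  then show ?thesis using T unfolding \<sigma>_up_def by (simp add: field_simps)
qed

lemma \<sigma>_up_le: "\<sigma>_up n w \<le> \<sigma> w + T / 2 ^ n"
proof -
  have "of_int \<lceil>\<sigma> w * 2 ^ n / T\<rceil> \<le> \<sigma> w * 2 ^ n / T + 1" by linarith
  then show ?thesis using T unfolding \<sigma>_up_def by (simp add: field_simps)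
qed

lemma \<sigma>_up_gp:
  assumes "w \<in> space M"
  obtains p where "p \<le> 2 ^ n" "\<sigma>_up n w = gp n p"
proof
  have "0 \<le> \<lceil>\<sigma> w * 2 ^ n / T\<rceil>" "\<lceil>\<sigma> w * 2 ^ n / T\<rceil> \<le> 2 ^ n"
  proof -
    have "0 \<le> \<sigma> w * 2 ^ n / T" using T \<sigma>_bounds[OF assms] by simp
    then show "0 \<le> \<lceil>\<sigma> w * 2 ^ n / T\<rceil>" using ceiling_mono[of 0 "\<sigma> w * 2 ^ n / T"] by simp
    have "\<sigma> w * 2 ^ n / T \<le> 2 ^ n"
      using T \<sigma>_bounds[OF assms] by (simp add: pos_divide_le_eq mult.commute)
    then show "\<lceil>\<sigma> w * 2 ^ n / T\<rceil> \<le> 2 ^ n" by (simp add: ceiling_le_iff)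
  qed
  then show "nat \<lceil>\<sigma> w * 2 ^ n / T\<rceil> \<le> 2 ^ n" "\<sigma>_up n w = gp n (nat \<lceil>\<sigma> w * 2 ^ n / T\<rceil>)"
    using T by (auto simp: nat_le_iff gp_def \<sigma>_up_def)
qed

lemma \<sigma>_up_tendsto: "(\<lambda>n. \<sigma>_up n w) \<longlonglongrightarrow> \<sigma> w"
proof (rule tendsto_sandwich[of "\<lambda>_. \<sigma> w" _ _ "\<lambda>n. \<sigma> w + T / 2 ^ n"])
  have "(\<lambda>n. T * (1 / 2) ^ n) \<longlonglongrightarrow> T * 0"
    by (intro tendsto_mult tendsto_const LIMSEQ_power_zero) auto
  then have "(\<lambda>n. \<sigma> w + T * (1 / 2) ^ n) \<longlonglongrightarrow> \<sigma> w + T * 0"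
    by (intro tendsto_add tendsto_const)
  then show "(\<lambda>n. \<sigma> w + T / 2 ^ n) \<longlonglongrightarrow> \<sigma> w"
    by (simp add: power_one_over field_simps)
qed (auto simp: \<sigma>_up_ge \<sigma>_up_le)

lemma \<sigma>_up_stop:
  assumes "0 \<le> x" "x < T"
  shows "{w \<in> space M. x < \<sigma>_up n w} \<in> sets (F x)"
proof -
  let ?y = "T / 2 ^ n * of_int \<lfloor>x * 2 ^ n / T\<rfloor>"
  have y0: "0 \<le> ?y" using T assms by simp
  have "of_int \<lfloor>x * 2 ^ n / T\<rfloor> * T \<le> x * 2 ^ n"
    by (subst pos_le_divide_eq[OF T, symmetric]) (rule of_int_floor_le)
  then have yx: "?y \<le> x" using T by (simp add: field_simps)
  have "{w \<in> space M. x < \<sigma>_up n w} = {w \<in> space M. ?y < \<sigma> w}"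
    unfolding \<sigma>_up_less_iff ..
  also have "\<dots> \<in> sets (F ?y)" using \<sigma>_stop[OF y0] yx assms by auto
  finally show ?thesis using sets_mono[OF y0 yx] by blast
qed

text \<open>Stopping at the rounded time is a telescoping sum of increments, each multiplied by a
  survival indicator that is known when the increment begins. Refinement keeps \<open>gp n q\<close>
  a grid point, and continuity of the paths gives the limit.\<close>

lemma stopped_measurable:
  fixes W :: "real \<Rightarrow> 'a \<Rightarrow> 'b::euclidean_space"
  assumes W: "\<And>t. 0 \<le> t \<Longrightarrow> W t \<in> borel_measurable (F t)"
    and cont: "\<And>w. w \<in> space M \<Longrightarrow> continuous_on {0..} (\<lambda>t. W t w)" and q: "q \<le> 2 ^ n"
  shows "(\<lambda>w. W (min (gp n q) (\<sigma> w)) w) \<in> borel_measurable (F (gp n q))"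
proof (rule borel_measurable_LIMSEQ_metric)
  let ?W = "\<lambda>d w. W 0 w + (\<Sum>k<q * 2 ^ d. indicator {w\<in>space M. gp (n + d) k < \<sigma>_up (n + d) w} w *\<^sub>R (W (gp (n + d) (Suc k)) w - W (gp (n + d) k) w))"
  have eq: "?W d w = W (min (gp n q) (\<sigma>_up (n + d) w)) w" if w: "w \<in> space M" for d w
  proof -
    obtain p where p: "p \<le> 2 ^ (n + d)" "\<sigma>_up (n + d) w = gp (n + d) p"
      using \<sigma>_up_gp[OF w] .
    \<comment> \<open>The indicators cut the telescoping sum off at the index \<open>p\<close> of
      the rounded time.\<close>
    have "(\<Sum>k<q'. indicator {w\<in>space M. gp (n + d) k < \<sigma>_up (n + d) w} w *\<^sub>R (W (gp (n + d) (Suc k)) w - W (gp (n + d) k) w))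
      = W (gp (n + d) (min q' p)) w - W 0 w" for q'
      using w by (induction q') (auto simp: p min_def not_le le_Suc_eq less_Suc_eq)
    moreover have "gp (n + d) (min (q * 2 ^ d) p) = min (gp n q) (\<sigma>_up (n + d) w)"
      unfolding p gp_refine[of n q d] by (auto simp: min_def)
    ultimately show ?thesis by simp
  qed
  show "(\<lambda>w. W (min (gp n q) (\<sigma>_up (n + d) w)) w) \<in> borel_measurable (F (gp n q))" for d
  proof -
    have "?W d \<in> borel_measurable (F (gp n q))"
    proof (intro borel_measurable_add borel_measurable_sum)
      show "W 0 \<in> borel_measurable (F (gp n q))"
        by (rule meas_mono[OF _ _ W]) auto
      fix k assume "k \<in> {..<q * 2 ^ d}"
      then have k: "k < q * 2 ^ d" by simp
      have le: "gp (n + d) k \<le> gp n q" "gp (n + d) (Suc k) \<le> gp n q" "gp (n + d) k < gp n q"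
        unfolding gp_refine[of n q d] using k by auto
      have [measurable]: "W (gp (n + d) k) \<in> borel_measurable (F (gp n q))"
        "W (gp (n + d) (Suc k)) \<in> borel_measurable (F (gp n q))"
        by (rule meas_mono[OF _ _ W]; simp add: le)+
      have [measurable]: "{w\<in>space M. gp (n + d) k < \<sigma>_up (n + d) w} \<in> sets (F (gp n q))"
        using \<sigma>_up_stop[of "gp (n + d) k" "n + d"] sets_mono[of "gp (n + d) k" "gp n q"] le gp_le_T[OF q] by auto
      show "(\<lambda>w. indicator {w\<in>space M. gp (n + d) k < \<sigma>_up (n + d) w} w *\<^sub>R (W (gp (n + d) (Suc k)) w - W (gp (n + d) k) w))
        \<in> borel_measurable (F (gp n q))"
        by measurable
    qed
    then show ?thesis
      by (subst (asm) measurable_cong[OF eq]) auto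
  qed
  show "(\<lambda>d. W (min (gp n q) (\<sigma>_up (n + d) w)) w) \<longlonglongrightarrow> W (min (gp n q) (\<sigma> w)) w" if "w \<in> space (F (gp n q))" for w
  proof -
    have w: "w \<in> space M" using that by simp
    have "(\<lambda>d. \<sigma>_up (d + n) w) \<longlonglongrightarrow> \<sigma> w"
      by (rule LIMSEQ_ignore_initial_segment[OF \<sigma>_up_tendsto])
    then have "(\<lambda>d. min (gp n q) (\<sigma>_up (n + d) w)) \<longlonglongrightarrow> min (gp n q) (\<sigma> w)"
      by (intro tendsto_min tendsto_const) (simp add: add.commute)
    moreover have "0 \<le> \<sigma>_up m w" for m
      using \<sigma>_up_ge[of w m] \<sigma>_bounds[OF w] by linarith
    ultimately show ?thesis
      by (intro continuous_on_tendsto_compose[OF cont[OF w]]) (use \<sigma>_bounds[OF w] in auto)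
  qed
qed

text \<open>Besides being stopped at \<open>\<sigma>_up n\<close>, the process is killed as soon as its energy would exceed \<open>C\<close>.
  The deterministic energy bound later upgrades almost sure convergence to convergence in \<open>L\<^sup>2\<close>.\<close>

lemma stopped_simple_process:
  fixes H :: "('a, 'm, 'd::finite) simple_process"
  assumes H: "simple_process F H" and C: "0 \<le> C"
  obtains J :: "('a, 'm, 'd) simple_process" where "simple_process F J"
    and "\<And>w. w \<in> space M \<Longrightarrow> (\<integral>\<^sup>+s\<in>{0..T}. ennreal ((norm (simple_value J s w))\<^sup>2) \<partial>lborel) \<le> ennreal C"
    and "\<And>w s. w \<in> space M \<Longrightarrow> s \<in> {0<..T} \<Longrightarrow>
       (\<integral>\<^sup>+s\<in>{0..T}. ennreal ((norm (indicator {..\<sigma>_up n w} s *\<^sub>R simple_value H s w))\<^sup>2) \<partial>lborel) \<le> ennreal C \<Longrightarrow>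
       simple_value J s w = indicator {..\<sigma>_up n w} s *\<^sub>R simple_value H s w"
    and "\<And>w q. w \<in> space M \<Longrightarrow> q \<le> 2 ^ n \<Longrightarrow>
       (\<integral>\<^sup>+s\<in>{0..T}. ennreal ((norm (indicator {..\<sigma>_up n w} s *\<^sub>R simple_value H s w))\<^sup>2) \<partial>lborel) \<le> ennreal C \<Longrightarrow>
       simple_integral B J (gp n q) w = simple_integral B H (min (gp n q) (\<sigma>_up n w)) w"
proof -
  \<comment> \<open>The grid contains all dyadic points of level \<open>n\<close>, so the rounded
    stopping time takes its values on it and no cell is cut in two.\<close>
  have "gp n ` {..2 ^ n} \<subseteq> {0..T}" "0 \<in> gp n ` {..2 ^ n}" "T \<in> gp n ` {..2 ^ n}"
    using gp_le_T by (force intro: image_eqI[of _ _ 0] image_eqI[of _ _ "2 ^ n"])+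
  from grid_for_exists[OF _ this, of H] obtain u L where g: "grid_for H u L" and uL: "u L = T"
    and P: "gp n ` {..2 ^ n} \<subseteq> u ` {..L}" and uT: "u ` {..L} \<subseteq> {0..T}" by auto
  have u0: "u 0 = 0" and inc: "\<And>k. k < L \<Longrightarrow> u k < u (Suc k)"
    using g by (auto simp: grid_for_def)
  have mono: "u i \<le> u j" if "i \<le> j" "j \<le> L" for i j
    by (rule grid_for_mono[OF g that])
  have smono: "u i < u j" if "i < j" "j \<le> L" for i j
    using mono[of "Suc i" j] inc[of i] that by auto
  have less_iff: "u i < u j \<longleftrightarrow> i < j" if "i \<le> L" "j \<le> L" for i j
    using smono[of i j] mono[of j i] that by (meson linorder_not_less)
  define c where "c k = simple_value H (u (Suc k))" for k
  have c: "c k \<in> borel_measurable (F (u k))" "\<exists>K. \<forall>w\<in>space M. norm (c k w) \<le> K" if "k < L" for k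
    using grid_for_adapted[OF g H that] by (auto simp: c_def)
  \<comment> \<open>The energy includes the cell that begins at \<open>u k\<close>. The coefficient
    on that cell is known at \<open>u k\<close>, so killing can act before the cap is exceeded and
    remains adapted.\<close>
  define en where "en k w = (\<Sum>j\<le>k. (u (Suc j) - u j) * (norm (c j w))\<^sup>2)" for k w
  define keep where "keep k w \<longleftrightarrow> u k < \<sigma>_up n w \<and> en k w \<le> C" for k w
  define d where "d k w = (if keep k w then c k w else 0)" for k w
  define J where "J = map (\<lambda>k. (u k, u (Suc k), d k)) [0..<L]"
  have u_nn: "0 \<le> u k" if "k \<le> L" for k using mono[of 0 k] that u0 by auto
  have d: "d k \<in> borel_measurable (F (u k))" "bounded (d k ` space M)" if k: "k < L" for k
  proof -
    have uk: "0 \<le> u k" "u k < T" using u_nn[of k] smono[of k L] k uL by auto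
    have "c j \<in> borel_measurable (F (u k))" if "j \<le> k" for j
      by (rule meas_mono[OF _ _ c(1)]) (use that k mono u_nn in auto)
    then have [measurable]: "en k \<in> borel_measurable (F (u k))"
      unfolding en_def[abs_def] by (intro borel_measurable_sum borel_measurable_times borel_measurable_power borel_measurable_norm) auto
    have "{w\<in>space (F (u k)). u k < \<sigma>_up n w} \<in> sets (F (u k))"
      using \<sigma>_up_stop[OF uk] uk by simp
    then have "{w\<in>space (F (u k)). u k < \<sigma>_up n w \<and> en k w \<le> C} \<in> sets (F (u k))"
      by (intro sets.sets_Collect_conj) auto
    then have "{w\<in>space (F (u k)). keep k w} \<in> sets (F (u k))"
      unfolding keep_def .
    then show "d k \<in> borel_measurable (F (u k))"
      unfolding d_def[abs_def] by (intro measurable_If c(1) k borel_measurable_const)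
    from c(2)[OF k] obtain K where "\<And>w. w \<in> space M \<Longrightarrow> norm (c k w) \<le> K" by auto
    then have "\<forall>w\<in>space M. norm (d k w) \<le> \<bar>K\<bar>" by (force simp: d_def)
    then show "bounded (d k ` space M)" by (auto simp: bounded_iff)
  qed
  have J: "simple_process F J"
    unfolding simple_process_def J_def
  proof (clarsimp, intro conjI)
    fix k assume k: "k < L"
    show "0 \<le> u k" "u k \<le> u (Suc k)" using u_nn[of k] k inc[OF k] by auto
    show "d k \<in> borel_measurable (F (u k))" by (rule d[OF k])
    show "bounded (d k ` space (F (u k)))" using d(2)[OF k] u_nn[of k] k by simp
  qed
  have gJ: "grid_for J u L"
    unfolding grid_for_def
  proof (intro conjI allI impI ballI)
    fix k x assume k: "k < L" and "x \<in> set J"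
    then obtain i where i: "i < L" "x = (u i, u (Suc i), d i)" by (auto simp: J_def)
    have "u j \<notin> {u k<..<u (Suc k)}" if "j \<le> L" for j
      using less_iff[of k j] less_iff[of j "Suc k"] that k by auto
    then show "case x of (a, b, c) \<Rightarrow> a \<notin> {u k<..<u (Suc k)} \<and> b \<notin> {u k<..<u (Suc k)}"
      using i by auto
  qed (use u0 inc in auto)
  have Jv: "simple_value J (u (Suc k)) w = d k w" if k: "k < L" for k w
  proof -
    have "simple_value J (u (Suc k)) w = (\<Sum>i<L. indicator {u i<..u (Suc i)} (u (Suc k)) *\<^sub>R d i w)"
      unfolding simple_value_def J_def by (simp add: sum_list_distinct_conv_sum_set atLeast0LessThan comp_def del: upt_Suc)
    also have "\<dots> = (\<Sum>i<L. if i = k then d k w else 0)"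
    proof (intro sum.cong refl)
      fix i assume "i \<in> {..<L}"
      then have "u (Suc k) \<in> {u i<..u (Suc i)} \<longleftrightarrow> i = k"
        using less_iff[of i "Suc k"] less_iff[of "Suc i" "Suc k"] k by (auto simp: not_less[symmetric])
      then show "indicator {u i<..u (Suc i)} (u (Suc k)) *\<^sub>R d i w = (if i = k then d k w else 0)"
        by (auto simp: indicator_def)
    qed
    finally show ?thesis using k by simp
  qed
  have Hc: "simple_value H s w = c k w" if "k < L" "s \<in> {u k<..u (Suc k)}" for k s w
    using grid_for_value[OF g that] by (simp add: c_def)
  have Jd: "simple_value J s w = d k w" if "k < L" "s \<in> {u k<..u (Suc k)}" for k s w
    using grid_for_value[OF gJ that] Jv[OF that(1)] by simp
  have cover: "\<exists>k<q. x \<in> {u k<..u (Suc k)}" if "x \<in> {0<..u q}" "q \<le> L" for x q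
    using that
  proof (induction q)
    case 0
    then show ?case using u0 by auto
  next
    case (Suc q)
    then show ?case by (cases "x \<le> u q") (auto intro: less_SucI)
  qed
  \<comment> \<open>Up to a kept cell the whole energy is within the cap; a killed cell adds
    nothing.\<close>
  have b: "(\<Sum>k<q. (u (Suc k) - u k) * (norm (d k w))\<^sup>2) \<le> C" if "q \<le> L" for q w
    using that
  proof (induction q)
    case 0
    then show ?case using C by simp
  next
    case (Suc q)
    show ?case
    proof (cases "keep q w")
      case True
      have "(\<Sum>k<Suc q. (u (Suc k) - u k) * (norm (d k w))\<^sup>2) \<le> (\<Sum>k<Suc q. (u (Suc k) - u k) * (norm (c k w))\<^sup>2)"
        using Suc inc by (intro sum_mono mult_left_mono) (auto simp: d_def less_imp_le)
      also have "\<dots> \<le> C" using True by (simp add: keep_def en_def lessThan_Suc_atMost)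
      finally show ?thesis .
    next
      case False
      then show ?thesis using Suc by (simp add: d_def)
    qed
  qed
  have e1: "(\<integral>\<^sup>+s\<in>{0..T}. ennreal ((norm (simple_value J s w))\<^sup>2) \<partial>lborel) \<le> ennreal C" for w
    using grid_for_nn_integral[OF gJ, of "\<lambda>s. (norm (simple_value J s w))\<^sup>2" "\<lambda>k. (norm (d k w))\<^sup>2"] b[of L w] Jd
    by (simp add: uL ennreal_leI)
  have st: "s \<le> \<sigma>_up n w \<longleftrightarrow> u k < \<sigma>_up n w" if w: "w \<in> space M" and k: "k < L" "s \<in> {u k<..u (Suc k)}" for w k s
  proof -
    obtain p where p: "p \<le> 2 ^ n" "\<sigma>_up n w = gp n p" using \<sigma>_up_gp[OF w] .
    with P obtain j where j: "j \<le> L" "\<sigma>_up n w = u j" by force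
    show ?thesis
    proof (cases "k < j")
      case True
      then show ?thesis using k j less_iff[of k j] mono[of "Suc k" j] by auto
    next
      case False
      then show ?thesis using k j mono[of j k] by auto
    qed
  qed
  \<comment> \<open>When the stopped energy itself respects the cap, the energy condition holds on
    every cell before the rounded time, and killing reduces to stopping.\<close>
  have keep: "keep k w \<longleftrightarrow> u k < \<sigma>_up n w"
    if le: "(\<integral>\<^sup>+s\<in>{0..T}. ennreal ((norm (indicator {..\<sigma>_up n w} s *\<^sub>R simple_value H s w))\<^sup>2) \<partial>lborel) \<le> ennreal C"
    and w: "w \<in> space M" and k: "k < L" for w k
  proof -
    have "(\<integral>\<^sup>+s\<in>{0..u L}. ennreal ((norm (indicator {..\<sigma>_up n w} s *\<^sub>R simple_value H s w))\<^sup>2) \<partial>lborel)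
      = ennreal (\<Sum>k<L. (u (Suc k) - u k) * (norm (indicator {..<\<sigma>_up n w} (u k) *\<^sub>R c k w))\<^sup>2)"
      by (rule grid_for_nn_integral[OF g]) (use st[OF w] Hc in \<open>auto simp: indicator_def\<close>)
    with le have t: "(\<Sum>k<L. (u (Suc k) - u k) * (norm (indicator {..<\<sigma>_up n w} (u k) *\<^sub>R c k w))\<^sup>2) \<le> C"
      using C by (simp add: uL)
    have "en k w \<le> C" if "u k < \<sigma>_up n w"
    proof -
      have "en k w = (\<Sum>k\<le>k. (u (Suc k) - u k) * (norm (indicator {..<\<sigma>_up n w} (u k) *\<^sub>R c k w))\<^sup>2)"
        unfolding en_def
      proof (intro sum.cong refl)
        fix j assume "j \<in> {..k}"
        then have "u j < \<sigma>_up n w" using mono[of j k] k that by auto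
        then show "(u (Suc j) - u j) * (norm (c j w))\<^sup>2 = (u (Suc j) - u j) * (norm (indicator {..<\<sigma>_up n w} (u j) *\<^sub>R c j w))\<^sup>2"
          by (auto simp: indicator_def)
      qed
      also have "\<dots> \<le> (\<Sum>k<L. (u (Suc k) - u k) * (norm (indicator {..<\<sigma>_up n w} (u k) *\<^sub>R c k w))\<^sup>2)"
        using k inc by (intro sum_mono2) (auto simp: less_imp_le)
      finally show ?thesis using t by simp
    qed
    then show ?thesis by (auto simp: keep_def)
  qed
  show ?thesis
  proof (rule that[OF J e1])
    fix w s assume w: "w \<in> space M" and s: "s \<in> {0<..T}"
      and le: "(\<integral>\<^sup>+s\<in>{0..T}. ennreal ((norm (indicator {..\<sigma>_up n w} s *\<^sub>R simple_value H s w))\<^sup>2) \<partial>lborel) \<le> ennreal C"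
    from cover[of s L] s uL obtain k where k: "k < L" "s \<in> {u k<..u (Suc k)}" by auto
    show "simple_value J s w = indicator {..\<sigma>_up n w} s *\<^sub>R simple_value H s w"
      using Jd[OF k] Hc[OF k] keep[OF le w k(1)] st[OF w k] by (auto simp: d_def indicator_def)
  next
    fix w and q :: nat assume w: "w \<in> space M" and q: "q \<le> 2 ^ n"
      and le: "(\<integral>\<^sup>+s\<in>{0..T}. ennreal ((norm (indicator {..\<sigma>_up n w} s *\<^sub>R simple_value H s w))\<^sup>2) \<partial>lborel) \<le> ennreal C"
    obtain p where p: "p \<le> 2 ^ n" "\<sigma>_up n w = gp n p" using \<sigma>_up_gp[OF w] .
    from P p obtain i where i: "i \<le> L" "\<sigma>_up n w = u i" by force
    from P q obtain j where j: "j \<le> L" "gp n q = u j" by force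
    have m: "min (u j) (u i) = u (min j i)" using mono[of i j] mono[of j i] i j by (auto simp: min_def)
    have 1: "simple_integral B J (u j) w = (\<Sum>k<j. d k w *v (B (u (Suc k)) w - B (u k) w))"
      unfolding grid_for_integral[OF gJ J j(1)] grid_sum_def using Jv j by (intro sum.cong) auto
    also have "\<dots> = (\<Sum>k<j. if k < i then c k w *v (B (u (Suc k)) w - B (u k) w) else 0)"
    proof (intro sum.cong refl)
      fix k assume "k \<in> {..<j}"
      then have k: "k < L" using j by auto
      have "keep k w \<longleftrightarrow> k < i" using keep[OF le w k] i less_iff[of k i] k by auto
      then show "d k w *v (B (u (Suc k)) w - B (u k) w) = (if k < i then c k w *v (B (u (Suc k)) w - B (u k) w) else 0)"
        by (simp add: d_def)
    qed
    also have "\<dots> = (\<Sum>k<min j i. c k w *v (B (u (Suc k)) w - B (u k) w))"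
      by (subst sum.inter_filter[symmetric]) (auto intro!: sum.cong)
    also have "\<dots> = simple_integral B H (u (min j i)) w"
      unfolding grid_for_integral[OF g H min.coboundedI1[OF j(1)]] grid_sum_def c_def by (rule refl)
    finally show "simple_integral B J (gp n q) w = simple_integral B H (min (gp n q) (\<sigma>_up n w)) w"
      unfolding i j m .
  qed
qed

end

section \<open>Convergence of products in \<open>L^2\<close>\<close>

lemma Cauchy_Schwarz_integral:
  fixes a b :: "'a \<Rightarrow> real"
  assumes [measurable]: "a \<in> borel_measurable N" "b \<in> borel_measurable N"
    and ia: "integrable N (\<lambda>x. (a x)\<^sup>2)" and ib: "integrable N (\<lambda>x. (b x)\<^sup>2)"
  shows "integrable N (\<lambda>x. a x * b x)"
    and "(\<integral>x. \<bar>a x * b x\<bar> \<partial>N) \<le> sqrt (\<integral>x. (a x)\<^sup>2 \<partial>N) * sqrt (\<integral>x. (b x)\<^sup>2 \<partial>N)"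
proof -
  have le: "\<bar>a x * b x\<bar> \<le> (\<theta> * (a x)\<^sup>2 + (b x)\<^sup>2 / \<theta>) / 2" if "\<theta> > 0" for x \<theta>
  proof -
    have "0 \<le> (sqrt \<theta> * \<bar>a x\<bar> - \<bar>b x\<bar> / sqrt \<theta>)\<^sup>2" by simp
    also have "\<dots> = \<theta> * (a x)\<^sup>2 + (b x)\<^sup>2 / \<theta> - 2 * \<bar>a x * b x\<bar>"
      using that by (simp add: power2_diff power_mult_distrib power_divide abs_mult)
    finally show ?thesis by simp
  qed
  show i: "integrable N (\<lambda>x. a x * b x)"
    by (rule Bochner_Integration.integrable_bound[of _ "\<lambda>x. (1 * (a x)\<^sup>2 + (b x)\<^sup>2 / 1) / 2"])
      (use ia ib le[of 1] in \<open>auto intro!: AE_I2\<close>)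
  let ?A = "\<integral>x. (a x)\<^sup>2 \<partial>N" and ?B = "\<integral>x. (b x)\<^sup>2 \<partial>N"
  have nn: "0 \<le> ?A" "0 \<le> ?B" by (auto intro!: integral_nonneg_AE)
  show "(\<integral>x. \<bar>a x * b x\<bar> \<partial>N) \<le> sqrt ?A * sqrt ?B"
  proof (cases "?A = 0 \<or> ?B = 0")
    case True
    then have "(AE x in N. (a x)\<^sup>2 = 0) \<or> (AE x in N. (b x)\<^sup>2 = 0)"
      using integral_nonneg_eq_0_iff_AE[OF ia] integral_nonneg_eq_0_iff_AE[OF ib] by auto
    then have "AE x in N. \<bar>a x * b x\<bar> = 0"
    proof (elim disjE)
      assume "AE x in N. (a x)\<^sup>2 = 0" then show ?thesis by eventually_elim simp
    next
      assume "AE x in N. (b x)\<^sup>2 = 0" then show ?thesis by eventually_elim simp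
    qed
    then have "(\<integral>x. \<bar>a x * b x\<bar> \<partial>N) = (\<integral>x. 0 \<partial>N)"
      by (intro integral_cong_AE) auto
    then show ?thesis using nn by simp
  next
    case False
    with nn have pos: "?A > 0" "?B > 0" by (metis less_eq_real_def)+
    \<comment> \<open>The value that balances the two terms of the weighted inequality between
      arithmetic and geometric mean.\<close>
    define \<theta> where "\<theta> = sqrt ?B / sqrt ?A"
    have \<theta>: "\<theta> > 0" using pos by (simp add: \<theta>_def)
    have "(\<integral>x. \<bar>a x * b x\<bar> \<partial>N) \<le> (\<integral>x. (\<theta> * (a x)\<^sup>2 + (b x)\<^sup>2 / \<theta>) / 2 \<partial>N)"
      using i ia ib le[OF \<theta>] by (intro integral_mono) auto
    also have "\<dots> = (\<theta> * ?A + ?B / \<theta>) / 2"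
      using ia ib by simp
    also have "\<theta> * ?A = sqrt ?B * (?A / sqrt ?A)" by (simp add: \<theta>_def)
    also have "?A / sqrt ?A = sqrt ?A" by (rule real_div_sqrt) (use nn in simp)
    also have "?B / \<theta> = sqrt ?A * (?B / sqrt ?B)" by (simp add: \<theta>_def)
    also have "?B / sqrt ?B = sqrt ?B" by (rule real_div_sqrt) (use nn in simp)
    finally show ?thesis by (simp add: mult.commute)
  qed
qed

text \<open>The difference of the products splits as
  \<open>(Xn - X)(Yn - Y) + (Xn - X) Y + X (Yn - Y)\<close>, and Cauchy-Schwarz controls each part.
  This carries the weighted isometry from simple processes to their limit.\<close>

lemma integral_mult_tendsto_L2:
  fixes X Y \<eta> :: "'a \<Rightarrow> real" and Xn Yn :: "nat \<Rightarrow> 'a \<Rightarrow> real"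
  assumes [measurable]: "X \<in> borel_measurable N" "Y \<in> borel_measurable N" "\<eta> \<in> borel_measurable N"
    "\<And>n. Xn n \<in> borel_measurable N" "\<And>n. Yn n \<in> borel_measurable N"
    and X: "integrable N (\<lambda>x. (X x)\<^sup>2)" and Y: "integrable N (\<lambda>x. (Y x)\<^sup>2)"
    and Xn: "\<And>n. integrable N (\<lambda>x. (Xn n x - X x)\<^sup>2)" and Yn: "\<And>n. integrable N (\<lambda>x. (Yn n x - Y x)\<^sup>2)"
    and Xl: "(\<lambda>n. \<integral>x. (Xn n x - X x)\<^sup>2 \<partial>N) \<longlonglongrightarrow> 0" and Yl: "(\<lambda>n. \<integral>x. (Yn n x - Y x)\<^sup>2 \<partial>N) \<longlonglongrightarrow> 0"
    and \<eta>: "\<And>x. x \<in> space N \<Longrightarrow> \<bar>\<eta> x\<bar> \<le> C"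
  shows "integrable N (\<lambda>x. \<eta> x * (X x * Y x))"
    and "(\<lambda>n. \<integral>x. \<eta> x * (Xn n x * Yn n x) \<partial>N) \<longlonglongrightarrow> (\<integral>x. \<eta> x * (X x * Y x) \<partial>N)"
proof -
  have bd: "integrable N (\<lambda>x. \<eta> x * h x)" "\<bar>\<integral>x. \<eta> x * h x \<partial>N\<bar> \<le> \<bar>C\<bar> * (\<integral>x. \<bar>h x\<bar> \<partial>N)"
    if h: "integrable N h" for h
  proof -
    have [measurable]: "h \<in> borel_measurable N" using h by auto
    have le: "\<bar>\<eta> x * h x\<bar> \<le> \<bar>C\<bar> * \<bar>h x\<bar>" if "x \<in> space N" for x
      using \<eta>[OF that] by (auto simp: abs_mult intro!: mult_right_mono)
    show i: "integrable N (\<lambda>x. \<eta> x * h x)"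
      by (rule Bochner_Integration.integrable_bound[of _ "\<lambda>x. \<bar>C\<bar> * \<bar>h x\<bar>"])
        (use h le in \<open>auto intro!: AE_I2\<close>)
    have "\<bar>\<integral>x. \<eta> x * h x \<partial>N\<bar> \<le> (\<integral>x. \<bar>\<eta> x * h x\<bar> \<partial>N)" by (rule integral_abs_bound)
    also have "\<dots> \<le> (\<integral>x. \<bar>C\<bar> * \<bar>h x\<bar> \<partial>N)"
      using i h le by (intro integral_mono) auto
    finally show "\<bar>\<integral>x. \<eta> x * h x \<partial>N\<bar> \<le> \<bar>C\<bar> * (\<integral>x. \<bar>h x\<bar> \<partial>N)" by simp
  qed
  note cs = Cauchy_Schwarz_integral
  have i0: "integrable N (\<lambda>x. X x * Y x)" by (rule cs) (use X Y in auto)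
  have i1: "integrable N (\<lambda>x. (Xn n x - X x) * (Yn n x - Y x))"
    "integrable N (\<lambda>x. (Xn n x - X x) * Y x)" "integrable N (\<lambda>x. X x * (Yn n x - Y x))" for n
    by (rule cs; use X Y Xn Yn in auto)+
  show "integrable N (\<lambda>x. \<eta> x * (X x * Y x))" by (rule bd[OF i0])
  let ?x = "\<lambda>n. \<integral>x. (Xn n x - X x)\<^sup>2 \<partial>N" and ?y = "\<lambda>n. \<integral>x. (Yn n x - Y x)\<^sup>2 \<partial>N"
  let ?X = "\<integral>x. (X x)\<^sup>2 \<partial>N" and ?Y = "\<integral>x. (Y x)\<^sup>2 \<partial>N"
  have "(\<lambda>n. (\<integral>x. \<eta> x * (Xn n x * Yn n x) \<partial>N) - (\<integral>x. \<eta> x * (X x * Y x) \<partial>N)) \<longlonglongrightarrow> 0"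
  proof (rule tendsto_rabs_zero_cancel, rule tendsto_sandwich[of "\<lambda>_. 0"])
    have "(\<lambda>n. \<bar>C\<bar> * (sqrt (?x n) * sqrt (?y n) + sqrt (?x n) * sqrt ?Y + sqrt ?X * sqrt (?y n)))
       \<longlonglongrightarrow> \<bar>C\<bar> * (sqrt 0 * sqrt 0 + sqrt 0 * sqrt ?Y + sqrt ?X * sqrt 0)"
      by (intro tendsto_intros Xl Yl)
    then show "(\<lambda>n. \<bar>C\<bar> * (sqrt (?x n) * sqrt (?y n) + sqrt (?x n) * sqrt ?Y + sqrt ?X * sqrt (?y n))) \<longlonglongrightarrow> 0"
      by simp
    show "\<forall>\<^sub>F n in sequentially. \<bar>(\<integral>x. \<eta> x * (Xn n x * Yn n x) \<partial>N) - (\<integral>x. \<eta> x * (X x * Y x) \<partial>N)\<bar>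
       \<le> \<bar>C\<bar> * (sqrt (?x n) * sqrt (?y n) + sqrt (?x n) * sqrt ?Y + sqrt ?X * sqrt (?y n))"
    proof (intro always_eventually allI)
      fix n
      let ?d1 = "\<lambda>x. (Xn n x - X x) * (Yn n x - Y x)" and ?d2 = "\<lambda>x. (Xn n x - X x) * Y x"
        and ?d3 = "\<lambda>x. X x * (Yn n x - Y x)"
      have "(\<integral>x. \<eta> x * (Xn n x * Yn n x) \<partial>N)
        = (\<integral>x. \<eta> x * (X x * Y x) + (\<eta> x * ?d1 x + (\<eta> x * ?d2 x + \<eta> x * ?d3 x)) \<partial>N)"
        by (intro Bochner_Integration.integral_cong) (auto simp: algebra_simps)
      also have "\<dots> = (\<integral>x. \<eta> x * (X x * Y x) \<partial>N) + ((\<integral>x. \<eta> x * ?d1 x \<partial>N) + ((\<integral>x. \<eta> x * ?d2 x \<partial>N) + (\<integral>x. \<eta> x * ?d3 x \<partial>N)))"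
        using bd(1)[OF i0] bd(1)[OF i1(1)[of n]] bd(1)[OF i1(2)[of n]] bd(1)[OF i1(3)[of n]]
        by (simp add: Bochner_Integration.integral_add)
      finally have "\<bar>(\<integral>x. \<eta> x * (Xn n x * Yn n x) \<partial>N) - (\<integral>x. \<eta> x * (X x * Y x) \<partial>N)\<bar>
         \<le> \<bar>\<integral>x. \<eta> x * ?d1 x \<partial>N\<bar> + \<bar>\<integral>x. \<eta> x * ?d2 x \<partial>N\<bar> + \<bar>\<integral>x. \<eta> x * ?d3 x \<partial>N\<bar>"
        by linarith
      also have "\<dots> \<le> \<bar>C\<bar> * (\<integral>x. \<bar>?d1 x\<bar> \<partial>N) + \<bar>C\<bar> * (\<integral>x. \<bar>?d2 x\<bar> \<partial>N) + \<bar>C\<bar> * (\<integral>x. \<bar>?d3 x\<bar> \<partial>N)"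
        by (intro add_mono bd i1)
      also have "\<dots> \<le> \<bar>C\<bar> * (sqrt (?x n) * sqrt (?y n)) + \<bar>C\<bar> * (sqrt (?x n) * sqrt ?Y) + \<bar>C\<bar> * (sqrt ?X * sqrt (?y n))"
        by (intro add_mono mult_left_mono cs) (use X Y Xn Yn in auto)
      finally show "\<bar>(\<integral>x. \<eta> x * (Xn n x * Yn n x) \<partial>N) - (\<integral>x. \<eta> x * (X x * Y x) \<partial>N)\<bar>
       \<le> \<bar>C\<bar> * (sqrt (?x n) * sqrt (?y n) + sqrt (?x n) * sqrt ?Y + sqrt ?X * sqrt (?y n))"
        by (simp add: algebra_simps)
    qed
  qed auto
  then show "(\<lambda>n. \<integral>x. \<eta> x * (Xn n x * Yn n x) \<partial>N) \<longlonglongrightarrow> (\<integral>x. \<eta> x * (X x * Y x) \<partial>N)"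
    by (simp add: LIM_zero_iff)
qed

lemma ennreal_norm_diff_squared_le:
  fixes x y :: "'z::real_normed_vector"
  shows "ennreal ((norm (x - y))\<^sup>2) \<le> 2 * ennreal ((norm x)\<^sup>2) + 2 * ennreal ((norm y)\<^sup>2)"
proof -
  have "(norm (x - y))\<^sup>2 \<le> (norm x + norm y)\<^sup>2" by (intro power_mono norm_triangle_ineq4) auto
  also have "\<dots> \<le> 2 * (norm x)\<^sup>2 + 2 * (norm y)\<^sup>2"
    using zero_le_power2[of "norm x - norm y"] by (simp add: power2_sum power2_diff)
  finally have "ennreal ((norm (x - y))\<^sup>2) \<le> ennreal (2 * (norm x)\<^sup>2 + 2 * (norm y)\<^sup>2)"
    by (rule ennreal_leI)
  also have "\<dots> = ennreal (2 * (norm x)\<^sup>2) + ennreal (2 * (norm y)\<^sup>2)"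
    by (rule ennreal_plus) auto
  also have "\<dots> = 2 * ennreal ((norm x)\<^sup>2) + 2 * ennreal ((norm y)\<^sup>2)"
    by (simp add: ennreal_mult')
  finally show ?thesis .
qed

text \<open>The set \<open>\<Omega>\<close> collects the good paths. It lies in \<open>F 0\<close>,
  so cutting processes to 0 outside it preserves adaptedness. The bound on \<open>G\<close> is asked
  for only up to \<open>\<sigma>\<close>, which is what a bound on the solution before its exit from
  a ball provides.\<close>

locale stopped_ito = bounded_stopping M F B T \<sigma>
  for M :: "'a measure" and F and B :: "real \<Rightarrow> 'a \<Rightarrow> real^'m::finite" and T \<sigma> +
  fixes G :: "real \<Rightarrow> 'a \<Rightarrow> real^'m^'d::finite" and I :: "real \<Rightarrow> 'a \<Rightarrow> real^'d" and K :: real and \<Omega> :: "'a set"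
  assumes ito: "has_ito_integral M F B G I"
    and \<Omega>: "\<Omega> \<in> sets (F 0)" "AE w in M. w \<in> \<Omega>"
    and I_cont: "\<And>w. w \<in> \<Omega> \<Longrightarrow> continuous_on {0..} (\<lambda>t. I t w)"
    and K: "0 \<le> K" and G_le: "\<And>w s. w \<in> \<Omega> \<Longrightarrow> 0 \<le> s \<Longrightarrow> s \<le> \<sigma> w \<Longrightarrow> norm (G s w) \<le> K"
begin

text \<open>Only progressive measurability on \<open>[0, T]\<close> is available, so time is clamped to that interval.\<close>

definition Gc :: "real \<Rightarrow> 'a \<Rightarrow> real^'m^'d" where "Gc s w = G (max 0 (min T s)) w"

definition Gs :: "real \<Rightarrow> 'a \<Rightarrow> real^'m^'d" where
  "Gs s w = (if w \<in> \<Omega> \<and> 0 \<le> s \<and> s \<le> \<sigma> w then Gc s w else 0)"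

abbreviation energy :: "('a, 'm, 'd) simple_process \<Rightarrow> 'a \<Rightarrow> ennreal" where
  "energy J w \<equiv> \<integral>\<^sup>+s\<in>{0..T}. ennreal ((norm (simple_value J s w))\<^sup>2) \<partial>lborel"

abbreviation distance :: "('a, 'm, 'd) simple_process \<Rightarrow> 'a \<Rightarrow> ennreal" where
  "distance J w \<equiv> \<integral>\<^sup>+s\<in>{0..T}. ennreal ((norm (simple_value J s w - Gs s w))\<^sup>2) \<partial>lborel"

text \<open>Serves as the Ito integral of \<open>Gs\<close>, obtained by stopping the given integral
  instead of integrating anew; \<open>N_moments\<close> confirms that it has the moments of that
  integral.\<close>

definition N :: "real \<Rightarrow> 'a \<Rightarrow> real^'d" where
  "N t w = (if w \<in> \<Omega> then I (min t (\<sigma> w)) w else 0)"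

lemma \<Omega>_sets [measurable]: "\<Omega> \<in> sets M" and \<Omega>_space: "\<Omega> \<subseteq> space M"
proof -
  show "\<Omega> \<in> sets M" using \<Omega>(1) sub[of 0] by (auto simp: subalgebra_def)
  then show "\<Omega> \<subseteq> space M" by (rule sets.sets_into_space)
qed

lemma Gc_eq: "s \<in> {0..T} \<Longrightarrow> Gc s w = G s w"
  by (simp add: Gc_def)

lemma Gc_measurable [measurable]: "(\<lambda>(s, w). Gc s w) \<in> borel_measurable LM"
proof -
  have 1: "(\<lambda>(t, w). G t w) \<in> borel_measurable (restrict_space borel {0..T} \<Otimes>\<^sub>M F T)"
    using ito T by (auto simp: has_ito_integral_def progressively_measurable_def)
  have 2: "(\<lambda>w. w) \<in> measurable M (F T)"
    using sub[of T] T by (auto simp: subalgebra_def measurable_def)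
  have 3: "(\<lambda>s. max 0 (min T s)) \<in> measurable lborel (restrict_space borel {0..T})"
    by (rule measurable_restrict_space2) (use T in auto)
  have "(\<lambda>x. (max 0 (min T (fst x)), snd x)) \<in> measurable LM (restrict_space borel {0..T} \<Otimes>\<^sub>M F T)"
    by (intro measurable_Pair measurable_compose[OF measurable_fst 3] measurable_compose[OF measurable_snd 2])
  from measurable_compose[OF this 1] show ?thesis
    by (simp add: Gc_def split_beta')
qed

lemma Gs_measurable [measurable]: "(\<lambda>(s, w). Gs s w) \<in> borel_measurable LM"
proof -
  have [measurable]: "(\<lambda>x. Gc (fst x) (snd x)) \<in> borel_measurable LM"
    using Gc_measurable by (simp add: split_beta')
  show ?thesis
    unfolding Gs_def[abs_def] split_beta' by measurable
qed

lemma Gs_le: "norm (Gs s w) \<le> K"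
proof (cases "w \<in> \<Omega> \<and> 0 \<le> s \<and> s \<le> \<sigma> w")
  case True
  with \<Omega>_space have "w \<in> space M" by auto
  with True \<sigma>_bounds[OF this] have "Gc s w = G s w" by (intro Gc_eq) auto
  with True show ?thesis using G_le[of w s] by (simp add: Gs_def)
next
  case False
  then show ?thesis using K by (auto simp: Gs_def)
qed

lemma simple_value_measurable:
  fixes H :: "('a, 'm, 'd) simple_process"
  assumes "simple_process F H"
  shows "(\<lambda>(s, w). simple_value H s w) \<in> borel_measurable LM"
proof -
  have "(\<lambda>x. \<Sum>(a, b, c)\<leftarrow>H'. indicator {a<..b} (fst x) *\<^sub>R c (snd x)) \<in> borel_measurable LM"
    if "set H' \<subseteq> set H" for H'
    using that
  proof (induction H')
    case Nil
    then show ?case by simp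
  next
    case (Cons h H')
    obtain a b c where h: "h = (a, b, c)" by (cases h)
    with Cons assms have "0 \<le> a" "c \<in> borel_measurable (F a)" unfolding simple_process_def by auto
    then have [measurable]: "c \<in> borel_measurable M" by (rule meas_M)
    have "(\<lambda>x. \<Sum>(a, b, c)\<leftarrow>H'. indicator {a<..b} (fst x) *\<^sub>R c (snd x)) \<in> borel_measurable LM"
      using Cons by auto
    moreover have "(\<lambda>x. indicator {a<..b} (fst x) *\<^sub>R c (snd x)) \<in> borel_measurable LM"
      by measurable
    ultimately have "(\<lambda>x. indicator {a<..b} (fst x) *\<^sub>R c (snd x) + (\<Sum>(a, b, c)\<leftarrow>H'. indicator {a<..b} (fst x) *\<^sub>R c (snd x)))
       \<in> borel_measurable LM"
      by (intro borel_measurable_add)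
    then show ?case by (simp add: h)
  qed
  from this[of H] show ?thesis by (simp add: simple_value_def split_beta')
qed

text \<open>Convergence in probability yields, along a suitable subsequence, exceptional events of
  summable probability, and almost every path lies in only finitely many of them. The approximants
  are stopped at the rounded time and capped in energy; on a good path both interventions become
  harmless in the limit.\<close>

lemma approximation:
  obtains J :: "nat \<Rightarrow> ('a, 'm, 'd) simple_process" where "\<And>m. simple_process F (J m)"
    and "\<And>m w. w \<in> space M \<Longrightarrow>
      energy (J m) w \<le> ennreal (2 * K\<^sup>2 * T + 1)"
    and "AE w in M. (\<lambda>m. distance (J m) w) \<longlonglongrightarrow> 0"
    and "AE w in M. \<forall>n q. q \<le> 2 ^ n \<longrightarrow> (\<lambda>m. simple_integral B (J m) (gp n q) w) \<longlonglongrightarrow> N (gp n q) w"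
proof -
  from ito obtain H :: "nat \<Rightarrow> ('a, 'm, 'd) simple_process" where H: "\<And>n. simple_process F (H n)"
    and nip1: "\<And>T. 0 \<le> T \<Longrightarrow> null_in_probability M
           (\<lambda>n w. \<integral>\<^sup>+s\<in>{0..T}. ennreal ((norm (simple_value (H n) s w - G s w))\<^sup>2) \<partial>lborel)"
    and nip2: "\<And>t. 0 \<le> t \<Longrightarrow> null_in_probability M
           (\<lambda>n w. ennreal (norm (simple_integral B (H n) t w - I t w)))"
    unfolding has_ito_integral_def by blast
  have G2: "AE w in M. (\<integral>\<^sup>+s\<in>{0..T}. ennreal ((norm (G s w))\<^sup>2) \<partial>lborel) < \<infinity>"
  proof -
    have "AE w in M. \<forall>T\<ge>0. (\<integral>\<^sup>+s\<in>{0..T}. ennreal ((norm (G s w))\<^sup>2) \<partial>lborel) < \<infinity>"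
      using ito by (auto simp: has_ito_integral_def)
    then show ?thesis by eventually_elim (use T in auto)
  qed
  \<comment> \<open>The cap is twice the energy bound \<open>K\<^sup>2 * T\<close> of the stopped
    integrand, plus 1 for errors that eventually drop below 1.\<close>
  let ?C = "2 * K\<^sup>2 * T + 1"
  \<comment> \<open>Failure of accuracy \<open>(1/2)^m\<close> for the approximant
    \<open>H n\<close>: in energy over the whole interval here, and in \<open>E2\<close> for the
    integral at a grid time of level \<open>m\<close>.\<close>
  define E1 where "E1 m n = {w\<in>space M. ennreal ((1/2)^m) < (\<integral>\<^sup>+s\<in>{0..T}. ennreal ((norm (simple_value (H n) s w - G s w))\<^sup>2) \<partial>lborel)}"
    for m n :: nat
  define E2 where "E2 m q n = {w\<in>space M. ennreal ((1/2)^m) < ennreal (norm (simple_integral B (H n) (gp m q) w - I (gp m q) w))}"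
    for m q n :: nat
  have E1: "E1 m n \<in> sets M" "(\<lambda>n. measure M (E1 m n)) \<longlonglongrightarrow> 0" for m n
  proof -
    note n = nip1[of T, unfolded null_in_probability_def]
    show "(\<lambda>n. measure M (E1 m n)) \<longlonglongrightarrow> 0" using n T unfolding E1_def by auto
    have [measurable]: "(\<lambda>w. \<integral>\<^sup>+s\<in>{0..T}. ennreal ((norm (simple_value (H n) s w - G s w))\<^sup>2) \<partial>lborel) \<in> borel_measurable M"
      using n T by auto
    show "E1 m n \<in> sets M" unfolding E1_def by measurable
  qed
  have E2: "E2 m q n \<in> sets M" "(\<lambda>n. measure M (E2 m q n)) \<longlonglongrightarrow> 0" for m q n
  proof -
    note n = nip2[of "gp m q", unfolded null_in_probability_def]
    show "(\<lambda>n. measure M (E2 m q n)) \<longlonglongrightarrow> 0" using n unfolding E2_def by auto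
    have [measurable]: "(\<lambda>w. ennreal (norm (simple_integral B (H n) (gp m q) w - I (gp m q) w))) \<in> borel_measurable M"
      using n by auto
    show "E2 m q n \<in> sets M" unfolding E2_def by measurable
  qed
  define E where "E m n = E1 m n \<union> (\<Union>q\<le>2^m. E2 m q n)" for m n
  have E: "E m n \<in> sets M" for m n unfolding E_def using E1 E2 by auto
  have "\<exists>n. measure M (E m n) < (1/2)^m" for m
  proof -
    have "(\<lambda>n. measure M (E1 m n) + (\<Sum>q\<le>2^m. measure M (E2 m q n))) \<longlonglongrightarrow> 0 + (\<Sum>q\<le>(2::nat)^m. 0)"
      by (intro tendsto_add tendsto_sum E1 E2)
    then have "\<forall>\<^sub>F n in sequentially. measure M (E1 m n) + (\<Sum>q\<le>2^m. measure M (E2 m q n)) < (1/2)^m"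
      by (intro order_tendstoD) auto
    then obtain n where n: "measure M (E1 m n) + (\<Sum>q\<le>2^m. measure M (E2 m q n)) < (1/2)^m"
      by (auto simp: eventually_sequentially)
    have "measure M (E m n) \<le> measure M (E1 m n) + measure M (\<Union>q\<le>2^m. E2 m q n)"
      unfolding E_def by (rule measure_Un_le) (use E1 E2 in auto)
    also have "\<dots> \<le> measure M (E1 m n) + (\<Sum>q\<le>2^m. measure M (E2 m q n))"
      by (intro add_left_mono measure_UNION_le) (use E2 in auto)
    also note n
    finally show ?thesis by blast
  qed
  then obtain nn where nn: "\<And>m. measure M (E m (nn m)) < (1/2)^m" by metis
  let ?H = "\<lambda>m. simple_value (H (nn m))"
  let ?e = "\<lambda>m w. \<integral>\<^sup>+s\<in>{0..T}. ennreal ((norm (indicator {..\<sigma>_up m w} s *\<^sub>R ?H m s w))\<^sup>2) \<partial>lborel"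
  have BC: "AE w in M. \<forall>\<^sub>F m in sequentially. w \<in> space M - E m (nn m)"
  proof (rule borel_cantelli_AE1)
    show "summable (\<lambda>m. measure M (E m (nn m)))"
      by (rule summable_comparison_test[OF _ summable_geometric[of "1/2"]]) (use nn in \<open>auto intro!: exI[of _ 0] less_imp_le\<close>)
  qed (use E in \<open>auto simp: emeasure_eq_measure\<close>)
  have C: "0 \<le> ?C" using T by simp
  \<comment> \<open>The properties of one stopped process are bundled so that a whole sequence can
    be chosen at once.\<close>
  define Q where "Q m J \<longleftrightarrow> simple_process F J
    \<and> (\<forall>w\<in>space M. energy J w \<le> ennreal ?C)
    \<and> (\<forall>w\<in>space M. ?e m w \<le> ennreal ?C
       \<longrightarrow> (\<forall>s\<in>{0<..T}. simple_value J s w = indicator {..\<sigma>_up m w} s *\<^sub>R ?H m s w)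
         \<and> (\<forall>q\<le>2^m. simple_integral B J (gp m q) w = simple_integral B (H (nn m)) (min (gp m q) (\<sigma>_up m w)) w))"
    for m and J :: "('a, 'm, 'd) simple_process"
  have "\<exists>J. Q m J" for m
    unfolding Q_def by (rule stopped_simple_process[OF H[of "nn m"] C, of m]) blast
  then obtain J where QJ: "Q m (J m)" for m
    using choice[of Q] by blast
  have J: "\<And>m. simple_process F (J m)"
    and J1: "\<And>m w. w \<in> space M \<Longrightarrow> energy (J m) w \<le> ennreal ?C"
    and J2: "\<And>m w. w \<in> space M \<Longrightarrow> ?e m w \<le> ennreal ?C
       \<Longrightarrow> (\<forall>s\<in>{0<..T}. simple_value (J m) s w = indicator {..\<sigma>_up m w} s *\<^sub>R ?H m s w)
         \<and> (\<forall>q\<le>2^m. simple_integral B (J m) (gp m q) w = simple_integral B (H (nn m)) (min (gp m q) (\<sigma>_up m w)) w)"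
    using QJ unfolding Q_def by blast+
  have path: "(\<lambda>m. distance (J m) w) \<longlonglongrightarrow> 0 \<and>
    (\<forall>n q. q \<le> 2 ^ n \<longrightarrow> (\<lambda>m. simple_integral B (J m) (gp n q) w) \<longlonglongrightarrow> N (gp n q) w)"
    if w: "w \<in> \<Omega>" and ev: "\<forall>\<^sub>F m in sequentially. w \<in> space M - E m (nn m)"
      and fin: "(\<integral>\<^sup>+s\<in>{0..T}. ennreal ((norm (G s w))\<^sup>2) \<partial>lborel) < \<infinity>" for w
  proof -
    have wM: "w \<in> space M" using w \<Omega>_space by auto
    have [measurable]: "(\<lambda>s. Gc s w) \<in> borel_measurable lborel"
      using measurable_compose[OF measurable_Pair2'[OF wM] Gc_measurable] by simp
    have Hm[measurable]: "(\<lambda>s. simple_value (H n) s w) \<in> borel_measurable lborel" for n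
      using measurable_compose[OF measurable_Pair2'[OF wM] simple_value_measurable[OF H]] by simp
    let ?g = "\<lambda>s. ennreal ((norm (Gc s w))\<^sup>2) * indicator {0..T} s"
    let ?u = "\<lambda>m s. (2 * ennreal ((norm (?H m s w - Gc s w))\<^sup>2) + 2 * (ennreal ((norm (Gc s w))\<^sup>2) * indicator {\<sigma> w<..\<sigma>_up m w} s)) * indicator {0..T} s"
    have fin': "integral\<^sup>N lborel ?g < \<infinity>"
      using fin by (subst nn_integral_cong[of _ _ "\<lambda>s. ennreal ((norm (G s w))\<^sup>2) * indicator {0..T} s"]) (auto simp: Gc_eq indicator_def)
    \<comment> \<open>Between \<open>\<sigma> w\<close> and the rounded time the integrand need not
      obey the bound \<open>K\<close>. Its energy there tends to 0, because the path is square
      integrable and the gap shrinks.\<close>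
    define \<rho> where "\<rho> m = (\<integral>\<^sup>+s. ?g s * indicator {\<sigma> w<..\<sigma>_up m w} s \<partial>lborel)" for m
    have \<rho>: "\<rho> \<longlonglongrightarrow> 0"
    proof -
      have "(\<lambda>m. \<integral>\<^sup>+s. ?g s * indicator {\<sigma> w<..\<sigma>_up m w} s \<partial>lborel) \<longlonglongrightarrow> (\<integral>\<^sup>+s. 0 \<partial>(lborel :: real measure))"
      proof (rule nn_integral_dominated_convergence[where w="?g" and u'="\<lambda>_. 0"])
        show "AE s in lborel. (\<lambda>m. ?g s * indicator {\<sigma> w<..\<sigma>_up m w} s) \<longlonglongrightarrow> 0"
        proof (rule AE_I2)
          fix s
          have "\<forall>\<^sub>F m in sequentially. ?g s * indicator {\<sigma> w<..\<sigma>_up m w} s = 0"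
          proof (cases "\<sigma> w < s")
            case True
            then have "\<forall>\<^sub>F m in sequentially. \<sigma>_up m w < s"
              using \<sigma>_up_tendsto by (rule order_tendstoD(2)[rotated])
            then show ?thesis by eventually_elim auto
          qed auto
          then show "(\<lambda>m. ?g s * indicator {\<sigma> w<..\<sigma>_up m w} s) \<longlonglongrightarrow> 0"
            by (rule tendsto_eventually)
        qed
      qed (use fin' in \<open>auto intro!: AE_I2 simp: indicator_def\<close>)
      then show ?thesis by (simp add: \<rho>_def[abs_def])
    qed
    define \<delta> where "\<delta> m = 2 * ennreal ((1/2)^m) + 2 * \<rho> m" for m
    have \<delta>: "\<delta> \<longlonglongrightarrow> 0"
    proof -
      have "(\<lambda>m. ennreal ((1/2)^m)) \<longlonglongrightarrow> ennreal 0"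
        by (intro tendsto_ennrealI LIMSEQ_power_zero) auto
      then have "(\<lambda>m. 2 * ennreal ((1/2)^m) + 2 * \<rho> m) \<longlonglongrightarrow> 2 * ennreal 0 + 2 * 0"
        by (intro tendsto_add ennreal_tendsto_cmult \<rho>) auto
      then show ?thesis by (simp add: \<delta>_def[abs_def])
    qed
    have H2: "(\<integral>\<^sup>+s. ennreal ((norm (?H m s w - Gc s w))\<^sup>2) * indicator {0..T} s \<partial>lborel) \<le> ennreal ((1/2)^m)"
      if "w \<in> space M - E m (nn m)" for m
    proof -
      have "w \<notin> E1 m (nn m)" using that by (auto simp: E_def)
      then have "(\<integral>\<^sup>+s\<in>{0..T}. ennreal ((norm (?H m s w - G s w))\<^sup>2) \<partial>lborel) \<le> ennreal ((1/2)^m)"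
        using wM by (auto simp: E1_def)
      then show ?thesis
        by (subst nn_integral_cong[of _ _ "\<lambda>s. ennreal ((norm (?H m s w - G s w))\<^sup>2) * indicator {0..T} s"])
          (auto simp: Gc_eq indicator_def)
    qed
    have sqe: "ennreal ((norm x)\<^sup>2) \<le> 2 * ennreal ((norm (x - y))\<^sup>2) + 2 * ennreal ((norm y)\<^sup>2)" for x y :: "real^'m^'d"
      using ennreal_norm_diff_squared_le[of "x - y" "- y"] by simp
    have Ks: "norm (Gc s w) \<le> K" if "0 \<le> s" "s \<le> \<sigma> w" for s
      using G_le[OF w that] \<sigma>_bounds[OF wM] that by (simp add: Gc_eq)
    have \<delta>_le: "(\<integral>\<^sup>+s. ?u m s \<partial>lborel) \<le> \<delta> m"
      if "w \<in> space M - E m (nn m)" for m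
    proof -
      have "(\<integral>\<^sup>+s. ?u m s \<partial>lborel)
        = (\<integral>\<^sup>+s. 2 * (ennreal ((norm (?H m s w - Gc s w))\<^sup>2) * indicator {0..T} s) + 2 * (?g s * indicator {\<sigma> w<..\<sigma>_up m w} s) \<partial>lborel)"
        by (intro nn_integral_cong) (auto simp: indicator_def)
      also have "\<dots> = 2 * (\<integral>\<^sup>+s. ennreal ((norm (?H m s w - Gc s w))\<^sup>2) * indicator {0..T} s \<partial>lborel) + 2 * \<rho> m"
        unfolding \<rho>_def by (subst nn_integral_add) (auto simp: nn_integral_cmult)
      also have "\<dots> \<le> \<delta> m"
        unfolding \<delta>_def by (intro add_mono mult_left_mono H2 that) auto
      finally show ?thesis .
    qed
    \<comment> \<open>As soon as \<open>\<delta> m < 1\<close> the cap is respected; then the energy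
      killing is inactive and \<open>J m\<close> is the approximant stopped at the rounded
      time.\<close>
    have en: "?e m w \<le> ennreal ?C"
      if m: "w \<in> space M - E m (nn m)" "\<delta> m < 1" for m
    proof -
      have "?e m w
        \<le> (\<integral>\<^sup>+s. ?u m s
            + ennreal (2 * K\<^sup>2) * indicator {0..T} s \<partial>lborel)"
      proof (intro nn_integral_mono)
        fix s
        have "ennreal ((norm (?H m s w))\<^sup>2) \<le> 2 * ennreal ((norm (?H m s w - Gc s w))\<^sup>2) + 2 * ennreal ((norm (Gc s w))\<^sup>2)"
          by (rule sqe)
        moreover have "ennreal ((norm (Gc s w))\<^sup>2) \<le> ennreal (K\<^sup>2)" if "0 \<le> s" "s \<le> \<sigma> w"
          using Ks[OF that] by (intro ennreal_leI power_mono) auto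
        moreover have "ennreal (2 * K\<^sup>2) = 2 * ennreal (K\<^sup>2)" by (simp add: ennreal_mult')
        \<comment> \<open>Up to \<open>\<sigma> w\<close> the integrand is bounded by
          \<open>K\<close>; on the gap before the rounded time its energy is counted in
          \<open>?u\<close>; afterwards the left side is 0.\<close>
        moreover have "s \<notin> {0..T} \<or> \<sigma>_up m w < s \<or> (s \<in> {0..T} \<and> s \<le> \<sigma>_up m w \<and> s \<le> \<sigma> w) \<or> (s \<in> {0..T} \<and> s \<le> \<sigma>_up m w \<and> \<sigma> w < s)"
          by auto
        ultimately show "ennreal ((norm (indicator {..\<sigma>_up m w} s *\<^sub>R ?H m s w))\<^sup>2) * indicator {0..T} s
          \<le> ?u m s
            + ennreal (2 * K\<^sup>2) * indicator {0..T} s"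
          by (elim disjE) (auto intro: order_trans[OF _ add_mono[OF order_refl mult_left_mono]] add_increasing2)
      qed
      also have "\<dots> = (\<integral>\<^sup>+s. ?u m s \<partial>lborel) + ennreal (2 * K\<^sup>2) * ennreal T"
        using T by (subst nn_integral_add) (auto simp: nn_integral_cmult_indicator)
      also have "\<dots> \<le> 1 + ennreal (2 * K\<^sup>2) * ennreal T"
        using \<delta>_le[OF m(1)] m(2) by (intro add_right_mono) auto
      also have "\<dots> = ennreal ?C"
        using T by (simp add: ennreal_mult''[symmetric] ennreal_plus[symmetric] add.commute del: ennreal_plus flip: ennreal_1)
      finally show ?thesis .
    qed
    have ev1: "\<forall>\<^sub>F m in sequentially. w \<in> space M - E m (nn m) \<and> \<delta> m < 1"
      by (intro eventually_conj ev order_tendstoD(2)[OF \<delta>]) simp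
    show ?thesis
    proof (intro conjI allI impI)
      have "\<forall>\<^sub>F m in sequentially. distance (J m) w \<le> \<delta> m"
        using ev1
      proof eventually_elim
        case (elim m)
        then have m: "w \<in> space M - E m (nn m)" "\<delta> m < 1" by auto
        have "distance (J m) w
          \<le> (\<integral>\<^sup>+s. ?u m s \<partial>lborel)"
        proof (rule nn_integral_mono_AE)
          show "AE s in lborel. ennreal ((norm (simple_value (J m) s w - Gs s w))\<^sup>2) * indicator {0..T} s
            \<le> ?u m s"
            using AE_lborel_singleton[of 0]
          proof eventually_elim
            case (elim s)
            show ?case
            proof (cases "s \<in> {0..T}")
              case True
              with elim have s: "s \<in> {0<..T}" by auto
              have Js: "simple_value (J m) s w = indicator {..\<sigma>_up m w} s *\<^sub>R ?H m s w"
                using J2[OF wM en[OF m]] s by blast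
              have 1: "ennreal ((norm (?H m s w))\<^sup>2) \<le> 2 * ennreal ((norm (?H m s w - Gc s w))\<^sup>2) + 2 * ennreal ((norm (Gc s w))\<^sup>2)"
                by (rule sqe)
              have 2: "(x::ennreal) \<le> 2 * x" for x by (simp add: mult_2 add_increasing)
              consider "s \<le> \<sigma> w" | "\<sigma> w < s" "s \<le> \<sigma>_up m w" | "\<sigma>_up m w < s" by force
              then show ?thesis
              proof cases
                case 1
                then have "Gs s w = Gc s w" "s \<le> \<sigma>_up m w" using w s \<sigma>_up_ge[of w m] by (auto simp: Gs_def)
                then show ?thesis using 1 True 2 by (simp add: Js)
              next
                case 2
                then have "Gs s w = 0" by (simp add: Gs_def)
                then show ?thesis using 1 True 2 by (simp add: Js)
              next
                case 3
                then have "Gs s w = 0" using \<sigma>_up_ge[of w m] by (simp add: Gs_def)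
                then show ?thesis using 3 by (simp add: Js)
              qed
            qed auto
          qed
        qed
        also have "\<dots> \<le> \<delta> m" by (rule \<delta>_le[OF m(1)])
        finally show ?case .
      qed
      then show "(\<lambda>m. distance (J m) w) \<longlonglongrightarrow> 0"
        by (intro tendsto_sandwich[OF _ _ tendsto_const \<delta>]) auto
    next
      fix n q :: nat assume q: "q \<le> 2 ^ n"
      have "\<forall>\<^sub>F m in sequentially. norm (simple_integral B (J m) (gp n q) w - I (min (gp n q) (\<sigma>_up m w)) w) \<le> (1/2)^m"
        using ev1 eventually_ge_at_top[of n]
      proof eventually_elim
        case (elim m)
        then have m: "w \<in> space M - E m (nn m)" "\<delta> m < 1" and nm: "n \<le> m" by auto
        \<comment> \<open>A dyadic time of level \<open>n\<close> is also one of level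
          \<open>m\<close>, and its minimum with the rounded time is again a grid time of level
          \<open>m\<close>; these are the times at which \<open>E2\<close> controls the
          integral.\<close>
        define k where "k = q * 2 ^ (m - n)"
        have "k \<le> 2 ^ n * 2 ^ (m - n)" unfolding k_def using q by (intro mult_right_mono) auto
        also have "\<dots> = 2 ^ m" using nm by (simp flip: power_add)
        finally have k: "k \<le> 2 ^ m" "gp n q = gp m k"
          using gp_refine[of n q "m - n"] nm by (auto simp: k_def)
        obtain p where p: "p \<le> 2 ^ m" "\<sigma>_up m w = gp m p" using \<sigma>_up_gp[OF wM] .
        have mm: "min (gp m k) (gp m p) = gp m (min k p)" by (auto simp: min_def)
        have "w \<notin> E2 m (min k p) (nn m)" using m k p by (auto simp: E_def)
        then have le: "norm (simple_integral B (H (nn m)) (gp m (min k p)) w - I (gp m (min k p)) w) \<le> (1/2)^m"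
          using wM by (auto simp: E2_def not_less)
        have "simple_integral B (J m) (gp m k) w = simple_integral B (H (nn m)) (min (gp m k) (\<sigma>_up m w)) w"
          using J2[OF wM en[OF m]] k by blast
        with le show ?case unfolding k p mm by simp
      qed
      then have 1: "(\<lambda>m. simple_integral B (J m) (gp n q) w - I (min (gp n q) (\<sigma>_up m w)) w) \<longlonglongrightarrow> 0"
        by (rule Lim_null_comparison) (intro LIMSEQ_power_zero, auto)
      have 2: "(\<lambda>m. I (min (gp n q) (\<sigma>_up m w)) w) \<longlonglongrightarrow> I (min (gp n q) (\<sigma> w)) w"
      proof (rule continuous_on_tendsto_compose[OF I_cont[OF w]])
        show "(\<lambda>m. min (gp n q) (\<sigma>_up m w)) \<longlonglongrightarrow> min (gp n q) (\<sigma> w)"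
          by (intro tendsto_intros \<sigma>_up_tendsto)
        show "\<forall>\<^sub>F m in sequentially. min (gp n q) (\<sigma>_up m w) \<in> {0..}"
          using \<sigma>_up_ge[of w] \<sigma>_bounds[OF wM] by (auto intro!: always_eventually intro: order_trans)
      qed (use \<sigma>_bounds[OF wM] in auto)
      from tendsto_add[OF 1 2] w show "(\<lambda>m. simple_integral B (J m) (gp n q) w) \<longlonglongrightarrow> N (gp n q) w"
        by (simp add: N_def)
    qed
  qed
  have "AE w in M. (\<lambda>m. distance (J m) w) \<longlonglongrightarrow> 0"
    using \<Omega>(2) BC G2 by eventually_elim (use path in blast)
  moreover have "AE w in M. \<forall>n q. q \<le> 2 ^ n \<longrightarrow> (\<lambda>m. simple_integral B (J m) (gp n q) w) \<longlonglongrightarrow> N (gp n q) w"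
    using \<Omega>(2) BC G2 by eventually_elim (use path in blast)
  ultimately show ?thesis using that[of J, OF J J1] by blast
qed

end

section \<open>Moments of the stopped integral\<close>

context filtered_brownian
begin

lemma simple_integral_0:
  assumes "simple_process F H"
  shows "simple_integral B H 0 w = 0"
proof -
  have "c w *v (B (min 0 b) w - B (min 0 a) w) = 0" if "(a, b, c) \<in> set H" for a b c
  proof -
    have "0 \<le> a" "a \<le> b" using that assms unfolding simple_process_def by auto
    then show ?thesis by simp
  qed
  then have "simple_integral B H 0 w = (\<Sum>(a,b,c)\<leftarrow>H. 0)"
    unfolding simple_integral_def by (intro arg_cong[of _ _ sum_list] map_cong) auto
  then show ?thesis by (auto simp: case_prod_beta')
qed

text \<open>With simple processes as lists, a difference is a concatenation with negated
  coefficients. It lets the isometry compare two approximants.\<close>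

lemma simple_process_diff:
  fixes H J :: "('a, 'm, 'd::finite) simple_process"
  assumes H: "simple_process F H" and J: "simple_process F J"
  obtains D :: "('a, 'm, 'd) simple_process" where "simple_process F D"
    "\<And>s w. simple_value D s w = simple_value H s w - simple_value J s w"
    "\<And>t w. simple_integral B D t w = simple_integral B H t w - simple_integral B J t w"
proof -
  let ?n = "\<lambda>J::('a, 'm, 'd) simple_process. map (\<lambda>(a, b, c). (a, b, \<lambda>w. - c w)) J"
  have "bounded ((\<lambda>w. - c w) ` A)" if "bounded (c ` A)" for c :: "'a \<Rightarrow> real^'m^'d" and A
    using that by (auto simp: bounded_iff)
  then have 1: "simple_process F (H @ ?n J)"
    using H J unfolding simple_process_def by fastforce
  have v: "simple_value (?n J) s w = - simple_value J s w" for J s w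
    unfolding simple_value_def by (induction J) auto
  have i: "simple_integral B (?n J) t w = - simple_integral B J t w" for J t w
    unfolding simple_integral_def
    by (induction J) (auto simp: matrix_vector_mult_def vec_eq_iff sum_negf)
  have v2: "simple_value (H @ ?n J) s w = simple_value H s w - simple_value J s w" for s w
    using v[of J s w] by (simp add: simple_value_def)
  have i2: "simple_integral B (H @ ?n J) t w = simple_integral B H t w - simple_integral B J t w" for t w
    using i[of J t w] by (simp add: simple_integral_def)
  show ?thesis by (rule that[OF 1 v2 i2])
qed

end

context stopped_ito
begin

lemma N_measurable:
  assumes "q \<le> 2 ^ n"
  shows "N (gp n q) \<in> borel_measurable (F (gp n q))"
proof -
  let ?W = "\<lambda>t w. if w \<in> \<Omega> then I t w else 0"
  have "(\<lambda>w. ?W (min (gp n q) (\<sigma> w)) w) \<in> borel_measurable (F (gp n q))"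
  proof (rule stopped_measurable[OF _ _ assms])
    fix t :: real assume t: "0 \<le> t"
    have "I t \<in> borel_measurable (F t)"
      using ito t by (auto simp: has_ito_integral_def adapted_process_def)
    moreover have "\<Omega> \<in> sets (F t)" using \<Omega>(1) sets_mono[of 0 t] t by auto
    then have "{w \<in> space (F t). w \<in> \<Omega>} \<in> sets (F t)"
      using \<Omega>_space t by (simp add: Collect_conj_eq Int_absorb1 Int_commute)
    ultimately show "?W t \<in> borel_measurable (F t)"
      by (intro measurable_If) auto
  next
    fix w assume "w \<in> space M"
    show "continuous_on {0..} (\<lambda>t. ?W t w)"
      using I_cont[of w] by (cases "w \<in> \<Omega>") auto
  qed
  then show ?thesis by (simp add: N_def[abs_def])
qed

lemma N_meas_M: "q \<le> 2 ^ n \<Longrightarrow> N (gp n q) \<in> borel_measurable M"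
  by (rule meas_M[OF gp_nonneg N_measurable])

text \<open>The first two conditional moments of the stopped integral, expressed by testing against
  bounded weights known at the start of the window. The isometry makes the approximating integrals
  Cauchy in \<open>L^2\<close>, Fatou's lemma identifies their limit as \<open>N\<close>, and
  products converge along with them.\<close>

lemma N_moments:
  assumes pq: "p \<le> q" "q \<le> 2 ^ n"
    and \<eta>: "\<eta> \<in> borel_measurable (F (gp n p))" "\<And>w. w \<in> space M \<Longrightarrow> \<bar>\<eta> w\<bar> \<le> C"
  shows "has_bochner_integral M (\<lambda>w. \<eta> w * (N (gp n q) w - N (gp n p) w) $ a) 0"
    and "has_bochner_integral M (\<lambda>w. \<eta> w * ((N (gp n q) w - N (gp n p) w) $ a * (N (gp n q) w - N (gp n p) w) $ b))
      (\<integral>w. \<eta> w * (\<integral>x. indicator {gp n p<..gp n q} x * (\<Sum>i\<in>UNIV. Gs x w $ a $ i * Gs x w $ b $ i) \<partial>lborel) \<partial>M)"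
proof -
  interpret pair_sigma_finite lborel M ..
  let ?R = "LM"
  obtain J :: "nat \<Rightarrow> ('a, 'm, 'd) simple_process" where J: "\<And>m. simple_process F (J m)"
    and J1: "\<And>m w. w \<in> space M \<Longrightarrow>
      energy (J m) w \<le> ennreal (2 * K\<^sup>2 * T + 1)"
    and J2: "AE w in M. (\<lambda>m. distance (J m) w) \<longlonglongrightarrow> 0"
    and J3: "AE w in M. \<forall>n q. q \<le> 2 ^ n \<longrightarrow> (\<lambda>m. simple_integral B (J m) (gp n q) w) \<longlonglongrightarrow> N (gp n q) w"
    by (rule approximation) blast
  let ?d = "\<lambda>m s w. (norm (simple_value (J m) s w - Gs s w))\<^sup>2"
  have [measurable]: "(\<lambda>x. Gs (fst x) (snd x)) \<in> borel_measurable ?R"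
    using Gs_measurable by (simp add: split_beta')
  have [measurable]: "(\<lambda>x. simple_value (J m) (fst x) (snd x)) \<in> borel_measurable ?R" for m
    using simple_value_measurable[OF J[of m]] by (simp add: split_beta')
  have [measurable]: "(\<lambda>s. Gs s w) \<in> borel_measurable lborel" if "w \<in> space M" for w
    using measurable_compose[OF measurable_Pair2'[OF that] Gs_measurable] by simp
  have [measurable]: "(\<lambda>s. simple_value (J m) s w) \<in> borel_measurable lborel" if "w \<in> space M" for m w
    using measurable_compose[OF measurable_Pair2'[OF that] simple_value_measurable[OF J]] by simp
  \<comment> \<open>Squared distance between approximant and stopped integrand in \<open>L^2\<close>
    of the product of time and probability space.\<close>
  define \<epsilon> where "\<epsilon> m = (\<integral>\<^sup>+x. ennreal (?d m (fst x) (snd x)) * indicator {0..T} (fst x) \<partial>?R)" for m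
  have \<epsilon>_eq: "\<epsilon> m = (\<integral>\<^sup>+w. distance (J m) w \<partial>M)" for m
    unfolding \<epsilon>_def by (subst nn_integral_snd[symmetric]) auto
  have TT: "(\<integral>\<^sup>+s. c * indicator {0..T} s \<partial>lborel) = c * ennreal T" for c
    using T by (simp add: nn_integral_cmult_indicator)
  \<comment> \<open>A deterministic bound, from the energy cap of \<open>J m\<close> and the bound
    \<open>K\<close> on \<open>Gs\<close>. It dominates the distances, so their almost sure
    convergence gives convergence of their means.\<close>
  let ?W = "2 * ennreal (2 * K\<^sup>2 * T + 1) + 2 * (ennreal (K\<^sup>2) * ennreal T)"
  have W_fin: "?W < \<infinity>" by (simp add: ennreal_mult_less_top)
  have bd: "distance (J m) w \<le> ?W" if w: "w \<in> space M" for m w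
  proof -
    have "distance (J m) w
      \<le> (\<integral>\<^sup>+s. 2 * (ennreal ((norm (simple_value (J m) s w))\<^sup>2) * indicator {0..T} s) + 2 * (ennreal (K\<^sup>2) * indicator {0..T} s) \<partial>lborel)"
    proof (intro nn_integral_mono)
      fix s
      have "ennreal ((norm (Gs s w))\<^sup>2) \<le> ennreal (K\<^sup>2)"
        by (intro ennreal_leI power_mono Gs_le) auto
      then have "2 * ennreal ((norm (simple_value (J m) s w))\<^sup>2) + 2 * ennreal ((norm (Gs s w))\<^sup>2) \<le> 2 * ennreal ((norm (simple_value (J m) s w))\<^sup>2) + 2 * ennreal (K\<^sup>2)"
        by (intro add_left_mono mult_left_mono) auto
      from order_trans[OF ennreal_norm_diff_squared_le this]
      show "ennreal (?d m s w) * indicator {0..T} s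
         \<le> 2 * (ennreal ((norm (simple_value (J m) s w))\<^sup>2) * indicator {0..T} s) + 2 * (ennreal (K\<^sup>2) * indicator {0..T} s)"
        by (auto simp: indicator_def)
    qed
    also have "\<dots> = 2 * energy (J m) w + 2 * (ennreal (K\<^sup>2) * ennreal T)"
      using w by (subst nn_integral_add) (auto simp: nn_integral_cmult TT)
    also have "\<dots> \<le> ?W" by (intro add_right_mono mult_left_mono J1 w) auto
    finally show ?thesis .
  qed
  have \<epsilon>_fin: "\<epsilon> m < \<infinity>" for m
  proof -
    have "\<epsilon> m \<le> (\<integral>\<^sup>+w. ?W \<partial>M)" unfolding \<epsilon>_eq by (intro nn_integral_mono bd)
    also have "\<dots> = ?W" by (simp add: emeasure_space_1)
    finally show ?thesis using W_fin by (rule order.strict_trans1)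
  qed
  have \<epsilon>: "\<epsilon> \<longlonglongrightarrow> 0"
  proof -
    have m: "(\<lambda>w. distance (J m) w) \<in> borel_measurable M" for m
    proof -
      have "(\<lambda>x. ennreal (?d m (snd x) (fst x)) * indicator {0..T} (snd x)) \<in> borel_measurable (M \<Otimes>\<^sub>M lborel)"
        by (rule measurable_compose[OF measurable_pair_swap'[of M lborel, unfolded split_beta'], of "\<lambda>x. ennreal (?d m (fst x) (snd x)) * indicator {0..T} (fst x)", simplified]) measurable
      from lborel.borel_measurable_nn_integral_fst[OF this] show ?thesis by simp
    qed
    have "(\<lambda>m. \<integral>\<^sup>+w. distance (J m) w \<partial>M) \<longlonglongrightarrow> (\<integral>\<^sup>+w. 0 \<partial>M)"
      by (rule nn_integral_dominated_convergence[where w="\<lambda>_. ?W"])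
        (use m bd W_fin J2 in \<open>auto simp: emeasure_space_1\<close>)
    then show ?thesis by (simp add: \<epsilon>_eq[abs_def])
  qed
  define S where "S m t w = simple_integral B (J m) t w" for m t w
  let ?D = "\<lambda>m k c w. ((S m (gp n k) w - N (gp n k) w) $ c)\<^sup>2"
  have S_meas: "S m t \<in> borel_measurable M" if "0 \<le> t" for m t
    using meas_M[OF that simple_integral_moments(3)[OF J[of m] order_refl that, of "\<lambda>_. 1" 1]]
    by (simp add: S_def[abs_def])
  have cauchy: "(\<integral>\<^sup>+w. ennreal (((S m t w - S l t w) $ c)\<^sup>2) \<partial>M) \<le> 2 * \<epsilon> m + 2 * \<epsilon> l" if t: "0 \<le> t" "t \<le> T" for m l t c
  proof -
    obtain D where D: "simple_process F D"
      "\<And>s w. simple_value D s w = simple_value (J m) s w - simple_value (J l) s w"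
      "\<And>t w. simple_integral B D t w = S m t w - S l t w"
      unfolding S_def by (rule simple_process_diff[OF J[of m] J[of l]]) blast
    let ?h = "\<lambda>x w. indicator {0<..t} x * (\<Sum>i\<in>UNIV. simple_value D x w $ c $ i * simple_value D x w $ c $ i)"
    have hb: "has_bochner_integral M (\<lambda>w. ((S m t w - S l t w) $ c)\<^sup>2) (\<integral>w. (\<integral>x. ?h x w \<partial>lborel) \<partial>M)"
      using simple_integral_moments(2)[OF D(1) order_refl t(1), of "\<lambda>_. 1" 1 c c]
      unfolding simple_integral_0[OF D(1)] by (simp add: D(3) power2_eq_square)
    have h0: "0 \<le> ?h x w" for x w
      by (intro mult_nonneg_nonneg sum_nonneg zero_le_square) simp
    have le1: "ennreal (\<integral>x. f x \<partial>L) \<le> (\<integral>\<^sup>+x. ennreal (f x) \<partial>L)" if "\<And>x. 0 \<le> f x" for f :: "'z \<Rightarrow> real" and L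
    proof (cases "integrable L f")
      case True
      then show ?thesis using that by (subst nn_integral_eq_integral) auto
    qed (simp add: not_integrable_integral_eq)
    have "(\<integral>\<^sup>+w. ennreal (((S m t w - S l t w) $ c)\<^sup>2) \<partial>M) = ennreal (\<integral>w. (\<integral>x. ?h x w \<partial>lborel) \<partial>M)"
      using hb by (subst nn_integral_eq_integral) (auto simp: has_bochner_integral_iff)
    also have "\<dots> \<le> (\<integral>\<^sup>+w. ennreal (\<integral>x. ?h x w \<partial>lborel) \<partial>M)"
      by (rule le1) (intro integral_nonneg_AE AE_I2 h0)
    also have "\<dots> \<le> (\<integral>\<^sup>+w. (\<integral>\<^sup>+x. ennreal (?h x w) \<partial>lborel) \<partial>M)"
      by (intro nn_integral_mono le1 h0)
    also have "\<dots> \<le> (\<integral>\<^sup>+w. (\<integral>\<^sup>+x. 2 * (ennreal (?d m x w) * indicator {0..T} x)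
        + 2 * (ennreal (?d l x w) * indicator {0..T} x) \<partial>lborel) \<partial>M)"
    proof (intro nn_integral_mono)
      fix w x
      show "ennreal (?h x w) \<le> 2 * (ennreal (?d m x w) * indicator {0..T} x)
        + 2 * (ennreal (?d l x w) * indicator {0..T} x)"
      proof (cases "x \<in> {0<..t}")
        case True
        have "?h x w = (norm (simple_value D x w $ c))\<^sup>2"
          using True by (simp add: norm_vec_def L2_set_def sum_nonneg power2_eq_square)
        also have "\<dots> \<le> (norm (simple_value D x w))\<^sup>2"
          by (intro power_mono Finite_Cartesian_Product.norm_nth_le) auto
        finally have "ennreal (?h x w) \<le> ennreal ((norm ((simple_value (J m) x w - Gs x w) - (simple_value (J l) x w - Gs x w)))\<^sup>2)"
          by (intro ennreal_leI) (simp add: D)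
        also note ennreal_norm_diff_squared_le
        finally show ?thesis using True t by (auto simp: indicator_def)
      qed simp
    qed
    also have "\<dots> = (\<integral>\<^sup>+x. 2 * (ennreal (?d m (fst x) (snd x)) * indicator {0..T} (fst x))
        + 2 * (ennreal (?d l (fst x) (snd x)) * indicator {0..T} (fst x)) \<partial>?R)"
      by (subst nn_integral_snd[symmetric]) auto
    also have "\<dots> = 2 * \<epsilon> m + 2 * \<epsilon> l"
      unfolding \<epsilon>_def by (subst nn_integral_add) (auto simp: nn_integral_cmult)
    finally show ?thesis .
  qed
  \<comment> \<open>In the Cauchy estimate \<open>m\<close> is held fixed while \<open>l\<close>
    tends to infinity.\<close>
  have L2: "(\<integral>\<^sup>+w. ennreal (?D m k c w) \<partial>M) \<le> 2 * \<epsilon> m" if k: "k \<le> 2 ^ n" for m k c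
  proof -
    have [measurable]: "S l (gp n k) \<in> borel_measurable M" for l
      by (rule S_meas) simp
    have "(\<integral>\<^sup>+w. ennreal (?D m k c w) \<partial>M)
      = (\<integral>\<^sup>+w. liminf (\<lambda>l. ennreal (((S m (gp n k) w - S l (gp n k) w) $ c)\<^sup>2)) \<partial>M)"
    proof (rule nn_integral_cong_AE)
      show "AE w in M. ennreal (?D m k c w) = liminf (\<lambda>l. ennreal (((S m (gp n k) w - S l (gp n k) w) $ c)\<^sup>2))"
        using J3
      proof eventually_elim
        case (elim w)
        then have "(\<lambda>l. S l (gp n k) w) \<longlonglongrightarrow> N (gp n k) w" using k by (simp add: S_def)
        then have "(\<lambda>l. ennreal (((S m (gp n k) w - S l (gp n k) w) $ c)\<^sup>2)) \<longlonglongrightarrow> ennreal (?D m k c w)"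
          by (intro tendsto_ennrealI tendsto_intros)
        from lim_imp_Liminf[OF _ this] show ?case by simp
      qed
    qed
    also have "\<dots> \<le> liminf (\<lambda>l. \<integral>\<^sup>+w. ennreal (((S m (gp n k) w - S l (gp n k) w) $ c)\<^sup>2) \<partial>M)"
      by (rule nn_integral_liminf) measurable
    also have "\<dots> \<le> liminf (\<lambda>l. 2 * \<epsilon> m + 2 * \<epsilon> l)"
      by (intro Liminf_mono always_eventually allI cauchy) (use gp_le_T[OF k] in auto)
    also have "\<dots> = 2 * \<epsilon> m + 2 * 0"
      by (intro lim_imp_Liminf tendsto_add tendsto_const ennreal_tendsto_cmult \<epsilon>) auto
    finally show ?thesis by simp
  qed
  have from_nn: "integrable L f \<and> (\<integral>x. f x \<partial>L) \<le> enn2real e"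
    if [measurable]: "f \<in> borel_measurable L" and "\<And>x. 0 \<le> f x" "(\<integral>\<^sup>+x. ennreal (f x) \<partial>L) \<le> e" "e < \<infinity>"
    for L and f :: "'z \<Rightarrow> real" and e
  proof
    show i: "integrable L f"
      using that by (intro integrableI_nonneg) (auto intro: order.strict_trans1)
    have "ennreal (\<integral>x. f x \<partial>L) \<le> e" using nn_integral_eq_integral[OF i] that by auto
    then have "enn2real (ennreal (\<integral>x. f x \<partial>L)) \<le> enn2real e"
      using that(4) by (intro enn2real_mono) auto
    then show "(\<integral>x. f x \<partial>L) \<le> enn2real e"
      using integral_nonneg_AE[of f L] that(2) by simp
  qed
  have \<epsilon>_real: "(\<lambda>m. c * enn2real (\<epsilon> m)) \<longlonglongrightarrow> 0" for c
  proof -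
    have "(\<lambda>m. enn2real (\<epsilon> m)) \<longlonglongrightarrow> enn2real 0"
      by (rule tendsto_enn2real) (use \<epsilon> in auto)
    from tendsto_mult[OF tendsto_const this, of c] show ?thesis by simp
  qed
  have L2r: "integrable M (\<lambda>w. ?D m k c w) \<and> (\<integral>w. ?D m k c w \<partial>M) \<le> enn2real (2 * \<epsilon> m)"
    if k: "k \<le> 2 ^ n" for m k c
  proof (rule from_nn[OF _ _ L2[OF k]])
    have [measurable]: "S m (gp n k) \<in> borel_measurable M" "N (gp n k) \<in> borel_measurable M"
      by (rule S_meas, simp) (rule N_meas_M[OF k])
    show "(\<lambda>w. ?D m k c w) \<in> borel_measurable M" by measurable
    show "2 * \<epsilon> m < \<infinity>" using \<epsilon>_fin[of m] by (simp add: ennreal_mult_less_top)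
  qed simp
  have p: "p \<le> 2 ^ n" using pq by simp
  let ?s = "gp n p" and ?t = "gp n q"
  let ?hh = "\<lambda>h x w. indicator {?s<..?t} x * (\<Sum>i\<in>UNIV. h x w $ a $ i * h x w $ b $ i)"
  let ?h2 = "\<lambda>h i x. (indicator {?s<..?t} (fst x) * h (fst x) (snd x) $ a $ i) * (indicator {?s<..?t} (fst x) * h (fst x) (snd x) $ b $ i)"
  have st: "0 \<le> ?s" "?s \<le> ?t" "0 \<le> ?t" using pq by auto
  have S_meas'[measurable]: "S m ?t \<in> borel_measurable M" "S m ?s \<in> borel_measurable M" for m
    by (rule S_meas, simp)+
  have N_meas'[measurable]: "N ?t \<in> borel_measurable M" "N ?s \<in> borel_measurable M"
    by (rule N_meas_M, rule pq p)+
  have \<eta>_meas[measurable]: "\<eta> \<in> borel_measurable M"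
    by (rule meas_M[OF _ \<eta>(1)]) simp
  have sq2: "(x + y)\<^sup>2 \<le> 2 * x\<^sup>2 + 2 * y\<^sup>2" for x y :: real
    using zero_le_power2[of "x - y"] by (simp add: power2_sum power2_diff)
  define X where "X m c w = (S m ?t w - S m ?s w) $ c" for m c w
  define Y where "Y c w = (N ?t w - N ?s w) $ c" for c w
  have [measurable]: "X m c \<in> borel_measurable M" "Y c \<in> borel_measurable M" for m c
    unfolding X_def[abs_def] Y_def[abs_def] by measurable
  have XY_le: "(X m c w - Y c w)\<^sup>2 \<le> 2 * ?D m q c w + 2 * ?D m p c w" for m c w
  proof -
    have "X m c w - Y c w = (S m ?t w - N ?t w) $ c + - ((S m ?s w - N ?s w) $ c)"
      by (simp add: X_def Y_def)
    then show ?thesis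
      using sq2[of "(S m ?t w - N ?t w) $ c" "- ((S m ?s w - N ?s w) $ c)"] by (simp only: power2_minus)
  qed
  have XYi: "integrable M (\<lambda>w. (X m c w - Y c w)\<^sup>2)" for m c
    by (rule Bochner_Integration.integrable_bound[of _ "\<lambda>w. 2 * ?D m q c w + 2 * ?D m p c w"])
      (use XY_le L2r[OF p] L2r[OF pq(2)] in \<open>auto intro!: AE_I2\<close>)
  have XY_lim: "(\<lambda>m. \<integral>w. (X m c w - Y c w)\<^sup>2 \<partial>M) \<longlonglongrightarrow> 0" for c
  proof (rule tendsto_sandwich[of "\<lambda>_. 0"])
    show "\<forall>\<^sub>F m in sequentially. (\<integral>w. (X m c w - Y c w)\<^sup>2 \<partial>M) \<le> 8 * enn2real (\<epsilon> m)"
    proof (intro always_eventually allI)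
      fix m
      have "(\<integral>w. (X m c w - Y c w)\<^sup>2 \<partial>M) \<le> (\<integral>w. 2 * ?D m q c w + 2 * ?D m p c w \<partial>M)"
        by (rule integral_mono[OF XYi _ XY_le]) (use L2r[OF p] L2r[OF pq(2)] in auto)
      also have "\<dots> = 2 * (\<integral>w. ?D m q c w \<partial>M) + 2 * (\<integral>w. ?D m p c w \<partial>M)"
        using L2r[OF p, of m c] L2r[OF pq(2), of m c] by simp
      also have "\<dots> \<le> 2 * enn2real (2 * \<epsilon> m) + 2 * enn2real (2 * \<epsilon> m)"
        using L2r[OF p, of m c] L2r[OF pq(2), of m c] by (intro add_mono mult_left_mono) auto
      also have "\<dots> = 8 * enn2real (\<epsilon> m)" by (simp add: enn2real_mult)
      finally show "(\<integral>w. (X m c w - Y c w)\<^sup>2 \<partial>M) \<le> 8 * enn2real (\<epsilon> m)" .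
    qed
  qed (use \<epsilon>_real in \<open>auto intro!: always_eventually integral_nonneg_AE\<close>)
  have X2: "integrable M (\<lambda>w. (X m c w)\<^sup>2)" for m c
    using simple_integral_moments(2)[OF J st(1,2), of "\<lambda>_. 1" 1 m c c]
    by (simp add: X_def S_def power2_eq_square has_bochner_integral_iff)
  have Y2: "integrable M (\<lambda>w. (Y c w)\<^sup>2)" for c
  proof (rule Bochner_Integration.integrable_bound[of _ "\<lambda>w. 2 * (X 0 c w)\<^sup>2 + 2 * (X 0 c w - Y c w)\<^sup>2"])
    show "AE w in M. norm ((Y c w)\<^sup>2) \<le> norm (2 * (X 0 c w)\<^sup>2 + 2 * (X 0 c w - Y c w)\<^sup>2)"
    proof (intro AE_I2)
      fix w
      show "norm ((Y c w)\<^sup>2) \<le> norm (2 * (X 0 c w)\<^sup>2 + 2 * (X 0 c w - Y c w)\<^sup>2)"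
        using sq2[of "X 0 c w" "Y c w - X 0 c w"] by (simp add: power2_commute)
    qed
  qed (use X2 XYi in auto)
  have \<eta>_space: "\<And>w. w \<in> space M \<Longrightarrow> \<bar>\<eta> w\<bar> \<le> C" by (rule \<eta>)
  \<comment> \<open>The first moment is the product limit with the constant 1 as second
    factor.\<close>
  have "integrable M (\<lambda>w. \<eta> w * (Y a w * 1))"
    and "(\<lambda>m. \<integral>w. \<eta> w * (X m a w * 1) \<partial>M) \<longlonglongrightarrow> (\<integral>w. \<eta> w * (Y a w * 1) \<partial>M)"
    by (rule integral_mult_tendsto_L2[of "Y a" M "\<lambda>_. 1" \<eta> "\<lambda>m. X m a" "\<lambda>_ _. 1", OF _ _ _ _ _ Y2 _ XYi _ XY_lim _ \<eta>_space]; simp)+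
  moreover have "(\<integral>w. \<eta> w * (X m a w * 1) \<partial>M) = 0" for m
    using simple_integral_moments(1)[OF J st(1,2) \<eta>, of m a] by (simp add: X_def S_def has_bochner_integral_iff)
  ultimately show "has_bochner_integral M (\<lambda>w. \<eta> w * (N (gp n q) w - N (gp n p) w) $ a) 0"
    by (simp add: has_bochner_integral_iff Y_def LIMSEQ_const_iff)
  let ?j = "\<lambda>m c i x. indicator {?s<..?t} (fst x) * simple_value (J m) (fst x) (snd x) $ c $ i"
  let ?g = "\<lambda>c i x. indicator {?s<..?t} (fst x) * Gs (fst x) (snd x) $ c $ i"
  have tT: "?t \<le> T" by (rule gp_le_T[OF pq(2)])
  have emR: "emeasure ?R ({?s<..?t} \<times> space M) < \<infinity>"
  proof -
    have "sigma_finite_measure M" by unfold_locales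
    from sigma_finite_measure.emeasure_pair_measure_Times[OF this, of "{?s<..?t}" lborel "space M"] st
    show ?thesis by (simp add: emeasure_space_1)
  qed
  have g2: "integrable ?R (\<lambda>x. (?g c i x)\<^sup>2)" for c i
  proof (rule Bochner_Integration.integrable_bound[of _ "\<lambda>x. K\<^sup>2 * indicator ({?s<..?t} \<times> space M) x"])
    show "integrable ?R (\<lambda>x. K\<^sup>2 * indicator ({?s<..?t} \<times> space M) x)"
      using emR by (intro integrable_mult_right) (auto simp: integrable_indicator_iff)
    show "AE x in ?R. norm ((?g c i x)\<^sup>2) \<le> norm (K\<^sup>2 * indicator ({?s<..?t} \<times> space M) x)"
    proof (intro AE_I2)
      fix x assume x: "x \<in> space ?R"
      have "\<bar>Gs (fst x) (snd x) $ c $ i\<bar> \<le> K"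
        using Gs_le[of "fst x" "snd x"] component_le_norm_cart[of "Gs (fst x) (snd x) $ c" i]
          Finite_Cartesian_Product.norm_nth_le[of "Gs (fst x) (snd x)" c] by linarith
      then have "(Gs (fst x) (snd x) $ c $ i)\<^sup>2 \<le> K\<^sup>2" by (simp add: abs_le_square_iff[symmetric] K)
      then show "norm ((?g c i x)\<^sup>2) \<le> norm (K\<^sup>2 * indicator ({?s<..?t} \<times> space M) x)"
        using x by (auto simp: indicator_def space_pair_measure mem_Times_iff)
    qed
  qed measurable
  have jg: "integrable ?R (\<lambda>x. (?j m c i x - ?g c i x)\<^sup>2) \<and> (\<integral>x. (?j m c i x - ?g c i x)\<^sup>2 \<partial>?R) \<le> enn2real (\<epsilon> m)" for m c i
  proof (rule from_nn[OF _ _ _ \<epsilon>_fin])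
    show "(\<integral>\<^sup>+x. ennreal ((?j m c i x - ?g c i x)\<^sup>2) \<partial>?R) \<le> \<epsilon> m"
      unfolding \<epsilon>_def
    proof (intro nn_integral_mono)
      fix x :: "real \<times> 'a"
      let ?d = "simple_value (J m) (fst x) (snd x) - Gs (fst x) (snd x)"
      have "\<bar>?d $ c $ i\<bar> \<le> \<bar>norm ?d\<bar>"
        using component_le_norm_cart[of "?d $ c" i] Finite_Cartesian_Product.norm_nth_le[of "?d" c] by linarith
      then have "(?d $ c $ i)\<^sup>2 \<le> (norm ?d)\<^sup>2" by (simp only: abs_le_square_iff)
      then show "ennreal ((?j m c i x - ?g c i x)\<^sup>2) \<le> ennreal ((norm ?d)\<^sup>2) * indicator {0..T} (fst x)"
        using st(1) tT order_trans[OF st(1) less_imp_le, of "fst x"] by (auto simp: indicator_def intro!: ennreal_leI)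
    qed
  qed simp_all
  have jg_lim: "(\<lambda>m. \<integral>x. (?j m c i x - ?g c i x)\<^sup>2 \<partial>?R) \<longlonglongrightarrow> 0" for c i
    by (rule tendsto_sandwich[of "\<lambda>_. 0" _ _ "\<lambda>m. 1 * enn2real (\<epsilon> m)"])
      (use jg \<epsilon>_real[of 1] in \<open>auto intro!: always_eventually integral_nonneg_AE\<close>)
  have \<eta>R: "\<bar>\<eta> (snd x)\<bar> \<le> C" if "x \<in> space ?R" for x
    using that \<eta> by (auto simp: space_pair_measure)
  have prod: "integrable ?R (\<lambda>x. \<eta> (snd x) * (?g a i x * ?g b i x))"
    "(\<lambda>m. \<integral>x. \<eta> (snd x) * (?j m a i x * ?j m b i x) \<partial>?R) \<longlonglongrightarrow> (\<integral>x. \<eta> (snd x) * (?g a i x * ?g b i x) \<partial>?R)" for i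
    by (rule integral_mult_tendsto_L2[of "?g a i" ?R "?g b i" "\<lambda>x. \<eta> (snd x)" "\<lambda>m. ?j m a i" "\<lambda>m. ?j m b i",
          OF _ _ _ _ _ g2 g2 jg[THEN conjunct1] jg[THEN conjunct1] jg_lim jg_lim \<eta>R]; simp)+
  have prodj: "integrable ?R (\<lambda>x. \<eta> (snd x) * (?j m a i x * ?j m b i x))" for m i
  proof -
    have j2: "integrable ?R (\<lambda>x. (?j m c i x)\<^sup>2)" for c
    proof (rule Bochner_Integration.integrable_bound[of _ "\<lambda>x. 2 * (?g c i x)\<^sup>2 + 2 * (?j m c i x - ?g c i x)\<^sup>2"])
      show "AE x in ?R. norm ((?j m c i x)\<^sup>2) \<le> norm (2 * (?g c i x)\<^sup>2 + 2 * (?j m c i x - ?g c i x)\<^sup>2)"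
      proof (intro AE_I2)
        fix x
        show "norm ((?j m c i x)\<^sup>2) \<le> norm (2 * (?g c i x)\<^sup>2 + 2 * (?j m c i x - ?g c i x)\<^sup>2)"
          using sq2[of "?g c i x" "?j m c i x - ?g c i x"] by simp
      qed
    qed (use g2[of c i] jg[of m c i] in auto)
    show ?thesis
      by (rule integral_mult_tendsto_L2(1)[of "?j m a i" ?R "?j m b i" "\<lambda>x. \<eta> (snd x)" "\<lambda>_. ?j m a i" "\<lambda>_. ?j m b i",
          OF _ _ _ _ _ j2 j2 _ _ _ _ \<eta>R]) auto
  qed
  \<comment> \<open>The time window is put into both factors, as the square of its indicator, so
    that each factor is square integrable on the product space.\<close>
  have fub: "(\<integral>w. \<eta> w * (\<integral>x. indicator {?s<..?t} x * (\<Sum>i\<in>UNIV. h x w $ a $ i * h x w $ b $ i) \<partial>lborel) \<partial>M)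
     = (\<Sum>i\<in>UNIV. \<integral>x. \<eta> (snd x) * (?h2 h i x) \<partial>?R)"
    if "\<And>i. integrable ?R (\<lambda>x. \<eta> (snd x) * (?h2 h i x))"
    for h :: "real \<Rightarrow> 'a \<Rightarrow> real^'m^'d"
  proof -
    have eq: "(\<Sum>i\<in>UNIV. \<eta> w * ((indicator {?s<..?t} x * h x w $ a $ i) * (indicator {?s<..?t} x * h x w $ b $ i)))
       = \<eta> w * ?hh h x w" for x w
      by (simp add: sum_distrib_left indicator_def)
    have "(\<Sum>i\<in>UNIV. \<integral>x. \<eta> (snd x) * (?h2 h i x) \<partial>?R)
      = (\<integral>x. (\<Sum>i\<in>UNIV. \<eta> (snd x) * (?h2 h i x)) \<partial>?R)"
      by (rule Bochner_Integration.integral_sum[symmetric]) (rule that)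
    also have "\<dots> = (\<integral>(x,w). \<eta> w * ?hh h x w \<partial>?R)"
      unfolding eq by (simp add: split_beta')
    also have "\<dots> = (\<integral>w. (\<integral>x. \<eta> w * ?hh h x w \<partial>lborel) \<partial>M)"
    proof (rule integral_snd[symmetric])
      have "integrable ?R (\<lambda>x. \<Sum>i\<in>UNIV. \<eta> (snd x) * (?h2 h i x))"
        by (rule Bochner_Integration.integrable_sum) (rule that)
      then show "integrable ?R (\<lambda>(x,w). \<eta> w * ?hh h x w)"
        unfolding eq by (simp add: split_beta')
    qed
    finally show ?thesis by simp
  qed
  have "integrable M (\<lambda>w. \<eta> w * (Y a w * Y b w))"
    and "(\<lambda>m. \<integral>w. \<eta> w * (X m a w * X m b w) \<partial>M) \<longlonglongrightarrow> (\<integral>w. \<eta> w * (Y a w * Y b w) \<partial>M)"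
    by (rule integral_mult_tendsto_L2[of "Y a" M "Y b" \<eta> "\<lambda>m. X m a" "\<lambda>m. X m b", OF _ _ _ _ _ Y2 Y2 XYi XYi XY_lim XY_lim \<eta>_space]; simp)+
  moreover have "(\<integral>w. \<eta> w * (X m a w * X m b w) \<partial>M) = (\<Sum>i\<in>UNIV. \<integral>x. \<eta> (snd x) * (?j m a i x * ?j m b i x) \<partial>?R)" for m
    using simple_integral_moments(2)[OF J st(1,2) \<eta>, of m a b] fub[of "simple_value (J m)", OF prodj]
    by (simp add: X_def S_def has_bochner_integral_iff)
  moreover have "(\<lambda>m. \<Sum>i\<in>UNIV. \<integral>x. \<eta> (snd x) * (?j m a i x * ?j m b i x) \<partial>?R) \<longlonglongrightarrow> (\<Sum>i\<in>UNIV. \<integral>x. \<eta> (snd x) * (?g a i x * ?g b i x) \<partial>?R)"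
    by (intro tendsto_sum prod)
  ultimately have "integrable M (\<lambda>w. \<eta> w * (Y a w * Y b w))"
    "(\<integral>w. \<eta> w * (Y a w * Y b w) \<partial>M) = (\<Sum>i\<in>UNIV. \<integral>x. \<eta> (snd x) * (?g a i x * ?g b i x) \<partial>?R)"
    using LIMSEQ_unique by (simp, simp, blast)
  with fub[of Gs, OF prod(1)]
  show "has_bochner_integral M (\<lambda>w. \<eta> w * ((N (gp n q) w - N (gp n p) w) $ a * (N (gp n q) w - N (gp n p) w) $ b))
      (\<integral>w. \<eta> w * (\<integral>x. indicator {gp n p<..gp n q} x * (\<Sum>i\<in>UNIV. Gs x w $ a $ i * Gs x w $ b $ i) \<partial>lborel) \<partial>M)"
    by (simp add: has_bochner_integral_iff Y_def)
qed

end

section \<open>Taylor expansion from continuous partial derivatives\<close>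

lemma partial_DERIV:
  assumes "partial_differentiable j h (y + s *\<^sub>R axis j 1)"
  shows "((\<lambda>s. h (y + s *\<^sub>R axis j 1)) has_real_derivative partial_deriv j h (y + s *\<^sub>R axis j 1)) (at s)"
proof -
  have "((\<lambda>u. h (y + s *\<^sub>R axis j 1 + u *\<^sub>R axis j 1)) has_real_derivative partial_deriv j h (y + s *\<^sub>R axis j 1)) (at 0)"
    using assms unfolding partial_differentiable_def partial_deriv_def
    by (simp add: DERIV_deriv_iff_real_differentiable)
  then have "((\<lambda>u. h (y + (s + u) *\<^sub>R axis j 1)) has_real_derivative partial_deriv j h (y + s *\<^sub>R axis j 1)) (at 0)"
    by (simp add: algebra_simps)
  then show ?thesis
    using DERIV_shift[of "\<lambda>s. h (y + s *\<^sub>R axis j 1)" _ 0 s] by (simp add: add.commute)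
qed

text \<open>Continuous partial derivatives give a total derivative: the displacement is carried out
  one coordinate at a time, with the mean value theorem on each leg.\<close>

lemma partials_has_derivative:
  fixes h :: "real^'d::finite \<Rightarrow> real"
  assumes pd: "\<And>x j. partial_differentiable j h x" and cont: "\<And>j. continuous_on UNIV (partial_deriv j h)"
  shows "(h has_derivative (\<lambda>v. \<Sum>j\<in>UNIV. v $ j * partial_deriv j h x)) (at x)"
proof -
  define P where "P S v = (\<Sum>j\<in>S. (v $ j) *\<^sub>R axis j (1::real))" for S and v :: "real^'d"
  have P_UNIV: "P UNIV v = v" for v :: "real^'d"
    unfolding P_def using basis_expansion[of v] by (simp add: scalar_mult_eq_scaleR)
  have P_le: "norm (P S v) \<le> CARD('d) * norm v" for S and v :: "real^'d"
  proof -
    have "norm (P S v) \<le> (\<Sum>j\<in>S. norm ((v $ j) *\<^sub>R axis j (1::real)))"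
      unfolding P_def by (rule norm_sum)
    also have "\<dots> \<le> (\<Sum>j\<in>S. norm v)"
      by (intro sum_mono) (auto simp: component_le_norm_cart)
    also have "\<dots> \<le> CARD('d) * norm v"
      using card_mono[of UNIV S] by (simp add: mult_right_mono)
    finally show ?thesis .
  qed
  show ?thesis
  proof (rule has_derivativeI)
    show "bounded_linear (\<lambda>v. \<Sum>j\<in>UNIV. v $ j * partial_deriv j h x)"
      by (intro bounded_linear_sum bounded_linear_mult_const bounded_linear_vec_nth)
    show "((\<lambda>y. (h y - h x - (\<Sum>j\<in>UNIV. (y - x) $ j * partial_deriv j h x)) /\<^sub>R norm (y - x)) \<longlongrightarrow> 0) (at x)"
    proof (rule tendstoI)
      fix e :: real assume e: "0 < e"
      define e' where "e' = e / (2 * CARD('d))"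
      have e': "0 < e'" using e by (simp add: e'_def)
      have "\<exists>r>0. \<forall>y. dist y x < r \<longrightarrow> dist (partial_deriv j h y) (partial_deriv j h x) < e'" for j
        using cont[of j] e' by (auto simp: continuous_on_iff)
      then obtain r where r: "\<And>j. r j > 0" "\<And>j y. dist y x < r j \<Longrightarrow> dist (partial_deriv j h y) (partial_deriv j h x) < e'"
        by metis
      \<comment> \<open>Every intermediate point lies within \<open>CARD('d) + 1\<close> times the
        length of the displacement from \<open>x\<close>; the extra unit pays for the leg in
        progress.\<close>
      define d where "d = Min (range r) / (CARD('d) + 1)"
      have rpos: "0 < Min (range r)" using r by simp
      have d: "0 < d" using rpos by (simp add: d_def)
      have dr: "(CARD('d) + 1) * d \<le> r j" for j
        by (simp add: d_def)
      have main: "\<bar>h (x + P S v) - h x - (\<Sum>j\<in>S. v $ j * partial_deriv j h x)\<bar> \<le> card S * (e' * norm v)"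
        if v: "norm v < d" and "finite S" for S v
        using \<open>finite S\<close>
      proof (induction S)
        case empty
        then show ?case by (simp add: P_def)
      next
        case (insert j S)
        let ?y = "x + P S v"
        define D where "D m s = (if m = 0 then h (?y + s *\<^sub>R axis j 1) else partial_deriv j h (?y + s *\<^sub>R axis j 1))"
          for m :: nat and s
        \<comment> \<open>With a single term the Maclaurin formula is the mean value theorem, here
          in the version that allows a negative coordinate \<open>v $ j\<close>.\<close>
        have "\<exists>t. \<bar>t\<bar> \<le> \<bar>v $ j\<bar> \<and> D 0 (v $ j) = (\<Sum>m<1. D m 0 / fact m * (v $ j) ^ m) + D 1 t / fact 1 * (v $ j) ^ 1"
          by (rule Maclaurin_bi_le) (auto simp: D_def[abs_def] intro: partial_DERIV pd)
        then obtain t where t: "\<bar>t\<bar> \<le> \<bar>v $ j\<bar>"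
          and eq: "h (?y + (v $ j) *\<^sub>R axis j 1) = h ?y + partial_deriv j h (?y + t *\<^sub>R axis j 1) * v $ j"
          by (auto simp: D_def)
        have "norm (P S v + t *\<^sub>R axis j 1) \<le> norm (P S v) + norm (t *\<^sub>R (axis j 1 :: real^'d))" by (rule norm_triangle_ineq)
        also have "\<dots> \<le> CARD('d) * norm v + norm v"
          using P_le[of S v] t component_le_norm_cart[of v j] by simp
        also have "\<dots> = (CARD('d) + 1) * norm v" by (simp add: algebra_simps)
        also have "\<dots> < (CARD('d) + 1) * d" using v by (intro mult_strict_left_mono) auto
        finally have "dist (?y + t *\<^sub>R axis j 1) x < r j" using dr[of j] by (simp add: dist_norm add.assoc)
        from r(2)[OF this] have b: "\<bar>partial_deriv j h (?y + t *\<^sub>R axis j 1) - partial_deriv j h x\<bar> \<le> e'" by (simp add: dist_real_def)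
        have PS: "x + P (insert j S) v = ?y + (v $ j) *\<^sub>R axis j 1"
          using insert by (simp add: P_def algebra_simps)
        have "h (x + P (insert j S) v) - h x - (\<Sum>j\<in>insert j S. v $ j * partial_deriv j h x)
          = (h ?y - h x - (\<Sum>j\<in>S. v $ j * partial_deriv j h x)) + (partial_deriv j h (?y + t *\<^sub>R axis j 1) - partial_deriv j h x) * v $ j"
          unfolding PS eq using insert by (simp add: algebra_simps)
        also have "\<bar>\<dots>\<bar> \<le> card S * (e' * norm v) + e' * norm v"
          using insert.IH b component_le_norm_cart[of v j] e'
          by (intro order_trans[OF abs_triangle_ineq] add_mono) (auto simp: abs_mult intro!: mult_mono)
        also have "\<dots> = card (insert j S) * (e' * norm v)"
          using insert by (simp add: algebra_simps)
        finally show ?case .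
      qed
      show "\<forall>\<^sub>F y in at x. dist ((h y - h x - (\<Sum>j\<in>UNIV. (y - x) $ j * partial_deriv j h x)) /\<^sub>R norm (y - x)) 0 < e"
        unfolding eventually_at
      proof (intro exI[of _ d] conjI ballI impI d)
        fix y assume y: "y \<noteq> x \<and> dist y x < d"
        then have n: "0 < norm (y - x)" "norm (y - x) < d" by (auto simp: dist_norm)
        from main[OF n(2), of UNIV] have "\<bar>h y - h x - (\<Sum>j\<in>UNIV. (y - x) $ j * partial_deriv j h x)\<bar> \<le> CARD('d) * (e' * norm (y - x))"
          unfolding P_UNIV by simp
        also have "\<dots> = (e / 2) * norm (y - x)" by (simp add: e'_def)
        also have "\<dots> < e * norm (y - x)" using e n by simp
        finally show "dist ((h y - h x - (\<Sum>j\<in>UNIV. (y - x) $ j * partial_deriv j h x)) /\<^sub>R norm (y - x)) 0 < e"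
          using n by (simp add: dist_norm pos_divide_less_eq divide_inverse[symmetric] mult.commute[of "inverse _"])
      qed
    qed
  qed
qed

lemma partials_DERIV_line:
  fixes h :: "real^'d::finite \<Rightarrow> real"
  assumes pd: "\<And>x j. partial_differentiable j h x" and cont: "\<And>j. continuous_on UNIV (partial_deriv j h)"
  shows "((\<lambda>s. h (z + s *\<^sub>R v)) has_real_derivative (\<Sum>j\<in>UNIV. v $ j * partial_deriv j h (z + s *\<^sub>R v))) (at s)"
proof -
  have "((\<lambda>s. z + s *\<^sub>R v) has_derivative (\<lambda>s. s *\<^sub>R v)) (at s)"
    by (auto intro!: derivative_eq_intros)
  note d = has_derivative_compose[OF this partials_has_derivative[OF pd cont, of "z + s *\<^sub>R v"]]
  show ?thesis
  proof -
    have "(\<lambda>x. \<Sum>j\<in>UNIV. (x *\<^sub>R v) $ j * partial_deriv j h (z + s *\<^sub>R v)) = (*) (\<Sum>j\<in>UNIV. v $ j * partial_deriv j h (z + s *\<^sub>R v))"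
      by (rule ext) (simp add: sum_distrib_left sum_distrib_right mult_ac)
    with d show ?thesis by (simp add: has_field_derivative_def)
  qed
qed

lemma C21_slice:
  assumes "C21 V" "0 \<le> t"
  shows "partial_differentiable j (\<lambda>z. V z t i) x"
    and "partial_differentiable l (partial_deriv j (\<lambda>z. V z t i)) x"
    and "continuous_on UNIV (partial_deriv j (\<lambda>z. V z t i))"
    and "continuous_on UNIV (partial_deriv l (partial_deriv j (\<lambda>z. V z t i)))"
proof -
  show "partial_differentiable j (\<lambda>z. V z t i) x"
    and "partial_differentiable l (partial_deriv j (\<lambda>z. V z t i)) x"
    using assms unfolding C21_def by blast+
  have c: "continuous_on UNIV (\<lambda>x. (x, t))" by (intro continuous_intros)
  have "continuous_on (UNIV \<times> {0..}) (\<lambda>(x, t). deriv_x V x t i)" "continuous_on (UNIV \<times> {0..}) (\<lambda>(x, t). deriv_xx V x t i)"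
    using assms unfolding C21_def by blast+
  then have 1: "continuous_on UNIV (\<lambda>x. deriv_x V x t i)" "continuous_on UNIV (\<lambda>x. deriv_xx V x t i)"
    using assms(2) by (auto intro: continuous_on_compose2[OF _ c, of _ "\<lambda>(x, t). deriv_x V x t i", simplified]
        continuous_on_compose2[OF _ c, of _ "\<lambda>(x, t). deriv_xx V x t i", simplified])
  have "continuous_on UNIV (\<lambda>x. deriv_x V x t i $ j)" "continuous_on UNIV (\<lambda>x. deriv_xx V x t i $ l $ j)"
    by (intro continuous_intros 1)+
  then show "continuous_on UNIV (partial_deriv j (\<lambda>z. V z t i))"
    and "continuous_on UNIV (partial_deriv l (partial_deriv j (\<lambda>z. V z t i)))"
    by (auto simp: deriv_x_def deriv_xx_def)
qed

text \<open>Lagrange's remainder for the restriction of \<open>V\<close> to the segment from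
  \<open>z\<close> to \<open>z + v\<close>. It is the Hessian at one point of the segment, to which
  a modulus of continuity can be applied.\<close>

lemma C21_taylor:
  fixes V :: "real^'d::finite \<Rightarrow> real \<Rightarrow> 's \<Rightarrow> real"
  assumes V: "C21 V" "0 \<le> t"
  obtains \<theta> where "0 \<le> \<theta>" "\<theta> \<le> 1"
    "V (z + v) t i = V z t i + deriv_x V z t i \<bullet> v + (v \<bullet> (deriv_xx V (z + \<theta> *\<^sub>R v) t i *v v)) / 2"
proof -
  let ?h = "\<lambda>z. V z t i"
  note s = C21_slice[OF V]
  define D where "D m s = (if m = 0 then ?h (z + s *\<^sub>R v)
    else if m = 1 then (\<Sum>j\<in>UNIV. v $ j * partial_deriv j ?h (z + s *\<^sub>R v))
    else (\<Sum>j\<in>UNIV. v $ j * (\<Sum>l\<in>UNIV. v $ l * partial_deriv l (partial_deriv j ?h) (z + s *\<^sub>R v))))" for m :: nat and s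
  have D0: "DERIV (D 0) s :> D 1 s" for s
    unfolding D_def[abs_def] using partials_DERIV_line[of ?h, OF s(1) s(3)] by simp
  have D1: "DERIV (D 1) s :> D 2 s" for s
    unfolding D_def[abs_def]
    by (auto intro!: DERIV_sum DERIV_cmult partials_DERIV_line s)
  have "\<exists>t. 0 < t \<and> t \<le> 1 \<and> D 0 1 = (\<Sum>m<2. D m 0 / fact m * 1 ^ m) + D 2 t / fact 2 * 1 ^ 2"
  proof (rule Maclaurin2)
    show "\<forall>m t. m < 2 \<and> 0 \<le> t \<and> t \<le> 1 \<longrightarrow> DERIV (D m) t :> D (Suc m) t"
    proof safe
      fix m :: nat and t :: real assume "m < 2"
      then consider "m = 0" | "m = 1" by linarith
      then show "DERIV (D m) t :> D (Suc m) t" using D0 D1 by cases (auto simp: numeral_2_eq_2)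
    qed
  qed auto
  then obtain \<theta> where \<theta>: "0 < \<theta>" "\<theta> \<le> 1" and eq: "D 0 1 = D 0 0 + D 1 0 + D 2 \<theta> / 2"
    by (auto simp: numeral_2_eq_2)
  have 1: "D 1 0 = deriv_x V z t i \<bullet> v"
    by (simp add: D_def deriv_x_def inner_vec_def mult.commute)
  have "D 2 \<theta> = v \<bullet> (deriv_xx V (z + \<theta> *\<^sub>R v) t i *v v)"
  proof -
    have "v \<bullet> (deriv_xx V (z + \<theta> *\<^sub>R v) t i *v v) = (\<Sum>l\<in>UNIV. \<Sum>j\<in>UNIV. v $ l * (partial_deriv l (partial_deriv j ?h) (z + \<theta> *\<^sub>R v) * v $ j))"
      by (simp add: deriv_xx_def inner_vec_def matrix_vector_mult_def sum_distrib_left)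
    also have "\<dots> = (\<Sum>j\<in>UNIV. \<Sum>l\<in>UNIV. v $ l * (partial_deriv l (partial_deriv j ?h) (z + \<theta> *\<^sub>R v) * v $ j))"
      by (rule sum.swap)
    also have "\<dots> = D 2 \<theta>"
      by (simp add: D_def sum_distrib_left mult_ac)
    finally show ?thesis by simp
  qed
  with eq 1 \<theta> show ?thesis
    by (intro that[of \<theta>]) (auto simp: D_def)
qed

text \<open>The derivative within \<open>{0..}\<close> restricts to one within
  \<open>{a..b}\<close>, which covers the one-sided case \<open>a = 0\<close>. The exponential
  factor is included because \<open>exp (c * t) * V\<close> is the function that is followed in
  time.\<close>

lemma C21_FTC:
  assumes V: "C21 V" and ab: "0 \<le> a" "a \<le> b"
  shows "has_bochner_integral lborel (\<lambda>s. indicator {a..b} s *\<^sub>R (exp (c * s) * (deriv_t V x s i + c * V x s i)))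
     (exp (c * b) * V x b i - exp (c * a) * V x a i)"
proof (rule has_bochner_integral_FTC_Icc[OF ab(2)])
  fix s assume s: "a \<le> s" "s \<le> b"
  have "(\<lambda>s. V x s i) differentiable (at s within {0..})"
    using V s ab unfolding C21_def by auto
  then have "((\<lambda>s. V x s i) has_vector_derivative deriv_t V x s i) (at s within {0..})"
    unfolding deriv_t_def by (simp add: vector_derivative_works)
  then have d: "((\<lambda>s. V x s i) has_real_derivative deriv_t V x s i) (at s within {a..b})"
    using ab by (auto simp: has_real_derivative_iff_has_vector_derivative intro: has_vector_derivative_within_subset)
  have "((\<lambda>s. exp (c * s) * V x s i) has_real_derivative (exp (c * s) * (deriv_t V x s i + c * V x s i))) (at s within {a..b})"
    by (auto intro!: derivative_eq_intros d simp: algebra_simps)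
  then show "((\<lambda>s. exp (c * s) * V x s i) has_vector_derivative (exp (c * s) * (deriv_t V x s i + c * V x s i))) (at s within {a..b})"
    by (simp add: has_real_derivative_iff_has_vector_derivative)
next
  have c: "continuous_on {a..b} (\<lambda>s. (x, s))" by (intro continuous_intros)
  have sub: "(\<lambda>s. (x, s)) ` {a..b} \<subseteq> UNIV \<times> {0..}" using ab by auto
  have "continuous_on (UNIV \<times> {0..}) (\<lambda>(x, t). V x t i)" "continuous_on (UNIV \<times> {0..}) (\<lambda>(x, t). deriv_t V x t i)"
    using V unfolding C21_def by blast+
  then have "continuous_on {a..b} (\<lambda>s. V x s i)" "continuous_on {a..b} (\<lambda>s. deriv_t V x s i)"
    using continuous_on_compose2[OF _ c sub, of "\<lambda>(x, t). V x t i"]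
      continuous_on_compose2[OF _ c sub, of "\<lambda>(x, t). deriv_t V x t i"] by auto
  then show "continuous_on {a..b} (\<lambda>s. exp (c * s) * (deriv_t V x s i + c * V x s i))"
    by (intro continuous_intros)
qed

section \<open>The Markov chain\<close>

text \<open>At level \<open>n\<close> the time is replaced by the next multiple of
  \<open>1 / Suc n\<close> strictly to its right: only countably many values occur, and they
  approach the time from the right.\<close>

lemma right_continuous_joint_measurable:
  fixes Z :: "real \<Rightarrow> 'a \<Rightarrow> 'b::metric_space"
  assumes Z: "\<And>t. 0 \<le> t \<Longrightarrow> Z t \<in> borel_measurable M"
    and rc: "\<And>w t. w \<in> space M \<Longrightarrow> 0 \<le> t \<Longrightarrow> ((\<lambda>u. Z u w) \<longlongrightarrow> Z t w) (at_right t)"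
  shows "(\<lambda>(s, w). Z (max 0 s) w) \<in> borel_measurable (lborel \<Otimes>\<^sub>M M)"
proof (rule borel_measurable_LIMSEQ_metric)
  let ?t = "\<lambda>n s. (real_of_int \<lfloor>max 0 s * real (Suc n)\<rfloor> + 1) / real (Suc n)"
  show "(\<lambda>(s, w). Z (?t n s) w) \<in> borel_measurable (lborel \<Otimes>\<^sub>M M)" for n
  proof -
    have "(\<lambda>x. (\<lambda>k x. Z (max 0 ((real_of_int k + 1) / real (Suc n))) (snd x)) \<lfloor>max 0 (fst x) * real (Suc n)\<rfloor> x) \<in> borel_measurable (lborel \<Otimes>\<^sub>M M)"
      by (rule measurable_compose_countable) (auto intro!: measurable_compose[OF measurable_snd Z])
    moreover have "max 0 (?t n s) = ?t n s" for s
    proof -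
      have "0 \<le> \<lfloor>max 0 s * real (Suc n)\<rfloor>" by simp
      then have "0 \<le> ?t n s" by (intro divide_nonneg_nonneg) linarith+
      then show ?thesis by (rule max_absorb2)
    qed
    ultimately show ?thesis by (simp add: split_beta' del: max.cobounded1 max_absorb2 of_nat_Suc)
  qed
  fix x :: "real \<times> 'a" assume x: "x \<in> space (lborel \<Otimes>\<^sub>M M)"
  obtain s :: real and w where s: "x = (s, w)" by (cases x)
  with x have w: "w \<in> space M" by (simp add: space_pair_measure)
  have t1: "max 0 s < ?t n s" for n
  proof -
    have "max 0 s * real (Suc n) < real_of_int \<lfloor>max 0 s * real (Suc n)\<rfloor> + 1" by linarith
    then show ?thesis by (simp only: pos_less_divide_eq of_nat_0_less_iff zero_less_Suc)
  qed
  have t2: "?t n s \<le> max 0 s + inverse (real (Suc n))" for n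
  proof -
    have "real_of_int \<lfloor>max 0 s * real (Suc n)\<rfloor> + 1 \<le> max 0 s * real (Suc n) + 1" by linarith
    then have "?t n s \<le> (max 0 s * real (Suc n) + 1) / real (Suc n)" by (intro divide_right_mono) auto
    also have "\<dots> = max 0 s + inverse (real (Suc n))" by (simp only: add_divide_distrib inverse_eq_divide) simp
    finally show ?thesis .
  qed
  have "(\<lambda>n. ?t n s) \<longlonglongrightarrow> max 0 s"
  proof (rule tendsto_sandwich[of "\<lambda>_. max 0 s" _ _ "\<lambda>n. max 0 s + inverse (real (Suc n))"])
    show "(\<lambda>n. max 0 s + inverse (real (Suc n))) \<longlonglongrightarrow> max 0 s"
      using tendsto_add[OF tendsto_const LIMSEQ_inverse_real_of_nat, of "max 0 s"] by simp
  qed (use t1 t2 in \<open>auto intro!: always_eventually less_imp_le\<close>)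
  then have "filterlim (\<lambda>n. ?t n s) (at_right (max 0 s)) sequentially"
    by (rule tendsto_imp_filterlim_at_right) (use t1 in \<open>auto intro: always_eventually\<close>)
  from filterlim_compose[OF rc[OF w, of "max 0 s"] this]
  show "(\<lambda>n. case x of (s, w) \<Rightarrow> Z (?t n s) w) \<longlonglongrightarrow> (case x of (s, w) \<Rightarrow> Z (max 0 s) w)"
    by (simp add: s)
qed

text \<open>Applied with \<open>a\<close> and \<open>b\<close> of order \<open>1 / m\<close>, so
  that the bound does not depend on the grid. The hypothesis on pairs comes from conditioning the
  later term on the earlier one.\<close>

lemma (in prob_space) sum_square_bound:
  fixes x :: "nat \<Rightarrow> 'a \<Rightarrow> real"
  assumes i: "\<And>k l. k < m \<Longrightarrow> l < m \<Longrightarrow> integrable M (\<lambda>w. x k w * x l w)"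
    and a: "\<And>k l. k < l \<Longrightarrow> l < m \<Longrightarrow> (\<integral>w. x k w * x l w \<partial>M) \<le> a\<^sup>2"
    and b: "\<And>k. k < m \<Longrightarrow> (\<integral>w. (x k w)\<^sup>2 \<partial>M) \<le> b"
  shows "integrable M (\<lambda>w. (\<Sum>k<m. x k w)\<^sup>2)"
    and "(\<integral>w. (\<Sum>k<m. x k w)\<^sup>2 \<partial>M) \<le> (real m * a)\<^sup>2 + real m * b"
proof -
  have eq: "(\<Sum>k<m. x k w)\<^sup>2 = (\<Sum>k<m. \<Sum>l<m. x k w * x l w)" for w
    by (simp add: power2_eq_square sum_product)
  show "integrable M (\<lambda>w. (\<Sum>k<m. x k w)\<^sup>2)"
    unfolding eq using i by (intro Bochner_Integration.integrable_sum) auto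
  have "(\<integral>w. (\<Sum>k<m. x k w)\<^sup>2 \<partial>M) = (\<Sum>k<m. \<Sum>l<m. (\<integral>w. x k w * x l w \<partial>M))"
  proof -
    have "(\<integral>w. (\<Sum>k<m. x k w)\<^sup>2 \<partial>M) = (\<Sum>k<m. (\<integral>w. (\<Sum>l<m. x k w * x l w) \<partial>M))"
      unfolding eq using i by (intro Bochner_Integration.integral_sum Bochner_Integration.integrable_sum) auto
    also have "\<dots> = (\<Sum>k<m. \<Sum>l<m. (\<integral>w. x k w * x l w \<partial>M))"
      using i by (intro sum.cong refl Bochner_Integration.integral_sum) auto
    finally show ?thesis .
  qed
  also have "\<dots> \<le> (\<Sum>k<m. \<Sum>l<m. a\<^sup>2 + (if k = l then b else 0))"
  proof (intro sum_mono)
    fix k l assume "k \<in> {..<m}" "l \<in> {..<m}"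
    then have kl: "k < m" "l < m" by auto
    consider "k < l" | "l < k" | "k = l" by linarith
    then show "(\<integral>w. x k w * x l w \<partial>M) \<le> a\<^sup>2 + (if k = l then b else 0)"
    proof cases
      case 1 then show ?thesis using a[of k l] kl by simp
    next
      case 2 then show ?thesis using a[of l k] kl by (simp add: mult.commute)
    next
      case 3 then show ?thesis using b[of k] kl by (simp add: power2_eq_square add_increasing)
    qed
  qed
  also have "\<dots> = (real m * a)\<^sup>2 + real m * b"
    by (simp add: sum.distrib power_mult_distrib power2_eq_square[of "real m"] algebra_simps)
  finally show "(\<integral>w. (\<Sum>k<m. x k w)\<^sup>2 \<partial>M) \<le> (real m * a)\<^sup>2 + real m * b" .
qed

context filtered_brownian
begin

text \<open>The state type carries no metric, so right continuity is applied to the real-valued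
  indicator process of each state.\<close>

lemma chain_joint:
  assumes mc: "markov_chain M F \<Gamma> r"
  shows "(\<lambda>x. r (max 0 (fst x)) (snd x)) \<in> measurable LM (count_space (UNIV :: 's::finite set))"
proof -
  have rc: "((\<lambda>u. of_bool (r u w = i) :: real) \<longlongrightarrow> of_bool (r t w = i)) (at_right t)" if "w \<in> space M" "0 \<le> t" for w t i
  proof (rule tendsto_eventually)
    have "\<forall>\<^sub>F u in at_right t. r u w = r t w"
      using mc that by (simp add: markov_chain_def)
    then show "\<forall>\<^sub>F u in at_right t. (of_bool (r u w = i) :: real) = of_bool (r t w = i)"
      by eventually_elim simp
  qed
  have m: "(\<lambda>w. of_bool (r t w = i) :: real) \<in> borel_measurable M" if "0 \<le> t" for t i
  proof -
    have "r t \<in> measurable M (count_space UNIV)"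
      using mc that meas_M by (auto simp: markov_chain_def adapted_process_def)
    then show ?thesis by measurable
  qed
  have *: "(\<lambda>(s, w). of_bool (r (max 0 s) w = i) :: real) \<in> borel_measurable LM" for i
    by (rule right_continuous_joint_measurable[of "\<lambda>t w. of_bool (r t w = i)", OF m rc])
  have "{x \<in> space LM. r (max 0 (fst x)) (snd x) = i} \<in> sets LM" for i
  proof -
    have "{x \<in> space LM. r (max 0 (fst x)) (snd x) = i}
      = (\<lambda>(s, w). of_bool (r (max 0 s) w = i) :: real) -` {1} \<inter> space LM" by (auto split: if_splits)
    then show ?thesis using measurable_sets[OF *[of i], of "{1}"] by simp
  qed
  then have "(\<lambda>x. r (max 0 (fst x)) (snd x)) -` {i} \<inter> space LM \<in> sets LM" for i
    by (simp add: vimage_def Int_def conj_commute)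
  then show ?thesis by (auto simp: measurable_count_space_eq2)
qed

text \<open>The Markov property in tested form, with an expansion of the transition probabilities
  that is uniform over all pairs of states. Off the diagonal it is the definition of the generator;
  on the diagonal it follows from the row sums of \<open>P\<close> and of
  \<open>\<Gamma>\<close>.\<close>

lemma chain_transition:
  fixes r :: "real \<Rightarrow> 'a \<Rightarrow> 's::finite"
  assumes mc: "markov_chain M F \<Gamma> r"
  obtains P :: "real \<Rightarrow> 's \<Rightarrow> 's \<Rightarrow> real" where
    "\<And>\<delta> i j. 0 \<le> \<delta> \<Longrightarrow> 0 \<le> P \<delta> i j"
    "\<And>s \<delta> \<eta> j C. 0 \<le> s \<Longrightarrow> 0 \<le> \<delta> \<Longrightarrow> \<eta> \<in> borel_measurable (F s) \<Longrightarrow> (\<And>w. w \<in> space M \<Longrightarrow> \<bar>\<eta> w\<bar> \<le> C) \<Longrightarrow>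
       (\<integral>w. \<eta> w * indicator {j} (r (s + \<delta>) w) \<partial>M) = (\<integral>w. \<eta> w * P \<delta> (r s w) j \<partial>M)"
    "\<And>\<epsilon>. 0 < \<epsilon> \<Longrightarrow> \<exists>\<delta>\<^sub>0>0. \<forall>\<delta>. 0 < \<delta> \<and> \<delta> < \<delta>\<^sub>0 \<longrightarrow>
       (\<forall>i j. \<bar>P \<delta> i j - (if i = j then 1 else 0) - \<Gamma> $ i $ j * \<delta>\<bar> \<le> \<epsilon> * \<delta>)"
proof -
  from mc obtain P :: "real \<Rightarrow> 's \<Rightarrow> 's \<Rightarrow> real"
    where PA: "\<forall>\<delta>\<ge>0. \<forall>i. (\<forall>j. P \<delta> i j \<ge> 0) \<and> (\<Sum>j\<in>UNIV. P \<delta> i j) = 1"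
    and PB: "\<forall>s\<ge>0. \<forall>\<delta>\<ge>0. \<forall>j. AE w in M.
           real_cond_exp M (F s) (\<lambda>w'. indicator {j} (r (s + \<delta>) w')) w = P \<delta> (r s w) j"
    and PC: "\<forall>i j. i \<noteq> j \<longrightarrow> (\<lambda>\<delta>. P \<delta> i j - \<Gamma> $ i $ j * \<delta>) \<in> o[at_right 0](\<lambda>\<delta>. \<delta>)"
    unfolding markov_chain_def by (elim conjE exE)
  have P: "\<And>\<delta> i j. 0 \<le> \<delta> \<Longrightarrow> 0 \<le> P \<delta> i j" "\<And>\<delta> i. 0 \<le> \<delta> \<Longrightarrow> (\<Sum>j\<in>UNIV. P \<delta> i j) = 1"
    using PA by auto
  have ce: "\<And>s \<delta> j. 0 \<le> s \<Longrightarrow> 0 \<le> \<delta> \<Longrightarrow> AE w in M.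
           real_cond_exp M (F s) (\<lambda>w'. indicator {j} (r (s + \<delta>) w')) w = P \<delta> (r s w) j"
    using PB by simp
  have o: "\<And>i j. i \<noteq> j \<Longrightarrow> (\<lambda>\<delta>. P \<delta> i j - \<Gamma> $ i $ j * \<delta>) \<in> o[at_right 0](\<lambda>\<delta>. \<delta>)"
    using PC by simp
  have gen: "\<Gamma> $ i $ i = - (\<Sum>j\<in>UNIV - {i}. \<Gamma> $ i $ j)" for i
    using mc by (simp add: markov_chain_def generator_matrix_def)
  have ad: "r t \<in> measurable (F t) (count_space UNIV)" if "0 \<le> t" for t
    using mc that by (simp add: markov_chain_def adapted_process_def)
  show ?thesis
  proof (rule that[of P])
    show "0 \<le> P \<delta> i j" if "0 \<le> \<delta>" for \<delta> i j by (rule P[OF that])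
  next
    fix s \<delta> :: real and \<eta> :: "'a \<Rightarrow> real" and j C
    assume s: "0 \<le> s" and \<delta>: "0 \<le> \<delta>" and \<eta>: "\<eta> \<in> borel_measurable (F s)" "\<And>w. w \<in> space M \<Longrightarrow> \<bar>\<eta> w\<bar> \<le> C"
    interpret finite_measure_subalgebra M "F s"
      by unfold_locales (rule sub[OF s])
    have [measurable]: "r (s + \<delta>) \<in> measurable M (count_space UNIV)" "r s \<in> measurable M (count_space UNIV)"
      by (rule meas_M[OF _ ad]; use s \<delta> in simp)+
    have \<eta>M[measurable]: "\<eta> \<in> borel_measurable M" by (rule meas_M[OF s \<eta>(1)])
    have g: "(\<lambda>w. indicator {j} (r (s + \<delta>) w) :: real) \<in> borel_measurable M" by measurable
    have i: "integrable M (\<lambda>w. \<eta> w * indicator {j} (r (s + \<delta>) w))"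
      by (rule integrable_mult_bounded[OF integrable_bounded[OF \<eta>M \<eta>(2)] g, of 1]) (auto simp: indicator_def)
    have "(\<integral>w. \<eta> w * indicator {j} (r (s + \<delta>) w) \<partial>M) = (\<integral>w. \<eta> w * real_cond_exp M (F s) (\<lambda>w'. indicator {j} (r (s + \<delta>) w')) w \<partial>M)"
      by (rule real_cond_exp_intg(2)[OF i \<eta>(1) g, symmetric])
    also have "\<dots> = (\<integral>w. \<eta> w * P \<delta> (r s w) j \<partial>M)"
    proof (rule integral_cong_AE)
      have "(\<lambda>w. (\<lambda>i w. P \<delta> i j) (r s w) w) \<in> borel_measurable M"
        by (rule measurable_compose_countable) auto
      then show "(\<lambda>w. \<eta> w * P \<delta> (r s w) j) \<in> borel_measurable M" by simp
      show "AE w in M. \<eta> w * real_cond_exp M (F s) (\<lambda>w'. indicator {j} (r (s + \<delta>) w')) w = \<eta> w * P \<delta> (r s w) j"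
        using ce[OF s \<delta>, of j] by eventually_elim simp
    qed simp
    finally show "(\<integral>w. \<eta> w * indicator {j} (r (s + \<delta>) w) \<partial>M) = (\<integral>w. \<eta> w * P \<delta> (r s w) j \<partial>M)" .
  next
    fix \<epsilon> :: real assume \<epsilon>: "0 < \<epsilon>"
    \<comment> \<open>The diagonal error is a sum of fewer than \<open>CARD('s)\<close> off-diagonal
      errors.\<close>
    define e where "e = \<epsilon> / CARD('s)"
    have e: "0 < e" "e \<le> \<epsilon>" using \<epsilon> by (auto simp: e_def divide_le_eq)
    have "\<forall>\<^sub>F \<delta> in at_right 0. \<forall>i j. i \<noteq> j \<longrightarrow> \<bar>P \<delta> i j - \<Gamma> $ i $ j * \<delta>\<bar> \<le> e * \<bar>\<delta>\<bar>"
    proof (intro eventually_all_finite)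
      fix i j
      show "\<forall>\<^sub>F \<delta> in at_right 0. i \<noteq> j \<longrightarrow> \<bar>P \<delta> i j - \<Gamma> $ i $ j * \<delta>\<bar> \<le> e * \<bar>\<delta>\<bar>"
        using landau_o.smallD[OF o e(1), of i j] by (cases "i = j") auto
    qed
    then obtain \<delta>\<^sub>0 where \<delta>0: "0 < \<delta>\<^sub>0" and
      off: "\<And>\<delta> i j. 0 < \<delta> \<Longrightarrow> \<delta> < \<delta>\<^sub>0 \<Longrightarrow> i \<noteq> j \<Longrightarrow> \<bar>P \<delta> i j - \<Gamma> $ i $ j * \<delta>\<bar> \<le> e * \<delta>"
      by (auto simp: eventually_at_right_field)
    show "\<exists>\<delta>\<^sub>0>0. \<forall>\<delta>. 0 < \<delta> \<and> \<delta> < \<delta>\<^sub>0 \<longrightarrow>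
       (\<forall>i j. \<bar>P \<delta> i j - (if i = j then 1 else 0) - \<Gamma> $ i $ j * \<delta>\<bar> \<le> \<epsilon> * \<delta>)"
    proof (intro exI[of _ \<delta>\<^sub>0] conjI \<delta>0 allI impI)
      fix \<delta> i j assume d: "0 < \<delta> \<and> \<delta> < \<delta>\<^sub>0"
      show "\<bar>P \<delta> i j - (if i = j then 1 else 0) - \<Gamma> $ i $ j * \<delta>\<bar> \<le> \<epsilon> * \<delta>"
      proof (cases "i = j")
        case False
        have "e * \<delta> \<le> \<epsilon> * \<delta>" using e d by (intro mult_right_mono) auto
        with off[of \<delta> i j] d False have "\<bar>P \<delta> i j - \<Gamma> $ i $ j * \<delta>\<bar> \<le> \<epsilon> * \<delta>" by (meson order_trans)
        then show ?thesis using False by simp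
      next
        case True
        have "1 = P \<delta> i i + (\<Sum>j\<in>UNIV - {i}. P \<delta> i j)"
          using P(2)[of \<delta> i] d by (simp add: sum.remove[of UNIV i])
        then have "P \<delta> i i - 1 - \<Gamma> $ i $ i * \<delta> = - (\<Sum>j\<in>UNIV - {i}. P \<delta> i j - \<Gamma> $ i $ j * \<delta>)"
          by (simp add: gen sum_subtractf sum_distrib_right)
        also have "\<bar>\<dots>\<bar> \<le> (\<Sum>j\<in>UNIV - {i}. \<bar>P \<delta> i j - \<Gamma> $ i $ j * \<delta>\<bar>)" by simp
        also have "\<dots> \<le> (\<Sum>j\<in>UNIV - {i}. e * \<delta>)"
          using off d by (intro sum_mono) auto
        also have "\<dots> \<le> CARD('s) * (e * \<delta>)"
          using e d by (simp add: mult_right_mono)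
        also have "\<dots> = \<epsilon> * \<delta>" by (simp add: e_def)
        finally show ?thesis using True by simp
      qed
    qed
  qed
qed

text \<open>A change of state within \<open>\<delta>\<close> has conditional probability of order
  \<open>\<delta>\<close>: it is a transition into some \<open>j\<close> from a different state
  \<open>i\<close>, and such a transition has probability at most
  \<open>(\<bar>\<Gamma> $ i $ j\<bar> + 1) * \<delta>\<close>.\<close>

lemma chain_jump:
  fixes r :: "real \<Rightarrow> 'a \<Rightarrow> 's::finite"
  assumes mc: "markov_chain M F \<Gamma> r"
  obtains C \<delta>\<^sub>0 where "0 \<le> C" "0 < \<delta>\<^sub>0"
    "\<And>s \<delta> \<eta> K. 0 \<le> s \<Longrightarrow> 0 < \<delta> \<Longrightarrow> \<delta> < \<delta>\<^sub>0 \<Longrightarrow> \<eta> \<in> borel_measurable (F s) \<Longrightarrow> (\<And>w. w \<in> space M \<Longrightarrow> 0 \<le> \<eta> w \<and> \<eta> w \<le> K) \<Longrightarrow>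
       (\<integral>w. \<eta> w * of_bool (r (s + \<delta>) w \<noteq> r s w) \<partial>M) \<le> C * \<delta> * (\<integral>w. \<eta> w \<partial>M)"
proof -
  obtain P :: "real \<Rightarrow> 's \<Rightarrow> 's \<Rightarrow> real" where
    P0: "\<And>\<delta> i j. 0 \<le> \<delta> \<Longrightarrow> 0 \<le> P \<delta> i j" and
    P1: "\<And>s \<delta> \<eta> j C. 0 \<le> s \<Longrightarrow> 0 \<le> \<delta> \<Longrightarrow> \<eta> \<in> borel_measurable (F s) \<Longrightarrow> (\<And>w. w \<in> space M \<Longrightarrow> \<bar>\<eta> w\<bar> \<le> C) \<Longrightarrow>
       (\<integral>w. \<eta> w * indicator {j} (r (s + \<delta>) w) \<partial>M) = (\<integral>w. \<eta> w * P \<delta> (r s w) j \<partial>M)" and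
    P2: "\<And>\<epsilon>. 0 < \<epsilon> \<Longrightarrow> \<exists>\<delta>\<^sub>0>0. \<forall>\<delta>. 0 < \<delta> \<and> \<delta> < \<delta>\<^sub>0 \<longrightarrow>
       (\<forall>i j. \<bar>P \<delta> i j - (if i = j then 1 else 0) - \<Gamma> $ i $ j * \<delta>\<bar> \<le> \<epsilon> * \<delta>)"
    by (rule chain_transition[OF mc]) blast
  from P2[of 1] obtain \<delta>\<^sub>0 where \<delta>0: "0 < \<delta>\<^sub>0" and
    P3: "\<And>\<delta> i j. 0 < \<delta> \<Longrightarrow> \<delta> < \<delta>\<^sub>0 \<Longrightarrow> \<bar>P \<delta> i j - (if i = j then 1 else 0) - \<Gamma> $ i $ j * \<delta>\<bar> \<le> \<delta>" by auto
  define C0 where "C0 = (\<Sum>i\<in>UNIV. \<Sum>j\<in>UNIV. \<bar>\<Gamma> $ i $ j\<bar>) + 1"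
  have \<Gamma>: "\<bar>\<Gamma> $ i $ j\<bar> + 1 \<le> C0" for i j
  proof -
    have "\<bar>\<Gamma> $ i $ j\<bar> \<le> (\<Sum>j\<in>UNIV. \<bar>\<Gamma> $ i $ j\<bar>)" by (rule member_le_sum) auto
    also have "\<dots> \<le> (\<Sum>i\<in>UNIV. \<Sum>j\<in>UNIV. \<bar>\<Gamma> $ i $ j\<bar>)"
      by (rule member_le_sum[of i UNIV "\<lambda>i. \<Sum>j\<in>UNIV. \<bar>\<Gamma> $ i $ j\<bar>"]) (auto intro: sum_nonneg)
    finally show ?thesis by (simp add: C0_def)
  qed
  have C0: "0 \<le> C0" unfolding C0_def by (intro add_nonneg_nonneg sum_nonneg) auto
  have ad: "r t \<in> measurable (F t) (count_space UNIV)" if "0 \<le> t" for t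
    using mc that by (simp add: markov_chain_def adapted_process_def)
  show ?thesis
  proof (rule that[of "CARD('s) * C0" \<delta>\<^sub>0])
    fix s \<delta> K :: real and \<eta> :: "'a \<Rightarrow> real"
    assume s: "0 \<le> s" and \<delta>: "0 < \<delta>" "\<delta> < \<delta>\<^sub>0" and \<eta>: "\<eta> \<in> borel_measurable (F s)" and \<eta>b: "\<And>w. w \<in> space M \<Longrightarrow> 0 \<le> \<eta> w \<and> \<eta> w \<le> K"
    have [measurable]: "r (s + \<delta>) \<in> measurable M (count_space UNIV)" "r s \<in> measurable M (count_space UNIV)"
      by (rule meas_M[OF _ ad]; use s \<delta> in simp)+
    have \<eta>M[measurable]: "\<eta> \<in> borel_measurable M" by (rule meas_M[OF s \<eta>])
    have \<eta>i: "integrable M \<eta>" by (rule integrable_bounded[OF \<eta>M, of K]) (use \<eta>b in fastforce)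
    \<comment> \<open>The weight vanishes where the chain already sits in \<open>j\<close>, so being
      in \<open>j\<close> afterwards means that the state has changed.\<close>
    let ?\<eta> = "\<lambda>j w. \<eta> w * of_bool (r s w \<noteq> j)"
    have \<eta>j: "?\<eta> j \<in> borel_measurable (F s)" for j
      using \<eta> ad[OF s] by measurable
    have \<eta>jb: "\<bar>?\<eta> j w\<bar> \<le> K" if "w \<in> space M" for j w
      using \<eta>b[OF that] by auto
    have ij: "integrable M (\<lambda>w. ?\<eta> j w * indicator {j} (r (s + \<delta>) w))" for j
      by (rule integrable_mult_bounded[OF integrable_bounded[OF meas_M[OF s \<eta>j] \<eta>jb], where K=1]) (auto simp: indicator_def)
    have "(\<integral>w. \<eta> w * of_bool (r (s + \<delta>) w \<noteq> r s w) \<partial>M) = (\<integral>w. (\<Sum>j\<in>UNIV. ?\<eta> j w * indicator {j} (r (s + \<delta>) w)) \<partial>M)"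
    proof (intro Bochner_Integration.integral_cong refl)
      fix w
      have "(\<Sum>j\<in>UNIV. ?\<eta> j w * indicator {j} (r (s + \<delta>) w)) = (\<Sum>j\<in>UNIV. if j = r (s + \<delta>) w then ?\<eta> j w else 0)"
        by (intro sum.cong) (auto simp: indicator_def)
      then show "\<eta> w * of_bool (r (s + \<delta>) w \<noteq> r s w) = (\<Sum>j\<in>UNIV. ?\<eta> j w * indicator {j} (r (s + \<delta>) w))"
        by auto
    qed
    also have "\<dots> = (\<Sum>j\<in>UNIV. \<integral>w. ?\<eta> j w * indicator {j} (r (s + \<delta>) w) \<partial>M)"
      by (rule Bochner_Integration.integral_sum) (rule ij)
    also have "\<dots> = (\<Sum>j\<in>UNIV. \<integral>w. ?\<eta> j w * P \<delta> (r s w) j \<partial>M)"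
      by (intro sum.cong refl P1[OF s less_imp_le[OF \<delta>(1)] \<eta>j \<eta>jb])
    also have "\<dots> \<le> (\<Sum>j\<in>(UNIV::'s set). \<integral>w. \<eta> w * (C0 * \<delta>) \<partial>M)"
    proof (intro sum_mono integral_mono')
      show "integrable M (\<lambda>w. \<eta> w * (C0 * \<delta>))" using \<eta>i by simp
      fix j w assume w: "w \<in> space M"
      have "P \<delta> (r s w) j \<le> C0 * \<delta>" if "r s w \<noteq> j"
      proof -
        have "P \<delta> (r s w) j \<le> (\<bar>\<Gamma> $ r s w $ j\<bar> + 1) * \<delta>"
        proof -
          have "\<Gamma> $ r s w $ j * \<delta> \<le> \<bar>\<Gamma> $ r s w $ j\<bar> * \<delta>" using \<delta> by (intro mult_right_mono) auto
          moreover have "\<bar>P \<delta> (r s w) j - \<Gamma> $ r s w $ j * \<delta>\<bar> \<le> \<delta>"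
            using P3[OF \<delta>, of "r s w" j] that by simp
          ultimately show ?thesis by (simp add: distrib_right)
        qed
        also have "\<dots> \<le> C0 * \<delta>" using \<Gamma> \<delta> by (intro mult_right_mono) auto
        finally show ?thesis .
      qed
      then show "?\<eta> j w * P \<delta> (r s w) j \<le> \<eta> w * (C0 * \<delta>)"
        using \<eta>b[OF w] C0 \<delta> by (auto intro!: mult_left_mono)
      show "0 \<le> \<eta> w * (C0 * \<delta>)"
        using \<eta>b[OF w] C0 \<delta> by simp
    qed
    also have "\<dots> = CARD('s) * C0 * \<delta> * (\<integral>w. \<eta> w \<partial>M)" by simp
    finally show "(\<integral>w. \<eta> w * of_bool (r (s + \<delta>) w \<noteq> r s w) \<partial>M) \<le> CARD('s) * C0 * \<delta> * (\<integral>w. \<eta> w \<partial>M)" .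
  qed (use C0 \<delta>0 in auto)
qed

end

section \<open>Dynkin's inequality\<close>

lemma bilinear_form_le:
  fixes A :: "real^'d::finite^'d" and v w :: "real^'d"
  shows "\<bar>v \<bullet> (A *v w)\<bar> \<le> real CARD('d) ^ 2 * norm A * norm v * norm w"
proof -
  have "v \<bullet> (A *v w) = (\<Sum>l\<in>UNIV. \<Sum>c\<in>UNIV. v $ l * (A $ l $ c * w $ c))"
    by (simp add: inner_vec_def matrix_vector_mult_def sum_distrib_left)
  also have "\<bar>\<dots>\<bar> \<le> (\<Sum>l\<in>UNIV. \<bar>\<Sum>c\<in>UNIV. v $ l * (A $ l $ c * w $ c)\<bar>)" by (rule sum_abs)
  also have "\<dots> \<le> (\<Sum>l\<in>UNIV. \<Sum>c\<in>UNIV. \<bar>v $ l * (A $ l $ c * w $ c)\<bar>)"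
    by (intro sum_mono sum_abs)
  also have "\<dots> \<le> (\<Sum>l\<in>(UNIV::'d set). \<Sum>c\<in>(UNIV::'d set). norm v * (norm A * norm w))"
  proof (intro sum_mono)
    fix l c :: 'd
    have "\<bar>A $ l $ c\<bar> \<le> norm A"
      using component_le_norm_cart[of "A $ l" c] Finite_Cartesian_Product.norm_nth_le[of A l] by linarith
    then show "\<bar>v $ l * (A $ l $ c * w $ c)\<bar> \<le> norm v * (norm A * norm w)"
      unfolding abs_mult by (intro mult_mono component_le_norm_cart) auto
  qed
  also have "\<dots> = real CARD('d) ^ 2 * norm A * norm v * norm w"
    by (simp add: power2_eq_square)
  finally show ?thesis .
qed

text \<open>Continuity is available for each state separately; countability of the states glues the
  measurable pieces together.\<close>

lemma measurable_switched:
  fixes h :: "'b::euclidean_space \<Rightarrow> 's::countable \<Rightarrow> 'c::euclidean_space"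
  assumes Y: "Y \<in> borel_measurable N" and r: "r \<in> measurable N (count_space UNIV)"
    and h: "\<And>i. continuous_on UNIV (\<lambda>z. h z i)"
  shows "(\<lambda>w. h (Y w) (r w)) \<in> borel_measurable N"
proof -
  have "(\<lambda>w. (\<lambda>i w. h (Y w) i) (r w) w) \<in> borel_measurable N"
    by (rule measurable_compose_countable[OF _ r])
      (rule measurable_compose[OF Y borel_measurable_continuous_onI[OF h]])
  then show ?thesis .
qed

lemma continuous_on_slice:
  fixes h :: "'x::topological_space \<Rightarrow> 'y::topological_space \<Rightarrow> 'z::topological_space"
  assumes "continuous_on UNIV (\<lambda>(z, t). h z t)"
  shows "continuous_on UNIV (\<lambda>z. h z t)" "continuous_on UNIV (\<lambda>t. h z t)"
proof -
  have "continuous_on UNIV (\<lambda>z::'x. (z, t))" "continuous_on UNIV (\<lambda>t::'y. (z, t))"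
    by (intro continuous_on_Pair continuous_on_const continuous_on_id)+
  from this[THEN continuous_on_compose2[OF assms], OF subset_UNIV]
  show "continuous_on UNIV (\<lambda>z. h z t)" "continuous_on UNIV (\<lambda>t. h z t)" by auto
qed

text \<open>An abstract setting for Dynkin's inequality: \<open>Y\<close> is a process with drift
  \<open>b\<close> and martingale part \<open>N\<close>, confined to a ball. The derivatives of
  \<open>W\<close> are functions of their own, tied to \<open>W\<close> only by a Taylor formula and
  the fundamental theorem of calculus, so that versions extended to negative times can be supplied.
  In the application \<open>Y\<close> stands still after \<open>\<sigma>\<close> while time and
  chain go on, which is why the process is killed there.\<close>

locale switching_ito = stopped_ito M F B T \<sigma> G I K \<Omega>
  for M :: "'a measure" and F and B :: "real \<Rightarrow> 'a \<Rightarrow> real^'m::finite" and T \<sigma>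
    and G :: "real \<Rightarrow> 'a \<Rightarrow> real^'m^'d::finite" and I K \<Omega> +
  fixes r :: "real \<Rightarrow> 'a \<Rightarrow> 's::finite" and \<Gamma> :: "real^'s^'s"
    and Y b :: "real \<Rightarrow> 'a \<Rightarrow> real^'d" and R C :: real
    and W Wt :: "real^'d \<Rightarrow> real \<Rightarrow> 's \<Rightarrow> real"
    and Wx :: "real^'d \<Rightarrow> real \<Rightarrow> 's \<Rightarrow> real^'d" and Wxx :: "real^'d \<Rightarrow> real \<Rightarrow> 's \<Rightarrow> real^'d^'d"
  assumes mc: "markov_chain M F \<Gamma> r"
    and Y_meas: "\<And>n q. q \<le> 2 ^ n \<Longrightarrow> Y (gp n q) \<in> borel_measurable (F (gp n q))"
    and Y_cont: "\<And>w. w \<in> space M \<Longrightarrow> continuous_on {0..T} (\<lambda>t. Y t w)"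
    and Y_le: "\<And>w t. w \<in> space M \<Longrightarrow> 0 \<le> t \<Longrightarrow> t \<le> T \<Longrightarrow> norm (Y t w) \<le> R"
    and b_meas: "(\<lambda>(s, w). b s w) \<in> borel_measurable LM"
    and b_le: "\<And>s w. norm (b s w) \<le> K"
    and Y_incr: "\<And>w s t. w \<in> space M \<Longrightarrow> 0 \<le> s \<Longrightarrow> s \<le> t \<Longrightarrow> t \<le> T \<Longrightarrow>
      Y t w - Y s w = (\<integral>x. indicator {s<..t} x *\<^sub>R b x w \<partial>lborel) + (N t w - N s w)"
    and W_cont: "\<And>i. continuous_on UNIV (\<lambda>(z, t). W z t i)" and Wt_cont: "\<And>i. continuous_on UNIV (\<lambda>(z, t). Wt z t i)"
    and Wx_cont: "\<And>i. continuous_on UNIV (\<lambda>(z, t). Wx z t i)" and Wxx_cont: "\<And>i. continuous_on UNIV (\<lambda>(z, t). Wxx z t i)"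
    and W_nonneg: "\<And>z t i. 0 \<le> t \<Longrightarrow> 0 \<le> W z t i"
    and taylor: "\<And>z v t i. 0 \<le> t \<Longrightarrow> \<exists>\<theta>. 0 \<le> \<theta> \<and> \<theta> \<le> 1 \<and>
      W (z + v) t i = W z t i + Wx z t i \<bullet> v + (v \<bullet> (Wxx (z + \<theta> *\<^sub>R v) t i *v v)) / 2"
    and FTC: "\<And>z i a c. 0 \<le> a \<Longrightarrow> a \<le> c \<Longrightarrow> has_bochner_integral lborel (\<lambda>s. indicator {a..c} s *\<^sub>R Wt z s i) (W z c i - W z a i)"
    and R: "0 \<le> R" and C: "0 \<le> C"
    and W_le: "\<And>z t i. norm z \<le> R \<Longrightarrow> 0 \<le> t \<Longrightarrow> t \<le> T \<Longrightarrow> \<bar>W z t i\<bar> \<le> C"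
    and Wt_le: "\<And>z t i. norm z \<le> R \<Longrightarrow> 0 \<le> t \<Longrightarrow> t \<le> T \<Longrightarrow> \<bar>Wt z t i\<bar> \<le> C"
    and Wx_le: "\<And>z t i. norm z \<le> R \<Longrightarrow> 0 \<le> t \<Longrightarrow> t \<le> T \<Longrightarrow> norm (Wx z t i) \<le> C"
    and Wxx_le: "\<And>z t i. norm z \<le> R \<Longrightarrow> 0 \<le> t \<Longrightarrow> t \<le> T \<Longrightarrow> norm (Wxx z t i) \<le> C"
    and modulus: "\<And>\<epsilon>. 0 < \<epsilon> \<Longrightarrow> \<exists>d>0. \<forall>z z' t i. norm z \<le> R \<and> norm z' \<le> R \<and> 0 \<le> t \<and> t \<le> T \<and> norm (z - z') \<le> d
      \<longrightarrow> norm (Wxx z t i - Wxx z' t i) \<le> \<epsilon>"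
begin

section \<open>Expansion over one grid step\<close>

abbreviation \<delta> :: "nat \<Rightarrow> real" where "\<delta> n \<equiv> T / 2 ^ n"

abbreviation Yg :: "nat \<Rightarrow> nat \<Rightarrow> 'a \<Rightarrow> real^'d" where "Yg n k w \<equiv> Y (gp n k) w"
abbreviation rg :: "nat \<Rightarrow> nat \<Rightarrow> 'a \<Rightarrow> 's" where "rg n k w \<equiv> r (gp n k) w"
abbreviation dY :: "nat \<Rightarrow> nat \<Rightarrow> 'a \<Rightarrow> real^'d" where "dY n k w \<equiv> Y (gp n (Suc k)) w - Y (gp n k) w"
abbreviation dN :: "nat \<Rightarrow> nat \<Rightarrow> 'a \<Rightarrow> real^'d" where "dN n k w \<equiv> N (gp n (Suc k)) w - N (gp n k) w"
abbreviation seg :: "nat \<Rightarrow> nat \<Rightarrow> real set" where "seg n k \<equiv> {gp n k<..gp n (Suc k)}"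
abbreviation db :: "nat \<Rightarrow> nat \<Rightarrow> 'a \<Rightarrow> real^'d" where "db n k w \<equiv> \<integral>x. indicator (seg n k) x *\<^sub>R b x w \<partial>lborel"
abbreviation jump :: "nat \<Rightarrow> nat \<Rightarrow> 'a \<Rightarrow> real" where "jump n k w \<equiv> of_bool (rg n (Suc k) w \<noteq> rg n k w)"
abbreviation alive :: "nat \<Rightarrow> nat \<Rightarrow> 'a \<Rightarrow> real" where "alive n k w \<equiv> of_bool (gp n k < \<sigma> w)"

text \<open>Entry \<open>l\<close>, \<open>c\<close> of \<open>Gs\<close> times its transpose: the
  covariance rate of the stopped integral.\<close>

definition GG :: "'d \<Rightarrow> 'd \<Rightarrow> real \<Rightarrow> 'a \<Rightarrow> real" where
  "GG l c s w = (\<Sum>i\<in>UNIV. Gs s w $ l $ i * Gs s w $ c $ i)"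

definition dd :: real where "dd = real CARD('d) ^ 2"

lemma dd: "0 \<le> dd" by (simp add: dd_def)

lemma gp_Suc: "gp n (Suc k) = gp n k + \<delta> n"
  by (simp add: gp_def field_simps)

lemma \<delta>_pos: "0 < \<delta> n" using T by simp

lemma seg_integral:
  fixes f :: "real \<Rightarrow> 'z::euclidean_space"
  assumes f: "f \<in> borel_measurable lborel" and le: "\<And>s. s \<in> seg n k \<Longrightarrow> norm (f s) \<le> c" and c: "0 \<le> c"
  shows "integrable lborel (\<lambda>s. indicator (seg n k) s *\<^sub>R f s)"
    and "norm (\<integral>s. indicator (seg n k) s *\<^sub>R f s \<partial>lborel) \<le> c * \<delta> n"
proof -
  have 1: "integrable lborel (\<lambda>s. c * indicator (seg n k) s :: real)"
    using \<delta>_pos[of n] by (intro integrable_mult_right integrable_real_indicator) (auto simp: gp_Suc)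
  show i: "integrable lborel (\<lambda>s. indicator (seg n k) s *\<^sub>R f s)"
    by (rule Bochner_Integration.integrable_bound[OF 1])
      (use f le in \<open>auto intro!: AE_I2 simp: indicator_def abs_of_nonneg[OF c]\<close>)
  have "norm (\<integral>s. indicator (seg n k) s *\<^sub>R f s \<partial>lborel) \<le> (\<integral>s. norm (indicator (seg n k) s *\<^sub>R f s) \<partial>lborel)"
    by (rule integral_norm_bound)
  also have "\<dots> \<le> (\<integral>s. c * indicator (seg n k) s \<partial>lborel)"
    using le by (intro integral_mono integrable_norm i 1) (auto simp: indicator_def)
  also have "\<dots> = c * \<delta> n" using T by (simp add: gp_Suc)
  finally show "norm (\<integral>s. indicator (seg n k) s *\<^sub>R f s \<partial>lborel) \<le> c * \<delta> n" .
qed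

lemma b_path: "w \<in> space M \<Longrightarrow> (\<lambda>s. b s w) \<in> borel_measurable lborel"
  using measurable_compose[OF measurable_Pair2' b_meas, of w] by simp

lemma db_le: "w \<in> space M \<Longrightarrow> norm (db n k w) \<le> K * \<delta> n"
  by (rule seg_integral(2)) (use b_path b_le K in auto)

lemma dY_eq: "w \<in> space M \<Longrightarrow> k < 2 ^ n \<Longrightarrow> dY n k w = db n k w + dN n k w"
  by (rule Y_incr) (use gp_le_T[of "Suc k" n] in auto)

lemma Yg_le: "w \<in> space M \<Longrightarrow> k \<le> 2 ^ n \<Longrightarrow> norm (Yg n k w) \<le> R"
  by (rule Y_le) (auto simp: gp_le_T)

lemma dY_le: "w \<in> space M \<Longrightarrow> k < 2 ^ n \<Longrightarrow> norm (dY n k w) \<le> 2 * R"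
  using norm_triangle_ineq4[of "Yg n (Suc k) w" "Yg n k w"] Yg_le[of w "Suc k" n] Yg_le[of w k n] by simp

lemma dN_le: "w \<in> space M \<Longrightarrow> k < 2 ^ n \<Longrightarrow> norm (dN n k w) \<le> norm (dY n k w) + K * \<delta> n"
  using norm_triangle_ineq4[of "dY n k w" "db n k w"] db_le[of w n k] dY_eq[of w k n] by simp

lemma quad_le: "\<bar>v \<bullet> (A *v w)\<bar> \<le> dd * norm A * norm v * norm w" for v w :: "real^'d"
  using bilinear_form_le[of v A w] by (simp add: dd_def)

lemma ball_line:
  assumes "norm z \<le> R" "norm (z + v) \<le> R" "0 \<le> \<theta>" "\<theta> \<le> 1"
  shows "norm (z + \<theta> *\<^sub>R v) \<le> R"
proof -
  have "z + \<theta> *\<^sub>R v = (1 - \<theta>) *\<^sub>R z + \<theta> *\<^sub>R (z + v)" by (simp add: algebra_simps)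
  also have "norm \<dots> \<le> (1 - \<theta>) * norm z + \<theta> * norm (z + v)"
    using assms norm_triangle_ineq[of "(1 - \<theta>) *\<^sub>R z" "\<theta> *\<^sub>R (z + v)"] by simp
  also have "\<dots> \<le> (1 - \<theta>) * R + \<theta> * R"
    using assms by (intro add_mono mult_left_mono) auto
  finally show ?thesis by (simp add: algebra_simps)
qed

text \<open>Inside the ball a displacement is at most \<open>2 * R\<close> long, which turns the
  quadratic Taylor term into a linear one.\<close>

lemma W_lipschitz:
  assumes z: "norm z \<le> R" "norm (z + v) \<le> R" and t: "0 \<le> t" "t \<le> T"
  shows "\<bar>W (z + v) t i - W z t i\<bar> \<le> C * (1 + dd * R) * norm v"
proof -
  obtain \<theta> where \<theta>: "0 \<le> \<theta>" "\<theta> \<le> 1" and eq: "W (z + v) t i = W z t i + Wx z t i \<bullet> v + (v \<bullet> (Wxx (z + \<theta> *\<^sub>R v) t i *v v)) / 2"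
    using taylor[OF t(1)] by blast
  have v: "norm v \<le> 2 * R" using norm_triangle_ineq4[of "z + v" z] z by simp
  have "\<bar>Wx z t i \<bullet> v\<bar> \<le> C * norm v"
    using Cauchy_Schwarz_ineq2[of "Wx z t i" v] mult_right_mono[OF Wx_le[OF z(1) t, of i], of "norm v"] by simp
  moreover have "\<bar>v \<bullet> (Wxx (z + \<theta> *\<^sub>R v) t i *v v)\<bar> \<le> dd * C * norm v * (2 * R)"
    using Wxx_le[OF ball_line[OF z \<theta>] t, of i] dd v C
    by (intro order_trans[OF quad_le] mult_mono mult_left_mono) (auto intro!: mult_nonneg_nonneg)
  ultimately have "\<bar>W (z + v) t i - W z t i\<bar> \<le> C * norm v + dd * C * norm v * (2 * R) / 2"
    unfolding eq by linarith
  then show ?thesis by (simp add: algebra_simps)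
qed

text \<open>The move is made in three stages: time, at the new position and state; position, at the
  old time; state, at the old position and time. The middle stage takes place in the new state
  \<open>j\<close> and is brought back to the old state \<open>i\<close> at a cost that arises only
  if there is a jump.\<close>

lemma path_step:
  assumes w: "w \<in> space M" and k: "k < 2 ^ n" and \<epsilon>: "0 \<le> \<epsilon>" and d: "0 < d"
    and mod: "\<forall>z z' t i. norm z \<le> R \<and> norm z' \<le> R \<and> 0 \<le> t \<and> t \<le> T \<and> norm (z - z') \<le> d \<longrightarrow> norm (Wxx z t i - Wxx z' t i) \<le> \<epsilon>"
  defines "y \<equiv> Yg n k w" and "y' \<equiv> Yg n (Suc k) w" and "i \<equiv> rg n k w" and "j \<equiv> rg n (Suc k) w" and "t \<equiv> gp n k"
  shows "W y' (gp n (Suc k)) j - W y t i \<le>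
    (\<integral>s. indicator (seg n k) s *\<^sub>R Wt y' s j \<partial>lborel) + (W y t j - W y t i) + Wx y t i \<bullet> db n k w
     + Wx y t i \<bullet> dN n k w + (dN n k w \<bullet> (Wxx y t i *v dN n k w)) / 2
     + 2 * (C * (1 + dd * R)) * (jump n k w * norm (dY n k w))
     + dd * (\<epsilon> + 2 * C / d * norm (dY n k w)) * (norm (dY n k w))\<^sup>2 / 2
     + dd * C * ((K * \<delta> n)\<^sup>2 + 2 * (K * \<delta> n) * norm (dN n k w)) / 2"
proof -
  have t: "0 \<le> t" "t \<le> T" "t \<le> gp n (Suc k)" "gp n (Suc k) \<le> T" using k by (auto simp: t_def gp_le_T)
  have yR: "norm y \<le> R" "norm y' \<le> R" using Yg_le[OF w] k by (auto simp: y_def y'_def)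
  define v where "v = dY n k w"
  define \<beta> where "\<beta> = db n k w"
  define \<nu> where "\<nu> = dN n k w"
  have v: "v = \<beta> + \<nu>" "y' = y + v" "norm \<beta> \<le> K * \<delta> n"
  proof -
    show "v = \<beta> + \<nu>" using dY_eq[OF w k] by (simp only: v_def \<beta>_def \<nu>_def)
    show "norm \<beta> \<le> K * \<delta> n" using db_le[OF w] by (simp only: \<beta>_def)
  qed (simp add: v_def y_def y'_def)
  have 1: "W y' (gp n (Suc k)) j - W y' t j = (\<integral>s. indicator (seg n k) s *\<^sub>R Wt y' s j \<partial>lborel)"
  proof -
    have "(\<integral>s. indicator (seg n k) s *\<^sub>R Wt y' s j \<partial>lborel) = (\<integral>s. indicator {t..gp n (Suc k)} s *\<^sub>R Wt y' s j \<partial>lborel)"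
    proof (rule integral_cong_AE)
      have "(\<lambda>s. Wt y' s j) \<in> borel_measurable borel"
        by (rule borel_measurable_continuous_onI) (rule continuous_on_slice[OF Wt_cont])
      then show "(\<lambda>s. indicator (seg n k) s *\<^sub>R Wt y' s j) \<in> borel_measurable lborel"
        "(\<lambda>s. indicator {t..gp n (Suc k)} s *\<^sub>R Wt y' s j) \<in> borel_measurable lborel" by auto
      show "AE s in lborel. indicator (seg n k) s *\<^sub>R Wt y' s j = indicator {t..gp n (Suc k)} s *\<^sub>R Wt y' s j"
        using AE_lborel_singleton[of t] by eventually_elim (auto simp: indicator_def t_def)
    qed
    with FTC[OF t(1,3), of y' j] show ?thesis by (simp add: has_bochner_integral_iff)
  qed
  have 2: "W y' t j - W y t j \<le> W y' t i - W y t i + 2 * (C * (1 + dd * R)) * (jump n k w * norm v)"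
  proof (cases "j = i")
    case True
    then show ?thesis by (simp add: i_def j_def)
  next
    case False
    then have "jump n k w = 1" by (simp add: i_def j_def)
    then show ?thesis
      using W_lipschitz[of y v t j] W_lipschitz[of y v t i] yR t v by (auto simp: abs_le_iff)
  qed
  obtain \<theta> where \<theta>: "0 \<le> \<theta>" "\<theta> \<le> 1" and eq: "W (y + v) t i = W y t i + Wx y t i \<bullet> v + (v \<bullet> (Wxx (y + \<theta> *\<^sub>R v) t i *v v)) / 2"
    using taylor[OF t(1)] by blast
  let ?A = "Wxx y t i" and ?A' = "Wxx (y + \<theta> *\<^sub>R v) t i"
  \<comment> \<open>A displacement longer than \<open>d\<close> is beyond the reach of the modulus,
    but there the trivial bound \<open>2 * C\<close> is at most
    \<open>2 * C / d * norm v\<close>.\<close>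
  have osc: "norm (?A' - ?A) \<le> \<epsilon> + 2 * C / d * norm v"
  proof (cases "norm v \<le> d")
    case True
    have "norm (\<theta> *\<^sub>R v) \<le> norm v" using \<theta> by (simp add: mult_left_le_one_le)
    with True have "norm (?A' - ?A) \<le> \<epsilon>"
      using ball_line[of y v \<theta>] yR v \<theta> t by (intro mod[rule_format]) auto
    moreover have "0 \<le> 2 * C / d * norm v" using C d by simp
    ultimately show ?thesis by linarith
  next
    case False
    have "norm (?A' - ?A) \<le> C + C"
      using norm_triangle_ineq4[of ?A' ?A] Wxx_le[of y t i] Wxx_le[of "y + \<theta> *\<^sub>R v" t i] ball_line[of y v \<theta>] yR v \<theta> t by force
    also have "\<dots> \<le> 2 * C / d * norm v"
      using False d C mult_left_mono[of d "norm v" "2 * C"] by (simp add: field_simps)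
    finally show ?thesis using \<epsilon> by linarith
  qed
  have q1: "v \<bullet> (?A' *v v) \<le> v \<bullet> (?A *v v) + dd * (\<epsilon> + 2 * C / d * norm v) * (norm v)\<^sup>2"
  proof -
    have "v \<bullet> (?A' *v v) = v \<bullet> (?A *v v) + v \<bullet> ((?A' - ?A) *v v)"
      by (simp add: matrix_vector_mult_diff_rdistrib inner_diff_right)
    also have "v \<bullet> ((?A' - ?A) *v v) \<le> dd * norm (?A' - ?A) * norm v * norm v"
      using quad_le[of v "?A' - ?A" v] by linarith
    also have "\<dots> \<le> dd * (\<epsilon> + 2 * C / d * norm v) * norm v * norm v"
      using osc dd by (intro mult_right_mono mult_left_mono) auto
    finally show ?thesis by (simp add: power2_eq_square mult.assoc)
  qed
  have A: "norm ?A \<le> C" by (rule Wxx_le[OF yR(1) t(1,2)])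
  have bnd: "v' \<bullet> (?A *v w') \<le> dd * C * (a' * b')" if "norm v' \<le> a'" "norm w' \<le> b'" for v' w' and a' b' :: real
  proof -
    have "v' \<bullet> (?A *v w') \<le> dd * norm ?A * norm v' * norm w'" using quad_le[of v' ?A w'] by linarith
    also have "\<dots> = (dd * norm ?A) * (norm v' * norm w')" by (simp add: mult.assoc)
    also have "\<dots> \<le> (dd * C) * (a' * b')"
      using that A dd C order_trans[OF norm_ge_zero that(1)] order_trans[OF norm_ge_zero that(2)]
      by (intro mult_mono mult_left_mono mult_nonneg_nonneg) auto
    finally show ?thesis .
  qed
  \<comment> \<open>The drift integral is of order \<open>\<delta> n\<close>, so each term of the
    quadratic form that contains it is negligible after summation; only the martingale part is
    kept.\<close>
  have q2: "v \<bullet> (?A *v v) \<le> \<nu> \<bullet> (?A *v \<nu>) + dd * C * ((K * \<delta> n)\<^sup>2 + 2 * (K * \<delta> n) * norm \<nu>)"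
  proof -
    have "v \<bullet> (?A *v v) = \<nu> \<bullet> (?A *v \<nu>) + \<beta> \<bullet> (?A *v \<beta>) + \<beta> \<bullet> (?A *v \<nu>) + \<nu> \<bullet> (?A *v \<beta>)"
      by (simp add: v matrix_vector_right_distrib inner_add_left inner_add_right)
    also have "\<dots> \<le> \<nu> \<bullet> (?A *v \<nu>) + dd * C * ((K * \<delta> n) * (K * \<delta> n)) + dd * C * ((K * \<delta> n) * norm \<nu>) + dd * C * (norm \<nu> * (K * \<delta> n))"
      by (intro add_mono bnd v(3)) auto
    finally show ?thesis by (simp add: power2_eq_square algebra_simps)
  qed
  have "W y' (gp n (Suc k)) j - W y t i = (W y' (gp n (Suc k)) j - W y' t j) + (W y' t j - W y t j) + (W y t j - W y t i)"
    by simp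
  also have "\<dots> \<le> (\<integral>s. indicator (seg n k) s *\<^sub>R Wt y' s j \<partial>lborel) + (W y' t i - W y t i + 2 * (C * (1 + dd * R)) * (jump n k w * norm v)) + (W y t j - W y t i)"
    using 1 2 by simp
  also have "W y' t i - W y t i = Wx y t i \<bullet> \<beta> + Wx y t i \<bullet> \<nu> + (v \<bullet> (?A' *v v)) / 2"
    unfolding v(2) eq by (simp add: v(1) inner_add_right)
  finally show ?thesis using q1 q2 unfolding v_def \<beta>_def \<nu>_def by argo
qed

text \<open>The rate whose integral over the step compensates the killed increment of
  \<open>W\<close>. The time derivative is taken at the new position and state, all else at the
  start of the step, as the stages of \<open>path_step\<close> dictate.\<close>

definition \<phi> :: "nat \<Rightarrow> nat \<Rightarrow> real \<Rightarrow> 'a \<Rightarrow> real" where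
  "\<phi> n k s w = alive n k w * (Wt (Yg n (Suc k) w) s (rg n (Suc k) w)
     + Wx (Yg n k w) (gp n k) (rg n k w) \<bullet> b s w
     + (\<Sum>l\<in>UNIV. \<Sum>c\<in>UNIV. Wxx (Yg n k w) (gp n k) (rg n k w) $ l $ c * GG l c s w) / 2
     + (\<Sum>j\<in>UNIV. \<Gamma> $ rg n k w $ j * W (Yg n k w) (gp n k) j))"

text \<open>The three summands bound the effect of a jump of the chain within the step, the second-order Taylor
  remainder (with \<open>\<epsilon>\<close> the modulus of continuity of \<open>Wxx\<close> at distance \<open>d\<close>), and the replacement of the
  increment of \<open>Y\<close> by that of the stochastic integral in the quadratic term.\<close>

definition err :: "real \<Rightarrow> real \<Rightarrow> nat \<Rightarrow> nat \<Rightarrow> 'a \<Rightarrow> real" where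
  "err \<epsilon> d n k w = 2 * (C * (1 + dd * R)) * (jump n k w * norm (dY n k w))
     + dd * (\<epsilon> + 2 * C / d * norm (dY n k w)) * (norm (dY n k w))\<^sup>2 / 2
     + dd * C * ((K * \<delta> n)\<^sup>2 + 2 * (K * \<delta> n) * norm (dN n k w)) / 2"

definition C\<phi> :: real where
  "C\<phi> = C + C * K + dd * (C * (real CARD('m) * K\<^sup>2)) + (\<Sum>i\<in>UNIV. \<Sum>j\<in>UNIV. \<bar>\<Gamma> $ i $ j\<bar>) * C"

lemma C\<phi>: "0 \<le> C\<phi>"
  unfolding C\<phi>_def by (intro add_nonneg_nonneg mult_nonneg_nonneg sum_nonneg) (use C K dd in auto)

lemma GG_le: "\<bar>GG l c s w\<bar> \<le> real CARD('m) * K\<^sup>2"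
proof -
  have "\<bar>Gs s w $ l $ i\<bar> \<le> K" for l i
    using Gs_le[of s w] component_le_norm_cart[of "Gs s w $ l" i] Finite_Cartesian_Product.norm_nth_le[of "Gs s w" l] by linarith
  then have "\<bar>Gs s w $ l $ i * Gs s w $ c $ i\<bar> \<le> K\<^sup>2" for i
    unfolding abs_mult power2_eq_square using K by (intro mult_mono) auto
  then have "\<bar>GG l c s w\<bar> \<le> (\<Sum>i\<in>(UNIV::'m set). K\<^sup>2)"
    unfolding GG_def by (intro order_trans[OF sum_abs] sum_mono) auto
  then show ?thesis by simp
qed

lemma generator_sum_le:
  assumes "norm z \<le> R" "0 \<le> t" "t \<le> T"
  shows "\<bar>\<Sum>j\<in>UNIV. \<Gamma> $ i $ j * W z t j\<bar> \<le> (\<Sum>i\<in>UNIV. \<Sum>j\<in>UNIV. \<bar>\<Gamma> $ i $ j\<bar>) * C"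
proof -
  have "\<bar>\<Sum>j\<in>UNIV. \<Gamma> $ i $ j * W z t j\<bar> \<le> (\<Sum>j\<in>UNIV. \<bar>\<Gamma> $ i $ j\<bar> * C)"
    using W_le[OF assms] by (intro order_trans[OF sum_abs] sum_mono) (auto simp: abs_mult intro!: mult_left_mono)
  also have "\<dots> = (\<Sum>j\<in>UNIV. \<bar>\<Gamma> $ i $ j\<bar>) * C" by (simp add: sum_distrib_right)
  also have "\<dots> \<le> (\<Sum>i\<in>UNIV. \<Sum>j\<in>UNIV. \<bar>\<Gamma> $ i $ j\<bar>) * C"
    using C by (intro mult_right_mono member_le_sum[of i UNIV "\<lambda>i. \<Sum>j\<in>UNIV. \<bar>\<Gamma> $ i $ j\<bar>"]) (auto intro: sum_nonneg)
  finally show ?thesis .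
qed

lemma integrand_le:
  assumes "norm z \<le> R" "0 \<le> t" "t \<le> T" "norm z' \<le> R" "0 \<le> s" "s \<le> T"
  shows "\<bar>Wt z' s j + Wx z t i \<bullet> b s w + (\<Sum>l\<in>UNIV. \<Sum>c\<in>UNIV. Wxx z t i $ l $ c * GG l c s w) / 2
     + (\<Sum>j\<in>UNIV. \<Gamma> $ i $ j * W z t j)\<bar> \<le> C\<phi>"
proof -
  have 1: "\<bar>Wt z' s j\<bar> \<le> C" by (rule Wt_le) (use assms in auto)
  have 2: "\<bar>Wx z t i \<bullet> b s w\<bar> \<le> C * K"
    by (intro order_trans[OF Cauchy_Schwarz_ineq2] mult_mono Wx_le b_le) (use assms C in auto)
  have "\<bar>Wxx z t i $ l $ c\<bar> \<le> C" for l c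
    using Wxx_le[OF assms(1-3), of i] component_le_norm_cart[of "Wxx z t i $ l" c] Finite_Cartesian_Product.norm_nth_le[of "Wxx z t i" l] by linarith
  then have "\<bar>\<Sum>l\<in>UNIV. \<Sum>c\<in>UNIV. Wxx z t i $ l $ c * GG l c s w\<bar> \<le> (\<Sum>l\<in>(UNIV::'d set). \<Sum>c\<in>(UNIV::'d set). C * (real CARD('m) * K\<^sup>2))"
    by (intro order_trans[OF sum_abs] sum_mono order_trans[OF sum_abs])
      (auto simp: abs_mult intro!: mult_mono GG_le C)
  also have "\<dots> = dd * (C * (real CARD('m) * K\<^sup>2))" by (simp add: dd_def power2_eq_square)
  finally have 3: "\<bar>(\<Sum>l\<in>UNIV. \<Sum>c\<in>UNIV. Wxx z t i $ l $ c * GG l c s w) / 2\<bar> \<le> dd * (C * (real CARD('m) * K\<^sup>2))"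
    by simp
  show ?thesis
    unfolding C\<phi>_def using 1 2 3 generator_sum_le[OF assms(1-3), of i] by linarith
qed

lemma \<phi>_le:
  assumes "w \<in> space M" "k < 2 ^ n" "s \<in> seg n k"
  shows "\<bar>\<phi> n k s w\<bar> \<le> C\<phi>"
proof -
  have "\<bar>Wt (Yg n (Suc k) w) s (rg n (Suc k) w)
     + Wx (Yg n k w) (gp n k) (rg n k w) \<bullet> b s w
     + (\<Sum>l\<in>UNIV. \<Sum>c\<in>UNIV. Wxx (Yg n k w) (gp n k) (rg n k w) $ l $ c * GG l c s w) / 2
     + (\<Sum>j\<in>UNIV. \<Gamma> $ rg n k w $ j * W (Yg n k w) (gp n k) j)\<bar> \<le> C\<phi>"
    using assms Yg_le[OF assms(1)] gp_le_T[of k n] gp_le_T[of "Suc k" n] gp_nonneg[of n k]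
    by (intro integrand_le) (auto simp del: gp_nonneg)
  then show ?thesis using C\<phi> by (simp add: \<phi>_def)
qed

lemma r_adapted: "0 \<le> t \<Longrightarrow> r t \<in> measurable (F t) (count_space UNIV)"
  using mc by (simp add: markov_chain_def adapted_process_def)

lemma r_measM: "0 \<le> t \<Longrightarrow> r t \<in> measurable M (count_space UNIV)"
  by (rule meas_M[OF _ r_adapted])

lemma Y_measM: "q \<le> 2 ^ n \<Longrightarrow> Y (gp n q) \<in> borel_measurable M"
  by (rule meas_M[OF gp_nonneg Y_meas])

lemma snd_meas: "f \<in> measurable M N' \<Longrightarrow> (\<lambda>x. f (snd x)) \<in> measurable LM N'"
  by (rule measurable_compose[OF measurable_snd])

lemma GG_meas [measurable]: "(\<lambda>x. GG l c (fst x) (snd x)) \<in> borel_measurable LM"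
proof -
  have [measurable]: "(\<lambda>x. Gs (fst x) (snd x)) \<in> borel_measurable LM"
    using Gs_measurable by (simp add: split_beta')
  show ?thesis unfolding GG_def by measurable
qed

lemma \<phi>_meas:
  assumes k: "k < 2 ^ n"
  shows "(\<lambda>x. \<phi> n k (fst x) (snd x)) \<in> borel_measurable LM"
proof -
  have [measurable]: "Yg n k \<in> borel_measurable M" "Yg n (Suc k) \<in> borel_measurable M"
    "rg n k \<in> measurable M (count_space UNIV)" "rg n (Suc k) \<in> measurable M (count_space UNIV)"
    using Y_measM[of k n] Y_measM[of "Suc k" n] r_measM k by auto
  have [measurable]: "(\<lambda>x. b (fst x) (snd x)) \<in> borel_measurable LM"
    using b_meas by (simp add: split_beta')
  have [measurable]: "(\<lambda>x. Wt (Yg n (Suc k) (snd x)) (fst x) (rg n (Suc k) (snd x))) \<in> borel_measurable LM"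
    using measurable_switched[where h="\<lambda>(z, s) i. Wt z s i" and Y="\<lambda>x. (Yg n (Suc k) (snd x), fst x)" and N="lborel \<Otimes>\<^sub>M M"
        and r="\<lambda>x. rg n (Suc k) (snd x)"] Wt_cont by (simp add: split_beta')
  have [measurable]: "(\<lambda>w. Wx (Yg n k w) (gp n k) (rg n k w)) \<in> borel_measurable M"
    "(\<lambda>w. Wxx (Yg n k w) (gp n k) (rg n k w)) \<in> borel_measurable M"
    "(\<lambda>w. \<Sum>j\<in>UNIV. \<Gamma> $ rg n k w $ j * W (Yg n k w) (gp n k) j) \<in> borel_measurable M"
  proof -
    note mm = Y_measM[OF less_imp_le[OF k]] r_measM[OF gp_nonneg[of n k]]
    show "(\<lambda>w. Wx (Yg n k w) (gp n k) (rg n k w)) \<in> borel_measurable M"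
      by (rule measurable_switched[OF mm]) (rule continuous_on_slice[OF Wx_cont])
    show "(\<lambda>w. Wxx (Yg n k w) (gp n k) (rg n k w)) \<in> borel_measurable M"
      by (rule measurable_switched[OF mm]) (rule continuous_on_slice[OF Wxx_cont])
    show "(\<lambda>w. \<Sum>j\<in>UNIV. \<Gamma> $ rg n k w $ j * W (Yg n k w) (gp n k) j) \<in> borel_measurable M"
      by (rule measurable_switched[OF mm, where h="\<lambda>z i. \<Sum>j\<in>UNIV. \<Gamma> $ i $ j * W z (gp n k) j"])
        (intro continuous_intros continuous_on_slice[OF W_cont])
  qed
  show ?thesis
    unfolding \<phi>_def by measurable
qed

lemma prod_integrable:
  fixes f :: "real \<times> 'a \<Rightarrow> real"
  assumes f[measurable]: "f \<in> borel_measurable LM" and ac: "a \<le> c"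
    and le: "\<And>s w. s \<in> {a<..c} \<Longrightarrow> w \<in> space M \<Longrightarrow> \<bar>f (s, w)\<bar> \<le> B'"
  shows "integrable LM (\<lambda>x. indicator {a<..c} (fst x) * f x)"
proof -
  have sf: "sigma_finite_measure M" by unfold_locales
  have em: "emeasure LM ({a<..c} \<times> space M) < \<infinity>"
    using sigma_finite_measure.emeasure_pair_measure_Times[OF sf, of "{a<..c}" lborel "space M"] ac by (simp add: emeasure_space_1)
  show ?thesis
  proof (rule Bochner_Integration.integrable_bound[of _ "\<lambda>x. \<bar>B'\<bar> * indicator ({a<..c} \<times> space M) x"])
    show "integrable LM (\<lambda>x. \<bar>B'\<bar> * indicator ({a<..c} \<times> space M) x)"
      using em by (intro integrable_mult_right) (auto simp: integrable_indicator_iff)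
    show "AE x in LM. norm (indicator {a<..c} (fst x) * f x) \<le> norm (\<bar>B'\<bar> * indicator ({a<..c} \<times> space M) x)"
    proof (intro AE_I2)
      fix x assume "x \<in> space LM"
      then obtain s w where "x = (s, w)" "w \<in> space M" by (auto simp: space_pair_measure)
      then show "norm (indicator {a<..c} (fst x) * f x) \<le> norm (\<bar>B'\<bar> * indicator ({a<..c} \<times> space M) x)"
        using le[of s w] by (auto simp: indicator_def)
    qed
  qed measurable
qed

lemma prod_Fubini:
  fixes f :: "real \<times> 'a \<Rightarrow> real"
  assumes "integrable LM f"
  shows "integrable M (\<lambda>w. \<integral>s. f (s, w) \<partial>lborel)"
    and "(\<integral>w. (\<integral>s. f (s, w) \<partial>lborel) \<partial>M) = (\<integral>x. f x \<partial>LM)"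
proof -
  interpret pair_sigma_finite lborel M ..
  have f: "integrable LM (\<lambda>(s, w). f (s, w))" using assms by simp
  show "integrable M (\<lambda>w. \<integral>s. f (s, w) \<partial>lborel)" using integrable_snd[OF f] .
  show "(\<integral>w. (\<integral>s. f (s, w) \<partial>lborel) \<partial>M) = (\<integral>x. f x \<partial>LM)"
    using integral_snd[OF f] by simp
qed

lemma err_nonneg: "0 \<le> \<epsilon> \<Longrightarrow> 0 < d \<Longrightarrow> 0 \<le> err \<epsilon> d n k w"
  unfolding err_def using C R dd K T by (intro add_nonneg_nonneg mult_nonneg_nonneg divide_nonneg_nonneg) auto

lemma err_integrable:
  assumes k: "k < 2 ^ n" shows "integrable M (err \<epsilon> d n k)"
proof -
  have [measurable]: "Yg n k \<in> borel_measurable M" "Yg n (Suc k) \<in> borel_measurable M"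
    "rg n k \<in> measurable M (count_space UNIV)" "rg n (Suc k) \<in> measurable M (count_space UNIV)"
    "N (gp n k) \<in> borel_measurable M" "N (gp n (Suc k)) \<in> borel_measurable M"
    using Y_measM[of k n] Y_measM[of "Suc k" n] r_measM N_meas_M[of k n] N_meas_M[of "Suc k" n] k by auto
  have m[measurable]: "(\<lambda>w. norm (dY n k w)) \<in> borel_measurable M" "(\<lambda>w. norm (dN n k w)) \<in> borel_measurable M"
    "jump n k \<in> borel_measurable M"
    by measurable
  have i1: "integrable M (\<lambda>w. norm (dY n k w))"
    by (rule integrable_bounded[OF m(1), of "2 * R"]) (use dY_le k in auto)
  have i2: "integrable M (\<lambda>w. norm (dN n k w))"
    by (rule integrable_bounded[OF m(2), of "2 * R + K * \<delta> n"]) (use dN_le[of _ k n] dY_le[of _ k n] k in force)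
  have i3: "integrable M (\<lambda>w. norm (dY n k w) * jump n k w)"
    by (rule integrable_mult_bounded[OF i1 m(3), of 1]) auto
  have i4: "integrable M (\<lambda>w. norm (dY n k w) * norm (dY n k w))"
    by (rule integrable_mult_bounded[OF i1 m(1), of "2 * R"]) (use dY_le k in auto)
  have i5: "integrable M (\<lambda>w. norm (dY n k w) * norm (dY n k w) * norm (dY n k w))"
    by (rule integrable_mult_bounded[OF i4 m(1), of "2 * R"]) (use dY_le k in auto)
  have "err \<epsilon> d n k = (\<lambda>w. 2 * (C * (1 + dd * R)) * (norm (dY n k w) * jump n k w)
     + (dd * \<epsilon> / 2) * (norm (dY n k w) * norm (dY n k w)) + (dd * (2 * C / d) / 2) * (norm (dY n k w) * norm (dY n k w) * norm (dY n k w))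
     + (dd * C * (K * \<delta> n)\<^sup>2 / 2 + dd * C * (2 * (K * \<delta> n)) / 2 * norm (dN n k w)))"
    unfolding err_def by (rule ext) (simp add: power2_eq_square algebra_simps add_divide_distrib)
  moreover have "integrable M \<dots>"
    by (intro Bochner_Integration.integrable_add integrable_mult_right i1 i2 i3 i4 i5) simp
  ultimately show ?thesis by simp
qed

text \<open>Survival, position and state at the start of the step are known there. Hence the linear
  term in the martingale increment averages out, its square is replaced by the covariance rate, and
  the jump of the chain by the generator, up to an error of order
  \<open>\<epsilon> * \<delta> n\<close> for each target state.\<close>

lemma step_bound:
  assumes k: "k < 2 ^ n" and \<epsilon>: "0 \<le> \<epsilon>" and d: "0 < d"
    and mod: "\<forall>z z' t i. norm z \<le> R \<and> norm z' \<le> R \<and> 0 \<le> t \<and> t \<le> T \<and> norm (z - z') \<le> d \<longrightarrow> norm (Wxx z t i - Wxx z' t i) \<le> \<epsilon>"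
    and P: "\<And>s \<eta> j C. 0 \<le> s \<Longrightarrow> \<eta> \<in> borel_measurable (F s) \<Longrightarrow> (\<And>w. w \<in> space M \<Longrightarrow> \<bar>\<eta> w\<bar> \<le> C) \<Longrightarrow>
       (\<integral>w. \<eta> w * indicator {j} (r (s + \<delta> n) w) \<partial>M) = (\<integral>w. \<eta> w * P (r s w) j \<partial>M)"
    and P': "\<And>i j. \<bar>P i j - (if i = j then 1 else 0) - \<Gamma> $ i $ j * \<delta> n\<bar> \<le> \<epsilon> * \<delta> n"
  shows "(\<integral>w. alive n k w * (W (Yg n (Suc k) w) (gp n (Suc k)) (rg n (Suc k) w) - W (Yg n k w) (gp n k) (rg n k w)) \<partial>M)
    \<le> (\<integral>x. indicator (seg n k) (fst x) * \<phi> n k (fst x) (snd x) \<partial>LM)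
      + (\<integral>w. err \<epsilon> d n k w \<partial>M) + real CARD('s) * C * \<epsilon> * \<delta> n"
proof -
  let ?t = "gp n k"
  let ?y = "Yg n k" and ?y' = "Yg n (Suc k)" and ?i = "rg n k" and ?j = "rg n (Suc k)"
  let ?A = "\<lambda>w. alive n k w"
  let ?p = "\<lambda>j w. (if ?i w = j then 1 else 0) + \<Gamma> $ ?i w $ j * \<delta> n"
  let ?x = "\<lambda>w. Wx (?y w) ?t (?i w)" and ?xx = "\<lambda>w. Wxx (?y w) ?t (?i w)"
  let ?GG = "\<lambda>l c w. \<integral>s. indicator (seg n k) s * GG l c s w \<partial>lborel" and ?Wt = "\<lambda>w. \<integral>s. indicator (seg n k) s * Wt (?y' w) s (?j w) \<partial>lborel"
  have t: "0 \<le> ?t" "?t < T" using gp_less_iff[of n k "2 ^ n"] k by auto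
  have kk: "k \<le> 2 ^ n" "Suc k \<le> 2 ^ n" using k by auto
  have t': "0 \<le> gp n (Suc k)" "gp n (Suc k) \<le> T" using gp_le_T[OF kk(2)] by auto
  have yR: "norm (?y w) \<le> R" "norm (?y' w) \<le> R" if "w \<in> space M" for w
    using Yg_le[OF that] kk by auto
  have mF[measurable]: "?y \<in> borel_measurable (F ?t)" "?i \<in> measurable (F ?t) (count_space UNIV)" "?A \<in> borel_measurable (F ?t)"
  proof -
    show "?y \<in> borel_measurable (F ?t)" by (rule Y_meas[OF kk(1)])
    show "?i \<in> measurable (F ?t) (count_space UNIV)" by (rule r_adapted) simp
    have "indicator {w \<in> space M. ?t < \<sigma> w} \<in> borel_measurable (F ?t)"
      using \<sigma>_stop[OF t] by (rule borel_measurable_indicator)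
    moreover have "(indicator {w \<in> space M. ?t < \<sigma> w} w :: real) = ?A w" if "w \<in> space (F ?t)" for w
      using that t by (simp add: indicator_def)
    ultimately show "?A \<in> borel_measurable (F ?t)"
      by (subst measurable_cong[of _ _ "indicator {w \<in> space M. ?t < \<sigma> w}"]) auto
  qed
  have mM[measurable]: "?y \<in> borel_measurable M" "?y' \<in> borel_measurable M"
    "?i \<in> measurable M (count_space UNIV)" "?j \<in> measurable M (count_space UNIV)"
    using Y_measM[of k n] Y_measM[of "Suc k" n] r_measM k by auto
  have Nm[measurable]: "N ?t \<in> borel_measurable M" "N (gp n (Suc k)) \<in> borel_measurable M"
    by (rule N_meas_M[OF kk(1)]) (rule N_meas_M[OF kk(2)])
  have sw: "(\<lambda>w. h (?y w) ?t (?i w)) \<in> borel_measurable (F ?t)"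
    if "\<And>i. continuous_on UNIV (\<lambda>(z, t). h z t i)" for h :: "real^'d \<Rightarrow> real \<Rightarrow> 's \<Rightarrow> 'z::euclidean_space"
    by (rule measurable_switched[OF mF(1,2)]) (rule continuous_on_slice[OF that])
  have [measurable]: "(\<lambda>w. ?x w) \<in> borel_measurable (F ?t)"
    "(\<lambda>w. ?xx w) \<in> borel_measurable (F ?t)"
    "(\<lambda>w. W (?y w) ?t (?i w)) \<in> borel_measurable (F ?t)"
    by (rule sw, rule Wx_cont Wxx_cont W_cont)+
  have Wj[measurable]: "(\<lambda>w. W (?y w) ?t j) \<in> borel_measurable (F ?t)" for j
    by (rule measurable_compose[OF mF(1) borel_measurable_continuous_onI[OF continuous_on_slice(1)[OF W_cont]]])
  have A1: "0 \<le> ?A w" "?A w \<le> 1" "\<bar>?A w\<bar> \<le> 1" for w by auto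
  define cx where "cx l w = ?A w * ?x w $ l" for l w
  define cxx where "cxx l c w = ?A w * ?xx w $ l $ c" for l c w
  have cx: "cx l \<in> borel_measurable (F ?t)" "w \<in> space M \<Longrightarrow> \<bar>cx l w\<bar> \<le> C" for l w
  proof -
    show "cx l \<in> borel_measurable (F ?t)" unfolding cx_def[abs_def] by measurable
    assume w: "w \<in> space M"
    have "\<bar>?x w $ l\<bar> \<le> C"
      using Wx_le[OF yR(1)[OF w] t(1), of "?i w"] t component_le_norm_cart[of "?x w" l] by linarith
    then show "\<bar>cx l w\<bar> \<le> C" using C by (simp add: cx_def)
  qed
  have cxx: "cxx l c \<in> borel_measurable (F ?t)" "w \<in> space M \<Longrightarrow> \<bar>cxx l c w\<bar> \<le> C" for l c w
  proof -
    show "cxx l c \<in> borel_measurable (F ?t)" unfolding cxx_def[abs_def] by measurable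
    assume w: "w \<in> space M"
    have "\<bar>?xx w $ l $ c\<bar> \<le> C"
      using Wxx_le[OF yR(1)[OF w] t(1), of "?i w"] t component_le_norm_cart[of "?xx w $ l" c]
        Finite_Cartesian_Product.norm_nth_le[of "?xx w" l] by linarith
    then show "\<bar>cxx l c w\<bar> \<le> C" using C by (simp add: cxx_def)
  qed
  have cM: "cx l \<in> borel_measurable M" "cxx l c \<in> borel_measurable M" for l c
    by (rule meas_M[OF t(1) cx(1)]) (rule meas_M[OF t(1) cxx(1)])
  \<comment> \<open>\<open>X1\<close> is the killed increment and \<open>X2\<close> the integral of
    its rate; \<open>X3\<close> is the chain term minus its generator term, \<open>X4\<close> the
    linear and \<open>X5\<close> the quadratic martingale term, \<open>X6\<close> the covariance
    integral that replaces \<open>X5\<close>.\<close>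
  define X1 where "X1 w = ?A w * (W (?y' w) (gp n (Suc k)) (?j w) - W (?y w) ?t (?i w))" for w
  define X2 where "X2 w = (\<integral>s. indicator (seg n k) s * \<phi> n k s w \<partial>lborel)" for w
  define X3 where "X3 w = ?A w * (W (?y w) ?t (?j w) - W (?y w) ?t (?i w) - \<delta> n * (\<Sum>j\<in>UNIV. \<Gamma> $ ?i w $ j * W (?y w) ?t j))" for w
  define X4 where "X4 w = (\<Sum>l\<in>UNIV. cx l w * dN n k w $ l)" for w
  define X5 where "X5 w = (\<Sum>l\<in>UNIV. \<Sum>c\<in>UNIV. cxx l c w * (dN n k w $ l * dN n k w $ c))" for w
  define X6 where "X6 w = (\<Sum>l\<in>UNIV. \<Sum>c\<in>UNIV. cxx l c w * ?GG l c w)" for w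
  have X2: "integrable M X2" "(\<integral>w. X2 w \<partial>M) = (\<integral>x. indicator (seg n k) (fst x) * \<phi> n k (fst x) (snd x) \<partial>LM)"
  proof -
    have "integrable LM (\<lambda>x. indicator (seg n k) (fst x) * \<phi> n k (fst x) (snd x))"
      by (rule prod_integrable[OF \<phi>_meas[OF k], of _ _ C\<phi>]) (use \<phi>_le[OF _ k] in auto)
    from prod_Fubini[OF this] show "integrable M X2" "(\<integral>w. X2 w \<partial>M) = (\<integral>x. indicator (seg n k) (fst x) * \<phi> n k (fst x) (snd x) \<partial>LM)"
      by (simp_all add: X2_def[abs_def])
  qed
  have GGi: "integrable M (\<lambda>w. \<integral>s. indicator (seg n k) s * GG l c s w \<partial>lborel)" for l c
    using prod_Fubini(1)[OF prod_integrable[of "\<lambda>x. GG l c (fst x) (snd x)" ?t "gp n (Suc k)" "real CARD('m) * K\<^sup>2"]] GG_le by simp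
  have X1: "integrable M X1"
  proof (rule integrable_bounded)
    have [measurable]: "(\<lambda>w. W (?y' w) (gp n (Suc k)) (?j w)) \<in> borel_measurable M"
      by (rule measurable_switched[OF mM(2,4)]) (rule continuous_on_slice[OF W_cont])
    have [measurable]: "(\<lambda>w. W (?y w) ?t (?i w)) \<in> borel_measurable M"
      by (rule measurable_switched[OF mM(1,3)]) (rule continuous_on_slice[OF W_cont])
    show "X1 \<in> borel_measurable M" unfolding X1_def[abs_def] by measurable
    fix w assume w: "w \<in> space M"
    show "\<bar>X1 w\<bar> \<le> 2 * C"
      using W_le[OF yR(1)[OF w] t(1), of "?i w"] W_le[OF yR(2)[OF w] t', of "?j w"] t C by (auto simp: X1_def)
  qed
  have X4: "has_bochner_integral M X4 (\<Sum>l\<in>(UNIV::'d set). 0)"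
    unfolding X4_def[abs_def] by (intro has_bochner_integral_sum N_moments(1)[OF _ kk(2) cx]) auto
  have X5: "has_bochner_integral M X5 (\<Sum>l\<in>UNIV. \<Sum>c\<in>UNIV. \<integral>w. cxx l c w * ?GG l c w \<partial>M)"
    unfolding X5_def[abs_def] GG_def by (intro has_bochner_integral_sum N_moments(2)[OF _ kk(2) cxx]) auto
  have X6: "has_bochner_integral M X6 (\<Sum>l\<in>UNIV. \<Sum>c\<in>UNIV. \<integral>w. cxx l c w * ?GG l c w \<partial>M)"
  proof -
    have "integrable M (\<lambda>w. cxx l c w * ?GG l c w)" for l c
      using integrable_mult_bounded[OF GGi cM(2) cxx(2)] by (simp add: mult.commute)
    then show ?thesis
      unfolding X6_def[abs_def] by (intro has_bochner_integral_sum has_bochner_integral_integrable)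
  qed
  have X3: "integrable M X3" "(\<integral>w. X3 w \<partial>M) \<le> real CARD('s) * C * \<epsilon> * \<delta> n"
  proof -
    define h where "h j w = ?A w * W (?y w) ?t j" for j w
    have h: "h j \<in> borel_measurable (F ?t)" "w \<in> space M \<Longrightarrow> \<bar>h j w\<bar> \<le> C" for j w
    proof -
      show "h j \<in> borel_measurable (F ?t)" unfolding h_def[abs_def] by measurable
      show "\<bar>h j w\<bar> \<le> C" if "w \<in> space M"
        using W_le[OF yR(1)[OF that] t(1), of j] t C by (auto simp: h_def)
    qed
    have hM[measurable]: "h j \<in> borel_measurable M" for j by (rule meas_M[OF t(1) h(1)])
    have hi: "integrable M (h j)" for j by (rule integrable_bounded[OF hM h(2)])
    have fm: "(\<lambda>w. f (?i w)) \<in> borel_measurable M" for f :: "'s \<Rightarrow> real" by measurable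
    have fb: "\<bar>f (?i w)\<bar> \<le> (\<Sum>i\<in>UNIV. \<bar>f i\<bar>)" for f :: "'s \<Rightarrow> real" and w
      by (rule member_le_sum[of _ _ "\<lambda>i. \<bar>f i\<bar>"]) auto
    have hf: "integrable M (\<lambda>w. h j w * f (?i w))" for j and f :: "'s \<Rightarrow> real"
      by (rule integrable_mult_bounded[OF hi fm fb])
    have hind: "integrable M (\<lambda>w. h j w * indicator {j} (?j w))" for j
      by (rule integrable_mult_bounded[OF hi, where K=1]) (auto simp: indicator_def)
    \<comment> \<open>Written over the target states, the chain term compares the indicator of the
      new state with the first-order transition probability \<open>?p\<close>.\<close>
    have X3_eq: "X3 w = (\<Sum>j\<in>UNIV. h j w * indicator {j} (?j w) - h j w * ?p j w)" for w
    proof -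
      have "(\<Sum>j\<in>UNIV. h j w * indicator {j} (?j w)) = ?A w * W (?y w) ?t (?j w)"
        by (simp add: h_def indicator_def if_distrib cong: if_cong)
      moreover have "(\<Sum>j\<in>UNIV. h j w * ?p j w)
        = ?A w * W (?y w) ?t (?i w) + ?A w * \<delta> n * (\<Sum>j\<in>UNIV. \<Gamma> $ ?i w $ j * W (?y w) ?t j)"
      proof -
        have "(\<Sum>j\<in>UNIV. h j w * ?p j w)
          = (\<Sum>j\<in>UNIV. (if ?i w = j then ?A w * W (?y w) ?t (?i w) else 0) + ?A w * \<delta> n * (\<Gamma> $ ?i w $ j * W (?y w) ?t j))"
          by (intro sum.cong refl) (auto simp: h_def algebra_simps)
        then show ?thesis by (simp only: sum.distrib sum_distrib_left[symmetric]) simp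
      qed
      ultimately show ?thesis by (simp add: X3_def sum_subtractf algebra_simps)
    qed
    have hg: "integrable M (\<lambda>w. h j w * ?p j w)" for j
      by (rule hf[of j "\<lambda>i. (if i = j then 1 else 0) + \<Gamma> $ i $ j * \<delta> n"])
    have hP: "integrable M (\<lambda>w. h j w * P (?i w) j)" for j
      by (rule hf[of j "\<lambda>i. P i j"])
    show "integrable M X3"
      unfolding X3_eq[abs_def]
      by (intro Bochner_Integration.integrable_sum Bochner_Integration.integrable_diff hind hg)
    have "(\<integral>w. X3 w \<partial>M) = (\<Sum>j\<in>UNIV. (\<integral>w. h j w * indicator {j} (?j w) \<partial>M) - (\<integral>w. h j w * ?p j w \<partial>M))"
    proof -
      have "(\<integral>w. X3 w \<partial>M) = (\<Sum>j\<in>UNIV. \<integral>w. h j w * indicator {j} (?j w) - h j w * ?p j w \<partial>M)"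
        unfolding X3_eq by (rule Bochner_Integration.integral_sum) (intro Bochner_Integration.integrable_diff hind hg)
      also have "\<dots> = (\<Sum>j\<in>UNIV. (\<integral>w. h j w * indicator {j} (?j w) \<partial>M) - (\<integral>w. h j w * ?p j w \<partial>M))"
        by (intro sum.cong refl Bochner_Integration.integral_diff hind hg)
      finally show ?thesis .
    qed
    also have "\<dots> = (\<Sum>j\<in>UNIV. (\<integral>w. h j w * P (?i w) j \<partial>M) - (\<integral>w. h j w * ?p j w \<partial>M))"
      using P[OF t(1) h] by (simp add: gp_Suc)
    also have "\<dots> = (\<Sum>j\<in>UNIV. \<integral>w. h j w * P (?i w) j - h j w * ?p j w \<partial>M)"
      by (intro sum.cong refl Bochner_Integration.integral_diff[symmetric] hP hg)
    also have "\<dots> \<le> (\<Sum>j\<in>(UNIV::'s set). C * (\<epsilon> * \<delta> n))"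
    proof (intro sum_mono)
      fix j
      have "(\<integral>w. h j w * P (?i w) j - h j w * ?p j w \<partial>M) \<le> (\<integral>w. C * (\<epsilon> * \<delta> n) \<partial>M)"
      proof (intro integral_mono Bochner_Integration.integrable_diff hP hg)
        fix w assume w: "w \<in> space M"
        have "h j w * P (?i w) j - h j w * ?p j w
          = h j w * (P (?i w) j - (if ?i w = j then 1 else 0) - \<Gamma> $ ?i w $ j * \<delta> n)"
          by (simp add: algebra_simps)
        also have "\<dots> \<le> \<bar>h j w\<bar> * \<bar>P (?i w) j - (if ?i w = j then 1 else 0) - \<Gamma> $ ?i w $ j * \<delta> n\<bar>"
          unfolding abs_mult[symmetric] by (rule abs_ge_self)
        also have "\<dots> \<le> C * (\<epsilon> * \<delta> n)"
          using h(2)[OF w, of j] P'[of "?i w" j] C by (intro mult_mono) auto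
        finally show "h j w * P (?i w) j - h j w * ?p j w \<le> C * (\<epsilon> * \<delta> n)" .
      qed auto
      then show "(\<integral>w. h j w * P (?i w) j - h j w * ?p j w \<partial>M) \<le> C * (\<epsilon> * \<delta> n)"
        by (simp add: prob_space)
    qed
    finally show "(\<integral>w. X3 w \<partial>M) \<le> real CARD('s) * C * \<epsilon> * \<delta> n" by (simp add: mult_ac)
  qed
  have le: "X1 w \<le> X2 w + X3 w + X4 w + (X5 w - X6 w) / 2 + err \<epsilon> d n k w" if w: "w \<in> space M" for w
  proof (cases "?A w = 0")
    \<comment> \<open>After killing every term vanishes except the error, which is
      nonnegative.\<close>
    case True
    then have "X1 w = 0" "X3 w = 0" "X4 w = 0" "X5 w = 0" "X6 w = 0" "X2 w = 0"
      unfolding X1_def X2_def X3_def X4_def X5_def X6_def cx_def cxx_def \<phi>_def True by simp_all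
    then show ?thesis using err_nonneg[OF \<epsilon> d, of n k w] by simp
  next
    case False
    then have A: "?A w = 1" by (auto split: if_splits)
    let ?W = "\<Sum>j\<in>UNIV. \<Gamma> $ ?i w $ j * W (?y w) ?t j"
    have GGp: "(\<lambda>s. GG l c s w) \<in> borel_measurable lborel" for l c
      using measurable_compose[OF measurable_Pair2'[OF w] GG_meas, of l c] by simp
    have gi: "integrable lborel (\<lambda>s. indicator (seg n k) s * GG l c s w)" for l c
      using seg_integral(1)[of "\<lambda>s. GG l c s w" n k "real CARD('m) * K\<^sup>2", OF GGp] GG_le[of l c _ w] by simp
    have Wtp: "(\<lambda>s. Wt (?y' w) s (?j w)) \<in> borel_measurable lborel"
      using borel_measurable_continuous_onI[OF continuous_on_slice(2)[OF Wt_cont]] by simp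
    have g1: "has_bochner_integral lborel (\<lambda>s. indicator (seg n k) s * Wt (?y' w) s (?j w)) (?Wt w)"
      using seg_integral(1)[OF Wtp, of n k C] Wt_le[OF yR(2)[OF w]] t t' C by (intro has_bochner_integral_integrable) auto
    have g2: "has_bochner_integral lborel (\<lambda>s. ?x w \<bullet> (indicator (seg n k) s *\<^sub>R b s w)) (?x w \<bullet> db n k w)"
      by (intro has_bochner_integral_inner_right has_bochner_integral_integrable seg_integral(1)[where c=K])
        (use b_path[OF w] b_le K in auto)
    have g3: "has_bochner_integral lborel (\<lambda>s. \<Sum>l\<in>UNIV. \<Sum>c\<in>UNIV. cxx l c w * (indicator (seg n k) s * GG l c s w)) (X6 w)"
      unfolding X6_def by (intro has_bochner_integral_sum has_bochner_integral_mult_right has_bochner_integral_integrable gi)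
    have g4: "has_bochner_integral lborel (\<lambda>s. indicator (seg n k) s * ?W) (\<delta> n * ?W)"
      using has_bochner_integral_mult_left[OF has_bochner_integral_real_indicator[of "seg n k" lborel], of ?W] \<delta>_pos[of n]
      by (simp add: gp_Suc measure_def)
    have "has_bochner_integral lborel (\<lambda>s. indicator (seg n k) s * \<phi> n k s w)
      ((?Wt w) + ?x w \<bullet> db n k w + X6 w / 2 + \<delta> n * ?W)"
    proof -
      have "indicator (seg n k) s * \<phi> n k s w = indicator (seg n k) s * Wt (?y' w) s (?j w)
        + ?x w \<bullet> (indicator (seg n k) s *\<^sub>R b s w)
        + (\<Sum>l\<in>UNIV. \<Sum>c\<in>UNIV. cxx l c w * (indicator (seg n k) s * GG l c s w)) / 2 + indicator (seg n k) s * ?W" for s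
        by (cases "s \<in> seg n k") (simp_all add: \<phi>_def A cxx_def)
      then show ?thesis
        using has_bochner_integral_add[OF has_bochner_integral_add[OF has_bochner_integral_add[OF g1 g2] has_bochner_integral_divide_zero[OF g3, of 2]] g4]
        by simp
    qed
    then have X2e: "X2 w = (?Wt w) + ?x w \<bullet> db n k w + X6 w / 2 + \<delta> n * ?W"
      by (simp add: X2_def has_bochner_integral_iff)
    have X4e: "X4 w = ?x w \<bullet> dN n k w"
      by (simp add: X4_def cx_def A inner_vec_def)
    have X5e: "X5 w = dN n k w \<bullet> (?xx w *v dN n k w)"
      unfolding X5_def cxx_def A inner_vec_def matrix_vector_mult_def by (simp add: sum_distrib_left mult_ac)
    have X3e: "X3 w = (W (?y w) ?t (?j w) - W (?y w) ?t (?i w)) - \<delta> n * ?W" by (simp add: X3_def A)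
    have X1e: "X1 w = W (?y' w) (gp n (Suc k)) (?j w) - W (?y w) ?t (?i w)" by (simp add: X1_def A)
    show ?thesis
      using path_step[OF w k \<epsilon> d mod] unfolding X2e X4e X5e X3e X1e err_def real_scaleR_def by argo
  qed
  have "(\<integral>w. X1 w \<partial>M) \<le> (\<integral>w. X2 w + X3 w + X4 w + (X5 w - X6 w) / 2 + err \<epsilon> d n k w \<partial>M)"
    using X1 X2(1) X3(1) X4 X5 X6 err_integrable[OF k] le by (intro integral_mono) (auto simp: has_bochner_integral_iff)
  also have "\<dots> = (\<integral>w. X2 w \<partial>M) + (\<integral>w. X3 w \<partial>M) + (\<integral>w. X4 w \<partial>M) + ((\<integral>w. X5 w \<partial>M) - (\<integral>w. X6 w \<partial>M)) / 2 + (\<integral>w. err \<epsilon> d n k w \<partial>M)"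
    using X2(1) X3(1) X4 X5 X6 err_integrable[OF k, of \<epsilon> d] by (simp add: has_bochner_integral_iff)
  also have "\<dots> = (\<integral>w. X2 w \<partial>M) + (\<integral>w. X3 w \<partial>M) + (\<integral>w. err \<epsilon> d n k w \<partial>M)"
    using X4 X5 X6 by (simp add: has_bochner_integral_iff)
  finally show ?thesis
    using X3(2) X2(2) unfolding X1_def by simp
qed

section \<open>Summing the errors over the grid\<close>

lemma grid_measM:
  assumes k: "k < 2 ^ n"
  shows "Yg n k \<in> borel_measurable M" "Yg n (Suc k) \<in> borel_measurable M"
    "rg n k \<in> measurable M (count_space UNIV)" "rg n (Suc k) \<in> measurable M (count_space UNIV)"
    "N (gp n k) \<in> borel_measurable M" "N (gp n (Suc k)) \<in> borel_measurable M"
    "jump n k \<in> borel_measurable M" "dY n k \<in> borel_measurable M" "dN n k \<in> borel_measurable M"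
proof -
  show [measurable]: "Yg n k \<in> borel_measurable M" "Yg n (Suc k) \<in> borel_measurable M"
    "rg n k \<in> measurable M (count_space UNIV)" "rg n (Suc k) \<in> measurable M (count_space UNIV)"
    "N (gp n k) \<in> borel_measurable M" "N (gp n (Suc k)) \<in> borel_measurable M"
    using Y_measM[of k n] Y_measM[of "Suc k" n] r_measM N_meas_M[of k n] N_meas_M[of "Suc k" n] k by auto
  show "jump n k \<in> borel_measurable M" "dY n k \<in> borel_measurable M" "dN n k \<in> borel_measurable M"
    by measurable
qed

lemma \<delta>_tendsto: "\<delta> \<longlonglongrightarrow> 0"
proof -
  have "(\<lambda>n. T * (1 / 2) ^ n) \<longlonglongrightarrow> T * 0"
    by (intro tendsto_mult tendsto_const LIMSEQ_power_zero) auto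
  then show ?thesis by (simp add: power_one_over field_simps)
qed

lemma jumps_square:
  obtains CJ where "0 \<le> CJ"
    "\<forall>\<^sub>F n in sequentially. integrable M (\<lambda>w. (\<Sum>k<2^n. jump n k w)\<^sup>2) \<and> (\<integral>w. (\<Sum>k<2^n. jump n k w)\<^sup>2 \<partial>M) \<le> CJ"
proof -
  obtain c \<delta>\<^sub>0 where c: "0 \<le> c" "0 < \<delta>\<^sub>0"
    "\<And>s \<delta> \<eta> K. 0 \<le> s \<Longrightarrow> 0 < \<delta> \<Longrightarrow> \<delta> < \<delta>\<^sub>0 \<Longrightarrow> \<eta> \<in> borel_measurable (F s) \<Longrightarrow> (\<And>w. w \<in> space M \<Longrightarrow> 0 \<le> \<eta> w \<and> \<eta> w \<le> K) \<Longrightarrow>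
       (\<integral>w. \<eta> w * of_bool (r (s + \<delta>) w \<noteq> r s w) \<partial>M) \<le> c * \<delta> * (\<integral>w. \<eta> w \<partial>M)"
    by (rule chain_jump[OF mc]) blast
  have "\<forall>\<^sub>F n in sequentially. integrable M (\<lambda>w. (\<Sum>k<2^n. jump n k w)\<^sup>2) \<and> (\<integral>w. (\<Sum>k<2^n. jump n k w)\<^sup>2 \<partial>M) \<le> (c * T)\<^sup>2 + c * T"
    using order_tendstoD(2)[OF \<delta>_tendsto c(2)]
  proof eventually_elim
    case (elim n)
    have E: "(\<integral>w. \<eta> w * jump n k w \<partial>M) \<le> c * \<delta> n * (\<integral>w. \<eta> w \<partial>M)"
      if "\<eta> \<in> borel_measurable (F (gp n k))" "\<And>w. w \<in> space M \<Longrightarrow> 0 \<le> \<eta> w \<and> \<eta> w \<le> 1" for \<eta> k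
      using c(3)[OF gp_nonneg \<delta>_pos elim that] by (simp add: gp_Suc)
    have E1: "(\<integral>w. jump n k w \<partial>M) \<le> c * \<delta> n" for k
      using E[of "\<lambda>_. 1" k] by (simp add: prob_space)
    have i: "integrable M (\<lambda>w. jump n k w * jump n l w)" if "k < 2 ^ n" "l < 2 ^ n" for k l
    proof -
      show ?thesis
        by (rule integrable_bounded[OF borel_measurable_times[OF grid_measM(7)[OF that(1)] grid_measM(7)[OF that(2)]], of 1]) auto
    qed
    have a: "(\<integral>w. jump n k w * jump n l w \<partial>M) \<le> (c * \<delta> n)\<^sup>2" if kl: "k < l" "l < 2 ^ n" for k l
    proof -
      have le: "gp n k \<le> gp n l" "gp n (Suc k) \<le> gp n l" using kl by auto
      have [measurable]: "rg n k \<in> measurable (F (gp n l)) (count_space UNIV)" "rg n (Suc k) \<in> measurable (F (gp n l)) (count_space UNIV)"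
        by (rule meas_mono[OF _ le(1) r_adapted] meas_mono[OF _ le(2) r_adapted]; simp)+
      have "jump n k \<in> borel_measurable (F (gp n l))" by measurable
      then have "(\<integral>w. jump n k w * jump n l w \<partial>M) \<le> c * \<delta> n * (\<integral>w. jump n k w \<partial>M)"
        by (rule E) auto
      also have "\<dots> \<le> c * \<delta> n * (c * \<delta> n)"
        using E1 c(1) T by (intro mult_left_mono) auto
      finally show ?thesis by (simp add: power2_eq_square)
    qed
    have b: "(\<integral>w. (jump n k w)\<^sup>2 \<partial>M) \<le> c * \<delta> n" for k
    proof -
      have "(jump n k w)\<^sup>2 = jump n k w" for w by simp
      then show ?thesis using E1[of k] by simp
    qed
    \<comment> \<open>The number of steps times their length is \<open>T\<close>, so the grid drops
      out of the bound.\<close>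
    have eq: "(real (2 ^ n) * (c * \<delta> n))\<^sup>2 + real (2 ^ n) * (c * \<delta> n) = (c * T)\<^sup>2 + c * T" by simp
    show ?case
      using sum_square_bound[of "2 ^ n" "\<lambda>k. jump n k" "c * \<delta> n" "c * \<delta> n", OF i a b] unfolding eq by blast
  qed
  moreover have "0 \<le> (c * T)\<^sup>2 + c * T" using c T by simp
  ultimately show ?thesis using that by blast
qed

definition \<kappa> :: real where "\<kappa> = real CARD('d) * (real CARD('m) * K\<^sup>2)"

lemma \<kappa>: "0 \<le> \<kappa>" by (simp add: \<kappa>_def)

text \<open>The conditional isometry summed over \<open>CARD('d)\<close> coordinates, each with a
  rate made of \<open>CARD('m)\<close> squares of at most \<open>K\<^sup>2\<close>; this is the
  origin of \<open>\<kappa>\<close>.\<close>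

lemma dN_second_moment:
  assumes k: "k < 2 ^ n" and \<eta>: "\<eta> \<in> borel_measurable (F (gp n k))" "\<And>w. w \<in> space M \<Longrightarrow> 0 \<le> \<eta> w \<and> \<eta> w \<le> D"
  shows "integrable M (\<lambda>w. \<eta> w * (norm (dN n k w))\<^sup>2)"
    and "(\<integral>w. \<eta> w * (norm (dN n k w))\<^sup>2 \<partial>M) \<le> \<kappa> * \<delta> n * (\<integral>w. \<eta> w \<partial>M)"
proof -
  have \<eta>': "\<And>w. w \<in> space M \<Longrightarrow> \<bar>\<eta> w\<bar> \<le> D" using \<eta>(2) by fastforce
  have \<eta>M: "\<eta> \<in> borel_measurable M" by (rule meas_M[OF gp_nonneg \<eta>(1)])
  have \<eta>i: "integrable M \<eta>" by (rule integrable_bounded[OF \<eta>M \<eta>'])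
  have h: "has_bochner_integral M (\<lambda>w. \<Sum>c\<in>UNIV. \<eta> w * (dN n k w $ c * dN n k w $ c))
    (\<Sum>c\<in>UNIV. \<integral>w. \<eta> w * (\<integral>s. indicator (seg n k) s * GG c c s w \<partial>lborel) \<partial>M)"
    unfolding GG_def by (intro has_bochner_integral_sum N_moments(2)[OF _ _ \<eta>(1) \<eta>']) (use k in auto)
  have eq: "\<eta> w * (norm (dN n k w))\<^sup>2 = (\<Sum>c\<in>UNIV. \<eta> w * (dN n k w $ c * dN n k w $ c))" for w
    by (simp add: power2_norm_eq_inner inner_vec_def sum_distrib_left)
  show "integrable M (\<lambda>w. \<eta> w * (norm (dN n k w))\<^sup>2)"
    unfolding eq using h by (simp add: has_bochner_integral_iff)
  have le: "(\<integral>w. \<eta> w * (\<integral>s. indicator (seg n k) s * GG c c s w \<partial>lborel) \<partial>M) \<le> (\<integral>w. \<eta> w * (real CARD('m) * K\<^sup>2 * \<delta> n) \<partial>M)" for c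
  proof (rule integral_mono')
    show "integrable M (\<lambda>w. \<eta> w * (real CARD('m) * K\<^sup>2 * \<delta> n))" using \<eta>i by simp
    fix w assume w: "w \<in> space M"
    have "(\<lambda>s. GG c c s w) \<in> borel_measurable lborel"
      using measurable_compose[OF measurable_Pair2'[OF w] GG_meas, of c c] by simp
    from seg_integral(2)[of "\<lambda>s. GG c c s w", OF this, of n k "real CARD('m) * K\<^sup>2"]
    have "(\<integral>s. indicator (seg n k) s * GG c c s w \<partial>lborel) \<le> real CARD('m) * K\<^sup>2 * \<delta> n"
      using GG_le[of c c _ w] by simp
    then show "\<eta> w * (\<integral>s. indicator (seg n k) s * GG c c s w \<partial>lborel) \<le> \<eta> w * (real CARD('m) * K\<^sup>2 * \<delta> n)"
      using \<eta>(2)[OF w] by (intro mult_left_mono) auto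
    show "0 \<le> \<eta> w * (real CARD('m) * K\<^sup>2 * \<delta> n)"
      using \<eta>(2)[OF w] \<delta>_pos[of n] by (intro mult_nonneg_nonneg) auto
  qed
  have "(\<integral>w. \<eta> w * (norm (dN n k w))\<^sup>2 \<partial>M) = (\<Sum>c\<in>UNIV. \<integral>w. \<eta> w * (\<integral>s. indicator (seg n k) s * GG c c s w \<partial>lborel) \<partial>M)"
    unfolding eq using h by (simp add: has_bochner_integral_iff)
  also have "\<dots> \<le> (\<Sum>c\<in>(UNIV::'d set). \<integral>w. \<eta> w * (real CARD('m) * K\<^sup>2 * \<delta> n) \<partial>M)"
    by (intro sum_mono le)
  also have "\<dots> = \<kappa> * \<delta> n * (\<integral>w. \<eta> w \<partial>M)" by (simp add: \<kappa>_def mult_ac)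
  finally show "(\<integral>w. \<eta> w * (norm (dN n k w))\<^sup>2 \<partial>M) \<le> \<kappa> * \<delta> n * (\<integral>w. \<eta> w \<partial>M)" .
qed

text \<open>Discrete quadratic variation of the stopped integral.\<close>

definition Q :: "nat \<Rightarrow> 'a \<Rightarrow> real" where "Q n w = (\<Sum>k<2^n. (norm (dN n k w))\<^sup>2)"

lemma \<delta>_le: "\<delta> n \<le> T"
  using T by (simp add: divide_le_eq)

lemma dN_bound: "w \<in> space M \<Longrightarrow> k < 2 ^ n \<Longrightarrow> norm (dN n k w) \<le> 2 * R + K * T"
  using dN_le[of w k n] dY_le[of w k n] mult_left_mono[OF \<delta>_le K, of n] by linarith

text \<open>The diagonal terms require fourth powers of increments to be of order
  \<open>\<delta> n\<close> in the mean. Since \<open>Y\<close> is confined to a ball, increments of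
  \<open>N\<close> are at most \<open>2 * R + K * T\<close>, so a fourth power is at most a constant
  times a square.\<close>

lemma Q_moments:
  shows "integrable M (\<lambda>w. (Q n w)\<^sup>2)" "(\<integral>w. (Q n w)\<^sup>2 \<partial>M) \<le> (\<kappa> * T)\<^sup>2 + (2 * R + K * T)\<^sup>2 * \<kappa> * T"
    and "integrable M (Q n)" "(\<integral>w. Q n w \<partial>M) \<le> \<kappa> * T"
proof -
  let ?D = "(2 * R + K * T)\<^sup>2"
  let ?x = "\<lambda>k w. (norm (dN n k w))\<^sup>2"
  have xb: "0 \<le> ?x k w \<and> ?x k w \<le> ?D" if "w \<in> space M" "k < 2 ^ n" for k w
    using power_mono[OF dN_bound[OF that], of 2] by simp
  have xF: "?x k \<in> borel_measurable (F (gp n l))" if "k < l" "l \<le> 2 ^ n" for k l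
  proof -
    have [measurable]: "N (gp n k) \<in> borel_measurable (F (gp n l))" "N (gp n (Suc k)) \<in> borel_measurable (F (gp n l))"
      using that by (auto intro!: meas_mono[OF _ _ N_measurable])
    show ?thesis by measurable
  qed
  have xM: "?x k \<in> borel_measurable M" if "k < 2 ^ n" for k
    using meas_M[OF gp_nonneg xF[of k "Suc k"]] that by simp
  have E1: "integrable M (?x k)" "(\<integral>w. ?x k w \<partial>M) \<le> \<kappa> * \<delta> n" if "k < 2 ^ n" for k
    using dN_second_moment[OF that, of "\<lambda>_. 1" 1] by (simp_all add: prob_space)
  have i: "integrable M (\<lambda>w. ?x k w * ?x l w)" if "k < 2 ^ n" "l < 2 ^ n" for k l
    by (rule integrable_mult_bounded[OF E1(1)[OF that(1)] xM[OF that(2)]]) (use xb that in fastforce)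
  have a: "(\<integral>w. ?x k w * ?x l w \<partial>M) \<le> (\<kappa> * \<delta> n)\<^sup>2" if kl: "k < l" "l < 2 ^ n" for k l
  proof -
    have "(\<integral>w. ?x k w * ?x l w \<partial>M) \<le> \<kappa> * \<delta> n * (\<integral>w. ?x k w \<partial>M)"
      by (rule dN_second_moment(2)[OF kl(2) xF xb]) (use kl in auto)
    also have "\<dots> \<le> \<kappa> * \<delta> n * (\<kappa> * \<delta> n)"
      using E1(2)[of k] kl \<kappa> T by (intro mult_left_mono) auto
    finally show ?thesis by (simp add: power2_eq_square)
  qed
  have b: "(\<integral>w. (?x k w)\<^sup>2 \<partial>M) \<le> ?D * (\<kappa> * \<delta> n)" if "k < 2 ^ n" for k
  proof -
    have "(\<integral>w. (?x k w)\<^sup>2 \<partial>M) \<le> (\<integral>w. ?D * ?x k w \<partial>M)"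
    proof (rule integral_mono)
      show "integrable M (\<lambda>w. (?x k w)\<^sup>2)" using i[OF that that] by (simp only: power2_eq_square[of "(norm _)\<^sup>2"])
      show "integrable M (\<lambda>w. ?D * ?x k w)" using E1(1)[OF that] by (rule integrable_mult_right)
      fix w assume "w \<in> space M"
      then have "?x k w * ?x k w \<le> ?D * ?x k w" using xb[OF _ that] by (intro mult_right_mono) auto
      then show "(?x k w)\<^sup>2 \<le> ?D * ?x k w" by (simp only: power2_eq_square[of "?x k w"])
    qed
    also have "\<dots> \<le> ?D * (\<kappa> * \<delta> n)" using mult_left_mono[OF E1(2)[OF that], of ?D] by simp
    finally show ?thesis .
  qed
  have eq: "(real (2 ^ n) * (\<kappa> * \<delta> n))\<^sup>2 + real (2 ^ n) * (?D * (\<kappa> * \<delta> n)) = (\<kappa> * T)\<^sup>2 + ?D * \<kappa> * T" by simp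
  show "integrable M (\<lambda>w. (Q n w)\<^sup>2)" "(\<integral>w. (Q n w)\<^sup>2 \<partial>M) \<le> (\<kappa> * T)\<^sup>2 + ?D * \<kappa> * T"
    using sum_square_bound[of "2 ^ n" ?x "\<kappa> * \<delta> n" "?D * (\<kappa> * \<delta> n)", OF i a b] unfolding eq Q_def by blast+
  show "integrable M (Q n)" unfolding Q_def[abs_def] using E1 by auto
  have "(\<integral>w. Q n w \<partial>M) = (\<Sum>k<2^n. \<integral>w. ?x k w \<partial>M)"
    unfolding Q_def using E1 by (intro Bochner_Integration.integral_sum) auto
  also have "\<dots> \<le> (\<Sum>k<(2::nat)^n. \<kappa> * \<delta> n)" using E1 by (intro sum_mono) auto
  also have "\<dots> = \<kappa> * T" by simp
  finally show "(\<integral>w. Q n w \<partial>M) \<le> \<kappa> * T" .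
qed

text \<open>The oscillation of the path over one step, maximised over the grid.\<close>

definition mx :: "nat \<Rightarrow> 'a \<Rightarrow> real" where "mx n w = Max ((\<lambda>k. norm (dY n k w)) ` {..<2^n})"

lemma mx_ge: "k < 2 ^ n \<Longrightarrow> norm (dY n k w) \<le> mx n w"
  unfolding mx_def by (intro Max_ge) auto

lemma mx_le: "(\<And>k. k < 2 ^ n \<Longrightarrow> norm (dY n k w) \<le> c) \<Longrightarrow> mx n w \<le> c"
  unfolding mx_def by (subst Max_le_iff) (auto simp: lessThan_empty_iff)

lemma mx_nonneg: "0 \<le> mx n w"
  using order_trans[OF norm_ge_zero mx_ge[of 0 n w]] by simp

lemma mx_meas: "mx n \<in> borel_measurable M"
  unfolding mx_def[abs_def] by (rule borel_measurable_Max) (auto intro!: measurable_compose[OF grid_measM(8) borel_measurable_norm])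

lemma mx_bound: "w \<in> space M \<Longrightarrow> mx n w \<le> 2 * R"
  by (rule mx_le) (rule dY_le)

lemma mx_tendsto:
  assumes w: "w \<in> space M" shows "(\<lambda>n. mx n w) \<longlonglongrightarrow> 0"
proof (rule LIMSEQ_I)
  fix e :: real assume e: "0 < e"
  have "uniformly_continuous_on {0..T} (\<lambda>t. Y t w)"
    by (rule compact_uniformly_continuous[OF Y_cont[OF w]]) simp
  then obtain d where d: "0 < d" "\<And>s t. s \<in> {0..T} \<Longrightarrow> t \<in> {0..T} \<Longrightarrow> dist s t < d \<Longrightarrow> dist (Y s w) (Y t w) < e / 2"
    unfolding uniformly_continuous_on_def using e half_gt_zero by metis
  have "\<forall>\<^sub>F n in sequentially. \<delta> n < d" by (rule order_tendstoD(2)[OF \<delta>_tendsto d(1)])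
  then obtain n0 where n0: "\<And>n. n \<ge> n0 \<Longrightarrow> \<delta> n < d" by (auto simp: eventually_sequentially)
  have "norm (mx n w - 0) < e" if "n0 \<le> n" for n
  proof -
    have "mx n w \<le> e / 2"
    proof (rule mx_le)
      fix k :: nat assume k: "k < 2 ^ n"
      have "dist (Y (gp n (Suc k)) w) (Y (gp n k) w) < e / 2"
        using n0[OF that] k \<delta>_pos[of n] gp_le_T[of "Suc k" n] gp_le_T[of k n]
        by (intro d(2)) (auto simp: dist_real_def gp_Suc)
      then show "norm (dY n k w) \<le> e / 2" by (simp add: dist_norm)
    qed
    then show ?thesis using e mx_nonneg[of n w] by simp
  qed
  then show "\<exists>no. \<forall>n\<ge>no. norm (mx n w - 0) < e" by blast
qed

lemma mx_sq: "w \<in> space M \<Longrightarrow> \<bar>(mx n w)\<^sup>2\<bar> \<le> (2 * R)\<^sup>2"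
  using power_mono[OF mx_bound mx_nonneg, of w n 2] by (simp only: abs_power2)

lemma mx2: "integrable M (\<lambda>w. (mx n w)\<^sup>2)"
  using borel_measurable_power[OF mx_meas[of n]] mx_sq by (rule integrable_bounded)

definition sm :: "nat \<Rightarrow> real" where "sm n = sqrt (\<integral>w. (mx n w)\<^sup>2 \<partial>M)"

lemma sm_nonneg: "0 \<le> sm n"
  unfolding sm_def by (simp add: integral_nonneg_AE)

text \<open>Each path is uniformly continuous, but there is no common modulus: the oscillation tends
  to 0 pointwise, and the bound \<open>2 * R\<close> upgrades this to convergence in
  \<open>L^2\<close>.\<close>

lemma sm_tendsto: "sm \<longlonglongrightarrow> 0"
proof -
  have "(\<lambda>n. \<integral>w. (mx n w)\<^sup>2 \<partial>M) \<longlonglongrightarrow> (\<integral>w. 0 \<partial>M)"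
  proof (rule integral_dominated_convergence[where w="\<lambda>_. (2 * R)\<^sup>2"])
    show "AE w in M. (\<lambda>n. (mx n w)\<^sup>2) \<longlonglongrightarrow> 0"
      using tendsto_power[OF mx_tendsto, of _ 2] by (intro AE_I2) simp
    show "AE w in M. norm ((mx n w)\<^sup>2) \<le> (2 * R)\<^sup>2" for n
      unfolding real_norm_def by (intro AE_I2 mx_sq)
    show "(\<lambda>w. (mx n w)\<^sup>2) \<in> borel_measurable M" for n
      using mx_meas by (rule borel_measurable_power)
  qed auto
  then have "(\<lambda>n. sqrt (\<integral>w. (mx n w)\<^sup>2 \<partial>M)) \<longlonglongrightarrow> sqrt 0"
    by (intro tendsto_real_sqrt) simp
  then show ?thesis by (simp add: sm_def[abs_def])
qed

text \<open>Single increments are replaced by the largest one. Where squares have to be summed, the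
  drift is split off and the discrete quadratic variation of \<open>N\<close> appears.\<close>

lemma err_sum_path:
  assumes w: "w \<in> space M" and \<epsilon>: "0 \<le> \<epsilon>" and d: "0 < d"
  shows "(\<Sum>k<2^n. err \<epsilon> d n k w) \<le> 2 * (C * (1 + dd * R)) * ((\<Sum>k<2^n. jump n k w) * mx n w)
    + dd * \<epsilon> * (Q n w + K\<^sup>2 * T\<^sup>2) + dd * (2 * C / d) * (Q n w * mx n w + K\<^sup>2 * T\<^sup>2 * mx n w)
    + (dd * C * (3 * K\<^sup>2 * T / 2) * \<delta> n + dd * C * K * T * mx n w)"
proof -
  have "err \<epsilon> d n k w \<le> 2 * (C * (1 + dd * R)) * (jump n k w * mx n w)
     + dd * (\<epsilon> + 2 * C / d * mx n w) * (2 * (norm (dN n k w))\<^sup>2 + 2 * (K * \<delta> n)\<^sup>2) / 2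
     + dd * C * ((K * \<delta> n)\<^sup>2 + 2 * (K * \<delta> n) * (mx n w + K * \<delta> n)) / 2" if k: "k < 2 ^ n" for k
  proof -
    have dYm: "norm (dY n k w) \<le> mx n w" by (rule mx_ge[OF k])
    have dNm: "norm (dN n k w) \<le> mx n w + K * \<delta> n" using dN_le[OF w k] dYm by linarith
    have sq: "(norm (dY n k w))\<^sup>2 \<le> 2 * (norm (dN n k w))\<^sup>2 + 2 * (K * \<delta> n)\<^sup>2"
    proof -
      have "norm (dY n k w) \<le> K * \<delta> n + norm (dN n k w)"
        unfolding dY_eq[OF w k] using norm_triangle_ineq[of "db n k w" "dN n k w"] db_le[OF w, of n k] by linarith
      then have "(norm (dY n k w))\<^sup>2 \<le> (K * \<delta> n + norm (dN n k w))\<^sup>2" by (intro power_mono) auto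
      also have "\<dots> \<le> 2 * (norm (dN n k w))\<^sup>2 + 2 * (K * \<delta> n)\<^sup>2"
        using zero_le_power2[of "K * \<delta> n - norm (dN n k w)"] unfolding power2_sum power2_diff by linarith
      finally show ?thesis .
    qed
    have Kd: "0 \<le> K * \<delta> n" using K T by simp
    have Cd: "0 \<le> 2 * C / d" using C d by simp
    show ?thesis
      unfolding err_def
    proof (intro add_mono divide_right_mono mult_left_mono mult_mono dYm dNm sq)
      show "0 \<le> dd * (\<epsilon> + 2 * C / d * mx n w)"
        using dd \<epsilon> mx_nonneg[of n w] Cd by (intro mult_nonneg_nonneg add_nonneg_nonneg) auto
      show "0 \<le> 2 * (C * (1 + dd * R))" using C dd R by simp
    qed (use dd C Kd Cd in auto)
  qed
  moreover have gen: "(\<Sum>k<2^n. l * (j k * m) + D * e k / 2 + c) = l * ((\<Sum>k<2^n. j k) * m) + D * (\<Sum>k<2^n. e k) / 2 + 2 ^ n * c"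
    for l m D c :: real and j e :: "nat \<Rightarrow> real"
    by (simp add: sum.distrib sum_distrib_left sum_distrib_right sum_divide_distrib)
  ultimately have "(\<Sum>k<2^n. err \<epsilon> d n k w) \<le> (\<Sum>k<2^n. 2 * (C * (1 + dd * R)) * (jump n k w * mx n w)
     + dd * (\<epsilon> + 2 * C / d * mx n w) * (2 * (norm (dN n k w))\<^sup>2 + 2 * (K * \<delta> n)\<^sup>2) / 2
     + dd * C * ((K * \<delta> n)\<^sup>2 + 2 * (K * \<delta> n) * (mx n w + K * \<delta> n)) / 2)"
    by (intro sum_mono) auto
  also have "\<dots> = 2 * (C * (1 + dd * R)) * ((\<Sum>k<2^n. jump n k w) * mx n w)
     + dd * (\<epsilon> + 2 * C / d * mx n w) * (\<Sum>k<2^n. 2 * (norm (dN n k w))\<^sup>2 + 2 * (K * \<delta> n)\<^sup>2) / 2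
     + 2 ^ n * (dd * C * ((K * \<delta> n)\<^sup>2 + 2 * (K * \<delta> n) * (mx n w + K * \<delta> n)) / 2)"
    by (rule gen)
  also have "(\<Sum>k<2^n. 2 * (norm (dN n k w))\<^sup>2 + 2 * (K * \<delta> n)\<^sup>2) = 2 * Q n w + 2 * (K\<^sup>2 * T * \<delta> n)"
    by (simp add: sum.distrib sum_distrib_left Q_def power2_eq_square)
  also have "2 ^ n * (dd * C * ((K * \<delta> n)\<^sup>2 + 2 * (K * \<delta> n) * (mx n w + K * \<delta> n)) / 2)
     = dd * C * (3 * K\<^sup>2 * T / 2) * \<delta> n + dd * C * K * T * mx n w"
    by (simp add: power2_eq_square field_simps)
  also have "dd * (\<epsilon> + 2 * C / d * mx n w) * (2 * Q n w + 2 * (K\<^sup>2 * T * \<delta> n)) / 2 = dd * (\<epsilon> + 2 * C / d * mx n w) * (Q n w + K\<^sup>2 * T * \<delta> n)"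
    by simp
  also have "dd * (\<epsilon> + 2 * C / d * mx n w) * (Q n w + K\<^sup>2 * T * \<delta> n) \<le> dd * (\<epsilon> + 2 * C / d * mx n w) * (Q n w + K\<^sup>2 * T\<^sup>2)"
  proof (intro mult_left_mono add_left_mono)
    show "K\<^sup>2 * T * \<delta> n \<le> K\<^sup>2 * T\<^sup>2"
    proof -
      have "K\<^sup>2 * T * \<delta> n \<le> K\<^sup>2 * T * T" by (intro mult_left_mono \<delta>_le) (use T in simp)
      then show ?thesis by (simp only: power2_eq_square[of T] mult.assoc)
    qed
    show "0 \<le> dd * (\<epsilon> + 2 * C / d * mx n w)"
      using dd \<epsilon> mx_nonneg[of n w] C d by (intro mult_nonneg_nonneg add_nonneg_nonneg) auto
  qed
  also have "dd * (\<epsilon> + 2 * C / d * mx n w) * (Q n w + K\<^sup>2 * T\<^sup>2)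
    = dd * \<epsilon> * (Q n w + K\<^sup>2 * T\<^sup>2) + dd * (2 * C / d) * (Q n w * mx n w + K\<^sup>2 * T\<^sup>2 * mx n w)"
    by (simp add: algebra_simps)
  finally show ?thesis by (simp add: add.assoc)
qed

text \<open>For fixed \<open>\<epsilon>\<close> and \<open>d\<close> all terms but one carry a
  factor \<open>sm n\<close> or \<open>\<delta> n\<close> and disappear in the limit, whatever the
  size of \<open>2 * C / d\<close>. The remaining term is \<open>\<epsilon>\<close> times a bounded
  quantity.\<close>

lemma err_sum_small:
  assumes \<epsilon>: "0 < \<epsilon>" and d: "0 < d"
  shows "\<forall>\<^sub>F n in sequentially. (\<Sum>k<2^n. \<integral>w. err \<epsilon> d n k w \<partial>M) \<le> (dd * (\<kappa> * T + K\<^sup>2 * T\<^sup>2) + 1) * \<epsilon>"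
proof -
  obtain CJ where CJ: "0 \<le> CJ" and
    J: "\<forall>\<^sub>F n in sequentially. integrable M (\<lambda>w. (\<Sum>k<2^n. jump n k w)\<^sup>2) \<and> (\<integral>w. (\<Sum>k<2^n. jump n k w)\<^sup>2 \<partial>M) \<le> CJ"
    by (rule jumps_square)
  define CQ where "CQ = (\<kappa> * T)\<^sup>2 + (2 * R + K * T)\<^sup>2 * \<kappa> * T"
  define L where "L = 2 * (C * (1 + dd * R))"
  have L: "0 \<le> L" using C dd R by (simp add: L_def)
  define \<rho> where "\<rho> n = L * (sqrt CJ * sm n) + dd * (2 * C / d) * (sqrt CQ * sm n + K\<^sup>2 * T\<^sup>2 * sm n)
    + (dd * C * (3 * K\<^sup>2 * T / 2) * \<delta> n + dd * C * K * T * sm n)" for n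
  have "\<rho> \<longlonglongrightarrow> L * (sqrt CJ * 0) + dd * (2 * C / d) * (sqrt CQ * 0 + K\<^sup>2 * T\<^sup>2 * 0)
    + (dd * C * (3 * K\<^sup>2 * T / 2) * 0 + dd * C * K * T * 0)"
    unfolding \<rho>_def[abs_def] by (intro tendsto_add tendsto_mult tendsto_const sm_tendsto \<delta>_tendsto)
  then have "\<rho> \<longlonglongrightarrow> 0" by simp
  from order_tendstoD(2)[OF this \<epsilon>] J
  show ?thesis
  proof eventually_elim
    case (elim n)
    define Jn where "Jn w = (\<Sum>k<2^n. jump n k w)" for w
    note [measurable] = mx_meas
    have [measurable]: "Jn \<in> borel_measurable M"
      unfolding Jn_def[abs_def] by (intro borel_measurable_sum) (auto intro: grid_measM)
    have [measurable]: "Q n \<in> borel_measurable M" using Q_moments(3) by auto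
    have J2: "integrable M (\<lambda>w. (Jn w)\<^sup>2)" "(\<integral>w. (Jn w)\<^sup>2 \<partial>M) \<le> CJ" using elim(2) unfolding Jn_def by blast+
    have Q2: "integrable M (\<lambda>w. (Q n w)\<^sup>2)" "(\<integral>w. (Q n w)\<^sup>2 \<partial>M) \<le> CQ" using Q_moments by (auto simp: CQ_def)
    have absI: "(\<integral>w. f w \<partial>M) \<le> (\<integral>w. \<bar>f w\<bar> \<partial>M)" for f :: "'a \<Rightarrow> real"
      using integral_abs_bound[of M f] by linarith
    have Jm: "integrable M (\<lambda>w. Jn w * mx n w)" "(\<integral>w. Jn w * mx n w \<partial>M) \<le> sqrt CJ * sm n"
    proof -
      show "integrable M (\<lambda>w. Jn w * mx n w)"
        by (rule Cauchy_Schwarz_integral) (use J2 mx2 in auto)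
      have "(\<integral>w. \<bar>Jn w * mx n w\<bar> \<partial>M) \<le> sqrt (\<integral>w. (Jn w)\<^sup>2 \<partial>M) * sm n"
        unfolding sm_def by (rule Cauchy_Schwarz_integral) (use J2 mx2 in auto)
      also have "\<dots> \<le> sqrt CJ * sm n" using J2 sm_nonneg by (intro mult_right_mono) auto
      finally show "(\<integral>w. Jn w * mx n w \<partial>M) \<le> sqrt CJ * sm n" using absI by (rule order_trans[rotated])
    qed
    have Qm: "integrable M (\<lambda>w. Q n w * mx n w)" "(\<integral>w. Q n w * mx n w \<partial>M) \<le> sqrt CQ * sm n"
    proof -
      show "integrable M (\<lambda>w. Q n w * mx n w)"
        by (rule Cauchy_Schwarz_integral) (use Q2 mx2 in auto)
      have "(\<integral>w. \<bar>Q n w * mx n w\<bar> \<partial>M) \<le> sqrt (\<integral>w. (Q n w)\<^sup>2 \<partial>M) * sm n"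
        unfolding sm_def by (rule Cauchy_Schwarz_integral) (use Q2 mx2 in auto)
      also have "\<dots> \<le> sqrt CQ * sm n" using Q2 sm_nonneg by (intro mult_right_mono) auto
      finally show "(\<integral>w. Q n w * mx n w \<partial>M) \<le> sqrt CQ * sm n" using absI by (rule order_trans[rotated])
    qed
    have m1: "integrable M (mx n)" "(\<integral>w. mx n w \<partial>M) \<le> sm n"
    proof -
      show "integrable M (mx n)"
        using Cauchy_Schwarz_integral(1)[of "\<lambda>_. 1" M "mx n"] mx2 by simp
      have "(\<integral>w. \<bar>1 * mx n w\<bar> \<partial>M) \<le> sqrt (\<integral>w. 1\<^sup>2 \<partial>M) * sm n"
        unfolding sm_def by (rule Cauchy_Schwarz_integral) (use mx2 in auto)
      then show "(\<integral>w. mx n w \<partial>M) \<le> sm n" using absI[of "mx n"] by (simp add: prob_space)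
    qed
    have ei: "integrable M (\<lambda>w. \<Sum>k<2^n. err \<epsilon> d n k w)"
      by (intro Bochner_Integration.integrable_sum err_integrable) simp
    have "(\<Sum>k<2^n. \<integral>w. err \<epsilon> d n k w \<partial>M) = (\<integral>w. (\<Sum>k<2^n. err \<epsilon> d n k w) \<partial>M)"
      by (intro Bochner_Integration.integral_sum[symmetric] err_integrable) simp
    also have "\<dots> \<le> (\<integral>w. L * (Jn w * mx n w)
      + dd * \<epsilon> * (Q n w + K\<^sup>2 * T\<^sup>2) + dd * (2 * C / d) * (Q n w * mx n w + K\<^sup>2 * T\<^sup>2 * mx n w)
      + (dd * C * (3 * K\<^sup>2 * T / 2) * \<delta> n + dd * C * K * T * mx n w) \<partial>M)"
    proof (rule integral_mono[OF ei])
      show "integrable M (\<lambda>w. L * (Jn w * mx n w)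
        + dd * \<epsilon> * (Q n w + K\<^sup>2 * T\<^sup>2) + dd * (2 * C / d) * (Q n w * mx n w + K\<^sup>2 * T\<^sup>2 * mx n w)
        + (dd * C * (3 * K\<^sup>2 * T / 2) * \<delta> n + dd * C * K * T * mx n w))"
        by (intro Bochner_Integration.integrable_add integrable_mult_right Jm Qm m1 Q_moments integrable_const)
      fix w assume "w \<in> space M"
      from err_sum_path[OF this less_imp_le[OF \<epsilon>] d, of n]
      show "(\<Sum>k<2^n. err \<epsilon> d n k w) \<le> L * (Jn w * mx n w)
        + dd * \<epsilon> * (Q n w + K\<^sup>2 * T\<^sup>2) + dd * (2 * C / d) * (Q n w * mx n w + K\<^sup>2 * T\<^sup>2 * mx n w)
        + (dd * C * (3 * K\<^sup>2 * T / 2) * \<delta> n + dd * C * K * T * mx n w)"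
        unfolding L_def Jn_def .
    qed
    also have "\<dots> = L * (\<integral>w. Jn w * mx n w \<partial>M)
      + dd * \<epsilon> * ((\<integral>w. Q n w \<partial>M) + K\<^sup>2 * T\<^sup>2) + dd * (2 * C / d) * ((\<integral>w. Q n w * mx n w \<partial>M) + K\<^sup>2 * T\<^sup>2 * (\<integral>w. mx n w \<partial>M))
      + (dd * C * (3 * K\<^sup>2 * T / 2) * \<delta> n + dd * C * K * T * (\<integral>w. mx n w \<partial>M))"
      using Jm(1) Qm(1) m1(1) Q_moments(3)[of n]
      by (subst Bochner_Integration.integral_add | subst integral_mult_right | intro Bochner_Integration.integrable_add integrable_mult_right integrable_const | simp add: prob_space)+
    also have "\<dots> \<le> L * (sqrt CJ * sm n)
      + dd * \<epsilon> * (\<kappa> * T + K\<^sup>2 * T\<^sup>2) + dd * (2 * C / d) * (sqrt CQ * sm n + K\<^sup>2 * T\<^sup>2 * sm n)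
      + (dd * C * (3 * K\<^sup>2 * T / 2) * \<delta> n + dd * C * K * T * sm n)"
      using L dd C d K T \<epsilon> by (intro add_mono mult_left_mono Jm Qm m1 Q_moments order_refl) auto
    also have "\<dots> = dd * (\<kappa> * T + K\<^sup>2 * T\<^sup>2) * \<epsilon> + \<rho> n" by (simp add: \<rho>_def)
    also have "\<dots> \<le> (dd * (\<kappa> * T + K\<^sup>2 * T\<^sup>2) + 1) * \<epsilon>" using elim(1) by (simp add: distrib_right)
    finally show ?case .
  qed
qed

section \<open>The integrand on the grid and its limit\<close>

definition LW :: "real \<Rightarrow> 'a \<Rightarrow> real" where
  "LW s w = Wt (Y s w) s (r s w) + Wx (Y s w) s (r s w) \<bullet> b s w
     + (\<Sum>l\<in>UNIV. \<Sum>c\<in>UNIV. Wxx (Y s w) s (r s w) $ l $ c * GG l c s w) / 2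
     + (\<Sum>j\<in>UNIV. \<Gamma> $ r s w $ j * W (Y s w) s j)"

text \<open>The chain is evaluated at the running time instead of the grid points of \<open>\<phi>\<close>: its paths are only right
  continuous, so \<open>\<phi>\<close> need not converge pointwise, whereas the two differ only on steps with a jump.\<close>

definition \<phi>' :: "nat \<Rightarrow> nat \<Rightarrow> real \<Rightarrow> 'a \<Rightarrow> real" where
  "\<phi>' n k s w = alive n k w * (Wt (Yg n (Suc k) w) s (r (max 0 s) w)
     + Wx (Yg n k w) (gp n k) (r (max 0 s) w) \<bullet> b s w
     + (\<Sum>l\<in>UNIV. \<Sum>c\<in>UNIV. Wxx (Yg n k w) (gp n k) (r (max 0 s) w) $ l $ c * GG l c s w) / 2
     + (\<Sum>j\<in>UNIV. \<Gamma> $ r (max 0 s) w $ j * W (Yg n k w) (gp n k) j))"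

lemmas r_joint = chain_joint[OF mc]

lemma \<phi>'_meas:
  assumes k: "k < 2 ^ n"
  shows "(\<lambda>x. \<phi>' n k (fst x) (snd x)) \<in> borel_measurable LM"
proof -
  have [measurable]: "(\<lambda>x. b (fst x) (snd x)) \<in> borel_measurable LM"
    using b_meas by (simp add: split_beta')
  note mY = snd_meas[OF grid_measM(1)[OF k]]
  have [measurable]: "(\<lambda>x. Wt (Yg n (Suc k) (snd x)) (fst x) (r (max 0 (fst x)) (snd x))) \<in> borel_measurable LM"
  proof -
    have "(\<lambda>x. (Yg n (Suc k) (snd x), fst x)) \<in> borel_measurable LM"
      using snd_meas[OF grid_measM(2)[OF k]] by (rule borel_measurable_Pair) measurable
    from measurable_switched[OF this r_joint, where h="\<lambda>(z, s) i. Wt z s i"] Wt_cont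
    show ?thesis by (simp add: split_beta')
  qed
  have [measurable]: "(\<lambda>x. Wx (Yg n k (snd x)) (gp n k) (r (max 0 (fst x)) (snd x))) \<in> borel_measurable LM"
    by (rule measurable_switched[OF mY r_joint]) (rule continuous_on_slice[OF Wx_cont])
  have [measurable]: "(\<lambda>x. Wxx (Yg n k (snd x)) (gp n k) (r (max 0 (fst x)) (snd x))) \<in> borel_measurable LM"
    by (rule measurable_switched[OF mY r_joint]) (rule continuous_on_slice[OF Wxx_cont])
  have [measurable]: "(\<lambda>x. \<Sum>j\<in>UNIV. \<Gamma> $ r (max 0 (fst x)) (snd x) $ j * W (Yg n k (snd x)) (gp n k) j) \<in> borel_measurable LM"
    by (rule measurable_switched[OF mY r_joint, where h="\<lambda>z i. \<Sum>j\<in>UNIV. \<Gamma> $ i $ j * W z (gp n k) j"])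
      (intro continuous_intros continuous_on_slice[OF W_cont])
  show ?thesis
    unfolding \<phi>'_def by measurable
qed

lemma \<phi>'_le:
  assumes "w \<in> space M" "k < 2 ^ n" "s \<in> seg n k"
  shows "\<bar>\<phi>' n k s w\<bar> \<le> C\<phi>"
proof -
  have "\<bar>Wt (Yg n (Suc k) w) s (r (max 0 s) w)
     + Wx (Yg n k w) (gp n k) (r (max 0 s) w) \<bullet> b s w
     + (\<Sum>l\<in>UNIV. \<Sum>c\<in>UNIV. Wxx (Yg n k w) (gp n k) (r (max 0 s) w) $ l $ c * GG l c s w) / 2
     + (\<Sum>j\<in>UNIV. \<Gamma> $ r (max 0 s) w $ j * W (Yg n k w) (gp n k) j)\<bar> \<le> C\<phi>"
    using assms Yg_le[OF assms(1)] gp_le_T[of k n] gp_le_T[of "Suc k" n] gp_nonneg[of n k]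
    by (intro integrand_le) (auto simp del: gp_nonneg)
  then show ?thesis using C\<phi> by (simp add: \<phi>'_def)
qed

text \<open>The cells are glued into one function on the product space, so that the limit in
  \<open>n\<close> can be taken by dominated convergence.\<close>

definition en :: "nat \<Rightarrow> real \<times> 'a \<Rightarrow> real" where
  "en n x = (\<Sum>k<2^n. indicator (seg n k) (fst x) * \<phi>' n k (fst x) (snd x))"

lemma seg_disjoint:
  assumes "s \<in> seg n j" "s \<in> seg n k"
  shows "j = k"
proof (rule ccontr)
  assume "j \<noteq> k"
  then have "gp n (Suc j) \<le> gp n k \<or> gp n (Suc k) \<le> gp n j" by (auto simp: Suc_le_eq)
  then show False using assms unfolding greaterThanAtMost_iff by linarith
qed

lemma seg_cover:
  assumes s: "s \<in> {0<..T}"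
  obtains k where "k < 2 ^ n" "s \<in> seg n k"
proof -
  have "\<exists>k<q. s \<in> seg n k" if "0 < s" "s \<le> gp n q" for q
    using that
  proof (induction q)
    case (Suc q)
    then show ?case by (cases "s \<le> gp n q") (auto intro: less_SucI)
  qed simp
  from this[of "2 ^ n"] s that show ?thesis by auto
qed

lemma seg_subset: "k < 2 ^ n \<Longrightarrow> seg n k \<subseteq> {0<..T}"
  using gp_le_T[of "Suc k" n] gp_nonneg[of n k] by (auto simp del: gp_nonneg)

lemma en_eq:
  assumes "s \<in> {0<..T}" "k < 2 ^ n" "s \<in> seg n k"
  shows "en n (s, w) = \<phi>' n k s w"
proof -
  have u: "j = k" if "s \<in> seg n j" for j using seg_disjoint[OF that assms(3)] .
  have "en n (s, w) = (\<Sum>j<2^n. if j = k then \<phi>' n k s w else 0)"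
    unfolding en_def fst_conv snd_conv
  proof (intro sum.cong refl)
    fix j
    show "indicator (seg n j) s * \<phi>' n j s w = (if j = k then \<phi>' n k s w else 0)"
    proof (cases "j = k")
      case True
      have "indicator (seg n k) s = (1::real)" by (rule indicator_simps(1)[OF assms(3)])
      with True show ?thesis by (simp only: if_True mult_1_left simp_thms)
    next
      case False
      then have "s \<notin> seg n j" using u by blast
      then have "indicator (seg n j) s = (0::real)" by (rule indicator_simps(2))
      with False show ?thesis by (simp only: if_False mult_zero_left)
    qed
  qed
  then show ?thesis using assms(2) by simp
qed

lemma en_eq_0: "s \<notin> {0<..T} \<Longrightarrow> en n (s, w) = 0"
  unfolding en_def fst_conv snd_conv
proof (intro sum.neutral ballI)
  fix k :: nat assume "s \<notin> {0<..T}" "k \<in> {..<2 ^ n}"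
  then have "s \<notin> seg n k" using seg_subset[of k n] by blast
  then show "indicator (seg n k) s * \<phi>' n k s w = 0" by (metis indicator_simps(2) mult_zero_left)
qed

lemma en_meas: "en n \<in> borel_measurable LM"
  unfolding en_def[abs_def] by (intro borel_measurable_sum borel_measurable_times \<phi>'_meas) auto

lemma tendsto_slice:
  fixes h :: "real^'d \<Rightarrow> real \<Rightarrow> 'z::topological_space"
  assumes "continuous_on UNIV (\<lambda>(z, t). h z t)" "Z \<longlonglongrightarrow> z" "tn \<longlonglongrightarrow> t"
  shows "(\<lambda>n. h (Z n) (tn n)) \<longlonglongrightarrow> h z t"
  using continuous_on_tendsto_compose[OF assms(1) tendsto_Pair[OF assms(2,3)]] by simp

text \<open>The cell around \<open>s\<close> shrinks to \<open>s\<close> while the chain is already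
  evaluated at \<open>s\<close>, so the limit rests on continuity of \<open>Y\<close> and of the
  derivatives of \<open>W\<close>.\<close>

lemma en_tendsto:
  assumes w: "w \<in> space M"
  shows "(\<lambda>n. en n (s, w)) \<longlonglongrightarrow> indicator {0<..T} s * (of_bool (s \<le> \<sigma> w) * LW s w)"
proof (cases "s \<in> {0<..T}")
  case False
  then show ?thesis by (simp add: en_eq_0)
next
  case True
  then have s: "0 < s" "s \<le> T" by auto
  have "\<exists>k. k < 2 ^ n \<and> s \<in> seg n k" for n
    by (rule seg_cover[OF True, of n]) blast
  then obtain k where k: "\<And>n. k n < 2 ^ n" "\<And>n. s \<in> seg n (k n)" by metis
  have t1: "(\<lambda>n. gp n (k n)) \<longlonglongrightarrow> s"
  proof (rule tendsto_sandwich[of "\<lambda>n. s - \<delta> n" _ _ "\<lambda>_. s"])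
    show "(\<lambda>n. s - \<delta> n) \<longlonglongrightarrow> s" using tendsto_diff[OF tendsto_const \<delta>_tendsto, of s] by simp
  qed (use k(2) in \<open>auto simp: gp_Suc algebra_simps intro!: always_eventually less_imp_le\<close>)
  have t2: "(\<lambda>n. gp n (Suc (k n))) \<longlonglongrightarrow> s"
    using tendsto_add[OF t1 \<delta>_tendsto] by (simp add: gp_Suc)
  have Yt: "(\<lambda>n. Yg n (k n) w) \<longlonglongrightarrow> Y s w" "(\<lambda>n. Yg n (Suc (k n)) w) \<longlonglongrightarrow> Y s w"
    by (rule continuous_on_tendsto_compose[OF Y_cont[OF w]];
        use t1 t2 s k(1) gp_le_T in \<open>auto intro!: always_eventually simp: Suc_le_eq less_imp_le\<close>)+
  \<comment> \<open>Cells are open on the left, so the left end lies strictly before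
    \<open>s\<close>; hence \<open>s = \<sigma> w\<close> still counts as alive in the
    limit.\<close>
  have al: "(\<lambda>n. alive n (k n) w) \<longlonglongrightarrow> of_bool (s \<le> \<sigma> w)"
  proof (rule tendsto_eventually, cases "s \<le> \<sigma> w")
    case True
    have "gp n (k n) < \<sigma> w" for n using k(2)[of n] True by auto
    then show "\<forall>\<^sub>F n in sequentially. alive n (k n) w = of_bool (s \<le> \<sigma> w)" using True by simp
  next
    case False
    then have "\<forall>\<^sub>F n in sequentially. \<sigma> w < gp n (k n)" by (intro order_tendstoD(1)[OF t1]) simp
    then show "\<forall>\<^sub>F n in sequentially. alive n (k n) w = of_bool (s \<le> \<sigma> w)"
      by eventually_elim (use False in auto)
  qed
  have ms: "max 0 s = s" using s by simp
  have "(\<lambda>n. \<phi>' n (k n) s w) \<longlonglongrightarrow> of_bool (s \<le> \<sigma> w) * LW s w"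
    unfolding \<phi>'_def LW_def ms
    by (intro tendsto_mult al tendsto_add tendsto_sum tendsto_inner tendsto_divide tendsto_const tendsto_vec_nth
        tendsto_slice[OF Wt_cont] tendsto_slice[OF Wx_cont] tendsto_slice[OF Wxx_cont] tendsto_slice[OF W_cont] Yt t1) simp
  moreover have "en n (s, w) = \<phi>' n (k n) s w" for n by (rule en_eq[OF True k])
  ultimately show ?thesis using True by simp
qed

lemma en_le:
  assumes "w \<in> space M" shows "\<bar>en n (s, w)\<bar> \<le> C\<phi> * indicator {0<..T} s"
proof (cases "s \<in> {0<..T}")
  case True
  obtain k where k: "k < 2 ^ n" "s \<in> seg n k" by (rule seg_cover[OF True, of n]) blast
  show ?thesis using \<phi>'_le[OF assms k] en_eq[OF True k] True by simp
qed (simp add: en_eq_0)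

definition LWi :: "real \<times> 'a \<Rightarrow> real" where
  "LWi x = indicator {0<..T} (fst x) * (of_bool (fst x \<le> \<sigma> (snd x)) * LW (fst x) (snd x))"

lemma LWi: "integrable LM LWi"
  and en_integral_tendsto: "(\<lambda>n. \<integral>x. en n x \<partial>LM) \<longlonglongrightarrow> (\<integral>x. LWi x \<partial>LM)"
proof -
  have lim: "(\<lambda>n. en n x) \<longlonglongrightarrow> LWi x" if "x \<in> space LM" for x
    using en_tendsto[of "snd x" "fst x"] that by (simp add: LWi_def space_pair_measure mem_Times_iff)
  have m: "LWi \<in> borel_measurable LM"
    by (rule borel_measurable_LIMSEQ_metric[OF en_meas lim])
  have w: "integrable LM (\<lambda>x. C\<phi> * indicator {0<..T} (fst x))"
    using integrable_mult_right[OF prod_integrable[of "\<lambda>_. 1" 0 T 1], of C\<phi>] T by simp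
  have le: "AE x in LM. norm (en n x) \<le> C\<phi> * indicator {0<..T} (fst x)" for n
  proof (rule AE_I2)
    fix x assume x: "x \<in> space LM"
    then show "norm (en n x) \<le> C\<phi> * indicator {0<..T} (fst x)"
      using en_le[of "snd x" n "fst x"] by (simp add: space_pair_measure mem_Times_iff)
  qed
  have AElim: "AE x in lborel \<Otimes>\<^sub>M M. (\<lambda>n. en n x) \<longlonglongrightarrow> LWi x" by (rule AE_I2[OF lim])
  note dct = m en_meas w AElim le
  show "integrable LM LWi" by (rule integrable_dominated_convergence[OF dct])
  show "(\<lambda>n. \<integral>x. en n x \<partial>LM) \<longlonglongrightarrow> (\<integral>x. LWi x \<partial>LM)"
    by (rule integral_dominated_convergence[OF dct])
qed

text \<open>The integrands differ at \<open>s\<close> only if the chain at \<open>s\<close> differs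
  from the chain at an end of its cell. This has probability of order \<open>\<delta> n\<close>, so
  each cell contributes order \<open>\<delta> n\<close> squared and the whole grid order
  \<open>\<delta> n\<close>.\<close>

lemma \<phi>_diff:
  obtains c where "0 \<le> c" "\<forall>\<^sub>F n in sequentially.
    (\<Sum>k<2^n. \<integral>x. indicator (seg n k) (fst x) * \<phi> n k (fst x) (snd x) \<partial>LM)
      \<le> (\<integral>x. en n x \<partial>LM) + c * \<delta> n"
proof -
  interpret pair_sigma_finite lborel M ..
  obtain c \<delta>\<^sub>0 where c: "0 \<le> c" "0 < \<delta>\<^sub>0"
    "\<And>s \<delta> \<eta> K. 0 \<le> s \<Longrightarrow> 0 < \<delta> \<Longrightarrow> \<delta> < \<delta>\<^sub>0 \<Longrightarrow> \<eta> \<in> borel_measurable (F s) \<Longrightarrow> (\<And>w. w \<in> space M \<Longrightarrow> 0 \<le> \<eta> w \<and> \<eta> w \<le> K) \<Longrightarrow>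
       (\<integral>w. \<eta> w * of_bool (r (s + \<delta>) w \<noteq> r s w) \<partial>M) \<le> c * \<delta> * (\<integral>w. \<eta> w \<partial>M)"
    by (rule chain_jump[OF mc]) blast
  have "\<forall>\<^sub>F n in sequentially.
    (\<Sum>k<2^n. \<integral>x. indicator (seg n k) (fst x) * \<phi> n k (fst x) (snd x) \<partial>LM)
      \<le> (\<integral>x. en n x \<partial>LM) + (2 * C\<phi> * (2 * c) * T) * \<delta> n"
    using order_tendstoD(2)[OF \<delta>_tendsto c(2)]
  proof eventually_elim
    case (elim n)
    \<comment> \<open>The jump estimate holds for every positive time increment below its threshold,
      hence also for part of a cell.\<close>
    have jp: "(\<integral>w. of_bool (r t w \<noteq> r s w) \<partial>M) \<le> c * \<delta> n" if "0 \<le> s" "s \<le> t" "t - s \<le> \<delta> n" for s t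
    proof (cases "s = t")
      case True
      then show ?thesis using c(1) T by simp
    next
      case False
      have "(\<integral>w. 1 * of_bool (r (s + (t - s)) w \<noteq> r s w) \<partial>M) \<le> c * (t - s) * (\<integral>w. 1 \<partial>M)"
        by (rule c(3)[of s "t - s" "\<lambda>_. 1" 1]) (use that False elim in auto)
      also have "\<dots> \<le> c * \<delta> n" using mult_left_mono[OF that(3) c(1)] by (simp add: prob_space)
      finally show ?thesis by simp
    qed
    define g where "g k x = 2 * C\<phi> * (of_bool (rg n k (snd x) \<noteq> r (max 0 (fst x)) (snd x)) + of_bool (rg n (Suc k) (snd x) \<noteq> r (max 0 (fst x)) (snd x)))" for k and x :: "real \<times> 'a"
    have gm: "g k \<in> borel_measurable LM" for k
    proof -
      note [measurable] = r_joint snd_meas[OF r_measM[OF gp_nonneg, of n k]] snd_meas[OF r_measM[OF gp_nonneg, of n "Suc k"]]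
      have "(\<lambda>x. of_bool (rg n k (snd x) \<noteq> r (max 0 (fst x)) (snd x)) :: real) \<in> borel_measurable LM"
        "(\<lambda>x. of_bool (rg n (Suc k) (snd x) \<noteq> r (max 0 (fst x)) (snd x)) :: real) \<in> borel_measurable LM"
        by measurable
      then show ?thesis unfolding g_def[abs_def] by (intro borel_measurable_times borel_measurable_add) auto
    qed
    have gi: "integrable LM (\<lambda>x. indicator (seg n k) (fst x) * g k x)" for k
      by (rule prod_integrable[OF gm, where B'="4 * C\<phi>"]) (use C\<phi> in \<open>auto simp: g_def\<close>)
    have gI: "(\<integral>x. indicator (seg n k) (fst x) * g k x \<partial>LM) \<le> (2 * C\<phi> * (2 * c) * \<delta> n) * \<delta> n" if k: "k < 2 ^ n" for k
    proof -
      \<comment> \<open>Time is integrated last: for each fixed time the probability of a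
        discrepancy is estimated first.\<close>
      have "(\<integral>x. indicator (seg n k) (fst x) * g k x \<partial>LM) = (\<integral>s. (\<integral>w. indicator (seg n k) s * g k (s, w) \<partial>M) \<partial>lborel)"
        using integral_fst'[OF gi[of k]] by simp
      also have "\<dots> \<le> (\<integral>s. indicator (seg n k) s * (2 * C\<phi> * (2 * c) * \<delta> n) \<partial>lborel)"
      proof (rule integral_mono')
        show "integrable lborel (\<lambda>s. indicator (seg n k) s * (2 * C\<phi> * (2 * c) * \<delta> n))"
          using \<delta>_pos[of n] by (intro integrable_mult_left integrable_real_indicator) (auto simp: gp_Suc)
        show "0 \<le> indicator (seg n k) s * (2 * C\<phi> * (2 * c) * \<delta> n)" for s
          using C\<phi> c(1) T by simp
        fix s :: real
        show "(\<integral>w. indicator (seg n k) s * g k (s, w) \<partial>M) \<le> indicator (seg n k) s * (2 * C\<phi> * (2 * c) * \<delta> n)"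
        proof (cases "s \<in> seg n k")
          case True
          have s0: "0 < s" using True gp_nonneg[of n k] by (auto simp del: gp_nonneg)
          have j12: "(\<integral>w. of_bool (r s w \<noteq> rg n k w) \<partial>M) \<le> c * \<delta> n" "(\<integral>w. of_bool (rg n (Suc k) w \<noteq> r s w) \<partial>M) \<le> c * \<delta> n"
            using True s0 jp[of "gp n k" s] jp[of s "gp n (Suc k)"] by (auto simp: gp_Suc)
          have [measurable]: "r s \<in> measurable M (count_space UNIV)" "rg n k \<in> measurable M (count_space UNIV)" "rg n (Suc k) \<in> measurable M (count_space UNIV)"
            using s0 by (auto intro!: r_measM)
          have i: "integrable M (\<lambda>w. of_bool (r s w \<noteq> rg n k w) :: real)" "integrable M (\<lambda>w. of_bool (rg n (Suc k) w \<noteq> r s w) :: real)"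
            by (rule integrable_bounded[of _ 1]; (measurable | simp))+
          have "(\<integral>w. g k (s, w) \<partial>M) = (\<integral>w. 2 * C\<phi> * (of_bool (r s w \<noteq> rg n k w) + of_bool (rg n (Suc k) w \<noteq> r s w)) \<partial>M)"
            using s0 by (intro Bochner_Integration.integral_cong) (auto simp: g_def)
          also have "\<dots> = 2 * C\<phi> * ((\<integral>w. of_bool (r s w \<noteq> rg n k w) \<partial>M) + (\<integral>w. of_bool (rg n (Suc k) w \<noteq> r s w) \<partial>M))"
            using i by (simp only: integral_mult_right_zero Bochner_Integration.integral_add)
          finally have ge: "(\<integral>w. g k (s, w) \<partial>M) = 2 * C\<phi> * ((\<integral>w. of_bool (r s w \<noteq> rg n k w) \<partial>M) + (\<integral>w. of_bool (rg n (Suc k) w \<noteq> r s w) \<partial>M))" .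
          have "(\<integral>w. g k (s, w) \<partial>M) \<le> 2 * C\<phi> * (c * \<delta> n + c * \<delta> n)"
            unfolding ge using C\<phi> by (intro mult_left_mono add_mono j12) auto
          then show ?thesis using True by (simp add: algebra_simps)
        qed simp
      qed
      also have "\<dots> = (2 * C\<phi> * (2 * c) * \<delta> n) * \<delta> n"
        using \<delta>_pos[of n] by (simp add: gp_Suc)
      finally show ?thesis .
    qed
    have \<phi>i: "integrable LM (\<lambda>x. indicator (seg n k) (fst x) * \<phi> n k (fst x) (snd x))" if "k < 2 ^ n" for k
      by (rule prod_integrable[OF \<phi>_meas[OF that], of _ _ C\<phi>]) (use \<phi>_le[OF _ that] in auto)
    have \<phi>'i: "integrable LM (\<lambda>x. indicator (seg n k) (fst x) * \<phi>' n k (fst x) (snd x))" if "k < 2 ^ n" for k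
      by (rule prod_integrable[OF \<phi>'_meas[OF that], of _ _ C\<phi>]) (use \<phi>'_le[OF _ that] in auto)
    have step: "(\<integral>x. indicator (seg n k) (fst x) * \<phi> n k (fst x) (snd x) \<partial>LM)
      \<le> (\<integral>x. indicator (seg n k) (fst x) * \<phi>' n k (fst x) (snd x) \<partial>LM) + (2 * C\<phi> * (2 * c) * \<delta> n) * \<delta> n" if k: "k < 2 ^ n" for k
    proof -
      have "(\<integral>x. indicator (seg n k) (fst x) * \<phi> n k (fst x) (snd x) \<partial>LM)
        \<le> (\<integral>x. indicator (seg n k) (fst x) * \<phi>' n k (fst x) (snd x) + indicator (seg n k) (fst x) * g k x \<partial>LM)"
      proof (rule integral_mono[OF \<phi>i[OF k] Bochner_Integration.integrable_add[OF \<phi>'i[OF k] gi]])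
        fix x assume x: "x \<in> space LM"
        then have w: "snd x \<in> space M" by (simp add: space_pair_measure mem_Times_iff)
        show "indicator (seg n k) (fst x) * \<phi> n k (fst x) (snd x) \<le> indicator (seg n k) (fst x) * \<phi>' n k (fst x) (snd x) + indicator (seg n k) (fst x) * g k x"
        proof (cases "fst x \<in> seg n k")
          case True
          have "\<phi> n k (fst x) (snd x) \<le> \<phi>' n k (fst x) (snd x) + g k x"
          proof (cases "rg n k (snd x) = r (max 0 (fst x)) (snd x) \<and> rg n (Suc k) (snd x) = r (max 0 (fst x)) (snd x)")
            case True
            then show ?thesis by (simp add: \<phi>_def \<phi>'_def g_def)
          next
            case False
            then have "2 * C\<phi> \<le> g k x" using C\<phi> by (auto simp: g_def)
            then show ?thesis
              using \<phi>_le[OF w k True] \<phi>'_le[OF w k True] by linarith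
          qed
          then show ?thesis using True by simp
        qed simp
      qed
      also have "\<dots> = (\<integral>x. indicator (seg n k) (fst x) * \<phi>' n k (fst x) (snd x) \<partial>LM) + (\<integral>x. indicator (seg n k) (fst x) * g k x \<partial>LM)"
        by (rule Bochner_Integration.integral_add[OF \<phi>'i[OF k] gi])
      finally show ?thesis using gI[OF k] by linarith
    qed
    have "(\<Sum>k<2^n. \<integral>x. indicator (seg n k) (fst x) * \<phi> n k (fst x) (snd x) \<partial>LM)
      \<le> (\<Sum>k<2^n. (\<integral>x. indicator (seg n k) (fst x) * \<phi>' n k (fst x) (snd x) \<partial>LM) + (2 * C\<phi> * (2 * c) * \<delta> n) * \<delta> n)"
      by (intro sum_mono step) simp
    also have "\<dots> = (\<Sum>k<2^n. \<integral>x. indicator (seg n k) (fst x) * \<phi>' n k (fst x) (snd x) \<partial>LM) + (2 * C\<phi> * (2 * c) * T) * \<delta> n"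
      by (simp add: sum.distrib)
    also have "(\<Sum>k<2^n. \<integral>x. indicator (seg n k) (fst x) * \<phi>' n k (fst x) (snd x) \<partial>LM) = (\<integral>x. en n x \<partial>LM)"
      unfolding en_def by (rule Bochner_Integration.integral_sum[symmetric]) (rule \<phi>'i, simp)
    finally show ?case .
  qed
  moreover have "0 \<le> 2 * C\<phi> * (2 * c) * T" using C\<phi> c T by simp
  ultimately show ?thesis using that by blast
qed

lemma grid_W_integrable:
  assumes "k \<le> 2 ^ n" "j \<le> 2 ^ n" "l \<le> 2 ^ n"
  shows "integrable M (\<lambda>w. W (Yg n k w) (gp n j) (rg n l w))"
proof (rule integrable_bounded[of _ C])
  show "(\<lambda>w. W (Yg n k w) (gp n j) (rg n l w)) \<in> borel_measurable M"
    by (rule measurable_switched[OF Y_measM[OF assms(1)] r_measM[OF gp_nonneg]]) (rule continuous_on_slice[OF W_cont])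
  show "\<bar>W (Yg n k w) (gp n j) (rg n l w)\<bar> \<le> C" if "w \<in> space M" for w
    by (rule W_le) (use Yg_le[OF that assms(1)] gp_le_T[OF assms(2)] in auto)
qed

theorem dynkin:
  "(\<integral>w. of_bool (T \<le> \<sigma> w) * W (Y T w) T (r T w) \<partial>M)
    \<le> (\<integral>w. W (Y 0 w) 0 (r 0 w) \<partial>M) + (\<integral>x. LWi x \<partial>LM)"
proof -
  let ?E = "\<integral>w. of_bool (T \<le> \<sigma> w) * W (Y T w) T (r T w) \<partial>M"
  let ?W0 = "\<integral>w. W (Y 0 w) 0 (r 0 w) \<partial>M"
  obtain P :: "real \<Rightarrow> 's \<Rightarrow> 's \<Rightarrow> real" where
    P1: "\<And>s \<delta> \<eta> j C. 0 \<le> s \<Longrightarrow> 0 \<le> \<delta> \<Longrightarrow> \<eta> \<in> borel_measurable (F s) \<Longrightarrow> (\<And>w. w \<in> space M \<Longrightarrow> \<bar>\<eta> w\<bar> \<le> C) \<Longrightarrow>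
       (\<integral>w. \<eta> w * indicator {j} (r (s + \<delta>) w) \<partial>M) = (\<integral>w. \<eta> w * P \<delta> (r s w) j \<partial>M)" and
    P2: "\<And>\<epsilon>. 0 < \<epsilon> \<Longrightarrow> \<exists>\<delta>\<^sub>0>0. \<forall>\<delta>. 0 < \<delta> \<and> \<delta> < \<delta>\<^sub>0 \<longrightarrow>
       (\<forall>i j. \<bar>P \<delta> i j - (if i = j then 1 else 0) - \<Gamma> $ i $ j * \<delta>\<bar> \<le> \<epsilon> * \<delta>)"
    by (rule chain_transition[OF mc]) blast
  obtain c where c: "0 \<le> c" and cd: "\<forall>\<^sub>F n in sequentially.
    (\<Sum>k<2^n. \<integral>x. indicator (seg n k) (fst x) * \<phi> n k (fst x) (snd x) \<partial>LM)
      \<le> (\<integral>x. en n x \<partial>LM) + c * \<delta> n"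
    by (rule \<phi>_diff)
  define D where "D n k w = alive n k w * (W (Yg n (Suc k) w) (gp n (Suc k)) (rg n (Suc k) w) - W (Yg n k w) (gp n k) (rg n k w))" for n k w
  have Di: "integrable M (D n k)" if "k < 2 ^ n" for n k
  proof -
    have "(\<lambda>w. alive n k w) \<in> borel_measurable M" by measurable
    moreover have "integrable M (\<lambda>w. W (Yg n (Suc k) w) (gp n (Suc k)) (rg n (Suc k) w) - W (Yg n k w) (gp n k) (rg n k w))"
      using that by (intro Bochner_Integration.integrable_diff grid_W_integrable) auto
    ultimately have "integrable M (\<lambda>w. (W (Yg n (Suc k) w) (gp n (Suc k)) (rg n (Suc k) w) - W (Yg n k w) (gp n k) (rg n k w)) * alive n k w)"
      by (intro integrable_mult_bounded[where K=1]) auto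
    then show ?thesis by (simp add: D_def[abs_def] mult.commute)
  qed
  have tel: "?E \<le> ?W0 + (\<Sum>k<2^n. \<integral>w. D n k w \<partial>M)" for n
  proof -
    \<comment> \<open>Killing only drops nonnegative values of \<open>W\<close>: the survival
      indicator decreases along the grid, so the telescoping sum remains an upper bound.\<close>
    have path: "of_bool (T \<le> \<sigma> w) * W (Y T w) T (r T w) \<le> W (Y 0 w) 0 (r 0 w) + (\<Sum>k<2^n. D n k w)" if w: "w \<in> space M" for w
    proof -
      let ?w = "\<lambda>k. W (Yg n k w) (gp n k) (rg n k w)"
      have wn: "0 \<le> ?w k" for k by (rule W_nonneg) simp
      have "alive n k w * ?w (Suc k) \<le> ?w 0 + (\<Sum>j<Suc k. D n j w)" for k
      proof (induction k)
        case 0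
        show ?case using wn[of 0] by (simp add: D_def)
      next
        case (Suc k)
        have m: "alive n (Suc k) w \<le> alive n k w"
        proof -
          have lt: "gp n k < gp n (Suc k)" by simp
          show ?thesis by (auto intro: less_trans[OF lt])
        qed
        have "alive n (Suc k) w * ?w (Suc (Suc k)) = D n (Suc k) w + alive n (Suc k) w * ?w (Suc k)"
          by (simp add: D_def algebra_simps)
        also have "\<dots> \<le> D n (Suc k) w + alive n k w * ?w (Suc k)"
          using m wn by (intro add_left_mono mult_right_mono)
        finally show ?case using Suc by simp
      qed
      from this[of "2 ^ n - 1"] have last: "alive n (2 ^ n - 1) w * W (Y T w) T (r T w) \<le> W (Y 0 w) 0 (r 0 w) + (\<Sum>k<2^n. D n k w)"
        by simp
      \<comment> \<open>Survival up to \<open>T\<close> implies survival at the start of the last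
        step.\<close>
      have "of_bool (T \<le> \<sigma> w) \<le> alive n (2 ^ n - 1) w"
        using gp_less_iff[of n "2 ^ n - 1" "2 ^ n"] by (auto simp del: gp_less_iff)
      then have "of_bool (T \<le> \<sigma> w) * W (Y T w) T (r T w) \<le> alive n (2 ^ n - 1) w * W (Y T w) T (r T w)"
        using W_nonneg[of T] T by (intro mult_right_mono) auto
      with last show ?thesis by linarith
    qed
    have iT: "integrable M (\<lambda>w. of_bool (T \<le> \<sigma> w) * W (Y T w) T (r T w))"
    proof -
      have "integrable M (\<lambda>w. W (Y T w) T (r T w) * of_bool (T \<le> \<sigma> w))"
        using grid_W_integrable[of "2 ^ 0" 0 "2 ^ 0" "2 ^ 0"] by (intro integrable_mult_bounded[where K=1]) (auto simp: gp_def)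
      then show ?thesis by (simp add: mult.commute)
    qed
    have i0: "integrable M (\<lambda>w. W (Y 0 w) 0 (r 0 w))"
      using grid_W_integrable[of 0 0 0 0] by simp
    have "?E \<le> (\<integral>w. W (Y 0 w) 0 (r 0 w) + (\<Sum>k<2^n. D n k w) \<partial>M)"
      by (rule integral_mono[OF iT _ path]) (intro Bochner_Integration.integrable_add i0 Bochner_Integration.integrable_sum Di, simp)
    also have "\<dots> = ?W0 + (\<integral>w. (\<Sum>k<2^n. D n k w) \<partial>M)"
      by (intro Bochner_Integration.integral_add i0 Bochner_Integration.integrable_sum Di) simp
    also have "(\<integral>w. (\<Sum>k<2^n. D n k w) \<partial>M) = (\<Sum>k<2^n. \<integral>w. D n k w \<partial>M)"
      by (intro Bochner_Integration.integral_sum Di) simp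
    finally show ?thesis .
  qed
  \<comment> \<open>Collects the coefficients of \<open>\<epsilon>\<close>: the limit of the error
    sum, and the transition error accumulated over \<open>[0, T]\<close>.\<close>
  define Cf where "Cf = (dd * (\<kappa> * T + K\<^sup>2 * T\<^sup>2) + 1) + real CARD('s) * C * T"
  have main: "?E \<le> ?W0 + (\<integral>x. LWi x \<partial>LM) + Cf * \<epsilon>" if \<epsilon>: "0 < \<epsilon>" for \<epsilon>
  proof -
    \<comment> \<open>The threshold \<open>d\<close> and the admissible step length are fixed by
      \<open>\<epsilon>\<close>; then the grid is refined, and \<open>\<epsilon>\<close> tends to 0
      last.\<close>
    obtain d where d: "0 < d" and mod: "\<forall>z z' t i. norm z \<le> R \<and> norm z' \<le> R \<and> 0 \<le> t \<and> t \<le> T \<and> norm (z - z') \<le> d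
      \<longrightarrow> norm (Wxx z t i - Wxx z' t i) \<le> \<epsilon>"
      using modulus[OF \<epsilon>] by blast
    obtain \<delta>\<^sub>0 where \<delta>0: "0 < \<delta>\<^sub>0" and P3: "\<And>\<delta> i j. 0 < \<delta> \<Longrightarrow> \<delta> < \<delta>\<^sub>0 \<Longrightarrow> \<bar>P \<delta> i j - (if i = j then 1 else 0) - \<Gamma> $ i $ j * \<delta>\<bar> \<le> \<epsilon> * \<delta>"
      using P2[OF \<epsilon>] by blast
    have "\<forall>\<^sub>F n in sequentially. ?E \<le> ?W0 + (\<integral>x. en n x \<partial>LM) + c * \<delta> n + Cf * \<epsilon>"
      using err_sum_small[OF \<epsilon> d] order_tendstoD(2)[OF \<delta>_tendsto \<delta>0] cd
    proof eventually_elim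
      case (elim n)
      have step: "(\<integral>w. D n k w \<partial>M) \<le> (\<integral>x. indicator (seg n k) (fst x) * \<phi> n k (fst x) (snd x) \<partial>LM)
        + (\<integral>w. err \<epsilon> d n k w \<partial>M) + real CARD('s) * C * \<epsilon> * \<delta> n" if k: "k < 2 ^ n" for k
        unfolding D_def
        by (rule step_bound[OF k less_imp_le[OF \<epsilon>] d mod P1[OF _ less_imp_le[OF \<delta>_pos]] P3[OF \<delta>_pos elim(2)]])
      have "?E \<le> ?W0 + (\<Sum>k<2^n. \<integral>w. D n k w \<partial>M)" by (rule tel)
      also have "\<dots> \<le> ?W0 + (\<Sum>k<2^n. (\<integral>x. indicator (seg n k) (fst x) * \<phi> n k (fst x) (snd x) \<partial>LM)
        + (\<integral>w. err \<epsilon> d n k w \<partial>M) + real CARD('s) * C * \<epsilon> * \<delta> n)"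
        by (intro add_left_mono sum_mono step) simp
      also have "\<dots> = ?W0 + (\<Sum>k<2^n. \<integral>x. indicator (seg n k) (fst x) * \<phi> n k (fst x) (snd x) \<partial>LM)
        + (\<Sum>k<2^n. \<integral>w. err \<epsilon> d n k w \<partial>M) + real CARD('s) * C * \<epsilon> * T"
        by (simp add: sum.distrib)
      finally show ?case using elim(1,3) by (simp add: Cf_def algebra_simps)
    qed
    moreover have "(\<lambda>n. ?W0 + (\<integral>x. en n x \<partial>LM) + c * \<delta> n + Cf * \<epsilon>) \<longlonglongrightarrow> ?W0 + (\<integral>x. LWi x \<partial>LM) + c * 0 + Cf * \<epsilon>"
      by (intro tendsto_intros en_integral_tendsto \<delta>_tendsto)
    ultimately have "?E \<le> ?W0 + (\<integral>x. LWi x \<partial>LM) + c * 0 + Cf * \<epsilon>"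
      by (intro tendsto_lowerbound[OF _ _ sequentially_bot])
    then show ?thesis by simp
  qed
  have Cf: "0 < Cf" unfolding Cf_def using dd \<kappa> T C by (intro add_pos_nonneg add_nonneg_pos mult_nonneg_nonneg add_nonneg_nonneg) auto
  show ?thesis
  proof (rule field_le_epsilon)
    fix e :: real assume e: "0 < e"
    from main[of "e / Cf"] e Cf show "?E \<le> ?W0 + (\<integral>x. LWi x \<partial>LM) + e" by simp
  qed
qed

end

section \<open>Gronwall's inequality and hitting times\<close>

text \<open>The bound \<open>C1\<close> depends only on \<open>C0\<close> and \<open>\<psi>\<close>: it must not depend on the radius of the ball that bounds \<open>y\<close> a priori.\<close>

lemma gronwall_L1:
  fixes \<psi> :: "real \<Rightarrow> real"
  assumes \<psi>[measurable]: "\<psi> \<in> borel_measurable lborel" and \<psi>i: "integrable lborel \<psi>" and \<psi>0: "\<And>s. 0 \<le> \<psi> s" and C0: "0 \<le> C0"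
  obtains C1 where "0 \<le> C1" "\<And>y B T. 0 \<le> B \<Longrightarrow> (\<lambda>s. indicator {0<..T} s * y s) \<in> borel_measurable lborel \<Longrightarrow>
      (\<And>t. 0 < t \<Longrightarrow> t \<le> T \<Longrightarrow> 0 \<le> y t \<and> y t \<le> B) \<Longrightarrow>
      (\<And>t. 0 < t \<Longrightarrow> t \<le> T \<Longrightarrow> y t \<le> C0 + (\<integral>s. indicator {0<..t} s * (\<psi> s * y s) \<partial>lborel)) \<Longrightarrow> 0 < T \<Longrightarrow> y T \<le> C1"
proof -
  define n\<psi> where "n\<psi> = (\<integral>s. \<psi> s \<partial>lborel)"
  have n\<psi>: "0 \<le> n\<psi>" unfolding n\<psi>_def by (intro integral_nonneg_AE AE_I2 \<psi>0)
  define \<Psi> where "\<Psi> t = (\<integral>s. indicator {0<..t} s * \<psi> s \<partial>lborel)" for t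
  have ind: "integrable lborel (\<lambda>s. indicator A s * \<psi> s)" if "A \<in> sets borel" for A
    using integrable_mult_indicator[of A lborel \<psi>] that \<psi>i by simp
  have \<Psi>_mono: "\<Psi> s \<le> \<Psi> t" if "s \<le> t" for s t
    unfolding \<Psi>_def using that \<psi>0 by (intro integral_mono ind) (auto simp: indicator_def)
  have \<Psi>_le: "\<Psi> t \<le> n\<psi>" for t
    unfolding \<Psi>_def n\<psi>_def using \<psi>0 by (intro integral_mono ind \<psi>i) (auto simp: indicator_def)
  have \<Psi>_cont: "continuous_on {0..t} \<Psi>" for t
  proof -
    have si: "set_integrable lborel {0..s} \<psi>" for s
      unfolding set_integrable_def using ind[of "{0..s}"] by simp
    have eq: "\<Psi> s = integral {0..s} \<psi>" for s
    proof -
      have "\<Psi> s = (LINT x:{0..s}|lborel. \<psi> x)"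
        unfolding \<Psi>_def set_lebesgue_integral_def
      proof (rule integral_cong_AE)
        show "AE x in lborel. indicator {0<..s} x * \<psi> x = indicator {0..s} x *\<^sub>R \<psi> x"
          using AE_lborel_singleton[of 0] by eventually_elim (auto simp: indicator_def)
      qed auto
      then show ?thesis using set_borel_integral_eq_integral(2)[OF si] by simp
    qed
    have "continuous_on {0..t} (\<lambda>s. integral {0..s} \<psi>)"
      by (rule indefinite_integral_continuous_1[OF set_borel_integral_eq_integral(1)[OF si]])
    then show ?thesis by (simp add: eq[abs_def])
  qed
  have \<Psi>0: "\<Psi> 0 = 0" by (simp add: \<Psi>_def)
  \<comment> \<open>The interval is cut at the levels \<open>m / 2\<close> of \<open>\<Psi>\<close>.
    On the next piece the kernel has mass at most 1/2, so the supremum \<open>S\<close> of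
    \<open>y\<close> satisfies \<open>S \<le> C0 + n\<psi> * Cm m + S / 2\<close>, whence the
    recursion.\<close>
  define Cm where "Cm = rec_nat C0 (\<lambda>_ c. c + 2 * (C0 + n\<psi> * c))"
  have Cm: "Cm 0 = C0" "Cm (Suc m) = Cm m + 2 * (C0 + n\<psi> * Cm m)" for m
    by (simp_all add: Cm_def)
  have Cm0: "0 \<le> Cm m" for m
    by (induction m) (use C0 n\<psi> in \<open>auto simp: Cm\<close>)
  \<comment> \<open>The total mass of \<open>\<psi>\<close> is used up after \<open>m0\<close>
    halves, a number that depends on \<open>\<psi>\<close> alone.\<close>
  obtain m0 :: nat where m0: "n\<psi> \<le> real m0 / 2"
    using real_arch_simple[of "2 * n\<psi>"] by (auto simp: field_simps)
  show ?thesis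
  proof (rule that[OF Cm0[of m0]])
    fix y :: "real \<Rightarrow> real" and B T :: real
    assume B: "0 \<le> B" and ym: "(\<lambda>s. indicator {0<..T} s * y s) \<in> borel_measurable lborel"
      and yb: "\<And>t. 0 < t \<Longrightarrow> t \<le> T \<Longrightarrow> 0 \<le> y t \<and> y t \<le> B"
      and yi: "\<And>t. 0 < t \<Longrightarrow> t \<le> T \<Longrightarrow> y t \<le> C0 + (\<integral>s. indicator {0<..t} s * (\<psi> s * y s) \<partial>lborel)"
      and T: "0 < T"
    have yint: "integrable lborel (\<lambda>s. indicator A s * (\<psi> s * y s))" if A: "A \<subseteq> {0<..T}" "A \<in> sets borel" for A
    proof (rule Bochner_Integration.integrable_bound[of _ "\<lambda>s. B * (indicator A s * \<psi> s)"])
      show "integrable lborel (\<lambda>s. B * (indicator A s * \<psi> s))" by (intro integrable_mult_right ind A)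
      have eq: "(\<lambda>s. indicator A s * (\<psi> s * y s)) = (\<lambda>s. indicator A s * (\<psi> s * (indicator {0<..T} s * y s)))"
        using A by (auto simp: indicator_def fun_eq_iff)
      show "(\<lambda>s. indicator A s * (\<psi> s * y s)) \<in> borel_measurable lborel"
        unfolding eq by (intro borel_measurable_times ym \<psi> borel_measurable_indicator) (use A in simp)
      show "AE s in lborel. norm (indicator A s * (\<psi> s * y s)) \<le> norm (B * (indicator A s * \<psi> s))"
      proof (rule AE_I2)
        fix s
        show "norm (indicator A s * (\<psi> s * y s)) \<le> norm (B * (indicator A s * \<psi> s))"
          using yb[of s] A \<psi>0[of s] B mult_right_mono[of "y s" B "\<psi> s"]
          by (cases "s \<in> A") (auto simp: abs_mult mult.commute subset_iff)
      qed
    qed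
    have main: "\<forall>t. 0 < t \<and> t \<le> T \<and> \<Psi> t \<le> real m / 2 \<longrightarrow> y t \<le> Cm m" for m
    proof (induction m)
      case 0
      show ?case
      proof (intro allI impI)
        fix t assume t: "0 < t \<and> t \<le> T \<and> \<Psi> t \<le> real 0 / 2"
        \<comment> \<open>The kernel has no mass so far, so the a priori bound \<open>B\<close> is
          multiplied by 0 and leaves no trace in the constant.\<close>
        have "(\<integral>s. indicator {0<..t} s * (\<psi> s * y s) \<partial>lborel) \<le> (\<integral>s. B * (indicator {0<..t} s * \<psi> s) \<partial>lborel)"
        proof (intro integral_mono yint integrable_mult_right ind)
          fix s
          show "indicator {0<..t} s * (\<psi> s * y s) \<le> B * (indicator {0<..t} s * \<psi> s)"
            using yb[of s] t \<psi>0[of s] mult_right_mono[of "y s" B "\<psi> s"] by (auto simp: indicator_def mult.commute)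
        qed (use t in auto)
        also have "\<dots> = B * \<Psi> t" by (simp add: \<Psi>_def)
        also have "\<dots> \<le> 0" using t B by (simp add: mult_nonneg_nonpos)
        finally show "y t \<le> Cm 0" using yi[of t] t by (simp add: Cm)
      qed
    next
      case (Suc m)
      define A where "A = {t. 0 < t \<and> t \<le> T \<and> \<Psi> t \<le> real (Suc m) / 2}"
      show ?case
      proof (cases "A = {}")
        case True
        then show ?thesis by (auto simp: A_def)
      next
        case False
        define S where "S = Sup (y ` A)"
        have bdd: "bdd_above (y ` A)" using yb by (auto simp: A_def intro!: bdd_aboveI[of _ B])
        have yS: "y t \<le> S" if "t \<in> A" for t unfolding S_def using that bdd by (intro cSup_upper) auto
        have S0: "0 \<le> S" using False yS yb by (force simp: A_def)
        have le: "y u \<le> (C0 + n\<psi> * Cm m) + S / 2" if u: "u \<in> A" for u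
        proof (cases "\<Psi> u \<le> real m / 2")
          case True
          have uA: "0 < u" "u \<le> T" using u by (auto simp: A_def)
          have "(\<integral>s. indicator {0<..u} s * (\<psi> s * y s) \<partial>lborel) \<le> (\<integral>s. Cm m * (indicator {0<..u} s * \<psi> s) \<partial>lborel)"
          proof (intro integral_mono yint integrable_mult_right ind)
            fix s
            have "y s \<le> Cm m" if "0 < s" "s \<le> u" using Suc.IH that uA \<Psi>_mono[of s u] True by auto
            then show "indicator {0<..u} s * (\<psi> s * y s) \<le> Cm m * (indicator {0<..u} s * \<psi> s)"
              using \<psi>0[of s] mult_right_mono[of "y s" "Cm m" "\<psi> s"] by (auto simp: indicator_def mult.commute)
          qed (use uA in auto)
          also have "\<dots> = Cm m * \<Psi> u" by (simp add: \<Psi>_def)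
          also have "\<dots> \<le> Cm m * n\<psi>" by (intro mult_left_mono \<Psi>_le Cm0)
          finally show ?thesis using yi[OF uA] S0 by (simp add: mult.commute)
        next
          case False
          have uA: "0 < u" "u \<le> T" "\<Psi> u \<le> real (Suc m) / 2" using u by (auto simp: A_def)
          \<comment> \<open>The time at which \<open>\<Psi>\<close> reaches the previous level: up
            to it the induction hypothesis applies, after it the supremum \<open>S\<close> is used
            with a kernel of mass at most 1/2.\<close>
          obtain t' where t': "0 \<le> t'" "t' \<le> u" "\<Psi> t' = real m / 2"
            using IVT'[of \<Psi> 0 "real m / 2" u] \<Psi>_cont[of u] uA False \<Psi>0 by auto
          have "(\<integral>s. indicator {0<..u} s * (\<psi> s * y s) \<partial>lborel) \<le> (\<integral>s. Cm m * (indicator {0<..t'} s * \<psi> s) + S * (indicator {t'<..u} s * \<psi> s) \<partial>lborel)"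
          proof (intro integral_mono yint integrable_mult_right ind Bochner_Integration.integrable_add)
            fix s
            have 1: "y s \<le> Cm m" if "0 < s" "s \<le> t'" using Suc.IH that uA t' \<Psi>_mono[of s t'] by auto
            have 2: "y s \<le> S" if "t' < s" "s \<le> u" using that uA t' \<Psi>_mono[of s u] by (intro yS) (auto simp: A_def)
            show "indicator {0<..u} s * (\<psi> s * y s) \<le> Cm m * (indicator {0<..t'} s * \<psi> s) + S * (indicator {t'<..u} s * \<psi> s)"
              using 1 2 t' \<psi>0[of s] mult_right_mono[of "y s" "Cm m" "\<psi> s"] mult_right_mono[of "y s" S "\<psi> s"]
              by (auto simp: indicator_def mult.commute)
          qed (use uA in auto)
          also have "\<dots> = Cm m * \<Psi> t' + S * (\<integral>s. indicator {t'<..u} s * \<psi> s \<partial>lborel)"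
            unfolding \<Psi>_def using ind[of "{0<..t'}"] ind[of "{t'<..u}"] by simp
          also have "(\<integral>s. indicator {t'<..u} s * \<psi> s \<partial>lborel) = \<Psi> u - \<Psi> t'"
          proof -
            have "\<Psi> u = (\<integral>s. indicator {0<..t'} s * \<psi> s + indicator {t'<..u} s * \<psi> s \<partial>lborel)"
              unfolding \<Psi>_def using t' by (intro Bochner_Integration.integral_cong) (auto simp: indicator_def)
            also have "\<dots> = \<Psi> t' + (\<integral>s. indicator {t'<..u} s * \<psi> s \<partial>lborel)"
              unfolding \<Psi>_def using ind by simp
            finally show ?thesis by simp
          qed
          also have "Cm m * \<Psi> t' + S * (\<Psi> u - \<Psi> t') \<le> Cm m * n\<psi> + S * (1 / 2)"
            using uA t' S0 by (intro add_mono mult_left_mono \<Psi>_le Cm0) auto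
          finally show ?thesis using yi[OF uA(1,2)] by (simp add: mult.commute)
        qed
        have "S \<le> (C0 + n\<psi> * Cm m) + S / 2"
          unfolding S_def[symmetric] by (subst S_def) (rule cSup_least, use False le in auto)
        then have "S \<le> 2 * (C0 + n\<psi> * Cm m)" by simp
        then show ?thesis using yS Cm0[of m] by (force simp: A_def Cm)
      qed
    qed
    show "y T \<le> Cm m0" using main[of m0] T \<Psi>_le[of T] m0 by auto
  qed
qed


text \<open>Convexity of the power at
  \<open>(1 - \<beta>) * (a / (1 - \<beta>)) + \<beta> * b\<close>; the first coefficient is what
  the factor \<open>1 - \<beta>\<close> becomes after the division inside the power.\<close>

lemma powr_convex_split:
  fixes a b \<beta> p :: real
  assumes a: "0 \<le> a" and b: "0 \<le> b" and \<beta>: "0 < \<beta>" "\<beta> < 1" and p: "1 \<le> p"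
  shows "(a + \<beta> * b) powr p \<le> (1 - \<beta>) powr (1 - p) * a powr p + \<beta> * b powr p"
proof -
  have c1: "1 \<le> (1 - \<beta>) powr (1 - p)"
  proof -
    have "(1 - \<beta>) powr 0 \<le> (1 - \<beta>) powr (1 - p)" by (rule powr_mono') (use \<beta> p in auto)
    then show ?thesis using \<beta> by simp
  qed
  consider "a = 0" | "b = 0" | "0 < a" "0 < b" using a b by linarith
  then show ?thesis
  proof cases
    case 1
    have "\<beta> powr p \<le> \<beta> powr 1" by (rule powr_mono') (use \<beta> p in auto)
    then have "\<beta> powr p * b powr p \<le> \<beta> * b powr p" using \<beta> by (intro mult_right_mono) auto
    then show ?thesis using 1 \<beta> b by (simp add: powr_mult)
  next
    case 2
    then show ?thesis using mult_right_mono[OF c1, of "a powr p"] by simp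
  next
    case 3
    have "((1 - \<beta>) *\<^sub>R (a / (1 - \<beta>)) + \<beta> *\<^sub>R b) powr p \<le> (1 - \<beta>) * (a / (1 - \<beta>)) powr p + \<beta> * b powr p"
      by (rule convex_onD[OF powr_convex[OF p]]) (use 3 \<beta> in auto)
    moreover have "(1 - \<beta>) * (a / (1 - \<beta>)) powr p = (1 - \<beta>) powr (1 - p) * a powr p"
      using 3 \<beta> by (simp add: powr_divide powr_diff)
    ultimately show ?thesis using \<beta> by simp
  qed
qed

section \<open>Good events and exit times\<close>

context filtered_brownian
begin

text \<open>Completeness of the filtration puts the exceptional null set into \<open>F 0\<close>, so
  an almost sure property holds on every path of an event known at time 0.\<close>

lemma good_set:
  assumes "AE w in M. P w"
  obtains \<Omega> where "\<Omega> \<in> sets (F 0)" "AE w in M. w \<in> \<Omega>" "\<And>w. w \<in> \<Omega> \<Longrightarrow> P w" "\<Omega> \<subseteq> space M"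
proof -
  from assms obtain N where N: "N \<in> null_sets M" "{w \<in> space M. \<not> P w} \<subseteq> N"
    by (auto simp: eventually_ae_filter)
  have N0: "N \<in> sets (F 0)" using filt N(1) unfolding complete_filtration_def by blast
  have 1: "space M - N \<in> sets (F 0)" using sets.compl_sets[OF N0] by simp
  have 2: "AE w in M. w \<in> space M - N"
    using AE_not_in[OF N(1)] AE_space by eventually_elim auto
  show ?thesis by (rule that[OF 1 2]) (use N in auto)
qed

text \<open>First exit from the open ball of radius \<open>R\<close>, capped by \<open>T\<close>.
  The last property expresses survival through the path alone, which makes it comparable for
  different horizons.\<close>

lemma hitting_time:
  fixes Z :: "real \<Rightarrow> 'a \<Rightarrow> real^'d::finite"
  assumes Z: "\<And>t. 0 \<le> t \<Longrightarrow> Z t \<in> borel_measurable (F t)"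
    and cont: "\<And>w. w \<in> space M \<Longrightarrow> continuous_on {0..} (\<lambda>t. Z t w)" and T: "0 < T"
  obtains \<sigma> where "\<sigma> \<in> borel_measurable M" "\<And>w. w \<in> space M \<Longrightarrow> 0 \<le> \<sigma> w \<and> \<sigma> w \<le> T"
    "\<And>t. 0 \<le> t \<Longrightarrow> t < T \<Longrightarrow> {w \<in> space M. t < \<sigma> w} \<in> sets (F t)"
    "\<And>w t. w \<in> space M \<Longrightarrow> 0 \<le> t \<Longrightarrow> t \<le> T \<Longrightarrow> t \<le> \<sigma> w \<longleftrightarrow> (\<forall>u. 0 \<le> u \<and> u < t \<longrightarrow> norm (Z u w) < R)"
proof -
  define \<sigma> where "\<sigma> w = Inf ({t. 0 \<le> t \<and> t \<le> T \<and> R \<le> norm (Z t w)} \<union> {T})" for w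
  let ?S = "\<lambda>w. {t. 0 \<le> t \<and> t \<le> T \<and> R \<le> norm (Z t w)} \<union> {T}"
  have bb: "bdd_below (?S w)" for w by (rule bdd_belowI[of _ 0]) (use T in auto)
  have \<sigma>b: "0 \<le> \<sigma> w" "\<sigma> w \<le> T" for w
    unfolding \<sigma>_def using T by (auto intro!: cInf_greatest cInf_lower bb)
  have cZ: "continuous_on {a..b} (\<lambda>t. norm (Z t w))" if "w \<in> space M" "0 \<le> a" for w a b
    by (intro continuous_on_norm continuous_on_subset[OF cont[OF that(1)]]) (use that in auto)
  have closed: "closed (?S w)" if w: "w \<in> space M" for w
  proof -
    have "closed {t \<in> {0..T}. R \<le> norm (Z t w)}"
      by (rule continuous_on_closed_Collect_le[OF continuous_on_const cZ[OF w]]) auto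
    moreover have "{t \<in> {0..T}. R \<le> norm (Z t w)} = {t. 0 \<le> t \<and> t \<le> T \<and> R \<le> norm (Z t w)}" by auto
    ultimately show ?thesis by auto
  qed
  have \<sigma>in: "\<sigma> w \<in> ?S w" if "w \<in> space M" for w
    unfolding \<sigma>_def by (rule closed_contains_Inf[OF _ bb closed[OF that]]) auto
  have less: "t < \<sigma> w \<longleftrightarrow> (\<forall>u. 0 \<le> u \<and> u \<le> t \<longrightarrow> norm (Z u w) < R)" if w: "w \<in> space M" and t: "0 \<le> t" "t < T" for w t
  proof
    assume l: "t < \<sigma> w"
    show "\<forall>u. 0 \<le> u \<and> u \<le> t \<longrightarrow> norm (Z u w) < R"
    proof (intro allI impI, rule ccontr)
      fix u assume u: "0 \<le> u \<and> u \<le> t" "\<not> norm (Z u w) < R"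
      then have "u \<in> ?S w" using t by auto
      then have "\<sigma> w \<le> u" unfolding \<sigma>_def by (intro cInf_lower bb)
      with l u show False by auto
    qed
  next
    assume a: "\<forall>u. 0 \<le> u \<and> u \<le> t \<longrightarrow> norm (Z u w) < R"
    show "t < \<sigma> w"
    proof (rule ccontr)
      assume "\<not> t < \<sigma> w"
      with \<sigma>in[OF w] \<sigma>b[of w] t a show False by force
    qed
  qed
  have le: "t \<le> \<sigma> w \<longleftrightarrow> (\<forall>u. 0 \<le> u \<and> u < t \<longrightarrow> norm (Z u w) < R)" if w: "w \<in> space M" and t: "0 \<le> t" "t \<le> T" for w t
  proof
    assume l: "t \<le> \<sigma> w"
    show "\<forall>u. 0 \<le> u \<and> u < t \<longrightarrow> norm (Z u w) < R"
      using less[OF w] l t by (meson less_le_trans order_refl)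
  next
    assume a: "\<forall>u. 0 \<le> u \<and> u < t \<longrightarrow> norm (Z u w) < R"
    show "t \<le> \<sigma> w"
    proof (rule ccontr)
      assume "\<not> t \<le> \<sigma> w"
      with \<sigma>in[OF w] \<sigma>b[of w] t a show False by force
    qed
  qed
  have st: "{w \<in> space M. t < \<sigma> w} \<in> sets (F t)" if t: "0 \<le> t" "t < T" for t
  proof -
    \<comment> \<open>On a compact interval a continuous norm that stays below \<open>R\<close> does
      so by a positive margin, and then rational points suffice. Rational multiples of
      \<open>t\<close> are taken so that the end point \<open>t\<close> is among them.\<close>
    have eq: "(\<forall>u. 0 \<le> u \<and> u \<le> t \<longrightarrow> norm (Z u w) < R) \<longleftrightarrow> (\<exists>n. \<forall>q\<in>\<rat> \<inter> {0..1}. norm (Z (t * q) w) \<le> R - inverse (real (Suc n)))"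
      if w: "w \<in> space M" for w
    proof
      assume a: "\<forall>u. 0 \<le> u \<and> u \<le> t \<longrightarrow> norm (Z u w) < R"
      have "\<exists>x\<in>{0..t}. \<forall>y\<in>{0..t}. norm (Z y w) \<le> norm (Z x w)"
        by (rule continuous_attains_sup[OF _ _ cZ[OF w]]) (use t in auto)
      then obtain x where x: "x \<in> {0..t}" "\<And>y. y \<in> {0..t} \<Longrightarrow> norm (Z y w) \<le> norm (Z x w)" by blast
      with a have "0 < R - norm (Z x w)" by auto
      then obtain n where n: "inverse (real (Suc n)) < R - norm (Z x w)" using reals_Archimedean by blast
      have "norm (Z (t * q) w) \<le> R - inverse (real (Suc n))" if "q \<in> \<rat> \<inter> {0..1}" for q
        using x(2)[of "t * q"] n that t by (auto simp: mult_left_le)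
      then show "\<exists>n. \<forall>q\<in>\<rat> \<inter> {0..1}. norm (Z (t * q) w) \<le> R - inverse (real (Suc n))" by blast
    next
      assume "\<exists>n. \<forall>q\<in>\<rat> \<inter> {0..1}. norm (Z (t * q) w) \<le> R - inverse (real (Suc n))"
      then obtain n where n: "\<And>q. q \<in> \<rat> \<inter> {0..1} \<Longrightarrow> norm (Z (t * q) w) \<le> R - inverse (real (Suc n))" by blast
      have cl: "closure (\<rat> \<inter> {0..1}) = {0..1::real}"
      proof -
        have "{0<..<1::real} \<subseteq> closure (\<rat> \<inter> {0<..<1})"
          using open_Int_closure_subset[of "{0<..<1::real}" \<rat>] Rats_closure_real by (simp add: Int_commute)
        also have "\<dots> \<subseteq> closure (\<rat> \<inter> {0..1})" by (intro closure_mono) auto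
        finally have "closure {0<..<1::real} \<subseteq> closure (\<rat> \<inter> {0..1})" by (intro closure_minimal) auto
        moreover have "closure (\<rat> \<inter> {0..1}) \<subseteq> {0..1::real}" by (intro closure_minimal) auto
        ultimately show ?thesis by auto
      qed
      have c: "continuous_on {0..1} (\<lambda>q. norm (Z (t * q) w))"
        by (rule continuous_on_compose2[OF cZ[OF w, of 0 t]]) (use t in \<open>auto intro!: continuous_intros simp: mult_left_le\<close>)
      have all: "norm (Z (t * q) w) \<le> R - inverse (real (Suc n))" if "q \<in> {0..1}" for q
        by (rule continuous_le_on_closure[of "\<rat> \<inter> {0..1}" "\<lambda>q. norm (Z (t * q) w)"]) (use cl c n that in auto)
      show "\<forall>u. 0 \<le> u \<and> u \<le> t \<longrightarrow> norm (Z u w) < R"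
      proof (intro allI impI)
        fix u assume u: "0 \<le> u \<and> u \<le> t"
        have "norm (Z u w) \<le> R - inverse (real (Suc n))"
        proof (cases "t = 0")
          case True
          then have "u = 0" using u by simp
          then show ?thesis using all[of 0] True by simp
        next
          case False
          then show ?thesis using all[of "u / t"] u t by (simp add: divide_le_eq)
        qed
        then show "norm (Z u w) < R" using positive_imp_inverse_positive[of "real (Suc n)"] by linarith
      qed
    qed
    have "{w \<in> space (F t). \<exists>n. \<forall>q\<in>\<rat> \<inter> {0..1}. norm (Z (t * q) w) \<le> R - inverse (real (Suc n))} \<in> sets (F t)"
    proof (intro sets.sets_Collect_countable_Ex sets.sets_Collect_countable_All')
      fix n and q :: real assume q: "q \<in> \<rat> \<inter> {0..1}"
      have "0 \<le> t * q" "t * q \<le> t" using q t by (auto simp: mult_left_le)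
      then have [measurable]: "Z (t * q) \<in> borel_measurable (F t)" using Z meas_mono by blast
      show "{w \<in> space (F t). norm (Z (t * q) w) \<le> R - inverse (real (Suc n))} \<in> sets (F t)" by measurable
    qed (use countable_rat in auto)
    moreover have "{w \<in> space (F t). \<exists>n. \<forall>q\<in>\<rat> \<inter> {0..1}. norm (Z (t * q) w) \<le> R - inverse (real (Suc n))} = {w \<in> space M. t < \<sigma> w}"
    proof (rule Collect_cong, rule conj_cong)
      show "w \<in> space (F t) \<longleftrightarrow> w \<in> space M" for w by (simp only: space_F[OF t(1)])
      show "(\<exists>n. \<forall>q\<in>\<rat> \<inter> {0..1}. norm (Z (t * q) w) \<le> R - inverse (real (Suc n))) \<longleftrightarrow> t < \<sigma> w" if "w \<in> space M" for w
        using eq[OF that] less[OF that t] by (simp only:)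
    qed
    ultimately show ?thesis by simp
  qed
  have m: "\<sigma> \<in> borel_measurable M"
  proof (rule borel_measurableI_greater)
    fix a
    consider "a < 0" | "0 \<le> a" "a < T" | "T \<le> a" by linarith
    then show "{w \<in> space M. a < \<sigma> w} \<in> sets M"
    proof cases
      case 1
      then have "{w \<in> space M. a < \<sigma> w} = space M" using \<sigma>b(1) by (auto intro: less_le_trans)
      then show ?thesis by simp
    next
      case 2
      then show ?thesis using st[OF 2] sub[OF 2(1)] by (auto simp: subalgebra_def)
    next
      case 3
      have "\<not> a < \<sigma> w" for w using \<sigma>b(2)[of w] 3 by linarith
      then have "{w \<in> space M. a < \<sigma> w} = {}" by blast
      then show ?thesis by (simp only: sets.empty_sets)
    qed
  qed
  show ?thesis by (rule that[OF m _ st le]) (use \<sigma>b in auto)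
qed

end

section \<open>Bounds on compact sets and the Lyapunov exponent\<close>

lemma compact_bound:
  fixes h :: "'x::heine_borel \<Rightarrow> real \<Rightarrow> 's::finite \<Rightarrow> 'z::real_normed_vector"
  assumes "\<And>i. continuous_on UNIV (\<lambda>(z, t). h z t i)" and S: "compact S"
  obtains C where "0 \<le> C" "\<And>z t i. (z, t) \<in> S \<Longrightarrow> norm (h z t i) \<le> C"
proof -
  have "\<exists>c. \<forall>x\<in>S. norm ((\<lambda>(z, t). h z t i) x) \<le> c" for i
  proof -
    have "compact ((\<lambda>(z, t). h z t i) ` S)"
      by (rule compact_continuous_image[OF continuous_on_subset[OF assms(1)] S]) auto
    from compact_imp_bounded[OF this] show ?thesis by (auto simp: bounded_iff)
  qed
  then obtain c where c: "\<And>i x. x \<in> S \<Longrightarrow> norm ((\<lambda>(z, t). h z t i) x) \<le> c i" by metis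
  show ?thesis
  proof (rule that[of "\<Sum>i\<in>UNIV. \<bar>c i\<bar>"])
    fix z t i assume "(z, t) \<in> S"
    from c[OF this, of i] have "norm (h z t i) \<le> \<bar>c i\<bar>" by simp
    also have "\<dots> \<le> (\<Sum>i\<in>UNIV. \<bar>c i\<bar>)" by (rule member_le_sum) auto
    finally show "norm (h z t i) \<le> (\<Sum>i\<in>UNIV. \<bar>c i\<bar>)" .
  qed (auto intro: sum_nonneg)
qed

lemma compact_modulus:
  fixes h :: "'x::euclidean_space \<Rightarrow> real \<Rightarrow> 's::finite \<Rightarrow> 'z::real_normed_vector"
  assumes cont: "\<And>i. continuous_on UNIV (\<lambda>(z, t). h z t i)" and \<epsilon>: "0 < \<epsilon>"
  shows "\<exists>d>0. \<forall>z z' t i. norm z \<le> R \<and> norm z' \<le> R \<and> 0 \<le> t \<and> t \<le> T \<and> norm (z - z') \<le> d \<longrightarrow> norm (h z t i - h z' t i) \<le> \<epsilon>"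
proof -
  let ?S = "cball (0::'x) R \<times> {0..T}"
  have "\<exists>d>0. \<forall>x\<in>?S. \<forall>x'\<in>?S. dist x' x < d \<longrightarrow> dist ((\<lambda>(z, t). h z t i) x') ((\<lambda>(z, t). h z t i) x) < \<epsilon>" for i
    using compact_uniformly_continuous[OF continuous_on_subset[OF cont subset_UNIV], of ?S i] \<epsilon>
    unfolding uniformly_continuous_on_def by (simp add: compact_Times)
  then obtain d where d: "\<And>i. 0 < d i" "\<And>i x x'. x \<in> ?S \<Longrightarrow> x' \<in> ?S \<Longrightarrow> dist x' x < d i \<Longrightarrow> dist ((\<lambda>(z, t). h z t i) x') ((\<lambda>(z, t). h z t i) x) < \<epsilon>"
    by metis
  have D: "0 < Min (range d)" using d by simp
  show ?thesis
  proof (intro exI[of _ "Min (range d) / 2"] conjI allI impI)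
    fix z z' :: 'x and t i assume a: "norm z \<le> R \<and> norm z' \<le> R \<and> 0 \<le> t \<and> t \<le> T \<and> norm (z - z') \<le> Min (range d) / 2"
    have "Min (range d) \<le> d i" by simp
    moreover have "norm (z - z') \<le> Min (range d) / 2" using a by blast
    ultimately have "norm (z - z') < d i" using D by linarith
    then have "dist (z, t) (z', t) < d i" by (simp add: dist_Pair_Pair dist_norm)
    from d(2)[OF _ _ this] a show "norm (h z t i - h z' t i) \<le> \<epsilon>" by (auto simp: dist_norm)
  qed (use D in simp)
qed

text \<open>The constant \<open>C\<close> is lost in the limit, since \<open>ln C / t\<close> tends
  to 0.\<close>

lemma moment_lyapunov_exponent_le:
  assumes C: "0 < C" and le: "\<And>t. 0 < t \<Longrightarrow> (\<integral>\<^sup>+w. ennreal (norm (X t w) powr p) \<partial>M) \<le> ennreal (C * exp (- lam * t))"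
  shows "moment_lyapunov_exponent M p X \<le> ereal (- lam)"
proof -
  have "\<forall>\<^sub>F t in at_top. ln_ennreal (\<integral>\<^sup>+w. ennreal (norm (X t w) powr p) \<partial>M) / ereal t \<le> ereal (ln C / t - lam)"
    using eventually_gt_at_top[of 0]
  proof eventually_elim
    case (elim t)
    let ?z = "\<integral>\<^sup>+w. ennreal (norm (X t w) powr p) \<partial>M"
    have z: "?z \<le> ennreal (C * exp (- lam * t))" by (rule le[OF elim])
    then have fin: "?z \<noteq> \<infinity>" by (metis ennreal_less_top infinity_ennreal_def leD)
    show ?case
    proof (cases "?z = 0")
      case True
      then show ?thesis using elim by (simp add: ln_ennreal_def)
    next
      case False
      then have pos: "0 < enn2real ?z" using fin by (simp add: enn2real_positive_iff top.not_eq_extremum zero_less_iff_neq_zero)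
      have "enn2real ?z \<le> C * exp (- lam * t)" using z C by (intro enn2real_leI) auto
      then have "ln (enn2real ?z) \<le> ln (C * exp (- lam * t))" using pos C by (subst ln_le_cancel_iff) auto
      also have "\<dots> = ln C - lam * t" using C by (simp add: ln_mult)
      finally have "ln (enn2real ?z) / t \<le> ln C / t - lam" using elim by (simp add: field_simps)
      then show ?thesis using False fin elim by (simp add: ln_ennreal_def)
    qed
  qed
  then have "moment_lyapunov_exponent M p X \<le> Limsup at_top (\<lambda>t. ereal (ln C / t - lam))"
    unfolding moment_lyapunov_exponent_def by (rule Limsup_mono)
  also have "\<dots> = ereal (- lam)"
  proof (rule lim_imp_Limsup)
    have "((\<lambda>t. ln C / t - lam) \<longlongrightarrow> 0 - lam) at_top"
      by (intro tendsto_diff tendsto_const tendsto_divide_0[OF tendsto_const] filterlim_at_top_imp_at_infinity filterlim_ident)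
    then show "((\<lambda>t. ereal (ln C / t - lam)) \<longlongrightarrow> ereal (- lam)) at_top" by simp
  qed simp
  finally show ?thesis .
qed


section \<open>The neutral equation\<close>

text \<open>Brings the trace in \<open>L_operator\<close> into the form of a Hessian contracted with
  a covariance rate, the form in which \<open>dynkin\<close> delivers it.\<close>

lemma trace_congruence:
  fixes A :: "real^'d::finite^'d" and G :: "real^'m::finite^'d"
  shows "trace (transpose G ** A ** G) = (\<Sum>l\<in>UNIV. \<Sum>c\<in>UNIV. A $ l $ c * (\<Sum>i\<in>UNIV. G $ l $ i * G $ c $ i))"
proof -
  have "trace (transpose G ** A ** G) = (\<Sum>i\<in>UNIV. \<Sum>c\<in>UNIV. \<Sum>l\<in>UNIV. G $ l $ i * A $ l $ c * G $ c $ i)"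
    by (simp add: trace_def matrix_matrix_mult_def transpose_def sum_distrib_right)
  also have "\<dots> = (\<Sum>l\<in>UNIV. \<Sum>c\<in>UNIV. \<Sum>i\<in>UNIV. G $ l $ i * A $ l $ c * G $ c $ i)"
    by (subst sum.swap, subst (2) sum.swap) (rule sum.swap)
  finally show ?thesis by (simp add: sum_distrib_left mult_ac)
qed

text \<open>A solution whose almost sure properties have been moved onto one event
  \<open>\<Omega>\<close>, where they hold on every path. The number \<open>K0\<close> bounds the
  initial segment.\<close>

locale neutral_equation = filtered_brownian M F B
  for M :: "'a measure" and F and B :: "real \<Rightarrow> 'a \<Rightarrow> real^'m::finite" +
  fixes r :: "real \<Rightarrow> 'a \<Rightarrow> 's::finite" and \<Gamma> :: "real^'s^'s" and \<tau> \<beta> :: real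
    and D :: "real^'d::finite \<Rightarrow> 's \<Rightarrow> real^'d"
    and f :: "real^'d \<Rightarrow> real^'d \<Rightarrow> real \<Rightarrow> 's \<Rightarrow> real^'d"
    and g :: "real^'d \<Rightarrow> real^'d \<Rightarrow> real \<Rightarrow> 's \<Rightarrow> real^'m^'d"
    and X I :: "real \<Rightarrow> 'a \<Rightarrow> real^'d" and \<Omega> :: "'a set" and K0 :: real
  assumes \<tau>: "0 < \<tau>" and mc: "markov_chain M F \<Gamma> r" and coeff: "nsdde_coefficients \<beta> D f g"
    and X_meas: "\<And>t. - \<tau> \<le> t \<Longrightarrow> X t \<in> borel_measurable (F (max 0 t))"
    and X_cadlag: "\<And>w. w \<in> space M \<Longrightarrow> cadlag_from (- \<tau>) (\<lambda>t. X t w)"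
    and \<Omega>: "\<Omega> \<in> sets (F 0)" "AE w in M. w \<in> \<Omega>"
    and K0: "0 \<le> K0" and X_init: "\<And>w s. w \<in> \<Omega> \<Longrightarrow> - \<tau> \<le> s \<Longrightarrow> s \<le> 0 \<Longrightarrow> norm (X s w) \<le> K0"
    and drift: "\<And>w t. w \<in> \<Omega> \<Longrightarrow> 0 \<le> t \<Longrightarrow> set_integrable lborel {0..t} (\<lambda>s. f (X s w) (X (s - \<tau>) w) s (r s w))"
    and ito: "has_ito_integral M F B (\<lambda>s w. g (X s w) (X (s - \<tau>) w) s (r s w)) I"
    and I_cont: "\<And>w. w \<in> \<Omega> \<Longrightarrow> continuous_on {0..} (\<lambda>t. I t w)"
    and equation: "\<And>w t. w \<in> \<Omega> \<Longrightarrow> 0 \<le> t \<Longrightarrow> X t w - D (X (t - \<tau>) w) (r t w) =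
             X 0 w - D (X (- \<tau>) w) (r 0 w)
             + (LINT s:{0..t}|lborel. f (X s w) (X (s - \<tau>) w) s (r s w)) + I t w"
begin

lemma \<beta>: "0 < \<beta>" "\<beta> < 1"
  and D_le: "norm (D x i) \<le> \<beta> * norm x"
proof -
  show "0 < \<beta>" "\<beta> < 1" using coeff by (auto simp: nsdde_coefficients_def)
  have "norm (D x i - D 0 i) \<le> \<beta> * norm (x - 0)" "D 0 i = 0"
    using coeff unfolding nsdde_coefficients_def by blast+
  then show "norm (D x i) \<le> \<beta> * norm x" by simp
qed

text \<open>Local Lipschitz continuity compared with the origin, where \<open>f\<close> and
  \<open>g\<close> vanish; the bound is uniform in time and state.\<close>

lemma fg_le:
  assumes R: "0 < R"
  obtains K where "0 \<le> K" "\<And>x y t i. 0 \<le> t \<Longrightarrow> norm x \<le> R \<Longrightarrow> norm y \<le> R \<Longrightarrow> norm (f x y t i) \<le> K \<and> norm (g x y t i) \<le> K"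
proof -
  have "\<exists>L>0. \<forall>x y x' y' t i.
        t \<ge> 0 \<and> norm x \<le> R \<and> norm y \<le> R \<and> norm x' \<le> R \<and> norm y' \<le> R \<longrightarrow>
        max (norm (f x y t i - f x' y' t i)) (norm (g x y t i - g x' y' t i))
          \<le> L * (norm (x - x') + norm (y - y'))"
    using coeff R unfolding nsdde_coefficients_def by (elim conjE allE[where x=R] impE) simp_all
  then obtain L where L: "L > 0" and lip: "\<And>x y x' y' t i.
        t \<ge> 0 \<and> norm x \<le> R \<and> norm y \<le> R \<and> norm x' \<le> R \<and> norm y' \<le> R \<Longrightarrow>
        max (norm (f x y t i - f x' y' t i)) (norm (g x y t i - g x' y' t i))
          \<le> L * (norm (x - x') + norm (y - y'))"
    by (elim exE conjE) (rule that, simp, simp)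
  have z: "f 0 0 t i = 0" "g 0 0 t i = 0" if "0 \<le> t" for t i
    using coeff that by (auto simp: nsdde_coefficients_def)
  show ?thesis
  proof (rule that)
    show "0 \<le> L * (R + R)" using L R by simp
    fix x y :: "real^'d" and t :: real and i assume a: "0 \<le> t" "norm x \<le> R" "norm y \<le> R"
    have "max (norm (f x y t i - f 0 0 t i)) (norm (g x y t i - g 0 0 t i)) \<le> L * (norm (x - 0) + norm (y - 0))"
      using lip[of t x y 0 0 i] a R by simp
    also have "\<dots> \<le> L * (R + R)" using a L by (intro mult_left_mono) auto
    finally show "norm (f x y t i) \<le> L * (R + R) \<and> norm (g x y t i) \<le> L * (R + R)" using z[OF a(1)] by simp
  qed
qed

text \<open>Set to 0 outside \<open>\<Omega>\<close>, so that every path is continuous and the exit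
  time can be treated without exceptional sets.\<close>

definition Z :: "real \<Rightarrow> 'a \<Rightarrow> real^'d" where
  "Z t w = (if w \<in> \<Omega> then X t w - D (X (t - \<tau>) w) (r t w) else 0)"

lemma r_meas: "0 \<le> t \<Longrightarrow> r t \<in> measurable (F t) (count_space UNIV)"
  using mc by (auto simp: markov_chain_def adapted_process_def)

lemma \<Omega>_space: "w \<in> \<Omega> \<Longrightarrow> w \<in> space M"
  using sets.sets_into_space[OF \<Omega>(1)] by auto

text \<open>The equation at time 0 is subtracted from the one at \<open>t\<close>, which is where
  the term \<open>I 0 w\<close> comes from.\<close>

lemma Z_eq:
  assumes "w \<in> \<Omega>" "0 \<le> t"
  shows "Z t w = Z 0 w + (LINT s:{0..t}|lborel. f (X s w) (X (s - \<tau>) w) s (r s w)) + I t w - I 0 w"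
proof -
  have "(LINT s:{0..0::real}|lborel. f (X s w) (X (s - \<tau>) w) s (r s w)) = 0"
  proof -
    have "AE s in lborel. (indicator {0..0::real} s :: real) *\<^sub>R f (X s w) (X (s - \<tau>) w) s (r s w) = 0"
      using AE_lborel_singleton[of 0] by eventually_elim (auto simp: indicator_def)
    then show ?thesis unfolding set_lebesgue_integral_def by (rule integral_eq_zero_AE)
  qed
  with equation[OF assms] equation[OF assms(1), of 0] assms show ?thesis
    by (simp add: Z_def algebra_simps)
qed

text \<open>The drift term is an indefinite integral, continuous on each compact interval;
  continuity at a point is read off on an interval that extends beyond it.\<close>

lemma Z_cont:
  assumes "w \<in> space M"
  shows "continuous_on {0..} (\<lambda>t. Z t w)"
proof (cases "w \<in> \<Omega>")
  case True
  let ?f = "\<lambda>s. f (X s w) (X (s - \<tau>) w) s (r s w)"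
  have "continuous_on {0..b} (\<lambda>t. Z t w)" if b: "0 \<le> b" for b
  proof -
    have "continuous_on {0..b} (\<lambda>t. integral {0..t} ?f)"
      by (rule indefinite_integral_continuous_1) (use set_borel_integral_eq_integral(1)[OF drift[OF True b]] in simp)
    then have "continuous_on {0..b} (\<lambda>t. Z 0 w + integral {0..t} ?f + I t w - I 0 w)"
      by (intro continuous_intros continuous_on_subset[OF I_cont[OF True]]) auto
    then show ?thesis
    proof (rule continuous_on_eq)
      fix t assume "t \<in> {0..b}"
      then show "Z 0 w + integral {0..t} ?f + I t w - I 0 w = Z t w"
        using Z_eq[OF True, of t] set_borel_integral_eq_integral(2)[OF drift[OF True, of t]] by simp
    qed
  qed
  then have "\<forall>b\<ge>0. continuous_on {0..b} (\<lambda>t. Z t w)" by blast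
  then have c: "continuous (at t within {0..}) (\<lambda>t. Z t w)" if "0 \<le> t" for t
  proof -
    have "continuous (at t within {0..t + 1}) (\<lambda>t. Z t w)"
      using \<open>\<forall>b\<ge>0. continuous_on {0..b} (\<lambda>t. Z t w)\<close> that by (auto simp: continuous_on_eq_continuous_within)
    moreover have "at t within {0..t + 1} = at t within {0..}"
      by (rule at_within_nhd[of _ "{..<t + 1}"]) auto
    ultimately show ?thesis by simp
  qed
  then show ?thesis by (simp add: continuous_on_eq_continuous_within)
next
  case False
  then show ?thesis by (simp add: Z_def)
qed

lemma Z_meas:
  assumes t: "0 \<le> t"
  shows "Z t \<in> borel_measurable (F t)"
proof -
  have [measurable]: "X t \<in> borel_measurable (F t)" using X_meas[of t] t \<tau> by simp
  have "X (t - \<tau>) \<in> borel_measurable (F (max 0 (t - \<tau>)))" using X_meas[of "t - \<tau>"] t by simp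
  then have [measurable]: "X (t - \<tau>) \<in> borel_measurable (F t)" by (rule meas_mono[rotated 2]) (use t \<tau> in auto)
  have [measurable]: "r t \<in> measurable (F t) (count_space UNIV)" by (rule r_meas[OF t])
  have [measurable]: "(\<lambda>(x, i). D x i) \<in> borel_measurable (borel \<Otimes>\<^sub>M count_space UNIV)"
    using coeff by (simp add: nsdde_coefficients_def)
  have [measurable]: "(\<lambda>w. D (X (t - \<tau>) w) (r t w)) \<in> borel_measurable (F t)"
    using measurable_compose[of "\<lambda>w. (X (t - \<tau>) w, r t w)" "F t" _ "\<lambda>(x, i). D x i"] by simp
  have [measurable]: "\<Omega> \<in> sets (F t)" using sets_mono[of 0 t] t \<Omega> by auto
  show ?thesis unfolding Z_def[abs_def] by measurable
qed

lemma Z_init: "w \<in> space M \<Longrightarrow> norm (Z 0 w) \<le> 2 * K0"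
proof (cases "w \<in> \<Omega>")
  case True
  have "norm (Z 0 w) \<le> norm (X 0 w) + \<beta> * norm (X (- \<tau>) w)"
    using norm_triangle_ineq4[of "X 0 w" "D (X (- \<tau>) w) (r 0 w)"] D_le[of "X (- \<tau>) w" "r 0 w"] True
    by (simp add: Z_def)
  also have "\<dots> \<le> K0 + 1 * K0"
    using X_init[OF True, of 0] X_init[OF True, of "- \<tau>"] \<tau> \<beta> by (intro add_mono mult_mono) auto
  finally show ?thesis by simp
qed (use K0 in \<open>simp add: Z_def\<close>)

text \<open>The exit time controls \<open>Z\<close> only, because \<open>X\<close> may jump with the
  chain. The bound is carried to \<open>X\<close> one delay interval at a time:
  \<open>R / (1 - \<beta>)\<close> is the fixed point of \<open>x \<mapsto> R + \<beta> * x\<close>,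
  and \<open>K0\<close> covers the initial segment.\<close>

lemma X_le:
  assumes w: "w \<in> \<Omega>" and R: "0 \<le> R" and Z: "\<And>u. 0 \<le> u \<Longrightarrow> u \<le> s \<Longrightarrow> norm (Z u w) \<le> R" and u: "- \<tau> \<le> u" "u \<le> s"
  shows "norm (X u w) \<le> R / (1 - \<beta>) + K0"
proof -
  have "\<forall>u. - \<tau> \<le> u \<and> u \<le> s \<and> u \<le> real n * \<tau> \<longrightarrow> norm (X u w) \<le> R / (1 - \<beta>) + K0" for n
  proof (induction n)
    case 0
    have "0 \<le> R / (1 - \<beta>)" using R \<beta> by simp
    then show ?case using X_init[OF w] by (auto intro: order_trans[of _ K0])
  next
    case (Suc n)
    show ?case
    proof (intro allI impI)
      fix u assume u: "- \<tau> \<le> u \<and> u \<le> s \<and> u \<le> real (Suc n) * \<tau>"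
      show "norm (X u w) \<le> R / (1 - \<beta>) + K0"
      proof (cases "0 \<le> u")
        case True
        have "norm (X u w) = norm (Z u w + D (X (u - \<tau>) w) (r u w))" using w by (simp add: Z_def)
        also have "\<dots> \<le> norm (Z u w) + \<beta> * norm (X (u - \<tau>) w)"
          using norm_triangle_ineq[of "Z u w" "D (X (u - \<tau>) w) (r u w)"] D_le[of "X (u - \<tau>) w" "r u w"] by linarith
        also have "\<dots> \<le> R + \<beta> * (R / (1 - \<beta>) + K0)"
          using Suc.IH u True Z[of u] \<beta> \<tau> by (intro add_mono mult_left_mono) (auto simp: algebra_simps)
        also have "\<dots> \<le> R / (1 - \<beta>) + K0"
        proof -
          have "R + \<beta> * (R / (1 - \<beta>)) = R / (1 - \<beta>)" using \<beta> by (simp add: field_simps)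
          moreover have "\<beta> * K0 \<le> 1 * K0" using \<beta> K0 by (intro mult_right_mono) auto
          ultimately show ?thesis by (simp add: algebra_simps)
        qed
        finally show ?thesis .
      next
        case False
        have "0 \<le> R / (1 - \<beta>)" using R \<beta> by simp
        then show ?thesis using X_init[OF w, of u] False u by auto
      qed
    qed
  qed
  moreover obtain n where "s / \<tau> \<le> real n" using real_arch_simple by blast
  then have "u \<le> real n * \<tau>" using u \<tau> by (simp add: divide_le_eq)
  ultimately show ?thesis using u by blast
qed

text \<open>Right continuity of the paths gives joint measurability, also after the shift by the
  delay.\<close>

lemma X_joint: "(\<lambda>x. X (max 0 (fst x)) (snd x)) \<in> borel_measurable LM"
  and X_delay_joint: "(\<lambda>x. X (max 0 (fst x) - \<tau>) (snd x)) \<in> borel_measurable LM"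
proof -
  have XM: "X t \<in> borel_measurable M" if "- \<tau> \<le> t" for t
    using meas_M[OF _ X_meas[OF that]] by simp
  have rc: "((\<lambda>u. X u w) \<longlongrightarrow> X t w) (at_right t)" if "w \<in> space M" "- \<tau> \<le> t" for w t
    using X_cadlag[OF that(1)] that(2) by (simp add: cadlag_from_def)
  show "(\<lambda>x. X (max 0 (fst x)) (snd x)) \<in> borel_measurable LM"
    using right_continuous_joint_measurable[of X M] XM rc \<tau> by (simp add: split_beta')
  have rc': "((\<lambda>u. X (u - \<tau>) w) \<longlongrightarrow> X (t - \<tau>) w) (at_right t)" if "w \<in> space M" "0 \<le> t" for w t
    using rc[OF that(1), of "t - \<tau>"] that(2) by (simp add: filtermap_at_right_shift[symmetric] filterlim_filtermap)
  show "(\<lambda>x. X (max 0 (fst x) - \<tau>) (snd x)) \<in> borel_measurable LM"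
    using right_continuous_joint_measurable[of "\<lambda>t. X (t - \<tau>)" M] XM rc' \<tau> by (simp add: split_beta')
qed

lemma f_joint:
  "(\<lambda>x. f (X (max 0 (fst x)) (snd x)) (X (max 0 (fst x) - \<tau>) (snd x)) (max 0 (fst x)) (r (max 0 (fst x)) (snd x)))
    \<in> borel_measurable LM"
proof -
  have fm: "(\<lambda>(x, y, t, i). f x y t i) \<in> borel_measurable (borel \<Otimes>\<^sub>M borel \<Otimes>\<^sub>M restrict_space borel {0..} \<Otimes>\<^sub>M count_space UNIV)"
    using coeff by (simp add: nsdde_coefficients_def)
  have t: "(\<lambda>x. max 0 (fst x)) \<in> measurable LM (restrict_space (borel :: real measure) {0..})"
    by (rule measurable_restrict_space2) auto
  have "(\<lambda>x. (X (max 0 (fst x)) (snd x), X (max 0 (fst x) - \<tau>) (snd x), max 0 (fst x), r (max 0 (fst x)) (snd x)))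
    \<in> measurable LM (borel \<Otimes>\<^sub>M borel \<Otimes>\<^sub>M restrict_space borel {0..} \<Otimes>\<^sub>M count_space UNIV)"
    by (intro measurable_Pair X_joint X_delay_joint t chain_joint[OF mc])
  from measurable_compose[OF this fm] show ?thesis by simp
qed

lemma X_path: "w \<in> space M \<Longrightarrow> (\<lambda>v. X (max (- \<tau>) v) w) \<in> borel_measurable borel"
proof -
  assume w: "w \<in> space M"
  have "(\<lambda>v::real. (v + \<tau>, w)) \<in> measurable borel LM"
    using w by (intro measurable_Pair) auto
  from measurable_compose[OF this X_delay_joint]
  have "(\<lambda>v. X (max 0 (v + \<tau>) - \<tau>) w) \<in> borel_measurable borel" by simp
  moreover have "max 0 (v + \<tau>) - \<tau> = max (- \<tau>) v" for v by (auto simp: max_def)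
  ultimately show ?thesis by simp
qed

end

lemma continuous_on_max_extend:
  fixes h :: "'b::topological_space \<Rightarrow> real \<Rightarrow> 'z::topological_space"
  assumes "continuous_on (UNIV \<times> {0..}) (\<lambda>(x, t). h x t)"
  shows "continuous_on UNIV (\<lambda>x. h (fst x) (max 0 (snd x)))"
proof -
  have "continuous_on UNIV (\<lambda>x. (fst x, max 0 (snd x)) :: 'b \<times> real)"
    by (intro continuous_intros)
  from continuous_on_compose2[OF assms this] show ?thesis by (simp add: image_subset_iff)
qed

context neutral_equation
begin

text \<open>The condition on \<open>R\<close> places the initial value of \<open>Z\<close> inside
  the ball. Up to the exit time \<open>X\<close> is then bounded, and with it \<open>f\<close> and
  \<open>g\<close>, so the stopped drift and integrand meet the requirements of the abstract
  setting.\<close>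

lemma dynkin_neutral:
  fixes V :: "real^'d \<Rightarrow> real \<Rightarrow> 's \<Rightarrow> real" and lam :: real
  assumes V: "C21 V" and V0: "\<And>x t i. 0 \<le> t \<Longrightarrow> 0 \<le> V x t i" and T: "0 < T" and R: "2 * K0 < R"
  obtains \<sigma> h where "\<sigma> \<in> borel_measurable M" "\<And>w. w \<in> space M \<Longrightarrow> 0 \<le> \<sigma> w \<and> \<sigma> w \<le> T"
    "\<And>w t. w \<in> space M \<Longrightarrow> 0 \<le> t \<Longrightarrow> t \<le> T \<Longrightarrow> t \<le> \<sigma> w \<longleftrightarrow> (\<forall>u. 0 \<le> u \<and> u < t \<longrightarrow> norm (Z u w) < R)"
    "\<And>w s. w \<in> space M \<Longrightarrow> 0 \<le> s \<Longrightarrow> s \<le> \<sigma> w \<Longrightarrow> norm (Z s w) \<le> R"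
    "integrable LM h"
    "\<And>w s. w \<in> \<Omega> \<Longrightarrow> 0 < s \<Longrightarrow> s \<le> \<sigma> w \<Longrightarrow>
       h (s, w) = exp (lam * s) * (L_operator \<Gamma> D f g V (X s w) (X (s - \<tau>) w) s (r s w) + lam * V (Z s w) s (r s w))"
    "\<And>w s. \<not> (0 < s \<and> s \<le> \<sigma> w) \<Longrightarrow> w \<in> space M \<Longrightarrow> h (s, w) = 0"
    "(\<integral>w. of_bool (T \<le> \<sigma> w) * (exp (lam * T) * V (Z T w) T (r T w)) \<partial>M)
      \<le> (\<integral>w. V (Z 0 w) 0 (r 0 w) \<partial>M) + (\<integral>x. h x \<partial>LM)"
proof -
  obtain \<sigma> where \<sigma>: "\<sigma> \<in> borel_measurable M" "\<And>w. w \<in> space M \<Longrightarrow> 0 \<le> \<sigma> w \<and> \<sigma> w \<le> T"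
    "\<And>t. 0 \<le> t \<Longrightarrow> t < T \<Longrightarrow> {w \<in> space M. t < \<sigma> w} \<in> sets (F t)"
    "\<And>w t. w \<in> space M \<Longrightarrow> 0 \<le> t \<Longrightarrow> t \<le> T \<Longrightarrow> t \<le> \<sigma> w \<longleftrightarrow> (\<forall>u. 0 \<le> u \<and> u < t \<longrightarrow> norm (Z u w) < R)"
    using hitting_time[OF Z_meas Z_cont T, of R] by blast
  have R0: "0 < R" using R K0 by linarith
  \<comment> \<open>Strictly before the exit time the norm is below \<open>R\<close>, and continuity
    gives at most \<open>R\<close> at that time. Time 0 has no past, so the bound on the initial
    data is used there.\<close>
  have Zle: "norm (Z s w) \<le> R" if w: "w \<in> space M" and s: "0 \<le> s" "s \<le> \<sigma> w" for s w
  proof (cases "s = 0")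
    case True
    then show ?thesis using Z_init[OF w] R by simp
  next
    case False
    have lt: "norm (Z u w) < R" if "0 \<le> u" "u < s" for u
      using \<sigma>(2)[OF w] \<sigma>(4)[OF w, of s] s that by auto
    have "closure {0..<s} = {0..s}" using False s by simp
    moreover have "continuous_on {0..s} (\<lambda>u. norm (Z u w))"
      by (intro continuous_intros continuous_on_subset[OF Z_cont[OF w]]) auto
    ultimately show ?thesis
      using continuous_le_on_closure[of "{0..<s}" "\<lambda>u. norm (Z u w)" s R] lt s by (auto intro: less_imp_le)
  qed
  define R' where "R' = R / (1 - \<beta>) + K0"
  have R': "0 < R'" using R0 \<beta> K0 unfolding R'_def by (intro add_pos_nonneg) auto
  obtain K where K: "0 \<le> K" and fg: "\<And>x y t i. 0 \<le> t \<Longrightarrow> norm x \<le> R' \<Longrightarrow> norm y \<le> R' \<Longrightarrow> norm (f x y t i) \<le> K \<and> norm (g x y t i) \<le> K"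
    using fg_le[OF R'] by blast
  have XR: "norm (X u w) \<le> R'" if "w \<in> \<Omega>" "s \<le> \<sigma> w" "- \<tau> \<le> u" "u \<le> s" for w s u
    unfolding R'_def by (rule X_le[OF that(1) _ _ that(3,4)]) (use R0 Zle[OF \<Omega>_space[OF that(1)]] that(2) in auto)
  define G where "G s w = g (X s w) (X (s - \<tau>) w) s (r s w)" for s w
  define b where "b s w = (if w \<in> \<Omega> \<and> 0 \<le> s \<and> s \<le> \<sigma> w then f (X s w) (X (s - \<tau>) w) s (r s w) else 0)" for s w
  define Y where "Y t w = Z (min t (\<sigma> w)) w" for t w
  interpret S: bounded_stopping M F B T \<sigma>
    by unfold_locales (use T \<sigma> in auto)
  have bK: "norm (b s w) \<le> K" for s w
  proof (cases "w \<in> \<Omega> \<and> 0 \<le> s \<and> s \<le> \<sigma> w")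
    case True
    then show ?thesis using fg[of s "X s w" "X (s - \<tau>) w"] XR[of w s s] XR[of w s "s - \<tau>"] \<tau> by (simp add: b_def)
  next
    case False
    then have "b s w = 0" unfolding b_def by (rule if_not_P)
    then show ?thesis using K by simp
  qed
  have GK: "norm (G s w) \<le> K" if "w \<in> \<Omega>" "0 \<le> s" "s \<le> \<sigma> w" for w s
    using fg[of s "X s w" "X (s - \<tau>) w"] XR[of w s s] XR[of w s "s - \<tau>"] \<tau> that by (simp add: G_def)
  interpret S: stopped_ito M F B T \<sigma> G I K \<Omega>
    using ito \<Omega> I_cont K GK by unfold_locales (auto simp: G_def[abs_def])
  \<comment> \<open>The stopped increment integrates the drift over a truncated window, which is the
    same as integrating the truncated drift \<open>b\<close> over the full window.\<close>
  have incr: "Y t w - Y s w = (\<integral>x. indicator {s<..t} x *\<^sub>R b x w \<partial>lborel) + (S.N t w - S.N s w)"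
    if w: "w \<in> space M" and st: "0 \<le> s" "s \<le> t" for w s t
  proof (cases "w \<in> \<Omega>")
    case True
    let ?f = "\<lambda>x. f (X x w) (X (x - \<tau>) w) x (r x w)"
    let ?s = "min s (\<sigma> w)" and ?t = "min t (\<sigma> w)"
    have s': "0 \<le> ?s" "0 \<le> ?t" "?s \<le> ?t" using st \<sigma>(2)[OF w] by auto
    have "(LINT x:{0..?t}|lborel. ?f x) = (LINT x:{0..?s} \<union> {?s<..?t}|lborel. ?f x)"
      using s' by (intro arg_cong2[where f="\<lambda>A h. set_lebesgue_integral lborel A h"] refl) auto
    also have "\<dots> = (LINT x:{0..?s}|lborel. ?f x) + (LINT x:{?s<..?t}|lborel. ?f x)"
    proof (rule set_integral_Un)
      show "set_integrable lborel {0..?s} ?f" "set_integrable lborel {?s<..?t} ?f"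
        by (rule set_integrable_subset[OF drift[OF True s'(2)]], use s' in auto)+
    qed auto
    finally have 1: "(LINT x:{0..?t}|lborel. ?f x) - (LINT x:{0..?s}|lborel. ?f x) = (LINT x:{?s<..?t}|lborel. ?f x)" by simp
    have 2: "(LINT x:{?s<..?t}|lborel. ?f x) = (\<integral>x. indicator {s<..t} x *\<^sub>R b x w \<partial>lborel)"
      unfolding set_lebesgue_integral_def
      by (rule Bochner_Integration.integral_cong) (use True st in \<open>auto simp: b_def indicator_def\<close>)
    show ?thesis
      using Z_eq[OF True s'(1)] Z_eq[OF True s'(2)] 1 2 True by (simp add: Y_def S.N_def)
  next
    case False
    then show ?thesis by (simp add: Y_def Z_def b_def S.N_def)
  qed
  have bm: "(\<lambda>(s, w). b s w) \<in> borel_measurable LM"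
  proof -
    note [measurable] = f_joint \<sigma>(1) S.\<Omega>_sets
    have "(\<lambda>x. if snd x \<in> \<Omega> \<and> 0 \<le> fst x \<and> fst x \<le> \<sigma> (snd x) then
        f (X (max 0 (fst x)) (snd x)) (X (max 0 (fst x) - \<tau>) (snd x)) (max 0 (fst x)) (r (max 0 (fst x)) (snd x)) else 0)
      \<in> borel_measurable LM" by measurable
    then show ?thesis
      by (rule measurable_cong[THEN iffD1, rotated]) (auto simp: b_def)
  qed
  \<comment> \<open>\<open>V\<close> is only controlled for \<open>t \<ge> 0\<close>; clamping time makes all functions continuous on the whole line.\<close>
  define W where "W z t i = exp (lam * max 0 t) * V z (max 0 t) i" for z t i
  define Wt where "Wt z t i = exp (lam * max 0 t) * (deriv_t V z (max 0 t) i + lam * V z (max 0 t) i)" for z t i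
  define Wx where "Wx z t i = exp (lam * max 0 t) *\<^sub>R deriv_x V z (max 0 t) i" for z t i
  define Wxx where "Wxx z t i = exp (lam * max 0 t) *\<^sub>R deriv_xx V z (max 0 t) i" for z t i
  have Vc: "continuous_on (UNIV \<times> {0..}) (\<lambda>(x, t). V x t i)" "continuous_on (UNIV \<times> {0..}) (\<lambda>(x, t). deriv_t V x t i)"
    "continuous_on (UNIV \<times> {0..}) (\<lambda>(x, t). deriv_x V x t i)" "continuous_on (UNIV \<times> {0..}) (\<lambda>(x, t). deriv_xx V x t i)" for i
    using V by (auto simp: C21_def)
  have Wc: "continuous_on UNIV (\<lambda>(z, t). W z t i)" "continuous_on UNIV (\<lambda>(z, t). Wt z t i)"
    "continuous_on UNIV (\<lambda>(z, t). Wx z t i)" "continuous_on UNIV (\<lambda>(z, t). Wxx z t i)" for i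
    unfolding W_def Wt_def Wx_def Wxx_def split_beta' by (intro continuous_intros continuous_on_max_extend Vc)+
  have comp: "compact (cball (0::real^'d) R \<times> {0..T})" by (intro compact_Times) auto
  obtain C1 where C1: "0 \<le> C1" "\<And>z t i. (z, t) \<in> cball 0 R \<times> {0..T} \<Longrightarrow> norm (W z t i) \<le> C1"
    using compact_bound[of W, OF Wc(1) comp] by blast
  obtain C2 where C2: "0 \<le> C2" "\<And>z t i. (z, t) \<in> cball 0 R \<times> {0..T} \<Longrightarrow> norm (Wt z t i) \<le> C2"
    using compact_bound[of Wt, OF Wc(2) comp] by blast
  obtain C3 where C3: "0 \<le> C3" "\<And>z t i. (z, t) \<in> cball 0 R \<times> {0..T} \<Longrightarrow> norm (Wx z t i) \<le> C3"
    using compact_bound[of Wx, OF Wc(3) comp] by blast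
  obtain C4 where C4: "0 \<le> C4" "\<And>z t i. (z, t) \<in> cball 0 R \<times> {0..T} \<Longrightarrow> norm (Wxx z t i) \<le> C4"
    using compact_bound[of Wxx, OF Wc(4) comp] by blast
  define C where "C = C1 + C2 + C3 + C4"
  have Cle: "C1 \<le> C" "C2 \<le> C" "C3 \<le> C" "C4 \<le> C" "0 \<le> C" using C1(1) C2(1) C3(1) C4(1) by (auto simp: C_def)
  interpret switching_ito M F B T \<sigma> G I K \<Omega> r \<Gamma> Y b R C W Wt Wx Wxx
  proof unfold_locales
    show "markov_chain M F \<Gamma> r" by (rule mc)
    show "Y (S.gp n q) \<in> borel_measurable (F (S.gp n q))" if "q \<le> 2 ^ n" for n q
      unfolding Y_def[abs_def] by (rule S.stopped_measurable[OF Z_meas Z_cont that])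
    show "continuous_on {0..T} (\<lambda>t. Y t w)" if "w \<in> space M" for w
      unfolding Y_def by (rule continuous_on_compose2[OF Z_cont[OF that], of _ "\<lambda>t. min t (\<sigma> w)"])
        (use \<sigma>(2)[OF that] in \<open>auto intro!: continuous_intros\<close>)
    show "norm (Y t w) \<le> R" if "w \<in> space M" "0 \<le> t" for w t
      unfolding Y_def by (rule Zle[OF that(1)]) (use \<sigma>(2)[OF that(1)] that in auto)
    show "(\<lambda>(s, w). b s w) \<in> borel_measurable LM" by (rule bm)
    show "norm (b s w) \<le> K" for s w by (rule bK)
    show "Y t w - Y s w = (\<integral>x. indicator {s<..t} x *\<^sub>R b x w \<partial>lborel) + (S.N t w - S.N s w)"
      if "w \<in> space M" "0 \<le> s" "s \<le> t" for w s t by (rule incr[OF that])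
    show "continuous_on UNIV (\<lambda>(z, t). W z t i)" "continuous_on UNIV (\<lambda>(z, t). Wt z t i)"
      "continuous_on UNIV (\<lambda>(z, t). Wx z t i)" "continuous_on UNIV (\<lambda>(z, t). Wxx z t i)" for i
      by (fact Wc)+
    show "0 \<le> W z t i" if "0 \<le> t" for z t i using V0[OF that] that by (simp add: W_def)
    show "\<exists>\<theta>. 0 \<le> \<theta> \<and> \<theta> \<le> 1 \<and>
      W (z + v) t i = W z t i + Wx z t i \<bullet> v + (v \<bullet> (Wxx (z + \<theta> *\<^sub>R v) t i *v v)) / 2" if t: "0 \<le> t" for z v t i
    proof -
      obtain \<theta> where \<theta>: "0 \<le> \<theta>" "\<theta> \<le> 1"
        "V (z + v) t i = V z t i + deriv_x V z t i \<bullet> v + (v \<bullet> (deriv_xx V (z + \<theta> *\<^sub>R v) t i *v v)) / 2"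
        using C21_taylor[OF V t] by blast
      show ?thesis
        by (rule exI[of _ \<theta>]) (use \<theta> t in \<open>simp add: W_def Wx_def Wxx_def scaleR_matrix_vector_assoc[symmetric] algebra_simps\<close>)
    qed
    show "has_bochner_integral lborel (\<lambda>s. indicator {a..c} s *\<^sub>R Wt z s i) (W z c i - W z a i)" if "0 \<le> a" "a \<le> c" for z i a c
    proof -
      have "has_bochner_integral lborel (\<lambda>s. indicator {a..c} s *\<^sub>R (exp (lam * s) * (deriv_t V z s i + lam * V z s i)))
        (W z c i - W z a i)" using C21_FTC[OF V that, of lam z i] that by (simp add: W_def)
      moreover have "(\<lambda>s. indicator {a..c} s *\<^sub>R (exp (lam * s) * (deriv_t V z s i + lam * V z s i))) = (\<lambda>s. indicator {a..c} s *\<^sub>R Wt z s i)"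
        using that by (auto simp: Wt_def indicator_def)
      ultimately show ?thesis by simp
    qed
    show "0 \<le> R" "0 \<le> C" using R0 Cle by auto
    show "\<bar>W z t i\<bar> \<le> C" "\<bar>Wt z t i\<bar> \<le> C" "norm (Wx z t i) \<le> C" "norm (Wxx z t i) \<le> C"
      if "norm z \<le> R" "0 \<le> t" "t \<le> T" for z t i
      using C1(2)[of z t i] C2(2)[of z t i] C3(2)[of z t i] C4(2)[of z t i] Cle that by auto
    show "\<exists>d>0. \<forall>z z' t i. norm z \<le> R \<and> norm z' \<le> R \<and> 0 \<le> t \<and> t \<le> T \<and> norm (z - z') \<le> d
      \<longrightarrow> norm (Wxx z t i - Wxx z' t i) \<le> \<epsilon>" if "0 < \<epsilon>" for \<epsilon>
      by (rule compact_modulus[OF Wc(4) that])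
  qed
  show ?thesis
  proof (rule that[OF \<sigma>(1,2,4) Zle LWi])
    show "LWi (s, w) = exp (lam * s) * (L_operator \<Gamma> D f g V (X s w) (X (s - \<tau>) w) s (r s w) + lam * V (Z s w) s (r s w))"
      if w: "w \<in> \<Omega>" and s: "0 < s" "s \<le> \<sigma> w" for w s
    proof -
      have sT: "s \<le> T" using s \<sigma>(2)[OF \<Omega>_space[OF w]] by auto
      have YZ: "Y s w = Z s w" using s by (simp add: Y_def)
      have ZX: "X s w - D (X (s - \<tau>) w) (r s w) = Z s w" using w by (simp add: Z_def)
      have Gs: "S.Gs s w = g (X s w) (X (s - \<tau>) w) s (r s w)"
        using w s sT S.Gc_eq[of s w] by (simp add: S.Gs_def G_def)
      have bs: "b s w = f (X s w) (X (s - \<tau>) w) s (r s w)" using w s by (simp add: b_def)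
      have "LWi (s, w) = LW s w" using s sT by (simp add: LWi_def)
      also have "\<dots> = exp (lam * s) * (L_operator \<Gamma> D f g V (X s w) (X (s - \<tau>) w) s (r s w) + lam * V (Z s w) s (r s w))"
        unfolding L_operator_def ZX trace_congruence LW_def YZ GG_def Gs bs
        using s by (simp add: W_def Wt_def Wx_def Wxx_def sum_distrib_left distrib_left mult_ac)
      finally show ?thesis .
    qed
    show "LWi (s, w) = 0" if "\<not> (0 < s \<and> s \<le> \<sigma> w)" "w \<in> space M" for w s
      using that by (auto simp: LWi_def)
    have "(\<integral>w. of_bool (T \<le> \<sigma> w) * (exp (lam * T) * V (Z T w) T (r T w)) \<partial>M) = (\<integral>w. of_bool (T \<le> \<sigma> w) * W (Y T w) T (r T w) \<partial>M)"
      using T by (intro Bochner_Integration.integral_cong) (auto simp: W_def Y_def)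
    also have "\<dots> \<le> (\<integral>w. W (Y 0 w) 0 (r 0 w) \<partial>M) + (\<integral>x. LWi x \<partial>LM)" by (rule dynkin)
    also have "(\<integral>w. W (Y 0 w) 0 (r 0 w) \<partial>M) = (\<integral>w. V (Z 0 w) 0 (r 0 w) \<partial>M)"
      using \<sigma>(2) by (intro Bochner_Integration.integral_cong) (auto simp: W_def Y_def min_absorb1)
    finally show "(\<integral>w. of_bool (T \<le> \<sigma> w) * (exp (lam * T) * V (Z T w) T (r T w)) \<partial>M)
      \<le> (\<integral>w. V (Z 0 w) 0 (r 0 w) \<partial>M) + (\<integral>x. LWi x \<partial>LM)" .
  qed
qed

end

text \<open>A shift by \<open>\<tau>\<close> turns the delayed integral into one over times that
  belong either to the history or to the running interval. The running part is absorbed because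
  \<open>\<kappa> \<le> a\<close>, and the history costs at most \<open>\<tau> * A\<close>. The
  global bound \<open>B\<close> secures integrability and does not enter the estimate.\<close>

lemma delay_cancellation:
  fixes w :: "real \<Rightarrow> real"
  assumes w[measurable]: "w \<in> borel_measurable borel" and w0: "\<And>v. 0 \<le> w v" and wB: "\<And>v. w v \<le> B" and wA: "\<And>v. v \<le> 0 \<Longrightarrow> w v \<le> A"
    and \<sigma>: "0 \<le> \<sigma>" and \<tau>: "0 < \<tau>" and \<kappa>: "0 \<le> \<kappa>" "\<kappa> \<le> a"
  shows "integrable lborel (\<lambda>s. indicator {0<..\<sigma>} s * (\<kappa> * w (s - \<tau>) - a * w s))"
    and "(\<integral>s. indicator {0<..\<sigma>} s * (\<kappa> * w (s - \<tau>) - a * w s) \<partial>lborel) \<le> \<kappa> * (\<tau> * A)"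
proof -
  have int: "integrable lborel (\<lambda>s. indicator {b<..c} s * w (s - d))" for b c d
  proof (rule Bochner_Integration.integrable_bound[of _ "\<lambda>s. indicator {b<..c} s * B"])
    show "integrable lborel (\<lambda>s. indicator {b<..c} s * B)"
      by (cases "b \<le> c") (simp_all add: integrable_indicator_iff)
    show "AE s in lborel. norm (indicator {b<..c} s * w (s - d)) \<le> norm (indicator {b<..c} s * B)"
    proof (intro AE_I2)
      fix s show "norm (indicator {b<..c} s * w (s - d)) \<le> norm (indicator {b<..c} s * B)"
        using w0[of "s - d"] wB[of "s - d"] by (auto simp: indicator_def)
    qed
  qed measurable
  note int0 = int[of _ _ 0, simplified]
  have eq: "indicator {0<..\<sigma>} s * (\<kappa> * w (s - \<tau>) - a * w s) = \<kappa> * (indicator {0<..\<sigma>} s * w (s - \<tau>)) - a * (indicator {0<..\<sigma>} s * w s)" for s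
    by (simp add: algebra_simps)
  show "integrable lborel (\<lambda>s. indicator {0<..\<sigma>} s * (\<kappa> * w (s - \<tau>) - a * w s))"
    unfolding eq by (intro Bochner_Integration.integrable_diff integrable_mult_right int int0)
  let ?I = "\<integral>s. indicator {0<..\<sigma>} s * w s \<partial>lborel"
  have I0: "0 \<le> ?I" by (intro integral_nonneg_AE AE_I2) (simp add: w0)
  have "(\<integral>s. indicator {0<..\<sigma>} s * w (s - \<tau>) \<partial>lborel) = (\<integral>s. indicator {- \<tau><..\<sigma> - \<tau>} s * w s \<partial>lborel)"
    by (subst lborel_integral_real_affine[of 1 _ \<tau>]) (auto intro!: Bochner_Integration.integral_cong simp: indicator_def)
  also have "\<dots> \<le> (\<integral>s. A * indicator {- \<tau><..0} s + indicator {0<..\<sigma>} s * w s \<partial>lborel)"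
  proof (rule integral_mono)
    show "integrable lborel (\<lambda>s. A * indicator {- \<tau><..0} s + indicator {0<..\<sigma>} s * w s)"
      using \<tau> by (intro Bochner_Integration.integrable_add integrable_mult_right int0) (simp add: integrable_indicator_iff)
    fix s show "indicator {- \<tau><..\<sigma> - \<tau>} s * w s \<le> A * indicator {- \<tau><..0} s + indicator {0<..\<sigma>} s * w s"
      using w0[of s] wA[of s] \<tau> \<sigma> order_trans[OF w0[of s] wA[of s]] by (auto simp: indicator_def)
  qed (rule int0)
  also have "\<dots> = \<tau> * A + ?I"
    using \<tau> by (subst Bochner_Integration.integral_add) (auto intro!: int0 simp: integrable_indicator_iff)
  finally have "\<kappa> * (\<integral>s. indicator {0<..\<sigma>} s * w (s - \<tau>) \<partial>lborel) \<le> \<kappa> * (\<tau> * A) + \<kappa> * ?I"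
    using \<kappa>(1) by (metis distrib_left mult_left_mono)
  moreover have "\<kappa> * ?I \<le> a * ?I" using \<kappa> I0 by (intro mult_right_mono)
  moreover have "(\<integral>s. indicator {0<..\<sigma>} s * (\<kappa> * w (s - \<tau>) - a * w s) \<partial>lborel)
    = \<kappa> * (\<integral>s. indicator {0<..\<sigma>} s * w (s - \<tau>) \<partial>lborel) - a * ?I"
    unfolding eq by (subst Bochner_Integration.integral_diff) (auto intro!: int int0)
  ultimately show "(\<integral>s. indicator {0<..\<sigma>} s * (\<kappa> * w (s - \<tau>) - a * w s) \<partial>lborel) \<le> \<kappa> * (\<tau> * A)" by linarith
qed

section \<open>The killed moment\<close>

context neutral_equation
begin

lemma Z_joint: "(\<lambda>x. Z (max 0 (fst x)) (snd x)) \<in> borel_measurable LM"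
proof -
  have "((\<lambda>u. Z u w) \<longlongrightarrow> Z t w) (at_right t)" if "w \<in> space M" "0 \<le> t" for w t
  proof -
    have "((\<lambda>u. Z u w) \<longlongrightarrow> Z t w) (at t within {0..})"
      using Z_cont[OF that(1)] that(2) by (simp add: continuous_on_def)
    then show ?thesis by (rule tendsto_within_subset) (use that in auto)
  qed
  then show ?thesis
    using right_continuous_joint_measurable[of Z M] meas_M[OF _ Z_meas] by (simp add: split_beta')
qed

text \<open>Formulated without the exit time, which depends on the horizon: for fixed
  \<open>R\<close> the killed moment has to be one function of \<open>t\<close> if Gronwall's
  inequality is to apply to it.\<close>

definition survives :: "real \<Rightarrow> real \<Rightarrow> 'a \<Rightarrow> bool" where
  "survives R t w \<longleftrightarrow> (\<forall>u. 0 \<le> u \<and> u < t \<longrightarrow> norm (Z u w) < R)"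

definition killed_moment :: "(real^'d \<Rightarrow> real \<Rightarrow> 's \<Rightarrow> real) \<Rightarrow> real \<Rightarrow> real \<Rightarrow> real \<Rightarrow> real" where
  "killed_moment V lam R t = (\<integral>w. of_bool (survives R t w) * (exp (lam * t) * V (Z t w) t (r t w)) \<partial>M)"

text \<open>The constant \<open>C0\<close> collects the initial value of \<open>V\<close>, the
  integral of \<open>\<gamma>\<close> and the share of the history in the delayed term, none of
  which involves \<open>R\<close> or \<open>T\<close>. The a priori bound \<open>B\<close> may
  depend on both.\<close>

lemma killed_moment_ineq:
  fixes V :: "real^'d \<Rightarrow> real \<Rightarrow> 's \<Rightarrow> real" and U :: "real^'d \<Rightarrow> real \<Rightarrow> real" and lam \<alpha>\<^sub>1 \<alpha>\<^sub>2 :: real and \<gamma> \<psi> :: "real \<Rightarrow> real"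
  assumes V: "C21 V" and V0: "\<And>x t i. 0 \<le> t \<Longrightarrow> 0 \<le> V x t i" and lam: "0 \<le> lam"
    and U: "continuous_on (UNIV \<times> {-\<tau>..}) (\<lambda>(x, t). U x t)" "\<And>x t. - \<tau> \<le> t \<Longrightarrow> 0 \<le> U x t"
    and \<gamma>: "integrable lborel \<gamma>" "\<And>t. 0 \<le> \<gamma> t" and \<psi>: "integrable lborel \<psi>" "\<And>t. 0 \<le> \<psi> t"
    and \<alpha>: "0 \<le> \<alpha>\<^sub>2" "\<alpha>\<^sub>2 * exp (lam * \<tau>) \<le> \<alpha>\<^sub>1"
    and LV: "AE s in lborel. 0 < s \<longrightarrow> (\<forall>x y i. exp (lam * s) * (L_operator \<Gamma> D f g V x y s i + lam * V (x - D y i) s i)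
      \<le> \<gamma> s + \<psi> s * (exp (lam * s) * V (x - D y i) s i) + exp (lam * s) * (\<alpha>\<^sub>2 * U y (s - \<tau>) - \<alpha>\<^sub>1 * U x s))"
  obtains C0 where "0 \<le> C0"
    "\<And>T R. 0 < T \<Longrightarrow> 2 * K0 < R \<Longrightarrow> \<exists>B\<ge>0. \<forall>t. 0 < t \<and> t \<le> T \<longrightarrow> 0 \<le> killed_moment V lam R t \<and> killed_moment V lam R t \<le> B"
    "\<And>T R. 0 < T \<Longrightarrow> 2 * K0 < R \<Longrightarrow> integrable M (\<lambda>w. of_bool (survives R T w) * (exp (lam * T) * V (Z T w) T (r T w)))"
    "\<And>T R. 0 < T \<Longrightarrow> 2 * K0 < R \<Longrightarrow> (\<lambda>s. indicator {0<..T} s * killed_moment V lam R s) \<in> borel_measurable lborel"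
    "\<And>T R. 0 < T \<Longrightarrow> 2 * K0 < R \<Longrightarrow> killed_moment V lam R T \<le> C0 + (\<integral>s. indicator {0<..T} s * (\<psi> s * killed_moment V lam R s) \<partial>lborel)"
proof -
  have Vc: "continuous_on UNIV (\<lambda>(x, t). V x (max 0 t) i)" for i
    using V continuous_on_max_extend[of "\<lambda>x t. V x t i"] by (simp add: C21_def split_beta')
  have Uc: "continuous_on UNIV (\<lambda>(x, t). U x (max (- \<tau>) t))"
  proof -
    have "continuous_on UNIV (\<lambda>x. (fst x, max (- \<tau>) (snd x)) :: (real^'d) \<times> real)"
      by (intro continuous_intros)
    from continuous_on_compose2[OF U(1) this] show ?thesis by (simp add: image_subset_iff split_beta')
  qed
  have Ucomp: "\<exists>A\<ge>0. \<forall>x t. norm x \<le> R \<and> t \<in> {a..b} \<longrightarrow> U x (max (- \<tau>) t) \<le> A" for R a b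
  proof (rule compact_bound[where h="\<lambda>x t (i::unit). U x (max (- \<tau>) t)" and S="cball 0 R \<times> {a..b}", OF Uc])
    fix A assume A: "0 \<le> A" "\<And>x t (i::unit). (x, t) \<in> cball 0 R \<times> {a..b} \<Longrightarrow> norm (U x (max (- \<tau>) t)) \<le> A"
    have "U x (max (- \<tau>) t) \<le> A" if "norm x \<le> R" "t \<in> {a..b}" for x t
      using A(2)[of x t] that by (simp add: abs_le_iff)
    with A(1) show ?thesis by blast
  qed (intro compact_Times compact_cball compact_Icc)
  have Vcomp: "\<exists>A\<ge>0. \<forall>x t i. norm x \<le> R \<and> 0 \<le> t \<and> t \<le> b \<longrightarrow> V x t i \<le> A" for R b
  proof (rule compact_bound[where h="\<lambda>x t i. V x (max 0 t) i" and S="cball 0 R \<times> {0..b}", OF Vc])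
    fix A assume A: "0 \<le> A" "\<And>x t i. (x, t) \<in> cball 0 R \<times> {0..b} \<Longrightarrow> norm (V x (max 0 t) i) \<le> A"
    have "V x t i \<le> A" if "norm x \<le> R" "0 \<le> t" "t \<le> b" for x t i
      using A(2)[of x t i] that by (simp add: abs_le_iff)
    with A(1) show ?thesis by blast
  qed (intro compact_Times compact_cball compact_Icc)
  obtain e0 where e0: "0 \<le> e0" "\<And>x t i. norm x \<le> 2 * K0 \<and> 0 \<le> t \<and> t \<le> 0 \<Longrightarrow> V x t i \<le> e0"
    using Vcomp[of "2 * K0" 0] by blast
  obtain A where A: "0 \<le> A" "\<And>x t. norm x \<le> K0 \<and> t \<in> {- \<tau>..0} \<Longrightarrow> U x (max (- \<tau>) t) \<le> A"
    using Ucomp[of K0 "- \<tau>" 0] by blast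
  \<comment> \<open>The weight \<open>exp (lam * s)\<close> of the delayed term equals
    \<open>exp (lam * \<tau>)\<close> times the weight at the delayed time; this is the origin of
    the factor.\<close>
  define \<kappa> where "\<kappa> = \<alpha>\<^sub>2 * exp (lam * \<tau>)"
  have \<kappa>: "0 \<le> \<kappa>" "\<kappa> \<le> \<alpha>\<^sub>1" using \<alpha> by (auto simp: \<kappa>_def)
  have [measurable]: "\<psi> \<in> borel_measurable borel" "\<gamma> \<in> borel_measurable borel" using \<psi>(1) \<gamma>(1) by auto
  define c where "c = (\<integral>s. \<gamma> s \<partial>lborel) + \<kappa> * (\<tau> * A)"
  have c0: "0 \<le> c"
    unfolding c_def using \<kappa> \<tau> A by (intro add_nonneg_nonneg integral_nonneg_AE AE_I2 \<gamma> mult_nonneg_nonneg) auto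
  interpret pair_sigma_finite lborel M ..
  define E where "E x = exp (lam * fst x) * V (Z (max 0 (fst x)) (snd x)) (max 0 (fst x)) (r (max 0 (fst x)) (snd x))" for x
  have Em[measurable]: "E \<in> borel_measurable LM"
  proof -
    have [measurable]: "(\<lambda>x. (Z (max 0 (fst x)) (snd x), fst x)) \<in> borel_measurable LM"
      using Z_joint by (intro borel_measurable_Pair) auto
    have "(\<lambda>x. V (Z (max 0 (fst x)) (snd x)) (max 0 (fst x)) (r (max 0 (fst x)) (snd x))) \<in> borel_measurable LM"
      using measurable_switched[where h="\<lambda>(z, s) i. V z (max 0 s) i" and Y="\<lambda>x. (Z (max 0 (fst x)) (snd x), fst x)"
          and N="lborel \<Otimes>\<^sub>M M", OF _ chain_joint[OF mc]] Vc by (simp add: split_beta')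
    then show ?thesis unfolding E_def[abs_def] by measurable
  qed
  let ?y = "killed_moment V lam"
  have main: "(\<exists>B\<ge>0. \<forall>t. 0 < t \<and> t \<le> T \<longrightarrow> 0 \<le> ?y R t \<and> ?y R t \<le> B)
    \<and> integrable M (\<lambda>w. of_bool (survives R T w) * (exp (lam * T) * V (Z T w) T (r T w)))
    \<and> (\<lambda>s. indicator {0<..T} s * ?y R s) \<in> borel_measurable lborel
    \<and> ?y R T \<le> e0 + c + (\<integral>s. indicator {0<..T} s * (\<psi> s * ?y R s) \<partial>lborel)"
    if T: "0 < T" and R: "2 * K0 < R" for T R
  proof -
    obtain \<sigma> h where \<sigma>[measurable]: "\<sigma> \<in> borel_measurable M" and \<sigma>b: "\<And>w. w \<in> space M \<Longrightarrow> 0 \<le> \<sigma> w \<and> \<sigma> w \<le> T" and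
      sv: "\<And>w t. w \<in> space M \<Longrightarrow> 0 \<le> t \<Longrightarrow> t \<le> T \<Longrightarrow> t \<le> \<sigma> w \<longleftrightarrow> (\<forall>u. 0 \<le> u \<and> u < t \<longrightarrow> norm (Z u w) < R)" and
      Zle: "\<And>w s. w \<in> space M \<Longrightarrow> 0 \<le> s \<Longrightarrow> s \<le> \<sigma> w \<Longrightarrow> norm (Z s w) \<le> R" and
      h: "integrable LM h" and
      hL: "\<And>w s. w \<in> \<Omega> \<Longrightarrow> 0 < s \<Longrightarrow> s \<le> \<sigma> w \<Longrightarrow>
       h (s, w) = exp (lam * s) * (L_operator \<Gamma> D f g V (X s w) (X (s - \<tau>) w) s (r s w) + lam * V (Z s w) s (r s w))" and
      h0: "\<And>w s. \<not> (0 < s \<and> s \<le> \<sigma> w) \<Longrightarrow> w \<in> space M \<Longrightarrow> h (s, w) = 0" and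
      dyn: "(\<integral>w. of_bool (T \<le> \<sigma> w) * (exp (lam * T) * V (Z T w) T (r T w)) \<partial>M)
        \<le> (\<integral>w. V (Z 0 w) 0 (r 0 w) \<partial>M) + (\<integral>x. h x \<partial>LM)"
      by (rule dynkin_neutral[OF V V0 T R, of lam], assumption) (rule that; assumption)
    have R0: "0 \<le> R" using R K0 by linarith
    have sv': "survives R t w \<longleftrightarrow> t \<le> \<sigma> w" if "w \<in> space M" "0 \<le> t" "t \<le> T" for w t
      using sv[OF that] by (simp add: survives_def)
    obtain CV where CV: "0 \<le> CV" "\<And>x t i. norm x \<le> R \<and> 0 \<le> t \<and> t \<le> T \<Longrightarrow> V x t i \<le> CV"
      using Vcomp[of R T] by blast
    define B where "B = exp (lam * T) * CV"
    have B0: "0 \<le> B" using CV by (simp add: B_def)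
    \<comment> \<open>The integrand of the killed moment for all times at once, jointly measurable,
      so that Fubini's theorem applies.\<close>
    define k where "k x = of_bool (fst x \<le> \<sigma> (snd x)) * E x" for x
    have km[measurable]: "k \<in> borel_measurable LM" unfolding k_def[abs_def] by measurable
    have kB: "0 \<le> k (s, w) \<and> k (s, w) \<le> B" if "w \<in> space M" "0 < s" "s \<le> T" for s w
    proof (cases "s \<le> \<sigma> w")
      case True
      have "E (s, w) \<le> exp (lam * T) * CV"
        unfolding E_def using CV(2)[of "Z s w" s "r s w"] Zle[of w s] that True lam V0 by (auto intro!: mult_mono)
      moreover have "0 \<le> E (s, w)" unfolding E_def using V0 by simp
      ultimately show ?thesis using True by (simp add: k_def B_def)
    qed (use B0 in \<open>simp add: k_def\<close>)
    have yk: "?y R s = (\<integral>w. k (s, w) \<partial>M)" if "0 < s" "s \<le> T" for s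
      unfolding killed_moment_def using that by (intro Bochner_Integration.integral_cong) (auto simp: k_def E_def sv')
    have ks: "integrable M (\<lambda>w. k (s, w))" if "0 < s" "s \<le> T" for s
      by (rule integrable_bounded[where K=B]) (use kB that in \<open>auto simp: abs_le_iff\<close>)
    have yB: "0 \<le> ?y R t \<and> ?y R t \<le> B" if "0 < t" "t \<le> T" for t
    proof -
      have "0 \<le> (\<integral>w. k (t, w) \<partial>M)" using kB that by (intro integral_nonneg_AE AE_I2) auto
      moreover have "(\<integral>w. k (t, w) \<partial>M) \<le> B" using kB that by (intro integral_le_const ks AE_I2) auto
      ultimately show ?thesis using yk[OF that] by simp
    qed
    have ym: "(\<lambda>s. indicator {0<..T} s * ?y R s) \<in> borel_measurable lborel"
    proof -
      have "(\<lambda>s. indicator {0<..T} s * (\<integral>w. k (s, w) \<partial>M)) \<in> borel_measurable lborel"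
        by measurable
      then show ?thesis
        by (rule measurable_cong[THEN iffD1, rotated]) (auto simp: indicator_def yk)
    qed
    define q where "q x = indicator {0<..T} (fst x) * (\<psi> (fst x) * k x)" for x
    have qi: "integrable LM q"
    proof (rule Bochner_Integration.integrable_bound[of _ "\<lambda>x. B * \<psi> (fst x)"])
      have "integrable LM (\<lambda>x. \<psi> (fst x))"
        using \<psi> by (intro Fubini_integrable) (auto simp: prob_space)
      then show "integrable LM (\<lambda>x. B * \<psi> (fst x))" by simp
      show "AE x in LM. norm (q x) \<le> norm (B * \<psi> (fst x))"
      proof (intro AE_I2)
        fix x assume "x \<in> space LM"
        then obtain s w where x: "x = (s, w)" "w \<in> space M" by (auto simp: space_pair_measure)
        show "norm (q x) \<le> norm (B * \<psi> (fst x))"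
        proof (cases "0 < s \<and> s \<le> T")
          case True
          then have "\<psi> s * k (s, w) \<le> \<psi> s * B" "0 \<le> \<psi> s * k (s, w)"
            using kB[OF x(2), of s] \<psi>(2)[of s] by (auto intro: mult_left_mono)
          then show ?thesis using x True by (simp add: q_def mult.commute)
        qed (use x in \<open>simp add: q_def\<close>)
      qed
    qed (unfold q_def, measurable)
    have qI: "(\<integral>x. q x \<partial>LM) = (\<integral>s. indicator {0<..T} s * (\<psi> s * ?y R s) \<partial>lborel)"
    proof -
      have "(\<integral>x. q x \<partial>LM) = (\<integral>s. (\<integral>w. q (s, w) \<partial>M) \<partial>lborel)"
        using integral_fst'[OF qi] by simp
      also have "\<dots> = (\<integral>s. indicator {0<..T} s * (\<psi> s * ?y R s) \<partial>lborel)"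
        by (intro Bochner_Integration.integral_cong) (auto simp: q_def indicator_def yk)
      finally show ?thesis .
    qed
    have path: "(\<integral>s. h (s, w) \<partial>lborel) \<le> c + (\<integral>s. q (s, w) \<partial>lborel)"
      if w: "w \<in> \<Omega>" and ih: "integrable lborel (\<lambda>s. h (s, w))" and iq: "integrable lborel (\<lambda>s. q (s, w))" for w
    proof -
      have wM: "w \<in> space M" by (rule \<Omega>_space[OF w])
      note \<sigma>w = \<sigma>b[OF wM]
      \<comment> \<open>The weighted \<open>U\<close> along the path, cut off before the history and
        after the exit time so that it is bounded on the whole line.\<close>
      define e where "e v = indicator {- \<tau>..\<sigma> w} v * (exp (lam * v) * U (X (max (- \<tau>) v) w) (max (- \<tau>) v))" for v
      have [measurable]: "(\<lambda>v. U (X (max (- \<tau>) v) w) (max (- \<tau>) v)) \<in> borel_measurable borel"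
      proof -
        note [measurable] = X_path[OF wM]
        have "(\<lambda>v. (\<lambda>(x, t). U x (max (- \<tau>) t)) (X (max (- \<tau>) v) w, v)) \<in> borel_measurable borel"
          by (rule borel_measurable_continuous_on[OF Uc]) measurable
        then show ?thesis by simp
      qed
      have em: "e \<in> borel_measurable borel" unfolding e_def[abs_def] by measurable
      have e0: "0 \<le> e v" for v unfolding e_def using U(2)[of "max (- \<tau>) v"] by simp
      have eA: "e v \<le> A" if "v \<le> 0" for v
      proof (cases "- \<tau> \<le> v")
        case True
        then have "U (X (max (- \<tau>) v) w) (max (- \<tau>) v) \<le> A" using A(2)[of "X v w" v] X_init[OF w True that] that by simp
        then have "exp (lam * v) * U (X (max (- \<tau>) v) w) (max (- \<tau>) v) \<le> 1 * A"
          using lam that U(2)[of "max (- \<tau>) v"] by (intro mult_mono) (auto simp: mult_le_0_iff)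
        then show ?thesis using A(1) unfolding e_def indicator_def by (cases "v \<in> {- \<tau>..\<sigma> w}") (simp_all only: of_bool_eq mult_1_left mult_zero_left)
      qed (use A(1) in \<open>simp add: e_def\<close>)
      \<comment> \<open>This bound depends on the radius, but it only secures integrability; the
        estimate obtained from the cancellation involves \<open>A\<close>.\<close>
      obtain A' where A': "0 \<le> A'" "\<And>x t. norm x \<le> R / (1 - \<beta>) + K0 \<and> t \<in> {- \<tau>..T} \<Longrightarrow> U x (max (- \<tau>) t) \<le> A'"
        using Ucomp[of "R / (1 - \<beta>) + K0" "- \<tau>" T] by blast
      have eB: "e v \<le> exp (lam * T) * A'" for v
      proof (cases "- \<tau> \<le> v \<and> v \<le> \<sigma> w")
        case True
        have "norm (X v w) \<le> R / (1 - \<beta>) + K0"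
          by (rule X_le[OF w R0, of "\<sigma> w"]) (use Zle[OF wM] True in auto)
        then have "U (X (max (- \<tau>) v) w) (max (- \<tau>) v) \<le> A'" using A'(2)[of "X v w" v] True \<sigma>w by simp
        then have "exp (lam * v) * U (X (max (- \<tau>) v) w) (max (- \<tau>) v) \<le> exp (lam * T) * A'"
          using True \<sigma>w lam U(2)[of "max (- \<tau>) v"] by (intro mult_mono) (auto intro!: mult_left_mono)
        then show ?thesis using True by (simp add: e_def)
      next
        case False
        then have "e v = 0" by (auto simp: e_def indicator_def)
        then show ?thesis using A'(1) by simp
      qed
      note dc = delay_cancellation[OF em e0 eB eA conjunct1[OF \<sigma>w] \<tau> \<kappa>]
      have "(\<integral>s. h (s, w) \<partial>lborel) \<le> (\<integral>s. \<gamma> s + q (s, w) + indicator {0<..\<sigma> w} s * (\<kappa> * e (s - \<tau>) - \<alpha>\<^sub>1 * e s) \<partial>lborel)"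
      proof (rule integral_mono_AE[OF ih])
        show "integrable lborel (\<lambda>s. \<gamma> s + q (s, w) + indicator {0<..\<sigma> w} s * (\<kappa> * e (s - \<tau>) - \<alpha>\<^sub>1 * e s))"
          by (intro Bochner_Integration.integrable_add \<gamma>(1) iq dc(1))
        show "AE s in lborel. h (s, w) \<le> \<gamma> s + q (s, w) + indicator {0<..\<sigma> w} s * (\<kappa> * e (s - \<tau>) - \<alpha>\<^sub>1 * e s)"
          using LV
        proof eventually_elim
          case (elim s)
          show ?case
          proof (cases "0 < s \<and> s \<le> \<sigma> w")
            case True
            then have s: "0 < s" "s \<le> \<sigma> w" "s \<le> T" using \<sigma>w by auto
            have ZX: "X s w - D (X (s - \<tau>) w) (r s w) = Z s w" using w by (simp add: Z_def)
            have "h (s, w) \<le> \<gamma> s + \<psi> s * (exp (lam * s) * V (Z s w) s (r s w)) + exp (lam * s) * (\<alpha>\<^sub>2 * U (X (s - \<tau>) w) (s - \<tau>) - \<alpha>\<^sub>1 * U (X s w) s)"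
              using elim[rule_format, OF s(1), of "X s w" "X (s - \<tau>) w" "r s w"] unfolding hL[OF w s(1,2)] ZX .
            moreover have "\<psi> s * (exp (lam * s) * V (Z s w) s (r s w)) = q (s, w)"
              using s by (simp add: q_def k_def E_def)
            moreover have "exp (lam * s) * (\<alpha>\<^sub>2 * U (X (s - \<tau>) w) (s - \<tau>) - \<alpha>\<^sub>1 * U (X s w) s) = \<kappa> * e (s - \<tau>) - \<alpha>\<^sub>1 * e s"
            proof -
              have "max (- \<tau>) s = s" "max (- \<tau>) (s - \<tau>) = s - \<tau>" using s \<tau> by auto
              then have "e s = exp (lam * s) * U (X s w) s" "e (s - \<tau>) = exp (lam * (s - \<tau>)) * U (X (s - \<tau>) w) (s - \<tau>)"
                using s \<tau> by (auto simp: e_def)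
              moreover have "exp (lam * \<tau>) * exp (lam * (s - \<tau>)) = exp (lam * s)"
                by (simp add: exp_add[symmetric] algebra_simps)
              ultimately show ?thesis by (simp add: \<kappa>_def right_diff_distrib mult_ac)
            qed
            ultimately show ?thesis using s by simp
          next
            \<comment> \<open>Outside the time of survival \<open>h\<close> and \<open>q\<close>
              vanish, and the right side is reduced to \<open>\<gamma> s\<close>.\<close>
            case False
            then have "q (s, w) = 0" by (auto simp: q_def k_def indicator_def)
            then show ?thesis using h0[OF False wM] False \<gamma>(2)[of s] by (auto simp: indicator_def)
          qed
        qed
      qed
      also have "\<dots> = (\<integral>s. \<gamma> s \<partial>lborel) + (\<integral>s. q (s, w) \<partial>lborel) + (\<integral>s. indicator {0<..\<sigma> w} s * (\<kappa> * e (s - \<tau>) - \<alpha>\<^sub>1 * e s) \<partial>lborel)"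
        using \<gamma>(1) iq dc(1) by simp
      also have "\<dots> \<le> c + (\<integral>s. q (s, w) \<partial>lborel)" using dc(2) by (simp add: c_def)
      finally show ?thesis .
    qed
    have h': "integrable LM (\<lambda>(s, w). h (s, w))" "integrable LM (\<lambda>(s, w). q (s, w))"
      using h qi by simp_all
    have "(\<integral>x. h x \<partial>LM) = (\<integral>w. (\<integral>s. h (s, w) \<partial>lborel) \<partial>M)"
      using integral_snd[OF h'(1)] by simp
    also have "\<dots> \<le> (\<integral>w. c + (\<integral>s. q (s, w) \<partial>lborel) \<partial>M)"
    proof (rule integral_mono_AE)
      show "integrable M (\<lambda>w. \<integral>s. h (s, w) \<partial>lborel)" by (rule integrable_snd[OF h'(1)])
      show "integrable M (\<lambda>w. c + (\<integral>s. q (s, w) \<partial>lborel))"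
        by (intro Bochner_Integration.integrable_add integrable_const integrable_snd[OF h'(2)])
      show "AE w in M. (\<integral>s. h (s, w) \<partial>lborel) \<le> c + (\<integral>s. q (s, w) \<partial>lborel)"
        using \<Omega>(2) AE_integrable_snd[OF h'(1)] AE_integrable_snd[OF h'(2)] by eventually_elim (rule path)
    qed
    also have "\<dots> = c + (\<integral>x. q x \<partial>LM)"
      using integral_snd[OF h'(2)] integrable_snd[OF h'(2)] by (simp add: prob_space)
    finally have hq: "(\<integral>x. h x \<partial>LM) \<le> c + (\<integral>s. indicator {0<..T} s * (\<psi> s * ?y R s) \<partial>lborel)"
      unfolding qI .
    have "(\<integral>w. V (Z 0 w) 0 (r 0 w) \<partial>M) \<le> e0"
    proof (rule integral_le_const)
      have b: "0 \<le> V (Z 0 w) 0 (r 0 w) \<and> V (Z 0 w) 0 (r 0 w) \<le> e0" if "w \<in> space M" for w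
        using e0(2)[of "Z 0 w" 0] Z_init[OF that] V0 by auto
      have "(\<lambda>w. V (Z 0 w) 0 (r 0 w)) \<in> borel_measurable M"
      proof (rule measurable_switched[where h="\<lambda>z i. V z 0 i"])
        show "Z 0 \<in> borel_measurable M" "r 0 \<in> measurable M (count_space UNIV)"
          using meas_M[OF _ Z_meas] meas_M[OF _ r_meas] by auto
        show "continuous_on UNIV (\<lambda>z. V z 0 i)" for i
          using continuous_on_slice(1)[OF Vc, of 0 i] by simp
      qed
      then show "integrable M (\<lambda>w. V (Z 0 w) 0 (r 0 w))"
        by (rule integrable_bounded[where K=e0]) (use b in \<open>auto simp: abs_le_iff intro: order_trans\<close>)
      show "AE w in M. V (Z 0 w) 0 (r 0 w) \<le> e0" using b by auto
    qed
    moreover have "?y R T = (\<integral>w. of_bool (T \<le> \<sigma> w) * (exp (lam * T) * V (Z T w) T (r T w)) \<partial>M)"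
      unfolding killed_moment_def using T by (intro Bochner_Integration.integral_cong) (auto simp: sv')
    ultimately have "?y R T \<le> e0 + c + (\<integral>s. indicator {0<..T} s * (\<psi> s * ?y R s) \<partial>lborel)"
      using dyn hq by linarith
    moreover have "integrable M (\<lambda>w. of_bool (survives R T w) * (exp (lam * T) * V (Z T w) T (r T w)))"
      by (rule Bochner_Integration.integrable_cong[THEN iffD1, rotated 2, OF ks[OF T order_refl]]) (use T in \<open>auto simp: k_def E_def sv'\<close>)
    ultimately show ?thesis using B0 yB ym by blast
  qed
  show ?thesis
    by (rule that[of "e0 + c"]) (use main e0(1) c0 in auto)
qed

end

text \<open>Absolute integrability refers to Lebesgue measurable functions, while the joint
  integrals over time and paths call for Borel ones. The change on a null set is why the bound on
  \<open>L_operator\<close> is used for almost every time.\<close>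

lemma absolutely_integrable_borel_version:
  fixes h :: "real \<Rightarrow> real"
  assumes h: "h absolutely_integrable_on {0..}" and h0: "\<And>t. 0 \<le> t \<Longrightarrow> 0 \<le> h t"
  obtains h' where "integrable lborel h'" "\<And>t. 0 \<le> h' t" "AE t in lborel. 0 \<le> t \<longrightarrow> h t = h' t"
proof -
  let ?g = "\<lambda>t. indicator {0..} t *\<^sub>R h t"
  have i: "integrable lebesgue ?g" using h by (simp add: set_integrable_def)
  obtain g' where g': "g' \<in> borel_measurable lborel" "AE t in lborel. ?g t = g' t"
    using completion_ex_borel_measurable_real[OF borel_measurable_integrable[OF i]] by blast
  have ae: "AE t in lborel. ?g t = max 0 (g' t)"
    using g'(2)
  proof eventually_elim
    case (elim t)
    have "0 \<le> ?g t" using h0[of t] by (cases "0 \<le> t") simp_all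
    then show ?case by (simp only: elim max_absorb2)
  qed
  have m: "(\<lambda>t. max 0 (g' t)) \<in> borel_measurable lborel" using g'(1) by simp
  show ?thesis
  proof (rule that[of "\<lambda>t. max 0 (g' t)"])
    have "integrable lebesgue (\<lambda>t. max 0 (g' t)) \<longleftrightarrow> integrable lebesgue ?g"
    proof (rule integrable_cong_AE)
      show "(\<lambda>t. max 0 (g' t)) \<in> borel_measurable lebesgue" by (rule measurable_completion[OF m])
      show "?g \<in> borel_measurable lebesgue" by (rule borel_measurable_integrable[OF i])
      show "AE t in lebesgue. max 0 (g' t) = ?g t" using AE_completion[OF ae] by eventually_elim (rule sym)
    qed
    then show "integrable lborel (\<lambda>t. max 0 (g' t))" using i integrable_completion[OF m] by simp
    show "AE t in lborel. 0 \<le> t \<longrightarrow> h t = max 0 (g' t)" using ae by eventually_elim (rule impI, simp)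
  qed auto
qed

section \<open>From the killed moment to the decay of \<open>X\<close>\<close>

context neutral_equation
begin

lemma X_moment_decay:
  fixes V :: "real^'d \<Rightarrow> real \<Rightarrow> 's \<Rightarrow> real" and U :: "real^'d \<Rightarrow> real \<Rightarrow> real" and lam \<alpha>\<^sub>1 \<alpha>\<^sub>2 c\<^sub>1 p :: real and \<gamma> \<psi> :: "real \<Rightarrow> real"
  assumes V: "C21 V" and V0: "\<And>x t i. 0 \<le> t \<Longrightarrow> 0 \<le> V x t i" and lam: "0 \<le> lam"
    and U: "continuous_on (UNIV \<times> {-\<tau>..}) (\<lambda>(x, t). U x t)" "\<And>x t. - \<tau> \<le> t \<Longrightarrow> 0 \<le> U x t"
    and \<gamma>: "integrable lborel \<gamma>" "\<And>t. 0 \<le> \<gamma> t" and \<psi>: "integrable lborel \<psi>" "\<And>t. 0 \<le> \<psi> t"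
    and \<alpha>: "0 \<le> \<alpha>\<^sub>2" "\<alpha>\<^sub>2 * exp (lam * \<tau>) \<le> \<alpha>\<^sub>1"
    and LV: "AE s in lborel. 0 < s \<longrightarrow> (\<forall>x y i. exp (lam * s) * (L_operator \<Gamma> D f g V x y s i + lam * V (x - D y i) s i)
      \<le> \<gamma> s + \<psi> s * (exp (lam * s) * V (x - D y i) s i) + exp (lam * s) * (\<alpha>\<^sub>2 * U y (s - \<tau>) - \<alpha>\<^sub>1 * U x s))"
    and p: "1 \<le> p" and c\<^sub>1: "0 < c\<^sub>1" and Vp: "\<And>x t i. 0 \<le> t \<Longrightarrow> c\<^sub>1 * norm x powr p \<le> V x t i"
    and \<beta>lam: "\<beta> * exp (lam * \<tau>) < 1"
  shows "\<exists>C>0. \<forall>t>0. (\<integral>\<^sup>+w. ennreal (norm (X t w) powr p) \<partial>M) \<le> ennreal (C * exp (- lam * t))"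
proof -
  let ?y = "killed_moment V lam"
  obtain C0 where C0: "0 \<le> C0" and
    yB: "\<And>T R. 0 < T \<Longrightarrow> 2 * K0 < R \<Longrightarrow> \<exists>B\<ge>0. \<forall>t. 0 < t \<and> t \<le> T \<longrightarrow> 0 \<le> ?y R t \<and> ?y R t \<le> B" and
    yi: "\<And>T R. 0 < T \<Longrightarrow> 2 * K0 < R \<Longrightarrow> integrable M (\<lambda>w. of_bool (survives R T w) * (exp (lam * T) * V (Z T w) T (r T w)))" and
    ym: "\<And>T R. 0 < T \<Longrightarrow> 2 * K0 < R \<Longrightarrow> (\<lambda>s. indicator {0<..T} s * ?y R s) \<in> borel_measurable lborel" and
    yle: "\<And>T R. 0 < T \<Longrightarrow> 2 * K0 < R \<Longrightarrow> ?y R T \<le> C0 + (\<integral>s. indicator {0<..T} s * (\<psi> s * ?y R s) \<partial>lborel)"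
    by (rule killed_moment_ineq[OF V V0 lam U \<gamma> \<psi> \<alpha> LV], assumption+) (rule that; assumption)
  have \<psi>m: "\<psi> \<in> borel_measurable lborel" using \<psi>(1) by auto
  \<comment> \<open>Gronwall's inequality is applied for each radius separately, always with the
    same \<open>C0\<close> and \<open>\<psi>\<close>, hence with one \<open>C1\<close> for all
    radii.\<close>
  have "\<exists>C1\<ge>0. \<forall>T R. 0 < T \<and> 2 * K0 < R \<longrightarrow> ?y R T \<le> C1"
  proof (rule gronwall_L1[OF \<psi>m \<psi> C0])
    fix C1 assume C1: "0 \<le> C1" and
      gr: "\<And>y B T. 0 \<le> B \<Longrightarrow> (\<lambda>s. indicator {0<..T} s * y s) \<in> borel_measurable lborel \<Longrightarrow>
      (\<And>t. 0 < t \<Longrightarrow> t \<le> T \<Longrightarrow> 0 \<le> y t \<and> y t \<le> B) \<Longrightarrow>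
      (\<And>t. 0 < t \<Longrightarrow> t \<le> T \<Longrightarrow> y t \<le> C0 + (\<integral>s. indicator {0<..t} s * (\<psi> s * y s) \<partial>lborel)) \<Longrightarrow> 0 < T \<Longrightarrow> y T \<le> C1"
    have "?y R T \<le> C1" if T: "0 < T" and R: "2 * K0 < R" for T R
    proof -
      obtain B where B: "0 \<le> B" "\<And>t. 0 < t \<and> t \<le> T \<Longrightarrow> 0 \<le> ?y R t \<and> ?y R t \<le> B" using yB[OF T R] by blast
      show ?thesis by (rule gr[OF B(1) ym[OF T R] _ _ T]) (use B(2) yle R in auto)
    qed
    with C1 show ?thesis by blast
  qed
  then obtain C1 where C1: "0 \<le> C1" "\<And>T R. 0 < T \<and> 2 * K0 < R \<Longrightarrow> ?y R T \<le> C1" by blast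
  \<comment> \<open>The radius tends to infinity: a path is bounded on \<open>[0, T]\<close>, so it
    survives from some radius on, and Fatou's lemma removes the killing.\<close>
  have EV: "(\<integral>\<^sup>+w. ennreal (exp (lam * T) * V (Z T w) T (r T w)) \<partial>M) \<le> ennreal C1" if T: "0 < T" for T
  proof -
    let ?e = "\<lambda>w. exp (lam * T) * V (Z T w) T (r T w)"
    define R where "R n = 2 * K0 + 1 + real n" for n
    have R: "2 * K0 < R n" for n by (simp add: R_def)
    have e0: "0 \<le> ?e w" for w using V0 T by simp
    have um: "(\<lambda>w. ennreal (of_bool (survives (R n) T w) * ?e w)) \<in> borel_measurable M" for n
      using borel_measurable_integrable[OF yi[OF T R]] by measurable
    have lim: "liminf (\<lambda>n. ennreal (of_bool (survives (R n) T w) * ?e w)) = ennreal (?e w)" if w: "w \<in> space M" for w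
    proof (rule lim_imp_Liminf[OF sequentially_bot tendsto_eventually])
      have "compact ((\<lambda>t. Z t w) ` {0..T})"
        by (intro compact_continuous_image continuous_on_subset[OF Z_cont[OF w]]) auto
      then obtain b where b: "\<And>t. t \<in> {0..T} \<Longrightarrow> norm (Z t w) \<le> b"
        using compact_imp_bounded[of "(\<lambda>t. Z t w) ` {0..T}"] unfolding bounded_iff by blast
      obtain n0 where n0: "b < real n0" using reals_Archimedean2 by blast
      have "survives (R n) T w" if "n0 \<le> n" for n
        unfolding survives_def R_def
      proof (intro allI impI)
        fix u assume "0 \<le> u \<and> u < T"
        then have "norm (Z u w) \<le> b" using b by simp
        then show "norm (Z u w) < 2 * K0 + 1 + real n" using n0 that K0 by linarith
      qed
      then show "\<forall>\<^sub>F n in sequentially. ennreal (of_bool (survives (R n) T w) * ?e w) = ennreal (?e w)"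
        by (intro eventually_sequentiallyI[of n0]) simp
    qed
    have "(\<integral>\<^sup>+w. ennreal (?e w) \<partial>M) = (\<integral>\<^sup>+w. liminf (\<lambda>n. ennreal (of_bool (survives (R n) T w) * ?e w)) \<partial>M)"
      by (intro nn_integral_cong) (simp only: lim)
    also have "\<dots> \<le> liminf (\<lambda>n. \<integral>\<^sup>+w. ennreal (of_bool (survives (R n) T w) * ?e w) \<partial>M)"
      by (rule nn_integral_liminf[OF um])
    also have "\<dots> \<le> limsup (\<lambda>n. \<integral>\<^sup>+w. ennreal (of_bool (survives (R n) T w) * ?e w) \<partial>M)"
      by (rule Liminf_le_Limsup) simp
    also have "\<dots> \<le> ennreal C1"
    proof (rule Limsup_bounded, rule always_eventually, rule allI)
      fix n
      have "(\<integral>\<^sup>+w. ennreal (of_bool (survives (R n) T w) * ?e w) \<partial>M) = ennreal (?y (R n) T)"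
        unfolding killed_moment_def by (rule nn_integral_eq_integral[OF yi[OF T R]]) (use e0 in simp)
      also have "\<dots> \<le> ennreal C1" using C1(2)[of T "R n"] T R by (simp add: ennreal_leI)
      finally show "(\<integral>\<^sup>+w. ennreal (of_bool (survives (R n) T w) * ?e w) \<partial>M) \<le> ennreal C1" .
    qed
    finally show ?thesis .
  qed
  have Zm: "Z t \<in> borel_measurable M" if "0 \<le> t" for t using meas_M[OF that Z_meas[OF that]] .
  have Xm: "X t \<in> borel_measurable M" if "- \<tau> \<le> t" for t using meas_M[OF _ X_meas[OF that]] by simp
  define q where "q t = (\<integral>\<^sup>+w. ennreal (norm (X t w) powr p) \<partial>M)" for t
  have Zp: "(\<integral>\<^sup>+w. ennreal (norm (Z t w) powr p) \<partial>M) \<le> ennreal (C1 / c\<^sub>1 * exp (- lam * t))" if t: "0 < t" for t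
  proof -
    let ?k = "exp (- lam * t) / c\<^sub>1"
    have "(\<integral>\<^sup>+w. ennreal (norm (Z t w) powr p) \<partial>M) \<le> (\<integral>\<^sup>+w. ennreal ?k * ennreal (exp (lam * t) * V (Z t w) t (r t w)) \<partial>M)"
    proof (intro nn_integral_mono)
      fix w
      have "norm (Z t w) powr p \<le> V (Z t w) t (r t w) / c\<^sub>1"
        using Vp[of t "Z t w" "r t w"] t c\<^sub>1 by (simp add: pos_le_divide_eq mult.commute)
      also have "\<dots> = ?k * (exp (lam * t) * V (Z t w) t (r t w))"
        by (simp add: exp_minus field_simps)
      finally show "ennreal (norm (Z t w) powr p) \<le> ennreal ?k * ennreal (exp (lam * t) * V (Z t w) t (r t w))"
        using c\<^sub>1 by (simp add: ennreal_mult'[symmetric] ennreal_leI)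
    qed
    also have "\<dots> = ennreal ?k * (\<integral>\<^sup>+w. ennreal (exp (lam * t) * V (Z t w) t (r t w)) \<partial>M)"
    proof (rule nn_integral_cmult)
      have "(\<lambda>w. V (Z t w) t (r t w)) \<in> borel_measurable M"
      proof (rule measurable_switched[OF Zm])
        show "r t \<in> measurable M (count_space UNIV)" using meas_M[OF _ r_meas] t by simp
        show "continuous_on UNIV (\<lambda>z. V z t i)" for i
        proof -
          have "continuous_on (UNIV \<times> {0..}) (\<lambda>(x, t). V x t i)" using V by (simp add: C21_def)
          then have "continuous_on UNIV (\<lambda>z. (\<lambda>(x, t). V x t i) (z, t))"
            by (rule continuous_on_compose2) (use t in \<open>auto intro!: continuous_intros\<close>)
          then show ?thesis by simp
        qed
      qed (use t in simp)
      then show "(\<lambda>w. ennreal (exp (lam * t) * V (Z t w) t (r t w))) \<in> borel_measurable M" by measurable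
    qed
    also have "\<dots> \<le> ennreal ?k * ennreal C1" by (intro mult_left_mono EV[OF t]) simp
    also have "\<dots> = ennreal (C1 / c\<^sub>1 * exp (- lam * t))"
      using c\<^sub>1 C1(1) by (simp add: ennreal_mult'[symmetric] mult.commute)
    finally show ?thesis .
  qed
  define a where "a = (1 - \<beta>) powr (1 - p) * (C1 / c\<^sub>1)"
  have a0: "0 \<le> a" unfolding a_def using C1(1) c\<^sub>1 by simp
  have rec: "q t \<le> ennreal (a * exp (- lam * t)) + ennreal \<beta> * q (t - \<tau>)" if t: "0 < t" for t
  proof -
    let ?b = "(1 - \<beta>) powr (1 - p)"
    have [measurable]: "Z t \<in> borel_measurable M" "X t \<in> borel_measurable M" "X (t - \<tau>) \<in> borel_measurable M"
      using Zm[of t] Xm[of t] Xm[of "t - \<tau>"] t \<tau> by auto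
    have "q t \<le> (\<integral>\<^sup>+w. ennreal ?b * ennreal (norm (Z t w) powr p) + ennreal \<beta> * ennreal (norm (X (t - \<tau>) w) powr p) \<partial>M)"
      unfolding q_def
    proof (rule nn_integral_mono_AE)
      show "AE w in M. ennreal (norm (X t w) powr p) \<le> ennreal ?b * ennreal (norm (Z t w) powr p) + ennreal \<beta> * ennreal (norm (X (t - \<tau>) w) powr p)"
        using \<Omega>(2)
      proof eventually_elim
        case (elim w)
        have "X t w = Z t w + D (X (t - \<tau>) w) (r t w)" using elim by (simp add: Z_def)
        then have "norm (X t w) \<le> norm (Z t w) + norm (D (X (t - \<tau>) w) (r t w))"
          by (simp only: norm_triangle_ineq)
        also have "\<dots> \<le> norm (Z t w) + \<beta> * norm (X (t - \<tau>) w)" using D_le by simp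
        finally have "norm (X t w) powr p \<le> (norm (Z t w) + \<beta> * norm (X (t - \<tau>) w)) powr p"
          using p by (intro powr_mono2) auto
        also have "\<dots> \<le> ?b * norm (Z t w) powr p + \<beta> * norm (X (t - \<tau>) w) powr p"
          by (rule powr_convex_split) (use \<beta> p in auto)
        finally have "ennreal (norm (X t w) powr p) \<le> ennreal (?b * norm (Z t w) powr p + \<beta> * norm (X (t - \<tau>) w) powr p)"
          by (rule ennreal_leI)
        then show ?case using \<beta> by (simp add: ennreal_mult')
      qed
    qed
    also have "\<dots> = ennreal ?b * (\<integral>\<^sup>+w. ennreal (norm (Z t w) powr p) \<partial>M) + ennreal \<beta> * q (t - \<tau>)"
      unfolding q_def by (subst nn_integral_add) (simp_all add: nn_integral_cmult)
    also have "ennreal ?b * (\<integral>\<^sup>+w. ennreal (norm (Z t w) powr p) \<partial>M) \<le> ennreal ?b * ennreal (C1 / c\<^sub>1 * exp (- lam * t))"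
      by (intro mult_left_mono Zp[OF t]) simp
    also have "\<dots> = ennreal (a * exp (- lam * t))" by (simp add: ennreal_mult'[symmetric] a_def mult.assoc)
    finally show ?thesis by (simp add: add_right_mono)
  qed
  define L where "L = 1 - \<beta> * exp (lam * \<tau>)"
  have L: "0 < L" using \<beta>lam by (simp add: L_def)
  \<comment> \<open>Large enough for the initial segment and for
    \<open>a + \<beta> * exp (lam * \<tau>) * C \<le> C\<close>, by which the bound reproduces
    itself from one delay interval to the next; this is where
    \<open>\<beta> * exp (lam * \<tau>) < 1\<close> enters.\<close>
  define C where "C = K0 powr p + a / L + 1"
  have "0 \<le> a / L" using a0 L by simp
  then have C: "0 < C" "K0 powr p \<le> C" "a / L \<le> C" by (auto simp: C_def intro: add_nonneg_pos)
  have aC: "a + \<beta> * exp (lam * \<tau>) * C \<le> C"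
  proof -
    have "a \<le> C * L" using C(3) L by (simp add: pos_divide_le_eq)
    then show ?thesis by (simp add: L_def algebra_simps)
  qed
  have init: "q t \<le> ennreal (C * exp (- lam * t))" if t: "- \<tau> \<le> t" "t \<le> 0" for t
  proof -
    have "q t \<le> (\<integral>\<^sup>+w. ennreal (K0 powr p) \<partial>M)"
      unfolding q_def
    proof (rule nn_integral_mono_AE)
      show "AE w in M. ennreal (norm (X t w) powr p) \<le> ennreal (K0 powr p)"
        using \<Omega>(2) by eventually_elim (use X_init t p in \<open>auto intro!: ennreal_leI powr_mono2\<close>)
    qed
    also have "\<dots> = ennreal (K0 powr p * 1)" by (simp add: emeasure_space_1)
    also have "\<dots> \<le> ennreal (C * exp (- lam * t))"
      using C(1,2) t lam by (intro ennreal_leI mult_mono) (auto simp: mult_nonneg_nonpos)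
    finally show ?thesis .
  qed
  have "\<forall>t. - \<tau> \<le> t \<and> t \<le> real n * \<tau> \<longrightarrow> q t \<le> ennreal (C * exp (- lam * t))" for n
  proof (induction n)
    case 0
    then show ?case using init by simp
  next
    case (Suc n)
    show ?case
    proof (intro allI impI)
      fix t assume t: "- \<tau> \<le> t \<and> t \<le> real (Suc n) * \<tau>"
      show "q t \<le> ennreal (C * exp (- lam * t))"
      proof (cases "t \<le> 0")
        case False
        have "q (t - \<tau>) \<le> ennreal (C * exp (- lam * (t - \<tau>)))"
          by (rule Suc.IH[rule_format]) (use t False in \<open>simp add: algebra_simps\<close>)
        then have "q t \<le> ennreal (a * exp (- lam * t)) + ennreal \<beta> * ennreal (C * exp (- lam * (t - \<tau>)))"
          using rec[of t] False by (intro order_trans[OF rec add_left_mono[OF mult_left_mono]]) auto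
        also have "\<dots> = ennreal (a * exp (- lam * t) + \<beta> * (C * exp (- lam * (t - \<tau>))))"
          using \<beta> C a0 by (simp add: ennreal_mult'[symmetric] ennreal_plus[symmetric] del: ennreal_plus)
        also have "a * exp (- lam * t) + \<beta> * (C * exp (- lam * (t - \<tau>))) = (a + \<beta> * exp (lam * \<tau>) * C) * exp (- lam * t)"
        proof -
          have "exp (- lam * (t - \<tau>)) = exp (lam * \<tau>) * exp (- lam * t)" by (simp add: exp_add[symmetric] algebra_simps)
          then show ?thesis by (simp only: distrib_left distrib_right mult_ac)
        qed
        also have "ennreal ((a + \<beta> * exp (lam * \<tau>) * C) * exp (- lam * t)) \<le> ennreal (C * exp (- lam * t))"
          by (intro ennreal_leI mult_right_mono aC) simp
        finally show ?thesis .
      qed (use t init in simp)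
    qed
  qed
  then have *: "\<And>n t. - \<tau> \<le> t \<and> t \<le> real n * \<tau> \<Longrightarrow> q t \<le> ennreal (C * exp (- lam * t))" by blast
  have "q t \<le> ennreal (C * exp (- lam * t))" if "0 < t" for t
  proof -
    obtain n where "t / \<tau> \<le> real n" using real_arch_simple by blast
    then show ?thesis using *[of t n] that \<tau> by (simp add: divide_le_eq)
  qed
  with C(1) show ?thesis unfolding q_def by blast
qed

end

theorem theorem3p2:
  fixes M :: "'a measure" and F :: "real \<Rightarrow> 'a measure"
    and B :: "real \<Rightarrow> 'a \<Rightarrow> real^'m::finite"
    and r :: "real \<Rightarrow> 'a \<Rightarrow> 's::finite" and \<Gamma> :: "real^'s^'s" and i\<^sub>0 :: 's
    and D :: "real^'d::finite \<Rightarrow> 's \<Rightarrow> real^'d"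
    and f :: "real^'d \<Rightarrow> real^'d \<Rightarrow> real \<Rightarrow> 's \<Rightarrow> real^'d"
    and g :: "real^'d \<Rightarrow> real^'d \<Rightarrow> real \<Rightarrow> 's \<Rightarrow> real^'m^'d"
    and \<xi> X :: "real \<Rightarrow> 'a \<Rightarrow> real^'d"
    and V :: "real^'d \<Rightarrow> real \<Rightarrow> 's \<Rightarrow> real" and U :: "real^'d \<Rightarrow> real \<Rightarrow> real"
    and \<gamma> \<psi> :: "real \<Rightarrow> real"
    and p \<tau> \<beta> c\<^sub>1 \<alpha>\<^sub>1 \<alpha>\<^sub>2 lam :: real
  assumes "prob_space M" and "complete_filtration M F" and "\<tau> > 0"
    and "brownian_motion M F B"
    and "markov_chain M F \<Gamma> r"
    and "prob_space.indep_set M (process_events M borel B) (process_events M (count_space UNIV) r)"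
    and "AE \<omega> in M. r 0 \<omega> = i\<^sub>0"
    and "initial_segment M F \<tau> \<xi>"
    and "nsdde_coefficients \<beta> D f g"
    and "nsdde_solution M F B r \<tau> D f g \<xi> X"
    and "p \<ge> 1"
    and "C21 V" and "\<And>x t i. t \<ge> 0 \<Longrightarrow> V x t i \<ge> 0"
    and "continuous_on (UNIV \<times> {-\<tau>..}) (\<lambda>(x, t). U x t)" and "\<And>x t. t \<ge> -\<tau> \<Longrightarrow> U x t \<ge> 0"
    and "\<And>t. t \<ge> 0 \<Longrightarrow> \<gamma> t \<ge> 0"
    and "(\<lambda>t. exp (lam * t) * \<gamma> t) absolutely_integrable_on {0..}"
    and "\<And>t. t \<ge> 0 \<Longrightarrow> \<psi> t \<ge> 0" and "\<psi> absolutely_integrable_on {0..}"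
    and "c\<^sub>1 > 0" and "\<alpha>\<^sub>1 > 0" and "\<alpha>\<^sub>2 > 0" and "lam > 0"
    and "\<alpha>\<^sub>1 \<ge> \<alpha>\<^sub>2 * exp (lam * \<tau>)" and "\<beta> * exp (lam * \<tau>) < 1"
    and "\<And>x t i. t \<ge> 0 \<Longrightarrow> c\<^sub>1 * norm x powr p \<le> V x t i"
    and "\<And>x y t i. t \<ge> 0 \<Longrightarrow>
           L_operator \<Gamma> D f g V x y t i
             \<le> \<gamma> t + (\<psi> t - lam) * V (x - D y i) t i - \<alpha>\<^sub>1 * U x t + \<alpha>\<^sub>2 * U y (t - \<tau>)"
  shows "moment_lyapunov_exponent M p X \<le> ereal (- lam)"
proof -
  note \<tau> = assms(3) and V = assms(12,13) and U = assms(14,15) and lam = \<open>lam > 0\<close>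
  interpret prob_space M by (rule assms(1))
  interpret filtered_brownian M F B
    by unfold_locales (fact assms)+
  obtain I where ito: "has_ito_integral M F B (\<lambda>s \<omega>. g (X s \<omega>) (X (s - \<tau>) \<omega>) s (r s \<omega>)) I" and
    eq: "AE \<omega> in M. \<forall>t\<ge>0. X t \<omega> - D (X (t - \<tau>) \<omega>) (r t \<omega>) =
             X 0 \<omega> - D (X (- \<tau>) \<omega>) (r 0 \<omega>)
             + (LINT s:{0..t}|lborel. f (X s \<omega>) (X (s - \<tau>) \<omega>) s (r s \<omega>)) + I t \<omega>"
    using assms(10) unfolding nsdde_solution_def by (elim conjE exE) (rule that)
  have sol: "\<And>t. - \<tau> \<le> t \<Longrightarrow> X t \<in> borel_measurable (F (max 0 t))" "\<And>\<omega>. \<omega> \<in> space M \<Longrightarrow> cadlag_from (- \<tau>) (\<lambda>t. X t \<omega>)"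
    "AE \<omega> in M. \<forall>s\<in>{-\<tau>..0}. X s \<omega> = \<xi> s \<omega>"
    "AE \<omega> in M. \<forall>t\<ge>0. set_integrable lborel {0..t} (\<lambda>s. f (X s \<omega>) (X (s - \<tau>) \<omega>) s (r s \<omega>))"
    using assms(10) by (simp_all add: nsdde_solution_def)
  have Ic: "AE \<omega> in M. continuous_on {0..} (\<lambda>t. I t \<omega>)" using ito by (simp add: has_ito_integral_def)
  obtain K where K: "\<And>\<omega> s. \<omega> \<in> space M \<Longrightarrow> s \<in> {- \<tau>..0} \<Longrightarrow> norm (\<xi> s \<omega>) \<le> K"
    using assms(8) unfolding initial_segment_def by blast
  \<comment> \<open>The exceptional null sets are merged here, so that a single event in
    \<open>F 0\<close> carries every path property.\<close>
  have "AE \<omega> in M. (\<forall>s\<in>{-\<tau>..0}. norm (X s \<omega>) \<le> \<bar>K\<bar>) \<and>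
      (\<forall>t\<ge>0. set_integrable lborel {0..t} (\<lambda>s. f (X s \<omega>) (X (s - \<tau>) \<omega>) s (r s \<omega>))) \<and>
      continuous_on {0..} (\<lambda>t. I t \<omega>) \<and>
      (\<forall>t\<ge>0. X t \<omega> - D (X (t - \<tau>) \<omega>) (r t \<omega>) =
             X 0 \<omega> - D (X (- \<tau>) \<omega>) (r 0 \<omega>)
             + (LINT s:{0..t}|lborel. f (X s \<omega>) (X (s - \<tau>) \<omega>) s (r s \<omega>)) + I t \<omega>)"
    (is "AE \<omega> in M. ?P \<omega>")
    using sol(3,4) Ic eq AE_space
  proof eventually_elim
    case (elim \<omega>)
    have "norm (X s \<omega>) \<le> \<bar>K\<bar>" if "s \<in> {- \<tau>..0}" for s
      using K[OF elim(5) that] elim(1) that by simp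
    then show ?case using elim(2-4) by blast
  qed
  then obtain \<Omega> where \<Omega>: "\<Omega> \<in> sets (F 0)" "AE \<omega> in M. \<omega> \<in> \<Omega>" "\<And>\<omega>. \<omega> \<in> \<Omega> \<Longrightarrow> ?P \<omega>"
    by (rule good_set) (rule that; assumption)
  interpret neutral_equation M F B r \<Gamma> \<tau> \<beta> D f g X I \<Omega> "\<bar>K\<bar>"
  proof unfold_locales
    show "norm (X s \<omega>) \<le> \<bar>K\<bar>" if "\<omega> \<in> \<Omega>" "- \<tau> \<le> s" "s \<le> 0" for \<omega> s using \<Omega>(3)[OF that(1)] that(2,3) by simp
    show "set_integrable lborel {0..t} (\<lambda>s. f (X s \<omega>) (X (s - \<tau>) \<omega>) s (r s \<omega>))" if "\<omega> \<in> \<Omega>" "0 \<le> t" for \<omega> t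
      using \<Omega>(3)[OF that(1)] that(2) by simp
    show "continuous_on {0..} (\<lambda>t. I t \<omega>)" if "\<omega> \<in> \<Omega>" for \<omega> using \<Omega>(3)[OF that] by simp
    show "X t \<omega> - D (X (t - \<tau>) \<omega>) (r t \<omega>) = X 0 \<omega> - D (X (- \<tau>) \<omega>) (r 0 \<omega>)
             + (LINT s:{0..t}|lborel. f (X s \<omega>) (X (s - \<tau>) \<omega>) s (r s \<omega>)) + I t \<omega>" if "\<omega> \<in> \<Omega>" "0 \<le> t" for \<omega> t
      using \<Omega>(3)[OF that(1)] that(2) by blast
  qed (fact assms ito sol \<Omega> abs_ge_zero)+
  \<comment> \<open>The exponential weight stays with \<open>\<gamma>\<close>, since it is the
    weighted function that is integrable; \<open>\<psi>\<close> multiplies the weighted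
    \<open>V\<close> and carries no weight of its own.\<close>
  obtain \<gamma>' where \<gamma>': "integrable lborel \<gamma>'" "\<And>t. 0 \<le> \<gamma>' t" "AE t in lborel. 0 \<le> t \<longrightarrow> exp (lam * t) * \<gamma> t = \<gamma>' t"
    by (rule absolutely_integrable_borel_version[OF assms(17)]) (use assms(16) in auto)
  obtain \<psi>' where \<psi>': "integrable lborel \<psi>'" "\<And>t. 0 \<le> \<psi>' t" "AE t in lborel. 0 \<le> t \<longrightarrow> \<psi> t = \<psi>' t"
    by (rule absolutely_integrable_borel_version[OF assms(19)]) (use assms(18) in auto)
  \<comment> \<open>The term with \<open>- lam\<close> in the hypothesis cancels the one produced by
    differentiating the exponential weight.\<close>
  have LV: "AE s in lborel. 0 < s \<longrightarrow> (\<forall>x y i. exp (lam * s) * (L_operator \<Gamma> D f g V x y s i + lam * V (x - D y i) s i)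
      \<le> \<gamma>' s + \<psi>' s * (exp (lam * s) * V (x - D y i) s i) + exp (lam * s) * (\<alpha>\<^sub>2 * U y (s - \<tau>) - \<alpha>\<^sub>1 * U x s))"
    using \<gamma>'(3) \<psi>'(3)
  proof eventually_elim
    case (elim s)
    show ?case
    proof (intro impI allI)
      fix x y i assume s: "0 < s"
      have "exp (lam * s) * (L_operator \<Gamma> D f g V x y s i + lam * V (x - D y i) s i)
        \<le> exp (lam * s) * (\<gamma> s + \<psi> s * V (x - D y i) s i + (\<alpha>\<^sub>2 * U y (s - \<tau>) - \<alpha>\<^sub>1 * U x s))"
        using assms(27)[of s x y i] s by (intro mult_left_mono) (auto simp: algebra_simps)
      also have "\<dots> = \<gamma>' s + \<psi>' s * (exp (lam * s) * V (x - D y i) s i) + exp (lam * s) * (\<alpha>\<^sub>2 * U y (s - \<tau>) - \<alpha>\<^sub>1 * U x s)"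
        using elim s by (simp add: distrib_left mult_ac)
      finally show "exp (lam * s) * (L_operator \<Gamma> D f g V x y s i + lam * V (x - D y i) s i)
        \<le> \<gamma>' s + \<psi>' s * (exp (lam * s) * V (x - D y i) s i) + exp (lam * s) * (\<alpha>\<^sub>2 * U y (s - \<tau>) - \<alpha>\<^sub>1 * U x s)" .
    qed
  qed
  have "\<exists>C>0. \<forall>t>0. (\<integral>\<^sup>+\<omega>. ennreal (norm (X t \<omega>) powr p) \<partial>M) \<le> ennreal (C * exp (- lam * t))"
    by (rule X_moment_decay[OF V _ U \<gamma>'(1,2) \<psi>'(1,2) _ assms(24) LV assms(11,20,26,25)])
      (use \<open>\<alpha>\<^sub>2 > 0\<close> lam in auto)
  then show ?thesis using moment_lyapunov_exponent_le by blast
qed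

end
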